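(* Assume the regularity and growth conditions (A1)–(A5) and the convexity condition (B) listed in the context. Suppose that $(\xi^*,\mu^* )$ is a solution to the potential mean-field game. Then the control $\xi^*$ is optimal for the mean-field control (MFC) problem, i.e. $J(\xi^* )\le J(\xi)$ for every admissible control $\xi\in\mathcal B$.
   Context: **Measures.** $\mathcal P_2(\mathbb R^n)$ is the set of probability measures on $\mathbb R^n$ with finite second moment, with the 2-Wasserstein topology. $\mathcal M([0,T];\mathcal P_2(\mathbb R^n))$ is the set of measurable maps $\mu:[0,T]\to\mathcal P_2(\mathbb R^n)$. A continuous $\phi:\mathcal P_2(\mathbb R^n)\to\mathbb R$ is *linearly differentiable* if there is $\delta_\mu\phi:\mathcal P_2(\mathbb R^n)\times\mathbb R^n\to\mathbb R$, jointly continuous and of at most quadratic growth in $y$ uniformly for $\mu$ in bounded subsets of $\mathcal P_2(\mathbb R^n)$, with $$\phi(\mu)-\phi(\nu)=\int_0^1\int_{\mathbb R^n}\delta_\mu\phi(t\mu+(1-t)\nu)(y)\,(\mu-\nu)(dy)\,dt .$$ $\phi$ is *L-differentiable* at $\mu_0$ if there is a measurable $\partial_\mu\phi(\mu_0):\mathbb R^n\to\mathbb R^n$ such that for all $\mu\in\mathcal P_2(\mathbb R^n)$, any atomless Polish probability space $(\tilde\Omega,\tilde{\mathcal F},\tilde{\mathbb P})$ and random variables $\tilde X_0\sim\mu_0$, $\tilde X\sim\mu$ on it, $\phi(\mu)-\phi(\mu_0)=\tilde{\mathbb E}[\partial_\mu\phi(\mu_0)(\tilde X_0)\cdot(\tilde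 X-\tilde X_0)]+o(\|\tilde X-\tilde X_0\|_{L^2})$. Under (A5) below, $C$ and $G$ are L-differentiable in $\mu$ with $\partial_\mu C(t,x,\mu)(y)=\partial_y\delta_\mu C(t,x,\mu)(y)$ and $\partial_\mu G(x,\mu)(y)=\partial_y\delta_\mu G(x,\mu)(y)$. A function $\phi:\mathbb R^n\times\mathcal P_2(\mathbb R^n)\to\mathbb R$ is *L-jointly convex* if for all $(x,\mu),(x',\mu')$, $$\phi(x,\mu)-\phi(x',\mu')\le\partial_x\phi(x,\mu)(x-x')+\tilde{\mathbb E}\big[\partial_\mu\phi(x,\mu)(\tilde X)\cdot(\tilde X-\tilde X')\big]$$ for any atomless Polish probability space and random variables $\tilde X\sim\mu$, $\tilde X'\sim\mu'$ on it. **Setting.** $T>0$; $n,d,m\ge1$ integers; $(\Omega,\mathcal F,\mathbb F,\mathbb P)$ is a complete filtered probability space satisfying the usual conditions, carrying a $d$-dimensional $\mathbb F$-Brownian motion $W$. $\mathcal B$ is the set of admissible controls: processes $\xi:[0,T]\times\Omega\to[0,\infty)^m$ whose components are $\mathbb F$-adapted, non-decreasing, càdlàg, with $\xi_{0-}=0$ a.s., and $\mathbb E[|\xi_T|^2]<\infty$. $b:[0,T]\times\mathbb R^n\to\mathbb R^n$, $\sigma:[0,T]\times\mathbb R^n\to\mathbb R^{n\times d}$, $\zeta:[0,T]\to\mathbb R^{n\times m}$, $C:[0,T]\times\mathbb R^n\times\mathcal P_2(\mathbb R^n)\to\mathbb R$, $G:\mathbb R^n\times\mathcal P_2(\mathbb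 R^n)\to\mathbb R$ are measurable, and $K:[0,T]\to[0,\infty)^m$ is continuous. For $\xi\in\mathcal B$, $X^\xi$ solves $$dX^\xi_t=b(t,X^\xi_t)\,dt+\sigma(t,X^\xi_t)\,dW_t+\zeta(t)\,d\xi_t,\qquad X^\xi_{0-}=x_0\in\mathbb R^n .$$ Integrals $\int_0^T\cdot\,d\xi_t$ are over the closed interval $[0,T]$ (jumps at $0$ and $T$ are included); $\mathcal L(\cdot)$ denotes law. **MFC problem:** minimize over $\xi\in\mathcal B$ $$J(\xi)=\mathbb E\Big[\int_0^TC(t,X^\xi_t,\mathcal L(X^\xi_t))\,dt+G(X^\xi_T,\mathcal L(X^\xi_T))+\int_0^TK(t)\,d\xi_t\Big].$$ **Potential MFG:** put $c(t,x,\mu)=C(t,x,\mu)+\int_{\mathbb R^n}\delta_\mu C(t,\tilde x,\mu)(x)\,\mu(d\tilde x)$, $g(x,\mu)=G(x,\mu)+\int_{\mathbb R^n}\delta_\mu G(\tilde x,\mu)(x)\,\mu(d\tilde x)$, and for $\mu\in\mathcal M([0,T];\mathcal P_2(\mathbb R^n))$ $$J_g(\xi,\mu)=\mathbb E\Big[\int_0^Tc(t,X^\xi_t,\mu_t)\,dt+g(X^\xi_T,\mu_T)+\int_0^TK(t)\,d\xi_t\Big].$$ A *solution to the potential MFG* is a pair $(\xi^*,\mu^* )\in\mathcal B\times\mathcal M([0,T];\mathcal P_2(\mathbb R^n))$ with (i) $J_g(\xi^*,\mu^* )\le J_g(\xi,\mu^* )$ for all $\xi\in\mathcal B$, and (ii)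 $\mu^*_t=\mathcal L(X^{\xi^*}_t)$ for $t\in[0,T]$. **Hamiltonian:** $H(t,x,\mu,p,q)=b(t,x)\cdot p+\operatorname{Tr}(\sigma(t,x)^\top q)+C(t,x,\mu)$ for $p\in\mathbb R^n$, $q\in\mathbb R^{n\times d}$. **Assumptions.** (A1) $b,\sigma$ are Lipschitz in $x$ uniformly in $t\in[0,T]$. (A2) $\zeta$ is continuous. (A3) $\mu\mapsto C(t,x,\mu)$ and $\mu\mapsto G(x,\mu)$ are linearly differentiable with jointly continuous linear derivatives. (A4) $C,G,\delta_\mu C,\delta_\mu G$ are jointly continuous and, for some $\kappa>0$, $|C(t,x,\mu)|+|G(x,\mu)|+|\delta_\mu C(t,x,\mu)(y)|+|\delta_\mu G(x,\mu)(y)|\le\kappa\big(1+|x|^2+\int|z|^2\mu(dz)+|y|^2\big)$. (A5) $\partial_xC,\partial_xG,\partial_y\delta_\mu C,\partial_y\delta_\mu G$ exist, are jointly continuous, and $|\partial_xC(t,x,\mu)|+|\partial_xG(x,\mu)|+|\partial_y\delta_\mu C(t,x,\mu)(y)|+|\partial_y\delta_\mu G(x,\mu)(y)|\le\kappa\big(1+|x|+(\int|z|^2\mu(dz))^{1/2}+|y|\big)$. (B) For every $(t,p,q)\in[0,T]\times\mathbb R^n\times\mathbb R^{n\times d}$, the maps $(x,\mu)\mapsto G(x,\mu)$ and $(x,\mu)\mapsto H(t,x,\mu,p,q)$ are L-jointly convex. *)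

theory Defs
  imports "HOL-Probability.Probability"
begin

section \<open>The Wasserstein space of order 2\<close>

definition P2 :: "'a::euclidean_space measure set" where
  "P2 = {\<mu>. prob_space \<mu> \<and> sets \<mu> = sets borel \<and> integrable \<mu> (\<lambda>x. (norm x)\<^sup>2)}"

definition moment2 :: "'a::euclidean_space measure \<Rightarrow> real" where
  "moment2 \<mu> = (\<integral>z. (norm z)\<^sup>2 \<partial>\<mu>)"

definition couplings :: "'a::euclidean_space measure \<Rightarrow> 'a measure \<Rightarrow> ('a \<times> 'a) measure set" where
  "couplings \<mu> \<nu> = {\<pi>. sets \<pi> = sets borel \<and> distr \<pi> borel fst = \<mu> \<and> distr \<pi> borel snd = \<nu>}"

definition W2 :: "'a::euclidean_space measure \<Rightarrow> 'a measure \<Rightarrow> real" where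
  "W2 \<mu> \<nu> = sqrt (INF \<pi>\<in>couplings \<mu> \<nu>. \<integral>z. (norm (fst z - snd z))\<^sup>2 \<partial>\<pi>)"

definition W2_open :: "'a::euclidean_space measure set \<Rightarrow> bool" where
  "W2_open U \<longleftrightarrow> U \<subseteq> P2 \<and> (\<forall>\<mu>\<in>U. \<exists>r>0. \<forall>\<nu>\<in>P2. W2 \<mu> \<nu> < r \<longrightarrow> \<nu> \<in> U)"

definition W2_topology :: "'a::euclidean_space measure topology" where
  "W2_topology = topology W2_open"

lemma istopology_W2_open: "istopology (W2_open :: 'a::euclidean_space measure set \<Rightarrow> bool)"
  unfolding istopology_def
proof (intro conjI allI impI)
  fix S T :: "'a measure set"
  assume S: "W2_open S" and T: "W2_open T"
  show "W2_open (S \<inter> T)"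
    unfolding W2_open_def
  proof (intro conjI ballI)
    show "S \<inter> T \<subseteq> P2" using S by (auto simp: W2_open_def)
    fix \<mu> assume "\<mu> \<in> S \<inter> T"
    then obtain r s where "r > 0" "\<forall>\<nu>\<in>P2. W2 \<mu> \<nu> < r \<longrightarrow> \<nu> \<in> S"
      "s > 0" "\<forall>\<nu>\<in>P2. W2 \<mu> \<nu> < s \<longrightarrow> \<nu> \<in> T"
      using S T unfolding W2_open_def by (metis IntD1 IntD2)
    then show "\<exists>r>0. \<forall>\<nu>\<in>P2. W2 \<mu> \<nu> < r \<longrightarrow> \<nu> \<in> S \<inter> T"
      by (intro exI[of _ "min r s"]) auto
  qed
next
  fix \<K> :: "'a measure set set"
  assume K: "\<forall>K\<in>\<K>. W2_open K"
  show "W2_open (\<Union>\<K>)"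
    unfolding W2_open_def
  proof (intro conjI ballI)
    show "\<Union>\<K> \<subseteq> P2" using K by (auto simp: W2_open_def)
    fix \<mu> assume "\<mu> \<in> \<Union>\<K>"
    then obtain A where A: "A \<in> \<K>" "\<mu> \<in> A" by auto
    then obtain r where "r > 0" "\<forall>\<nu>\<in>P2. W2 \<mu> \<nu> < r \<longrightarrow> \<nu> \<in> A"
      using K unfolding W2_open_def by metis
    with A show "\<exists>r>0. \<forall>\<nu>\<in>P2. W2 \<mu> \<nu> < r \<longrightarrow> \<nu> \<in> \<Union>\<K>"
      by (intro exI[of _ r]) auto
  qed
qed

lemma openin_W2_topology: "openin W2_topology U \<longleftrightarrow> W2_open U"
  by (simp add: W2_topology_def topology_inverse' istopology_W2_open)

lemma topspace_W2_topology: "topspace (W2_topology :: 'a::euclidean_space measure topology) = P2"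
proof -
  have "W2_open (P2 :: 'a measure set)"
    by (auto simp: W2_open_def intro: exI[of _ 1])
  then show ?thesis
    by (metis openin_W2_topology openin_subset openin_topspace W2_open_def subset_antisym)
qed

definition borel_P2 :: "'a::euclidean_space measure measure" where
  "borel_P2 = sigma P2 {U. openin W2_topology U}"

text \<open>Measurable flows of measures on the time interval; measurability into
  \<open>borel_P2\<close> includes that all values lie in \<open>P2\<close>.\<close>
definition measure_flows :: "real \<Rightarrow> (real \<Rightarrow> 'a::euclidean_space measure) set" where
  "measure_flows T = measurable (restrict_space borel {0..T}) borel_P2"


section \<open>Derivatives with respect to measures\<close>

definition mixture :: "real \<Rightarrow> 'a::euclidean_space measure \<Rightarrow> 'a measure \<Rightarrow> 'a measure" where
  "mixture t \<mu> \<nu> = measure_of UNIV (sets borel)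
     (\<lambda>A. ennreal t * emeasure \<mu> A + ennreal (1 - t) * emeasure \<nu> A)"

text \<open>The bound is required on every set of finite \<open>W2\<close>-diameter. The linear derivative is
  determined by \<open>\<phi>\<close> only up to adding a function of the measure alone.\<close>
definition has_linear_derivative ::
  "('a::euclidean_space measure \<Rightarrow> real) \<Rightarrow> ('a measure \<Rightarrow> 'a \<Rightarrow> real) \<Rightarrow> bool" where
  "has_linear_derivative \<phi> \<delta>\<phi> \<longleftrightarrow>
     continuous_map W2_topology euclideanreal \<phi> \<and>
     continuous_map (prod_topology W2_topology euclidean) euclideanreal (\<lambda>(\<mu>, y). \<delta>\<phi> \<mu> y) \<and>
     (\<forall>S\<subseteq>P2. (\<exists>R. \<forall>\<mu>\<in>S. \<forall>\<nu>\<in>S. W2 \<mu> \<nu> \<le> R) \<longrightarrow>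
        (\<exists>k. \<forall>\<mu>\<in>S. \<forall>y. \<bar>\<delta>\<phi> \<mu> y\<bar> \<le> k * (1 + (norm y)\<^sup>2))) \<and>
     (\<forall>\<mu>\<in>P2. \<forall>\<nu>\<in>P2. \<phi> \<mu> - \<phi> \<nu> =
        (LBINT t:{0..1}. (\<integral>y. \<delta>\<phi> (mixture t \<mu> \<nu>) y \<partial>\<mu>) - (\<integral>y. \<delta>\<phi> (mixture t \<mu> \<nu>) y \<partial>\<nu>)))"

text \<open>An atomless probability measure on the Borel sets of a Polish space. Definitions cannot
  quantify over types, so below the carrier of the Polish space ranges over the subsets of
  \<^typ>\<open>real\<close> and the topology over all (abstract) Polish topologies on it. A Polish space has at
  most the cardinality of the continuum, so every Polish space is homeomorphic to one of these.\<close>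
definition atomless_polish_prob :: "'s topology \<Rightarrow> 's measure \<Rightarrow> bool" where
  "atomless_polish_prob S Q \<longleftrightarrow>
     completely_metrizable_space S \<and> separable_space S \<and>
     space Q = topspace S \<and> sets Q = sigma_sets (topspace S) {U. openin S U} \<and>
     prob_space Q \<and>
     (\<forall>A\<in>sets Q. measure Q A > 0 \<longrightarrow>
        (\<exists>B\<in>sets Q. B \<subseteq> A \<and> 0 < measure Q B \<and> measure Q B < measure Q A))"

definition L2norm :: "'s measure \<Rightarrow> ('s \<Rightarrow> 'a::euclidean_space) \<Rightarrow> real" where
  "L2norm Q X = sqrt (\<integral>\<omega>. (norm (X \<omega>))\<^sup>2 \<partial>Q)"

text \<open>The integrability clause expresses that the expectation in the expansion exists (Bochner
  integrals of non-integrable functions are 0 by convention).\<close>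
definition has_L_derivative ::
  "('a::euclidean_space measure \<Rightarrow> real) \<Rightarrow> 'a measure \<Rightarrow> ('a \<Rightarrow> 'a) \<Rightarrow> bool" where
  "has_L_derivative \<phi> \<mu>0 D \<longleftrightarrow>
     D \<in> borel_measurable borel \<and>
     (\<forall>(S :: real topology) Q. \<forall>X0\<in>borel_measurable Q.
        atomless_polish_prob S Q \<and> distr Q borel X0 = \<mu>0 \<longrightarrow>
        (\<forall>X\<in>borel_measurable Q. distr Q borel X \<in> P2 \<longrightarrow>
           integrable Q (\<lambda>\<omega>. D (X0 \<omega>) \<bullet> (X \<omega> - X0 \<omega>))) \<and>
        (\<forall>\<epsilon>>0. \<exists>\<eta>>0. \<forall>X\<in>borel_measurable Q. 
           distr Q borel X \<in> P2 \<and> L2norm Q (\<lambda>\<omega>. X \<omega> - X0 \<omega>) < \<eta> \<longrightarrow>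
           \<bar>\<phi> (distr Q borel X) - \<phi> \<mu>0 - (\<integral>\<omega>. D (X0 \<omega>) \<bullet> (X \<omega> - X0 \<omega>) \<partial>Q)\<bar>
             \<le> \<epsilon> * L2norm Q (\<lambda>\<omega>. X \<omega> - X0 \<omega>)))"

text \<open>\<open>Dm x \<mu>\<close> is determined \<open>\<mu>\<close>-almost everywhere by \<open>\<phi>\<close>, so the existential quantifier over
  the derivatives is harmless. \<open>GDERIV\<close> is the gradient.\<close>
definition L_jointly_convex :: "('a::euclidean_space \<Rightarrow> 'a measure \<Rightarrow> real) \<Rightarrow> bool" where
  "L_jointly_convex \<phi> \<longleftrightarrow>
     (\<exists>Dx Dm.
       (\<forall>x. \<forall>\<mu>\<in>P2. (GDERIV (\<lambda>z. \<phi> z \<mu>) x :> Dx x \<mu>) \<and> has_L_derivative (\<phi> x) \<mu> (Dm x \<mu>)) \<and>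
       (\<forall>x x'. \<forall>\<mu>\<in>P2. \<forall>\<mu>'\<in>P2. \<forall>(S :: real topology) Q.
          \<forall>X\<in>borel_measurable Q. \<forall>X'\<in>borel_measurable Q.
          atomless_polish_prob S Q \<and> distr Q borel X = \<mu> \<and> distr Q borel X' = \<mu>' \<longrightarrow>
          \<phi> x \<mu> - \<phi> x' \<mu>' \<le>
            Dx x \<mu> \<bullet> (x - x') + (\<integral>\<omega>. Dm x \<mu> (X \<omega>) \<bullet> (X \<omega> - X' \<omega>) \<partial>Q)))"


section \<open>Brownian motion and the Ito integral\<close>

definition usual_filtration :: "real \<Rightarrow> 'w measure \<Rightarrow> (real \<Rightarrow> 'w measure) \<Rightarrow> bool" where
  "usual_filtration T M F \<longleftrightarrow>
     (\<forall>t\<in>{0..T}. subalgebra M (F t)) \<and>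
     (\<forall>s\<in>{0..T}. \<forall>t\<in>{0..T}. s \<le> t \<longrightarrow> sets (F s) \<subseteq> sets (F t)) \<and>
     null_sets M \<subseteq> sets (F 0) \<and>
     (\<forall>t\<in>{0..<T}. sets (F t) = (\<Inter>s\<in>{t<..T}. sets (F s)))"

definition brownian_motion ::
  "real \<Rightarrow> 'w measure \<Rightarrow> (real \<Rightarrow> 'w measure) \<Rightarrow> (real \<Rightarrow> 'w \<Rightarrow> real^'d) \<Rightarrow> bool" where
  "brownian_motion T M F W \<longleftrightarrow>
     (\<forall>t\<in>{0..T}. W t \<in> borel_measurable (F t)) \<and>
     (AE \<omega> in M. W 0 \<omega> = 0) \<and>
     (AE \<omega> in M. continuous_on {0..T} (\<lambda>t. W t \<omega>)) \<and>
     (\<forall>s t. 0 \<le> s \<and> s < t \<and> t \<le> T \<longrightarrow>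
        prob_space.indep_set M (sets (F s))
          {(\<lambda>\<omega>. W t \<omega> - W s \<omega>) -` A \<inter> space M | A. A \<in> sets borel} \<and>
        prob_space.indep_vars M (\<lambda>_. borel) (\<lambda>j \<omega>. (W t \<omega> - W s \<omega>) $ j) UNIV \<and>
        (\<forall>j. distributed M lborel (\<lambda>\<omega>. (W t \<omega> - W s \<omega>) $ j) (normal_density 0 (sqrt (t - s)))))"

text \<open>A triple \<open>(k, \<tau>, A)\<close> stands for the simple process
  \<open>\<Sum>i<k. A i * indicator {\<tau> i<..\<tau> (i+1)}\<close>.\<close>
type_synonym ('w, 'd, 'n) simple_process = "nat \<times> (nat \<Rightarrow> real) \<times> (nat \<Rightarrow> 'w \<Rightarrow> real^'d^'n)"

fun simple_process ::
  "real \<Rightarrow> 'w measure \<Rightarrow> (real \<Rightarrow> 'w measure) \<Rightarrow> ('w, 'd::finite, 'n::finite) simple_process \<Rightarrow> bool" where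
  "simple_process T M F (k, \<tau>, A) \<longleftrightarrow>
     (\<forall>i\<le>k. \<tau> i \<in> {0..T}) \<and> (\<forall>i<k. \<tau> i \<le> \<tau> (Suc i)) \<and>
     (\<forall>i<k. A i \<in> borel_measurable (F (\<tau> i)) \<and> bounded (A i ` space M))"

fun simple_value :: "('w, 'd::finite, 'n::finite) simple_process \<Rightarrow> real \<Rightarrow> 'w \<Rightarrow> real^'d^'n" where
  "simple_value (k, \<tau>, A) s \<omega> = (\<Sum>i<k. indicator {\<tau> i<..\<tau> (Suc i)} s *\<^sub>R A i \<omega>)"

fun simple_integral ::
  "(real \<Rightarrow> 'w \<Rightarrow> real^'d::finite) \<Rightarrow> ('w, 'd, 'n::finite) simple_process \<Rightarrow> real \<Rightarrow> 'w \<Rightarrow> real^'n" where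
  "simple_integral W (k, \<tau>, A) t \<omega> =
     (\<Sum>i<k. A i \<omega> *v (W (min t (\<tau> (Suc i))) \<omega> - W (min t (\<tau> i)) \<omega>))"

text \<open>\<open>I\<close> is a continuous adapted version of the Ito integral process \<open>\<integral>\<^sub>0\<^sup>t H dW\<close> of a measurable
  adapted integrand \<open>H\<close> which is square-integrable for the product of Lebesgue measure and \<open>M\<close>.\<close>
definition is_ito_integral ::
  "real \<Rightarrow> 'w measure \<Rightarrow> (real \<Rightarrow> 'w measure) \<Rightarrow> (real \<Rightarrow> 'w \<Rightarrow> real^'d) \<Rightarrow>
   (real \<Rightarrow> 'w \<Rightarrow> real^'d^'n) \<Rightarrow> (real \<Rightarrow> 'w \<Rightarrow> real^'n) \<Rightarrow> bool" where
  "is_ito_integral T M F W H I \<longleftrightarrow>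
     (\<lambda>(s, \<omega>). H s \<omega>) \<in> borel_measurable (restrict_space borel {0..T} \<Otimes>\<^sub>M M) \<and>
     (\<forall>s\<in>{0..T}. H s \<in> borel_measurable (F s)) \<and>
     (\<integral>\<^sup>+\<omega>. (\<integral>\<^sup>+s\<in>{0..T}. (ennreal ((norm (H s \<omega>))\<^sup>2)) \<partial>lborel) \<partial>M) < \<infinity> \<and>
     (\<forall>t\<in>{0..T}. I t \<in> borel_measurable (F t)) \<and>
     (AE \<omega> in M. continuous_on {0..T} (\<lambda>t. I t \<omega>)) \<and>
     (\<exists>Z. (\<forall>k. simple_process T M F (Z k)) \<and>
        (\<lambda>k. \<integral>\<^sup>+\<omega>. (\<integral>\<^sup>+s\<in>{0..T}. (ennreal ((norm (simple_value (Z k) s \<omega> - H s \<omega>))\<^sup>2)) \<partial>lborel) \<partial>M)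
          \<longlonglongrightarrow> 0 \<and>
        (\<forall>t\<in>{0..T}. (\<lambda>k. \<integral>\<^sup>+\<omega>. ennreal ((norm (simple_integral W (Z k) t \<omega> - I t \<omega>))\<^sup>2) \<partial>M)
          \<longlonglongrightarrow> 0))"


section \<open>Singular controls and the controlled state\<close>

text \<open>Controls are only looked at on \<open>{0..T}\<close>. The convention \<open>\<xi>\<^sub>0\<^sub>- = 0\<close> enters through
  \<open>control_measure\<close>, which has mass \<open>\<xi> 0\<close> at time \<open>0\<close>; likewise for the state, \<open>x0\<close> is the value
  before the jump at time \<open>0\<close>.\<close>

definition cadlag_on :: "real \<Rightarrow> (real \<Rightarrow> 'a::topological_space) \<Rightarrow> bool" where
  "cadlag_on T f \<longleftrightarrow>
     (\<forall>t\<in>{0..<T}. (f \<longlongrightarrow> f t) (at_right t)) \<and> (\<forall>t\<in>{0<..T}. \<exists>l. (f \<longlongrightarrow> l) (at_left t))"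

definition admissible_controls ::
  "real \<Rightarrow> 'w measure \<Rightarrow> (real \<Rightarrow> 'w measure) \<Rightarrow> (real \<Rightarrow> 'w \<Rightarrow> real^'m) set" where
  "admissible_controls T M F = {\<xi>.
     (\<forall>t\<in>{0..T}. \<xi> t \<in> borel_measurable (F t)) \<and>
     (\<forall>\<omega>\<in>space M. cadlag_on T (\<lambda>t. \<xi> t \<omega>) \<and>
        (\<forall>j. (\<forall>t\<in>{0..T}. 0 \<le> \<xi> t \<omega> $ j) \<and> mono_on {0..T} (\<lambda>t. \<xi> t \<omega> $ j))) \<and>
     integrable M (\<lambda>\<omega>. (norm (\<xi> T \<omega>))\<^sup>2)}"

definition control_measure :: "real \<Rightarrow> (real \<Rightarrow> 'w \<Rightarrow> real^'m) \<Rightarrow> 'm \<Rightarrow> 'w \<Rightarrow> real measure" where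
  "control_measure T \<xi> j \<omega> = interval_measure (\<lambda>s. if s < 0 then 0 else \<xi> (min s T) \<omega> $ j)"

text \<open>The stochastic integral in the state equation is the Ito integral of square-integrable
  integrands. For coefficients that are Lipschitz in the state this is no restriction: whenever the
  equation has a solution at all (with locally square-integrable diffusion term), standard moment
  estimates give \<open>E(sup\<^sub>t |X\<^sub>t|\<^sup>2) < \<infinity>\<close> and square-integrability of \<open>\<sigma>(t, X\<^sub>t)\<close>.\<close>
definition solves_state_equation ::
  "real \<Rightarrow> 'w measure \<Rightarrow> (real \<Rightarrow> 'w measure) \<Rightarrow> (real \<Rightarrow> 'w \<Rightarrow> real^'d) \<Rightarrow>
   (real \<Rightarrow> real^'n \<Rightarrow> real^'n) \<Rightarrow> (real \<Rightarrow> real^'n \<Rightarrow> real^'d^'n) \<Rightarrow> (real \<Rightarrow> real^'m^'n) \<Rightarrow>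
   real^'n \<Rightarrow> (real \<Rightarrow> 'w \<Rightarrow> real^'m) \<Rightarrow> (real \<Rightarrow> 'w \<Rightarrow> real^'n) \<Rightarrow> bool" where
  "solves_state_equation T M F W b \<sigma> \<zeta> x0 \<xi> X \<longleftrightarrow>
     (\<forall>t\<in>{0..T}. X t \<in> borel_measurable (F t)) \<and>
     (\<forall>\<omega>\<in>space M. cadlag_on T (\<lambda>t. X t \<omega>)) \<and>
     (AE \<omega> in M. set_integrable lborel {0..T} (\<lambda>s. b s (X s \<omega>))) \<and>
     (\<exists>I. is_ito_integral T M F W (\<lambda>s \<omega>. \<sigma> s (X s \<omega>)) I \<and>
       (AE \<omega> in M. \<forall>t\<in>{0..T}.
          X t \<omega> = x0 + (LBINT s:{0..t}. b s (X s \<omega>)) + I t \<omega>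
            + (\<chi> i. \<Sum>j\<in>UNIV. LINT s:{0..t}|control_measure T \<xi> j \<omega>. \<zeta> s $ i $ j)))"


section \<open>Mean-field control and the potential mean-field game\<close>

definition control_cost :: "real \<Rightarrow> (real \<Rightarrow> real^'m) \<Rightarrow> (real \<Rightarrow> 'w \<Rightarrow> real^'m) \<Rightarrow> 'w \<Rightarrow> real" where
  "control_cost T K \<xi> \<omega> = (\<Sum>j\<in>UNIV. LINT s:{0..T}|control_measure T \<xi> j \<omega>. K s $ j)"

text \<open>In both cost functionals \<open>X\<close> maps a control to its state process.\<close>

definition J_mfc ::
  "real \<Rightarrow> 'w measure \<Rightarrow> (real \<Rightarrow> real^'n \<Rightarrow> (real^'n) measure \<Rightarrow> real) \<Rightarrow>
   (real^'n \<Rightarrow> (real^'n) measure \<Rightarrow> real) \<Rightarrow> (real \<Rightarrow> real^'m) \<Rightarrow>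
   ((real \<Rightarrow> 'w \<Rightarrow> real^'m) \<Rightarrow> real \<Rightarrow> 'w \<Rightarrow> real^'n) \<Rightarrow> (real \<Rightarrow> 'w \<Rightarrow> real^'m) \<Rightarrow> real" where
  "J_mfc T M C G K X \<xi> =
     (\<integral>\<omega>. (LBINT t:{0..T}. C t (X \<xi> t \<omega>) (distr M borel (X \<xi> t)))
        + G (X \<xi> T \<omega>) (distr M borel (X \<xi> T)) + control_cost T K \<xi> \<omega> \<partial>M)"

definition J_mfg ::
  "real \<Rightarrow> 'w measure \<Rightarrow> (real \<Rightarrow> real^'n \<Rightarrow> (real^'n) measure \<Rightarrow> real) \<Rightarrow>
   (real^'n \<Rightarrow> (real^'n) measure \<Rightarrow> real) \<Rightarrow> (real \<Rightarrow> real^'m) \<Rightarrow>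
   ((real \<Rightarrow> 'w \<Rightarrow> real^'m) \<Rightarrow> real \<Rightarrow> 'w \<Rightarrow> real^'n) \<Rightarrow>
   (real \<Rightarrow> 'w \<Rightarrow> real^'m) \<Rightarrow> (real \<Rightarrow> (real^'n) measure) \<Rightarrow> real" where
  "J_mfg T M c g K X \<xi> \<mu> =
     (\<integral>\<omega>. (LBINT t:{0..T}. c t (X \<xi> t \<omega>) (\<mu> t)) + g (X \<xi> T \<omega>) (\<mu> T) + control_cost T K \<xi> \<omega> \<partial>M)"

text \<open>The arguments of a linear derivative \<open>\<delta>\<Phi>\<close> are the state, the measure and the point.\<close>
definition potential ::
  "('a::euclidean_space \<Rightarrow> 'a measure \<Rightarrow> real) \<Rightarrow> ('a \<Rightarrow> 'a measure \<Rightarrow> 'a \<Rightarrow> real) \<Rightarrow>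
   'a \<Rightarrow> 'a measure \<Rightarrow> real" where
  "potential \<Phi> \<delta>\<Phi> x \<mu> = \<Phi> x \<mu> + (\<integral>z. \<delta>\<Phi> z \<mu> x \<partial>\<mu>)"

definition potential_mfg_solution ::
  "real \<Rightarrow> 'w measure \<Rightarrow> (real \<Rightarrow> 'w measure) \<Rightarrow>
   (real \<Rightarrow> real^'n \<Rightarrow> (real^'n) measure \<Rightarrow> real) \<Rightarrow>
   (real \<Rightarrow> real^'n \<Rightarrow> (real^'n) measure \<Rightarrow> real^'n \<Rightarrow> real) \<Rightarrow>
   (real^'n \<Rightarrow> (real^'n) measure \<Rightarrow> real) \<Rightarrow>
   (real^'n \<Rightarrow> (real^'n) measure \<Rightarrow> real^'n \<Rightarrow> real) \<Rightarrow> (real \<Rightarrow> real^'m) \<Rightarrow>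
   ((real \<Rightarrow> 'w \<Rightarrow> real^'m) \<Rightarrow> real \<Rightarrow> 'w \<Rightarrow> real^'n) \<Rightarrow>
   (real \<Rightarrow> 'w \<Rightarrow> real^'m) \<Rightarrow> (real \<Rightarrow> (real^'n) measure) \<Rightarrow> bool" where
  "potential_mfg_solution T M F C \<delta>C G \<delta>G K X \<xi>s \<mu>s \<longleftrightarrow>
     \<xi>s \<in> admissible_controls T M F \<and> \<mu>s \<in> measure_flows T \<and>
     (\<forall>\<xi>\<in>admissible_controls T M F.
        J_mfg T M (\<lambda>t. potential (C t) (\<delta>C t)) (potential G \<delta>G) K X \<xi>s \<mu>s
          \<le> J_mfg T M (\<lambda>t. potential (C t) (\<delta>C t)) (potential G \<delta>G) K X \<xi> \<mu>s) \<and>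
     (\<forall>t\<in>{0..T}. \<mu>s t = distr M borel (X \<xi>s t))"

definition hamiltonian ::
  "(real \<Rightarrow> real^'n \<Rightarrow> real^'n) \<Rightarrow> (real \<Rightarrow> real^'n \<Rightarrow> real^'d^'n) \<Rightarrow>
   (real \<Rightarrow> real^'n \<Rightarrow> (real^'n) measure \<Rightarrow> real) \<Rightarrow>
   real \<Rightarrow> real^'n \<Rightarrow> (real^'n) measure \<Rightarrow> real^'n \<Rightarrow> real^'d^'n \<Rightarrow> real" where
  "hamiltonian b \<sigma> C t x \<mu> p q = b t x \<bullet> p + trace (transpose (\<sigma> t x) ** q) + C t x \<mu>"

abbreviation state_measure_topology :: "('a::euclidean_space \<times> 'a measure) topology" where
  "state_measure_topology \<equiv> prod_topology euclidean W2_topology"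

abbreviation state_measure_point_topology :: "('a::euclidean_space \<times> 'a measure \<times> 'a) topology" where
  "state_measure_point_topology \<equiv> prod_topology euclidean (prod_topology W2_topology euclidean)"

end

theory Submission
  imports Defs
begin

text \<open>The Hamiltonian is convex for all \<open>p\<close> and \<open>q\<close>, and it depends on them linearly. So \<open>b\<close> and \<open>\<sigma>\<close>
  are affine in the state, and \<open>C\<close> is jointly convex. By uniqueness for the state equation the state
  is then affine in the control, and the control cost is affine in the control as well. Let
  \<open>\<xi>\<^sub>e = (1 - e) \<xi>\<^sup>* + e \<xi>\<close>. The potentials are chosen such that the increments of the two cost
  functionals from \<open>\<xi>\<^sup>*\<close> to \<open>\<xi>\<^sub>e\<close> differ only by \<open>o(e)\<close>; this uses the linear derivatives with their
  gradients in the point variable and dominated convergence. Since \<open>\<xi>\<^sup>*\<close> minimizes the cost of the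
  game, convexity of \<open>J\<close> gives \<open>e (J \<xi> - J \<xi>\<^sup>*) \<ge> J \<xi>\<^sub>e - J \<xi>\<^sup>* \<ge> o(e)\<close>. No adjoint equation is needed.\<close>

section \<open>Linear combinations of Ito integrals\<close>

text \<open>Several obstacles shape the proof. L-joint convexity speaks of variables on an atomless
  Polish space, while \<open>M\<close> is an arbitrary probability space; so joint laws are
  transported to the uniform law on the unit interval. The Ito integral is given only as an
  \<open>L^2\<close> limit of simple integrals along some sequence; instead of its linearity, a
  second moment bound is proved for arbitrary linear combinations, and this bound is what uniqueness
  of the state needs. The increments of the two functionals in the state variable coincide and
  cancel; what remains are increments in the measure, and after an exchange of two independent
  copies both have the same limit, the expectation of \<open>\<delta>y\<close> paired with the
  displacement. For the running cost this limit is taken under the time integral. That requires a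
  bound uniform in time, hence explicit constants in terms of a moment bound, and measurability in
  time of the costs, hence right continuity of the laws in the Wasserstein topology.\<close>

lemma borel_measurable_vec_nth_compose [measurable (raw)]:
  fixes f :: "'a \<Rightarrow> ('b::{second_countable_topology, real_normed_vector}) ^ 'n"
  assumes "f \<in> borel_measurable M"
  shows "(\<lambda>x. f x $ i) \<in> borel_measurable M"
  by (rule measurable_compose[OF assms borel_measurable_continuous_onI])
    (auto intro!: continuous_intros)

lemma borel_measurable_vec_lambda_compose [measurable (raw)]:
  fixes f :: "'a \<Rightarrow> 'n::finite \<Rightarrow> real"
  assumes [measurable]: "\<And>i. (\<lambda>x. f x i) \<in> borel_measurable M"
  shows "(\<lambda>x. \<chi> i. f x i) \<in> borel_measurable M"
proof -
  have "(\<chi> i. f x i) = (\<Sum>i\<in>UNIV. f x i *\<^sub>R axis i 1)" for x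
    by (simp add: vec_eq_iff axis_def if_distrib cong: if_cong)
  then show ?thesis by simp
qed

section \<open>Moments of Brownian increments\<close>

locale filtered_brownian = prob_space M for M :: "'w measure" +
  fixes T :: real and F :: "real \<Rightarrow> 'w measure" and W :: "real \<Rightarrow> 'w \<Rightarrow> real^'d"
  assumes filtration: "usual_filtration T M F"
    and brownian: "brownian_motion T M F W"
begin

lemma measurable_F_imp_M: "t \<in> {0..T} \<Longrightarrow> X \<in> measurable (F t) N \<Longrightarrow> X \<in> measurable M N"
  using filtration by (auto simp: usual_filtration_def intro: measurable_from_subalg)

lemma measurable_F_mono:
  "0 \<le> s \<Longrightarrow> s \<le> t \<Longrightarrow> t \<le> T \<Longrightarrow> X \<in> measurable (F s) N \<Longrightarrow> X \<in> measurable (F t) N"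
proof -
  assume "0 \<le> s" "s \<le> t" "t \<le> T" "X \<in> measurable (F s) N"
  moreover from this have "subalgebra (F t) (F s)"
    using filtration by (auto simp: usual_filtration_def subalgebra_def)
  ultimately show ?thesis by (auto intro: measurable_from_subalg)
qed

lemma W_measurable_F: "t \<in> {0..T} \<Longrightarrow> W t \<in> borel_measurable (F t)"
  using brownian by (auto simp: brownian_motion_def)

lemma W_measurable: "t \<in> {0..T} \<Longrightarrow> W t \<in> borel_measurable M"
  using W_measurable_F measurable_F_imp_M by blast

lemma W_measurable_F': "0 \<le> s \<Longrightarrow> s \<le> t \<Longrightarrow> t \<le> T \<Longrightarrow> W s \<in> borel_measurable (F t)"
  using W_measurable_F[of s] measurable_F_mono[of s t] by auto

text \<open>The sigma-algebra generated by \<open>h\<close> lies in \<open>F s\<close>, and the one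
  generated by \<open>g\<close> of the increment consists of preimages under the increment. These
  inclusions reduce the claim to the product rule for independent integrable variables.\<close>

lemma increment_independent:
  fixes h :: "'w \<Rightarrow> real" and g :: "real^'d \<Rightarrow> real"
  assumes st: "0 \<le> s" "s < t" "t \<le> T"
    and h: "h \<in> borel_measurable (F s)" "integrable M h"
    and g[measurable]: "g \<in> borel_measurable borel" and gi: "integrable M (\<lambda>\<omega>. g (W t \<omega> - W s \<omega>))"
  shows "integrable M (\<lambda>\<omega>. h \<omega> * g (W t \<omega> - W s \<omega>))"
    "expectation (\<lambda>\<omega>. h \<omega> * g (W t \<omega> - W s \<omega>)) = expectation h * expectation (\<lambda>\<omega>. g (W t \<omega> - W s \<omega>))"
proof -
  have [measurable]: "W t \<in> borel_measurable M" "W s \<in> borel_measurable M" "h \<in> borel_measurable M"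
    using W_measurable st measurable_F_imp_M[OF _ h(1)] by auto
  let ?D = "\<lambda>\<omega>. W t \<omega> - W s \<omega>"
  have ind: "indep_set (sets (F s)) {?D -` A \<inter> space M | A. A \<in> sets borel}"
    using brownian st by (auto simp: brownian_motion_def)
  have spF: "space (F s) = space M"
    using filtration st by (auto simp: usual_filtration_def subalgebra_def)
  let ?S = "{?D -` A \<inter> space M | A. A \<in> sets borel}"
  have iv: "indep_var borel h borel (\<lambda>\<omega>. g (?D \<omega>))"
    unfolding indep_var_eq
  proof (intro conjI)
    have 1: "sigma_sets (space M) {h -` A \<inter> space M | A. A \<in> sets borel} \<subseteq> sets (F s)"
      unfolding spF[symmetric]
    proof (rule sets.sigma_sets_subset, safe)
      fix A :: "real set" assume "A \<in> sets borel"
      then show "h -` A \<inter> space (F s) \<in> sets (F s)" by (rule measurable_sets[OF h(1)])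
    qed
    \<comment> \<open>Preimages of Borel sets under a single map already form a sigma-algebra, so
      generation does not lead out of \<open>?S\<close>.\<close>
    have 2: "sigma_sets (space M) {(\<lambda>\<omega>. g (?D \<omega>)) -` A \<inter> space M | A. A \<in> sets borel} \<subseteq> ?S"
    proof -
      have "{(\<lambda>\<omega>. g (?D \<omega>)) -` A \<inter> space M | A. A \<in> sets borel} \<subseteq> ?S"
      proof safe
        fix A :: "real set" assume "A \<in> sets borel"
        then have "g -` A \<in> sets borel" using measurable_sets[OF g] by simp
        then show "\<exists>B. (\<lambda>\<omega>. g (?D \<omega>)) -` A \<inter> space M = ?D -` B \<inter> space M \<and> B \<in> sets borel"
          by (intro exI[of _ "g -` A"]) auto
      qed
      moreover have "?S = sets (vimage_algebra (space M) ?D borel)"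
        by (simp add: sets_vimage_algebra2)
      moreover have "space (vimage_algebra (space M) ?D borel) = space M" by simp
      ultimately show ?thesis using sets.sigma_sets_subset[of _ "vimage_algebra (space M) ?D borel"] by simp
    qed
    show "indep_set (sigma_sets (space M) {h -` A \<inter> space M |A. A \<in> sets borel})
     (sigma_sets (space M) {(\<lambda>\<omega>. g (?D \<omega>)) -` A \<inter> space M |A. A \<in> sets borel})"
    proof (rule indep_setI)
      have "sets (F s) \<subseteq> events" "?S \<subseteq> events" using ind by (auto simp only: indep_sets2_eq)
      then show "sigma_sets (space M) {h -` A \<inter> space M |A. A \<in> sets borel} \<subseteq> events"
        "sigma_sets (space M) {(\<lambda>\<omega>. g (?D \<omega>)) -` A \<inter> space M |A. A \<in> sets borel} \<subseteq> events"
        using subset_trans[OF 1] subset_trans[OF 2] by (simp_all only:)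
      fix a b
      assume "a \<in> sigma_sets (space M) {h -` A \<inter> space M |A. A \<in> sets borel}"
        "b \<in> sigma_sets (space M) {(\<lambda>\<omega>. g (?D \<omega>)) -` A \<inter> space M |A. A \<in> sets borel}"
      then show "prob (a \<inter> b) = prob a * prob b"
        by (intro indep_setD[OF ind] subsetD[OF 1] subsetD[OF 2])
    qed
  qed simp_all
  show "integrable M (\<lambda>\<omega>. h \<omega> * g (W t \<omega> - W s \<omega>))"
    using indep_var_integrable[OF iv h(2) gi] .
  show "expectation (\<lambda>\<omega>. h \<omega> * g (W t \<omega> - W s \<omega>)) = expectation h * expectation (\<lambda>\<omega>. g (W t \<omega> - W s \<omega>))"
    using indep_var_lebesgue_integral[OF iv h(2) gi] .
qed

text \<open>The components are independent centred Gaussians of variance \<open>t - s\<close>. The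
  law of the increment is prescribed only for \<open>s < t\<close>; at \<open>s = t\<close> the
  increment is 0.\<close>

lemma increment_moments:
  assumes st: "0 \<le> s" "s \<le> t" "t \<le> T"
  shows "integrable M (\<lambda>\<omega>. (W t \<omega> - W s \<omega>) $ j)" "expectation (\<lambda>\<omega>. (W t \<omega> - W s \<omega>) $ j) = 0"
    "integrable M (\<lambda>\<omega>. (W t \<omega> - W s \<omega>) $ j * (W t \<omega> - W s \<omega>) $ k)"
    "expectation (\<lambda>\<omega>. (W t \<omega> - W s \<omega>) $ j * (W t \<omega> - W s \<omega>) $ k) = (if j = k then t - s else 0)"
proof -
  have "integrable M (\<lambda>\<omega>. (W t \<omega> - W s \<omega>) $ j) \<and> expectation (\<lambda>\<omega>. (W t \<omega> - W s \<omega>) $ j) = 0 \<and>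
    integrable M (\<lambda>\<omega>. (W t \<omega> - W s \<omega>) $ j * (W t \<omega> - W s \<omega>) $ k) \<and>
    expectation (\<lambda>\<omega>. (W t \<omega> - W s \<omega>) $ j * (W t \<omega> - W s \<omega>) $ k) = (if j = k then t - s else 0)"
  proof (cases "s = t")
    case False
    with st have st': "s < t" by simp
    let ?D = "\<lambda>j \<omega>. (W t \<omega> - W s \<omega>) $ j"
    have d: "distributed M lborel (?D i) (normal_density 0 (sqrt (t - s)))" for i
      using brownian st st' by (auto simp: brownian_motion_def)
    have iv: "indep_vars (\<lambda>_. borel) ?D UNIV"
      using brownian st st' by (auto simp: brownian_motion_def)
    have pos: "sqrt (t - s) > 0" using st' by simp
    have i1: "integrable M (?D i)" for i
      using integrable_normal_moment_nz_1[of "sqrt (t-s)" 0] pos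
      by (subst distributed_integrable[OF d, of "\<lambda>x. x", symmetric]) auto
    have e1: "expectation (?D i) = 0" for i
      using normal_distributed_expectation[OF pos d] by simp
    have i2: "integrable M (\<lambda>\<omega>. (?D i \<omega>)\<^sup>2)" for i
      using integrable_normal_moment[of "sqrt (t-s)" 0 2] pos
      by (subst distributed_integrable[OF d, of "\<lambda>x. x^2", symmetric]) auto
    have e2: "expectation (\<lambda>\<omega>. (?D i \<omega>)\<^sup>2) = t - s" for i
      using normal_distributed_variance[OF pos d[of i]] e1[of i] st' by simp
    show ?thesis
    proof (cases "j = k")
      case True
      then show ?thesis using i1 e1 i2 e2 by (simp add: power2_eq_square)
    next
      case False
      have "indep_vars (\<lambda>_. borel) ?D {j, k}" by (rule indep_vars_subset[OF iv]) auto
      then have "integrable M (\<lambda>\<omega>. \<Prod>i\<in>{j, k}. ?D i \<omega>)"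
        "expectation (\<lambda>\<omega>. \<Prod>i\<in>{j, k}. ?D i \<omega>) = (\<Prod>i\<in>{j, k}. expectation (?D i))"
        using indep_vars_integrable[of "{j, k}" ?D] indep_vars_lebesgue_integral[of "{j, k}" ?D] i1
        by (simp_all del: prod.insert)

      with i1 e1 False show ?thesis by simp
    qed
  qed auto
  then show "integrable M (\<lambda>\<omega>. (W t \<omega> - W s \<omega>) $ j)" "expectation (\<lambda>\<omega>. (W t \<omega> - W s \<omega>) $ j) = 0"
    "integrable M (\<lambda>\<omega>. (W t \<omega> - W s \<omega>) $ j * (W t \<omega> - W s \<omega>) $ k)"
    "expectation (\<lambda>\<omega>. (W t \<omega> - W s \<omega>) $ j * (W t \<omega> - W s \<omega>) $ k) = (if j = k then t - s else 0)"
    by auto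
qed

end

lemma norm_sum_sq_le:
  fixes x :: "'i \<Rightarrow> 'a::real_normed_vector"
  shows "(norm (\<Sum>l\<in>Q. x l))\<^sup>2 \<le> real (card Q) * (\<Sum>l\<in>Q. (norm (x l))\<^sup>2)"
proof -
  have "(norm (\<Sum>l\<in>Q. x l))\<^sup>2 \<le> (\<Sum>l\<in>Q. norm (x l))\<^sup>2"
    by (intro power_mono norm_sum) auto
  also have "\<dots> \<le> (\<Sum>l\<in>Q. (norm (x l))\<^sup>2) * real (card Q)"
    by (rule sum_squared_le_sum_of_squares)
  finally show ?thesis by (simp add: mult.commute)
qed

lemma norm_add_sq_le:
  fixes x y :: "'a::real_normed_vector"
  shows "(norm (x + y))\<^sup>2 \<le> 2 * (norm x)\<^sup>2 + 2 * (norm y)\<^sup>2"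
proof -
  have "(norm (x + y))\<^sup>2 \<le> (norm x + norm y)\<^sup>2"
    by (intro power_mono norm_triangle_ineq) auto
  also have "\<dots> \<le> 2 * (norm x)\<^sup>2 + 2 * (norm y)\<^sup>2"
    using sum_squares_bound[of "norm x" "norm y"] by (simp add: power2_eq_square algebra_simps)
  finally show ?thesis .
qed

lemma ennreal_norm_add_sq_le:
  fixes x y :: "'a::real_normed_vector"
  shows "ennreal ((norm (x + y))\<^sup>2) \<le> 2 * ennreal ((norm x)\<^sup>2) + 2 * ennreal ((norm y)\<^sup>2)"
proof -
  have "ennreal ((norm (x + y))\<^sup>2) \<le> ennreal (2 * (norm x)\<^sup>2 + 2 * (norm y)\<^sup>2)"
    by (intro ennreal_leI norm_add_sq_le)
  also have "\<dots> = 2 * ennreal ((norm x)\<^sup>2) + 2 * ennreal ((norm y)\<^sup>2)"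
    by (simp add: ennreal_plus ennreal_mult')
  finally show ?thesis .
qed

lemma ennreal_norm_sum_sq_le:
  fixes x :: "'i \<Rightarrow> 'a::real_normed_vector"
  shows "ennreal ((norm (\<Sum>l\<in>Q. c l *\<^sub>R x l))\<^sup>2)
    \<le> (\<Sum>l\<in>Q. ennreal (real (card Q) * (c l)\<^sup>2) * ennreal ((norm (x l))\<^sup>2))"
proof -
  have "ennreal ((norm (\<Sum>l\<in>Q. c l *\<^sub>R x l))\<^sup>2) \<le> ennreal (real (card Q) * (\<Sum>l\<in>Q. (norm (c l *\<^sub>R x l))\<^sup>2))"
    by (intro ennreal_leI norm_sum_sq_le)
  also have "\<dots> = ennreal (\<Sum>l\<in>Q. real (card Q) * (c l)\<^sup>2 * (norm (x l))\<^sup>2)"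
    by (simp add: sum_distrib_left power_mult_distrib mult.assoc)
  also have "\<dots> = (\<Sum>l\<in>Q. ennreal (real (card Q) * (c l)\<^sup>2 * (norm (x l))\<^sup>2))"
    by (intro sum_ennreal[symmetric]) auto
  also have "\<dots> = (\<Sum>l\<in>Q. ennreal (real (card Q) * (c l)\<^sup>2) * ennreal ((norm (x l))\<^sup>2))"
    by (intro sum.cong refl ennreal_mult) auto
  finally show ?thesis .
qed

context filtered_brownian
begin

lemma increment_uncorrelated:
  fixes h :: "'w \<Rightarrow> real"
  assumes st: "0 \<le> s" "s \<le> t" "t \<le> T"
    and h: "h \<in> borel_measurable (F s)" "integrable M h"
  shows "integrable M (\<lambda>\<omega>. h \<omega> * (W t \<omega> - W s \<omega>) $ j)"
    "expectation (\<lambda>\<omega>. h \<omega> * (W t \<omega> - W s \<omega>) $ j) = 0"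
  using increment_independent[of s t h "\<lambda>x. x $ j"] increment_moments(1,2)[of s t j] assms
  by (cases "s = t"; simp)+

lemma increment_square:
  fixes h :: "'w \<Rightarrow> real"
  assumes st: "0 \<le> s" "s \<le> t" "t \<le> T"
    and h: "h \<in> borel_measurable (F s)" "integrable M h"
  shows "integrable M (\<lambda>\<omega>. h \<omega> * ((W t \<omega> - W s \<omega>) $ j * (W t \<omega> - W s \<omega>) $ k))"
    "expectation (\<lambda>\<omega>. h \<omega> * ((W t \<omega> - W s \<omega>) $ j * (W t \<omega> - W s \<omega>) $ k))
      = expectation h * (if j = k then t - s else 0)"
  using increment_independent[of s t h "\<lambda>x. x $ j * x $ k"] increment_moments(3,4)[of s t j k] assms
  by (cases "s = t"; simp)+

lemma integrable_bounded_mult: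
  fixes h f :: "'w \<Rightarrow> real"
  assumes "h \<in> borel_measurable M" "bounded (h ` space M)" "integrable M f"
  shows "integrable M (\<lambda>\<omega>. h \<omega> * f \<omega>)"
proof -
  obtain B where "\<forall>x\<in>h ` space M. norm x \<le> B" using assms(2) unfolding bounded_iff by blast
  then have B: "\<And>\<omega>. \<omega> \<in> space M \<Longrightarrow> \<bar>h \<omega>\<bar> \<le> \<bar>B\<bar>" by force
  show ?thesis
  proof (rule Bochner_Integration.integrable_bound[of M "\<lambda>\<omega>. B * f \<omega>"])
    show "AE \<omega> in M. norm (h \<omega> * f \<omega>) \<le> norm (B * f \<omega>)"
      by (intro AE_I2) (auto simp: abs_mult intro!: mult_right_mono B)
  qed (use assms in auto)
qed

text \<open>The first increment is cut at \<open>u'\<close> and \<open>m\<close>, the second at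
  \<open>m\<close>, so that \<open>?D2\<close> is the increment over the overlap of the two
  intervals. In a mixed product one factor is an increment that starts when all the others are
  already known, so the mean is zero; and of \<open>?D3\<close> and \<open>?D4\<close> at least one
  vanishes. Only the product over the overlap survives and yields its length.\<close>

lemma elementary_integrals_product_aux:
  fixes a a' :: "'w \<Rightarrow> real"
  assumes uv: "0 \<le> u" "u \<le> v" "v \<le> T" "0 \<le> u'" "u' \<le> v'" "v' \<le> T" and le: "u \<le> u'"
    and a: "a \<in> borel_measurable (F u)" "bounded (a ` space M)"
    and a': "a' \<in> borel_measurable (F u')" "bounded (a' ` space M)"
  shows "integrable M (\<lambda>\<omega>. (a \<omega> * (W v \<omega> - W u \<omega>) $ j) * (a' \<omega> * (W v' \<omega> - W u' \<omega>) $ k)) \<and>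
    expectation (\<lambda>\<omega>. (a \<omega> * (W v \<omega> - W u \<omega>) $ j) * (a' \<omega> * (W v' \<omega> - W u' \<omega>) $ k))
      = expectation (\<lambda>\<omega>. a \<omega> * a' \<omega>) * (if j = k then max 0 (min v v' - max u u') else 0)"
proof -
  \<comment> \<open>The right end of the overlap. For disjoint intervals it is \<open>u'\<close>,
    and then \<open>?D2\<close> and \<open>?D3\<close> vanish.\<close>
  define m where "m = max u' (min v v')"
  define h where "h \<omega> = a \<omega> * a' \<omega>" for \<omega>
  let ?D1 = "\<lambda>\<omega>. W (min v u') \<omega> - W u \<omega>" and ?D2 = "\<lambda>\<omega>. W m \<omega> - W u' \<omega>"
    and ?D3 = "\<lambda>\<omega>. W (max v m) \<omega> - W m \<omega>" and ?D4 = "\<lambda>\<omega>. W v' \<omega> - W m \<omega>"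
  have m: "u' \<le> m" "m \<le> v'" "m \<le> max v m" "max v m \<le> T" "m \<le> T" "0 \<le> m"
    using uv by (auto simp: m_def)
  have D: "W v \<omega> - W u \<omega> = ?D1 \<omega> + ?D2 \<omega> + ?D3 \<omega>" "W v' \<omega> - W u' \<omega> = ?D2 \<omega> + ?D4 \<omega>"
    "?D3 \<omega> $ j * ?D4 \<omega> $ k = 0" for \<omega>
  proof -
    consider "v \<le> u'" | "u' < v" "v \<le> v'" | "v' < v" by linarith
    then have "W v \<omega> - W u \<omega> = ?D1 \<omega> + ?D2 \<omega> + ?D3 \<omega> \<and> W v' \<omega> - W u' \<omega> = ?D2 \<omega> + ?D4 \<omega> \<and> ?D3 \<omega> $ j * ?D4 \<omega> $ k = 0"
    proof cases
      case 1
      then have "m = u'" "min v u' = v" "max v m = u'" using uv by (simp_all add: m_def)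
      then show ?thesis by (simp only:) simp
    next
      case 2
      then have "m = v" "min v u' = u'" "max v m = v" using uv by (simp_all add: m_def)
      then show ?thesis by (simp only:) simp
    next
      case 3
      then have "m = v'" "min v u' = u'" "max v m = v" using uv by (simp_all add: m_def)
      then show ?thesis by (simp only:) simp
    qed
    then show "W v \<omega> - W u \<omega> = ?D1 \<omega> + ?D2 \<omega> + ?D3 \<omega>" "W v' \<omega> - W u' \<omega> = ?D2 \<omega> + ?D4 \<omega>"
      "?D3 \<omega> $ j * ?D4 \<omega> $ k = 0" by blast+
  qed
  have hF: "h \<in> borel_measurable (F u')"
    unfolding h_def using measurable_F_mono[of u u' a borel] uv le a a' by (intro borel_measurable_times) auto
  have hM: "h \<in> borel_measurable M" using measurable_F_imp_M[OF _ hF] uv by auto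
  obtain B B' where "\<forall>x\<in>a ` space M. norm x \<le> B" "\<forall>x\<in>a' ` space M. norm x \<le> B'"
    using a(2) a'(2) unfolding bounded_iff by blast
  then have B: "\<And>\<omega>. \<omega> \<in> space M \<Longrightarrow> \<bar>a \<omega>\<bar> \<le> \<bar>B\<bar>" "\<And>\<omega>. \<omega> \<in> space M \<Longrightarrow> \<bar>a' \<omega>\<bar> \<le> \<bar>B'\<bar>"
    by force+
  have hb: "bounded (h ` space M)"
    unfolding bounded_iff h_def
    by (rule exI[of _ "\<bar>B\<bar> * \<bar>B'\<bar>"]) (auto simp: abs_mult intro!: mult_mono B)
  have hi: "integrable M h"
    using integrable_bounded_mult[OF hM hb, of "\<lambda>_. 1"] by simp
  have Wm: "W s \<in> borel_measurable (F t)" if "0 \<le> s" "s \<le> t" "t \<le> T" for s t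
    using W_measurable_F' that by auto
  have hF': "h \<in> borel_measurable (F m)" using measurable_F_mono[of u' m h borel] hF m uv by auto
  have F1: "(\<lambda>\<omega>. h \<omega> * ?D1 \<omega> $ j) \<in> borel_measurable (F u')"
  proof -
    have [measurable]: "W (min v u') \<in> borel_measurable (F u')" "W u \<in> borel_measurable (F u')" "h \<in> borel_measurable (F u')"
      using Wm uv le hF by auto
    show ?thesis by measurable
  qed
  have F1': "(\<lambda>\<omega>. h \<omega> * ?D1 \<omega> $ j) \<in> borel_measurable (F m)"
    using measurable_F_mono[OF uv(4) m(1) m(5) F1] by auto
  have F2: "(\<lambda>\<omega>. h \<omega> * ?D2 \<omega> $ i) \<in> borel_measurable (F m)" for i
  proof -
    have [measurable]: "W m \<in> borel_measurable (F m)" "W u' \<in> borel_measurable (F m)" "h \<in> borel_measurable (F m)"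
      using Wm uv m hF' by auto
    show ?thesis by measurable
  qed
  have I1: "integrable M (\<lambda>\<omega>. h \<omega> * ?D1 \<omega> $ j)"
    using uv le by (intro integrable_bounded_mult[OF hM hb] increment_moments) auto
  have I2: "integrable M (\<lambda>\<omega>. h \<omega> * ?D2 \<omega> $ i)" for i
    using uv m by (intro integrable_bounded_mult[OF hM hb] increment_moments) auto
  note t12 = increment_uncorrelated[OF uv(4) m(1) m(5) F1 I1, of k]
  note t14 = increment_uncorrelated[OF m(6) m(2) uv(6) F1' I1, of k]
  note t24 = increment_uncorrelated[OF m(6) m(2) uv(6) F2[of j] I2[of j], of k]
  note t32 = increment_uncorrelated[OF m(6) m(3) m(4) F2[of k] I2[of k], of j]
  note t22 = increment_square[OF uv(4) m(1) m(5) hF hi, of j k]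
  have eq: "(a \<omega> * (W v \<omega> - W u \<omega>) $ j) * (a' \<omega> * (W v' \<omega> - W u' \<omega>) $ k) =
    h \<omega> * ?D1 \<omega> $ j * ?D2 \<omega> $ k + h \<omega> * ?D1 \<omega> $ j * ?D4 \<omega> $ k + h \<omega> * (?D2 \<omega> $ j * ?D2 \<omega> $ k)
     + h \<omega> * ?D2 \<omega> $ j * ?D4 \<omega> $ k + h \<omega> * ?D2 \<omega> $ k * ?D3 \<omega> $ j" for \<omega>
  proof -
    have "(a \<omega> * (W v \<omega> - W u \<omega>) $ j) * (a' \<omega> * (W v' \<omega> - W u' \<omega>) $ k) =
      h \<omega> * ((?D1 \<omega> $ j + ?D2 \<omega> $ j + ?D3 \<omega> $ j) * (?D2 \<omega> $ k + ?D4 \<omega> $ k))"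
      by (simp only: D(1,2) vector_add_component h_def mult_ac)
    also have "\<dots> = h \<omega> * ?D1 \<omega> $ j * ?D2 \<omega> $ k + h \<omega> * ?D1 \<omega> $ j * ?D4 \<omega> $ k + h \<omega> * (?D2 \<omega> $ j * ?D2 \<omega> $ k)
     + h \<omega> * ?D2 \<omega> $ j * ?D4 \<omega> $ k + h \<omega> * ?D2 \<omega> $ k * ?D3 \<omega> $ j + h \<omega> * (?D3 \<omega> $ j * ?D4 \<omega> $ k)"
      by (simp only: distrib_left distrib_right mult_ac add_ac)
    finally show ?thesis by (simp only: D(3) mult_zero_right add_0_right)
  qed
  have ov: "m - u' = max 0 (min v v' - max u u')" using le by (auto simp: m_def)
  show ?thesis
    unfolding eq using t12 t14 t24 t32 t22 ov by (simp add: h_def[symmetric])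
qed

lemma elementary_integrals_product:
  fixes a a' :: "'w \<Rightarrow> real"
  assumes "0 \<le> u" "u \<le> v" "v \<le> T" "0 \<le> u'" "u' \<le> v'" "v' \<le> T"
    and "a \<in> borel_measurable (F u)" "bounded (a ` space M)"
    and "a' \<in> borel_measurable (F u')" "bounded (a' ` space M)"
  shows "integrable M (\<lambda>\<omega>. (a \<omega> * (W v \<omega> - W u \<omega>) $ j) * (a' \<omega> * (W v' \<omega> - W u' \<omega>) $ k))"
    "expectation (\<lambda>\<omega>. (a \<omega> * (W v \<omega> - W u \<omega>) $ j) * (a' \<omega> * (W v' \<omega> - W u' \<omega>) $ k))
      = expectation (\<lambda>\<omega>. a \<omega> * a' \<omega>) * (if j = k then max 0 (min v v' - max u u') else 0)"
  using elementary_integrals_product_aux[of u v u' v' a a' j k]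
    elementary_integrals_product_aux[of u' v' u v a' a k j] assms
  by (cases "u \<le> u'"; simp add: mult.commute min.commute max.commute)+

end

lemma integral_indicator_Ioc_mult:
  fixes a b c d :: real
  shows "has_bochner_integral lborel (\<lambda>s. indicator {a<..b} s * indicator {c<..d} s :: real) (max 0 (min b d - max a c))"
proof -
  have "(\<lambda>s. indicator {a<..b} s * indicator {c<..d} s :: real) = indicator {max a c<..min b d}"
    by (auto simp: fun_eq_iff indicator_def)
  moreover have fin: "emeasure lborel {x<..y} < \<top>" for x y :: real by (cases "x \<le> y") auto
  have "has_bochner_integral lborel (indicator {max a c<..min b d} :: real \<Rightarrow> real)
      (measure lborel {max a c<..min b d})"
    by (intro has_bochner_integral_real_indicator) (auto simp: fin)
  moreover have "measure lborel {max a c<..min b d} = max 0 (min b d - max a c)"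
    by (cases "max a c \<le> min b d") auto
  ultimately show ?thesis by simp
qed

context filtered_brownian
begin

text \<open>The intervals may overlap and come in no order: both sides expand into double sums over
  pairs of indices, and each pair contributes the expected product of the coefficients times the
  length of the overlap. Thus simple processes over different partitions can be combined without a
  common refinement.\<close>

lemma elementary_isometry:
  fixes A :: "'i \<Rightarrow> 'w \<Rightarrow> real^'d^'n"
  assumes J: "finite J"
    and uv: "\<And>i. i \<in> J \<Longrightarrow> 0 \<le> u i" "\<And>i. i \<in> J \<Longrightarrow> u i \<le> v i" "\<And>i. i \<in> J \<Longrightarrow> v i \<le> T"
    and A: "\<And>i. i \<in> J \<Longrightarrow> A i \<in> borel_measurable (F (u i))" "\<And>i. i \<in> J \<Longrightarrow> bounded (A i ` space M)"
  shows "(\<integral>\<^sup>+\<omega>. ennreal ((norm (\<Sum>i\<in>J. A i \<omega> *v (W (v i) \<omega> - W (u i) \<omega>)))\<^sup>2) \<partial>M)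
     = (\<integral>\<^sup>+\<omega>. (\<integral>\<^sup>+s. ennreal ((norm (\<Sum>i\<in>J. indicator {u i<..v i} s *\<^sub>R A i \<omega>))\<^sup>2) \<partial>lborel) \<partial>M)"
proof -
  define ov where "ov i i' = max 0 (min (v i) (v i') - max (u i) (u i'))" for i i'
  define D where "D i \<omega> = W (v i) \<omega> - W (u i) \<omega>" for i \<omega>
  define S where "S \<omega> = (\<Sum>i\<in>J. A i \<omega> *v D i \<omega>)" for \<omega>
  have AF: "(\<lambda>\<omega>. A i \<omega> $ l $ j) \<in> borel_measurable (F (u i))" if "i \<in> J" for i l j
    using A(1)[OF that] by measurable
  have Ab: "bounded ((\<lambda>\<omega>. A i \<omega> $ l $ j) ` space M)" if "i \<in> J" for i l j
  proof -
    obtain B where B: "\<forall>x\<in>A i ` space M. norm x \<le> B" using A(2)[OF \<open>i \<in> J\<close>] unfolding bounded_iff by blast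
    have "norm (A i \<omega> $ l $ j) \<le> B" if "\<omega> \<in> space M" for \<omega>
      using B that Finite_Cartesian_Product.norm_nth_le[of "A i \<omega>" l] Finite_Cartesian_Product.norm_nth_le[of "A i \<omega> $ l" j] by fastforce
    then show ?thesis unfolding bounded_iff by blast
  qed
  have S2: "(norm (S \<omega>))\<^sup>2 = (\<Sum>l\<in>UNIV. \<Sum>i\<in>J. \<Sum>i'\<in>J. \<Sum>j\<in>UNIV. \<Sum>k\<in>UNIV.
      (A i \<omega> $ l $ j * D i \<omega> $ j) * (A i' \<omega> $ l $ k * D i' \<omega> $ k))" for \<omega>
    unfolding power2_norm_eq_inner inner_vec_def inner_real_def S_def
    by (simp only: sum_component matrix_vector_mult_def vec_lambda_beta sum_product)
  have trm: "has_bochner_integral M (\<lambda>\<omega>. (A i \<omega> $ l $ j * D i \<omega> $ j) * (A i' \<omega> $ l $ k * D i' \<omega> $ k))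
    (expectation (\<lambda>\<omega>. A i \<omega> $ l $ j * A i' \<omega> $ l $ k) * (if j = k then ov i i' else 0))"
    if "i \<in> J" "i' \<in> J" for l i i' j k
    unfolding has_bochner_integral_iff D_def ov_def
    using elementary_integrals_product[OF uv(1)[OF that(1)] uv(2)[OF that(1)] uv(3)[OF that(1)]
        uv(1)[OF that(2)] uv(2)[OF that(2)] uv(3)[OF that(2)] AF[OF that(1)] Ab[OF that(1)] AF[OF that(2)] Ab[OF that(2)]]
    by blast
  have "has_bochner_integral M (\<lambda>\<omega>. (norm (S \<omega>))\<^sup>2) (\<Sum>l\<in>UNIV. \<Sum>i\<in>J. \<Sum>i'\<in>J. \<Sum>j\<in>UNIV. \<Sum>k\<in>UNIV.
      expectation (\<lambda>\<omega>. A i \<omega> $ l $ j * A i' \<omega> $ l $ k) * (if j = k then ov i i' else 0))"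
    unfolding S2 by (intro has_bochner_integral_sum trm) auto
  then have left: "has_bochner_integral M (\<lambda>\<omega>. (norm (S \<omega>))\<^sup>2)
     (\<Sum>l\<in>UNIV. \<Sum>i\<in>J. \<Sum>i'\<in>J. \<Sum>j\<in>UNIV. expectation (\<lambda>\<omega>. A i \<omega> $ l $ j * A i' \<omega> $ l $ j) * ov i i')"
    by (simp add: if_distrib cong: if_cong)
  define R where "R \<omega> = (\<Sum>i\<in>J. \<Sum>i'\<in>J. ov i i' * (A i \<omega> \<bullet> A i' \<omega>))" for \<omega>
  have inner: "has_bochner_integral lborel (\<lambda>s. (norm (\<Sum>i\<in>J. indicator {u i<..v i} s *\<^sub>R A i \<omega>))\<^sup>2) (R \<omega>)" for \<omega>
  proof -
    have "(norm (\<Sum>i\<in>J. indicator {u i<..v i} s *\<^sub>R A i \<omega>))\<^sup>2 =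
      (\<Sum>i\<in>J. \<Sum>i'\<in>J. (indicator {u i<..v i} s * indicator {u i'<..v i'} s) * (A i \<omega> \<bullet> A i' \<omega>))" for s
      unfolding power2_norm_eq_inner inner_sum_left
      unfolding inner_sum_right by (simp add: mult_ac)
    then show ?thesis
      unfolding R_def ov_def
      by (simp only:) (intro has_bochner_integral_sum has_bochner_integral_mult_left integral_indicator_Ioc_mult)
  qed
  have "has_bochner_integral M (\<lambda>\<omega>. \<Sum>l\<in>UNIV. \<Sum>i\<in>J. \<Sum>i'\<in>J. \<Sum>j\<in>UNIV. (A i \<omega> $ l $ j * A i' \<omega> $ l $ j) * ov i i')
     (\<Sum>l\<in>UNIV. \<Sum>i\<in>J. \<Sum>i'\<in>J. \<Sum>j\<in>UNIV. expectation (\<lambda>\<omega>. A i \<omega> $ l $ j * A i' \<omega> $ l $ j) * ov i i')"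
  proof (intro has_bochner_integral_sum has_bochner_integral_mult_left)
    fix l i i' j assume i: "i \<in> J" "i' \<in> J"
    have m: "(\<lambda>\<omega>. A i \<omega> $ l $ j) \<in> borel_measurable M" if "i \<in> J" for i
      using measurable_F_imp_M[OF _ AF[OF that]] uv[OF that] by force
    have "integrable M (\<lambda>\<omega>. A i' \<omega> $ l $ j * 1)"
      by (intro integrable_bounded_mult m Ab i) auto
    then have "integrable M (\<lambda>\<omega>. A i \<omega> $ l $ j * A i' \<omega> $ l $ j)"
      by (intro integrable_bounded_mult m Ab i) auto
    then show "has_bochner_integral M (\<lambda>\<omega>. A i \<omega> $ l $ j * A i' \<omega> $ l $ j)
        (expectation (\<lambda>\<omega>. A i \<omega> $ l $ j * A i' \<omega> $ l $ j))"
      by (rule has_bochner_integral_integrable)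
  qed
  moreover have "R \<omega> = (\<Sum>l\<in>UNIV. \<Sum>i\<in>J. \<Sum>i'\<in>J. \<Sum>j\<in>UNIV. (A i \<omega> $ l $ j * A i' \<omega> $ l $ j) * ov i i')" for \<omega>
  proof -
    have "R \<omega> = (\<Sum>i\<in>J. \<Sum>i'\<in>J. \<Sum>l\<in>UNIV. \<Sum>j\<in>UNIV. (A i \<omega> $ l $ j * A i' \<omega> $ l $ j) * ov i i')"
      unfolding R_def inner_vec_def inner_real_def by (simp add: sum_distrib_left mult_ac)
    also have "\<dots> = (\<Sum>i\<in>J. \<Sum>l\<in>UNIV. \<Sum>i'\<in>J. \<Sum>j\<in>UNIV. (A i \<omega> $ l $ j * A i' \<omega> $ l $ j) * ov i i')"
      by (intro sum.cong refl sum.swap)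
    finally show ?thesis by (subst sum.swap)
  qed
  ultimately have right: "has_bochner_integral M R
     (\<Sum>l\<in>UNIV. \<Sum>i\<in>J. \<Sum>i'\<in>J. \<Sum>j\<in>UNIV. expectation (\<lambda>\<omega>. A i \<omega> $ l $ j * A i' \<omega> $ l $ j) * ov i i')"
    by presburger
  have R0: "0 \<le> R \<omega>" for \<omega>
    unfolding has_bochner_integral_integral_eq[OF inner, symmetric] by (rule Bochner_Integration.integral_nonneg) simp
  have "(\<integral>\<^sup>+\<omega>. ennreal ((norm (S \<omega>))\<^sup>2) \<partial>M) = (\<integral>\<^sup>+\<omega>. ennreal (R \<omega>) \<partial>M)"
    using left right R0 by (simp add: nn_integral_eq_integral has_bochner_integral_iff)
  also have "\<dots> = (\<integral>\<^sup>+\<omega>. (\<integral>\<^sup>+s. ennreal ((norm (\<Sum>i\<in>J. indicator {u i<..v i} s *\<^sub>R A i \<omega>))\<^sup>2) \<partial>lborel) \<partial>M)"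
    using inner by (intro nn_integral_cong) (simp add: nn_integral_eq_integral has_bochner_integral_iff)
  finally show ?thesis unfolding S_def D_def .
qed

end

text \<open>Processes are measurable only over the time interval, while Tonelli is applied over the
  whole real line; extension by zero bridges the two.\<close>

lemma borel_measurable_extend_indicator:
  fixes f :: "real \<times> 'w \<Rightarrow> ennreal"
  assumes f: "f \<in> borel_measurable (restrict_space borel S \<Otimes>\<^sub>M M)" and S[measurable]: "S \<in> sets borel"
  shows "(\<lambda>x. f x * indicator S (fst x)) \<in> borel_measurable (borel \<Otimes>\<^sub>M M)"
proof -
  let ?R = "restrict_space (borel \<Otimes>\<^sub>M M) (S \<times> space M)"
  have "(\<lambda>x. x) \<in> ?R \<rightarrow>\<^sub>M (restrict_space borel S \<Otimes>\<^sub>M M)"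
  proof (rule measurable_pair)
    show "fst \<circ> (\<lambda>x. x) \<in> ?R \<rightarrow>\<^sub>M restrict_space borel S"
      by (intro measurable_restrict_space2) (auto simp: comp_def space_restrict_space intro: measurable_restrict_space1)
    show "snd \<circ> (\<lambda>x. x) \<in> ?R \<rightarrow>\<^sub>M M"
      by (auto simp: comp_def intro: measurable_restrict_space1)
  qed
  from measurable_compose[OF this f]
  have "(\<lambda>x. f x * indicator (S \<times> space M) x) \<in> borel_measurable (borel \<Otimes>\<^sub>M M)"
    by (subst (asm) borel_measurable_restrict_space_iff_ennreal) auto
  then show ?thesis
    by (subst measurable_cong[where g="\<lambda>x. f x * indicator (S \<times> space M) x"])
      (auto simp: space_pair_measure indicator_def)
qed

section \<open>Second moments of combinations of Ito integrals\<close>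

context filtered_brownian
begin

text \<open>Clamping the partition points to \<open>{r..t}\<close> turns the difference into one
  elementary sum. Summands with \<open>\<tau> i > t\<close> vanish and have to be dropped, because
  their coefficient \<open>A i\<close> need not be measurable for \<open>F\<close> at the clamped
  point \<open>t\<close>.\<close>

lemma simple_integral_diff_eq:
  assumes Z: "simple_process T M F (n, \<tau>, A)" and rt: "0 \<le> r" "r \<le> t" "t \<le> T"
  defines "cl \<equiv> \<lambda>x. max r (min t x)"
  shows "simple_integral W (n, \<tau>, A) t \<omega> - simple_integral W (n, \<tau>, A) r \<omega>
    = (\<Sum>i\<in>{i. i < n \<and> \<tau> i \<le> t}. A i \<omega> *v (W (cl (\<tau> (Suc i))) \<omega> - W (cl (\<tau> i)) \<omega>))"
proof -
  have W: "W (min t x) \<omega> - W (min r x) \<omega> = W (cl x) \<omega> - W r \<omega>" for x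
    using rt by (cases "x \<le> r") (simp_all add: cl_def)
  have "simple_integral W (n, \<tau>, A) t \<omega> - simple_integral W (n, \<tau>, A) r \<omega>
    = (\<Sum>i<n. A i \<omega> *v ((W (min t (\<tau> (Suc i))) \<omega> - W (min r (\<tau> (Suc i))) \<omega>) - (W (min t (\<tau> i)) \<omega> - W (min r (\<tau> i)) \<omega>)))"
    by (simp add: sum_subtractf[symmetric] matrix_vector_mult_diff_distrib algebra_simps)
  also have "\<dots> = (\<Sum>i<n. A i \<omega> *v (W (cl (\<tau> (Suc i))) \<omega> - W (cl (\<tau> i)) \<omega>))"
    unfolding W by simp
  also have "\<dots> = (\<Sum>i\<in>{i. i < n \<and> \<tau> i \<le> t}. A i \<omega> *v (W (cl (\<tau> (Suc i))) \<omega> - W (cl (\<tau> i)) \<omega>))"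
  proof (rule sum.mono_neutral_right)
    show "\<forall>i\<in>{..<n} - {i. i < n \<and> \<tau> i \<le> t}. A i \<omega> *v (W (cl (\<tau> (Suc i))) \<omega> - W (cl (\<tau> i)) \<omega>) = 0"
    proof
      fix i assume i: "i \<in> {..<n} - {i. i < n \<and> \<tau> i \<le> t}"
      then have "t < \<tau> i" "\<tau> i \<le> \<tau> (Suc i)" using Z by auto
      then have "cl (\<tau> (Suc i)) = t" "cl (\<tau> i) = t" using rt by (simp_all add: cl_def)
      then show "A i \<omega> *v (W (cl (\<tau> (Suc i))) \<omega> - W (cl (\<tau> i)) \<omega>) = 0" by simp
    qed
  qed auto
  finally show ?thesis .
qed

lemma simple_value_restrict:
  assumes Z: "simple_process T M F (n, \<tau>, A)" and s: "0 \<le> r" "r < s" "s \<le> t"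
  defines "cl \<equiv> \<lambda>x. max r (min t x)"
  shows "simple_value (n, \<tau>, A) s \<omega>
    = (\<Sum>i\<in>{i. i < n \<and> \<tau> i \<le> t}. indicator {cl (\<tau> i)<..cl (\<tau> (Suc i))} s *\<^sub>R A i \<omega>)"
proof -
  have "indicator {cl (\<tau> i)<..cl (\<tau> (Suc i))} s = (indicator {\<tau> i<..\<tau> (Suc i)} s :: real)" for i
    using s by (auto simp: indicator_def cl_def)
  then have "(\<Sum>i\<in>{i. i < n \<and> \<tau> i \<le> t}. indicator {cl (\<tau> i)<..cl (\<tau> (Suc i))} s *\<^sub>R A i \<omega>)
    = (\<Sum>i\<in>{i. i < n \<and> \<tau> i \<le> t}. indicator {\<tau> i<..\<tau> (Suc i)} s *\<^sub>R A i \<omega>)" by simp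
  also have "\<dots> = (\<Sum>i<n. indicator {\<tau> i<..\<tau> (Suc i)} s *\<^sub>R A i \<omega>)"
    using s by (intro sum.mono_neutral_left) (auto simp: indicator_def split: if_splits)
  finally show ?thesis by simp
qed

text \<open>The summands of all processes are pooled into one family indexed by pairs, to which the
  isometry for overlapping intervals applies. Only an inequality is recorded, because the closed
  interval contains \<open>r\<close>, where the clamped indicators vanish.\<close>

lemma simple_combination_bound:
  fixes N :: "'i \<Rightarrow> nat" and A :: "'i \<Rightarrow> nat \<Rightarrow> 'w \<Rightarrow> real^'d^'n"
  assumes Q: "finite Q" and Z: "\<And>l. l \<in> Q \<Longrightarrow> simple_process T M F (N l, \<tau> l, A l)"
    and rt: "0 \<le> r" "r \<le> t" "t \<le> T"
  shows "(\<integral>\<^sup>+\<omega>. ennreal ((norm (\<Sum>l\<in>Q. c l *\<^sub>R (simple_integral W (N l, \<tau> l, A l) t \<omega> - simple_integral W (N l, \<tau> l, A l) r \<omega>)))\<^sup>2) \<partial>M)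
    \<le> (\<integral>\<^sup>+\<omega>. (\<integral>\<^sup>+s\<in>{r..t}. ennreal ((norm (\<Sum>l\<in>Q. c l *\<^sub>R simple_value (N l, \<tau> l, A l) s \<omega>))\<^sup>2) \<partial>lborel) \<partial>M)"
proof -
  define cl where "cl x = max r (min t x)" for x
  define B where "B l = {i. i < N l \<and> \<tau> l i \<le> t}" for l
  have fB: "finite (B l)" for l unfolding B_def by auto
  define u where "u p = cl (\<tau> (fst p) (snd p))" for p
  define v where "v p = cl (\<tau> (fst p) (Suc (snd p)))" for p
  define A' where "A' p \<omega> = c (fst p) *\<^sub>R A (fst p) (snd p) \<omega>" for p \<omega>
  have S: "(\<Sum>l\<in>Q. c l *\<^sub>R (simple_integral W (N l, \<tau> l, A l) t \<omega> - simple_integral W (N l, \<tau> l, A l) r \<omega>))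
    = (\<Sum>p\<in>Sigma Q B. A' p \<omega> *v (W (v p) \<omega> - W (u p) \<omega>))" for \<omega>
  proof -
    have "(\<Sum>l\<in>Q. c l *\<^sub>R (simple_integral W (N l, \<tau> l, A l) t \<omega> - simple_integral W (N l, \<tau> l, A l) r \<omega>))
      = (\<Sum>l\<in>Q. \<Sum>i\<in>B l. A' (l, i) \<omega> *v (W (v (l, i)) \<omega> - W (u (l, i)) \<omega>))"
    proof (rule sum.cong)
      fix l assume "l \<in> Q"
      from simple_integral_diff_eq[OF Z[OF this] rt, of \<omega>]
      show "c l *\<^sub>R (simple_integral W (N l, \<tau> l, A l) t \<omega> - simple_integral W (N l, \<tau> l, A l) r \<omega>)
        = (\<Sum>i\<in>B l. A' (l, i) \<omega> *v (W (v (l, i)) \<omega> - W (u (l, i)) \<omega>))"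
        by (simp only: A'_def u_def v_def B_def cl_def fst_conv snd_conv scaleR_sum_right scaleR_matrix_vector_assoc)
    qed simp
    also have "\<dots> = (\<Sum>p\<in>Sigma Q B. A' p \<omega> *v (W (v p) \<omega> - W (u p) \<omega>))"
      using Q fB by (subst sum.Sigma) (auto simp: case_prod_beta)
    finally show ?thesis .
  qed
  have V: "(\<Sum>l\<in>Q. c l *\<^sub>R simple_value (N l, \<tau> l, A l) s \<omega>) = (\<Sum>p\<in>Sigma Q B. indicator {u p<..v p} s *\<^sub>R A' p \<omega>)"
    if s: "r < s" "s \<le> t" for s \<omega>
  proof -
    have "(\<Sum>l\<in>Q. c l *\<^sub>R simple_value (N l, \<tau> l, A l) s \<omega>) = (\<Sum>l\<in>Q. \<Sum>i\<in>B l. indicator {u (l, i)<..v (l, i)} s *\<^sub>R A' (l, i) \<omega>)"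
    proof (rule sum.cong)
      fix l assume "l \<in> Q"
      from simple_value_restrict[OF Z[OF this] rt(1) s, of \<omega>]
      show "c l *\<^sub>R simple_value (N l, \<tau> l, A l) s \<omega> = (\<Sum>i\<in>B l. indicator {u (l, i)<..v (l, i)} s *\<^sub>R A' (l, i) \<omega>)"
        by (simp only: A'_def u_def v_def B_def cl_def fst_conv snd_conv scaleR_sum_right scaleR_scaleR mult.commute)
    qed simp
    also have "\<dots> = (\<Sum>p\<in>Sigma Q B. indicator {u p<..v p} s *\<^sub>R A' p \<omega>)"
      using Q fB by (subst sum.Sigma) (auto simp: case_prod_beta)
    finally show ?thesis .
  qed
  have "(\<integral>\<^sup>+\<omega>. ennreal ((norm (\<Sum>p\<in>Sigma Q B. A' p \<omega> *v (W (v p) \<omega> - W (u p) \<omega>)))\<^sup>2) \<partial>M)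
     = (\<integral>\<^sup>+\<omega>. (\<integral>\<^sup>+s. ennreal ((norm (\<Sum>p\<in>Sigma Q B. indicator {u p<..v p} s *\<^sub>R A' p \<omega>))\<^sup>2) \<partial>lborel) \<partial>M)"
  proof (rule elementary_isometry)
    show "finite (Sigma Q B)" using Q fB by auto
    fix p assume "p \<in> Sigma Q B"
    then obtain l i where p: "p = (l, i)" "l \<in> Q" "i < N l" "\<tau> l i \<le> t" by (auto simp: B_def)
    have Zl: "\<tau> l i \<in> {0..T}" "\<tau> l i \<le> \<tau> l (Suc i)" "A l i \<in> borel_measurable (F (\<tau> l i))" "bounded (A l i ` space M)"
      using Z[OF p(2)] p(3) by auto
    show "0 \<le> u p" "v p \<le> T" using rt Zl by (auto simp: u_def v_def cl_def p)
    show "u p \<le> v p" using Zl(2) unfolding u_def v_def cl_def p fst_conv snd_conv by (intro max.mono min.mono order_refl)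
    have "A l i \<in> borel_measurable (F (u p))"
      by (rule measurable_F_mono[OF _ _ _ Zl(3)]) (use rt Zl p in \<open>auto simp: u_def cl_def\<close>)
    then show "A' p \<in> borel_measurable (F (u p))" unfolding A'_def p by simp
    show "bounded (A' p ` space M)"
      using bounded_scaling[OF Zl(4), of "c l"] unfolding A'_def p by (simp add: image_image)
  qed
  also have "\<dots> \<le> (\<integral>\<^sup>+\<omega>. (\<integral>\<^sup>+s\<in>{r..t}. ennreal ((norm (\<Sum>l\<in>Q. c l *\<^sub>R simple_value (N l, \<tau> l, A l) s \<omega>))\<^sup>2) \<partial>lborel) \<partial>M)"
  proof (intro nn_integral_mono)
    fix \<omega> s
    show "ennreal ((norm (\<Sum>p\<in>Sigma Q B. indicator {u p<..v p} s *\<^sub>R A' p \<omega>))\<^sup>2)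
      \<le> ennreal ((norm (\<Sum>l\<in>Q. c l *\<^sub>R simple_value (N l, \<tau> l, A l) s \<omega>))\<^sup>2) * indicator {r..t} s"
    proof (cases "r < s \<and> s \<le> t")
      case True
      then show ?thesis using V[of s \<omega>] by simp
    next
      case False
      then have "indicator {u p<..v p} s = (0::real)" for p
        using rt by (auto simp: indicator_def u_def v_def cl_def)
      then show ?thesis by simp
    qed
  qed
  finally show ?thesis unfolding S .
qed

text \<open>Each integral is an \<open>L^2\<close> limit along its own sequence of simple processes,
  so the bound for simple combinations passes to the limit. The factor 4 comes from squaring a sum
  twice, once when the integrals and once when the integrands are replaced by their approximations.
  It only enlarges the constants in Gronwall estimates.\<close>

theorem ito_combination_bound:
  fixes H :: "'i \<Rightarrow> real \<Rightarrow> 'w \<Rightarrow> real^'d^'n"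
  assumes Q: "finite Q" and ito: "\<And>l. l \<in> Q \<Longrightarrow> is_ito_integral T M F W (H l) (I l)"
    and rt: "0 \<le> r" "r \<le> t" "t \<le> T"
  shows "(\<integral>\<^sup>+\<omega>. ennreal ((norm (\<Sum>l\<in>Q. c l *\<^sub>R (I l t \<omega> - I l r \<omega>)))\<^sup>2) \<partial>M)
    \<le> 4 * (\<integral>\<^sup>+\<omega>. (\<integral>\<^sup>+s\<in>{r..t}. ennreal ((norm (\<Sum>l\<in>Q. c l *\<^sub>R H l s \<omega>))\<^sup>2) \<partial>lborel) \<partial>M)"
proof -
  have "\<forall>l\<in>Q. \<exists>Z. (\<forall>k. simple_process T M F (Z k)) \<and>
        (\<lambda>k. \<integral>\<^sup>+\<omega>. (\<integral>\<^sup>+s\<in>{0..T}. (ennreal ((norm (simple_value (Z k) s \<omega> - H l s \<omega>))\<^sup>2)) \<partial>lborel) \<partial>M)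
          \<longlonglongrightarrow> 0 \<and>
        (\<forall>t\<in>{0..T}. (\<lambda>k. \<integral>\<^sup>+\<omega>. ennreal ((norm (simple_integral W (Z k) t \<omega> - I l t \<omega>))\<^sup>2) \<partial>M)
          \<longlonglongrightarrow> 0)"
    using ito unfolding is_ito_integral_def by blast
  from bchoice[OF this] obtain Z where
    Z0: "\<And>l k. l \<in> Q \<Longrightarrow> simple_process T M F (Z l k)"
    and ZH: "\<And>l. l \<in> Q \<Longrightarrow> (\<lambda>k. \<integral>\<^sup>+\<omega>. (\<integral>\<^sup>+s\<in>{0..T}. (ennreal ((norm (simple_value (Z l k) s \<omega> - H l s \<omega>))\<^sup>2)) \<partial>lborel) \<partial>M)
          \<longlonglongrightarrow> 0"
    and ZI: "\<And>l t. l \<in> Q \<Longrightarrow> t \<in> {0..T} \<Longrightarrow> (\<lambda>k. \<integral>\<^sup>+\<omega>. ennreal ((norm (simple_integral W (Z l k) t \<omega> - I l t \<omega>))\<^sup>2) \<partial>M)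
          \<longlonglongrightarrow> 0" by blast
  define N where "N l k = fst (Z l k)" for l k
  define \<tau> where "\<tau> l k = fst (snd (Z l k))" for l k
  define A where "A l k = snd (snd (Z l k))" for l k
  have Ze: "Z l k = (N l k, \<tau> l k, A l k)" for l k by (simp add: N_def \<tau>_def A_def)
  define X where "X l k = simple_integral W (Z l k)" for l k
  define V where "V l k = simple_value (Z l k)" for l k
  have Im[measurable]: "I l s \<in> borel_measurable M" if "l \<in> Q" "s \<in> {0..T}" for l s
    using ito[OF that(1)] that measurable_F_imp_M unfolding is_ito_integral_def by blast
  have AM: "A l k i \<in> borel_measurable M" if "l \<in> Q" "i < N l k" for l k i
  proof -
    have "\<tau> l k i \<in> {0..T}" "A l k i \<in> borel_measurable (F (\<tau> l k i))"
      using Z0[OF that(1), of k] that(2) unfolding Ze by auto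
    then show ?thesis by (rule measurable_F_imp_M)
  qed
  have Xm: "X l k s \<in> borel_measurable M" if "l \<in> Q" "s \<in> {0..T}" for l k s
  proof -
    have "(\<lambda>\<omega>. A l k i \<omega> *v (W (min s (\<tau> l k (Suc i))) \<omega> - W (min s (\<tau> l k i)) \<omega>)) \<in> borel_measurable M" if i: "i < N l k" for i
    proof -
      have "0 \<le> \<tau> l k i" "0 \<le> \<tau> l k (Suc i)" using Z0[OF \<open>l \<in> Q\<close>, of k] i unfolding Ze by auto
      then have [measurable]: "W (min s (\<tau> l k (Suc i))) \<in> borel_measurable M" "W (min s (\<tau> l k i)) \<in> borel_measurable M"
        "A l k i \<in> borel_measurable M"
        using \<open>s \<in> {0..T}\<close> i AM \<open>l \<in> Q\<close> by (auto intro!: W_measurable)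
      show ?thesis unfolding matrix_vector_mult_def by measurable
    qed
    moreover have "X l k s = (\<lambda>\<omega>. \<Sum>i<N l k. A l k i \<omega> *v (W (min s (\<tau> l k (Suc i))) \<omega> - W (min s (\<tau> l k i)) \<omega>))"
      by (simp add: fun_eq_iff X_def Ze)
    ultimately show ?thesis by simp
  qed
  have Vm: "(\<lambda>(s, \<omega>). V l k s \<omega>) \<in> borel_measurable (borel \<Otimes>\<^sub>M M)" if "l \<in> Q" for l k
  proof -
    have "(\<lambda>(s, \<omega>). indicator {\<tau> l k i<..\<tau> l k (Suc i)} s *\<^sub>R A l k i \<omega>) \<in> borel_measurable (borel \<Otimes>\<^sub>M M)" if i: "i < N l k" for i
      using AM[OF \<open>l \<in> Q\<close> i] by measurable
    then have "(\<lambda>x. \<Sum>i<N l k. case x of (s, \<omega>) \<Rightarrow> indicator {\<tau> l k i<..\<tau> l k (Suc i)} s *\<^sub>R A l k i \<omega>) \<in> borel_measurable (borel \<Otimes>\<^sub>M M)"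
      by (intro borel_measurable_sum) simp
    moreover have "(\<lambda>(s, \<omega>). V l k s \<omega>) = (\<lambda>x. \<Sum>i<N l k. case x of (s, \<omega>) \<Rightarrow> indicator {\<tau> l k i<..\<tau> l k (Suc i)} s *\<^sub>R A l k i \<omega>)"
      by (rule ext) (simp only: V_def Ze simple_value.simps split_beta)
    ultimately show ?thesis by (simp only:)
  qed
  have Hm: "(\<lambda>(s, \<omega>). H l s \<omega>) \<in> borel_measurable (restrict_space borel {0..T} \<Otimes>\<^sub>M M)" if "l \<in> Q" for l
    using ito[OF that] by (auto simp: is_ito_integral_def)
  \<comment> \<open>The weights that Cauchy-Schwarz for the finite sum over \<open>Q\<close> puts on
    the single errors.\<close>
  define \<alpha> where "\<alpha> l = ennreal (real (card Q) * (c l)\<^sup>2)" for l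
  define hd where "hd l k s \<omega> = ennreal ((norm (V l k s \<omega> - H l s \<omega>))\<^sup>2) * indicator {0..T} s" for l k s \<omega>
  define h where "h s \<omega> = ennreal ((norm (\<Sum>l\<in>Q. c l *\<^sub>R H l s \<omega>))\<^sup>2) * indicator {r..t} s" for s \<omega>
  have hd_m: "(\<lambda>(s, \<omega>). hd l k s \<omega>) \<in> borel_measurable (borel \<Otimes>\<^sub>M M)" if "l \<in> Q" for l k
  proof -
    have "(\<lambda>(s, \<omega>). V l k s \<omega>) \<in> borel_measurable (restrict_space borel {0..T} \<Otimes>\<^sub>M M)"
    proof (rule measurable_compose[OF _ Vm[OF that], of "\<lambda>x. x", simplified])
      have "fst \<in> restrict_space borel {0..T} \<Otimes>\<^sub>M M \<rightarrow>\<^sub>M borel"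
        by (rule measurable_compose[OF measurable_fst measurable_restrict_space1]) simp
      then show "(\<lambda>x. x) \<in> restrict_space borel {0..T} \<Otimes>\<^sub>M M \<rightarrow>\<^sub>M borel \<Otimes>\<^sub>M M"
        by (intro measurable_pair) (auto simp: comp_def)
    qed
    with Hm[OF that] have "(\<lambda>x. ennreal ((norm (V l k (fst x) (snd x) - H l (fst x) (snd x)))\<^sup>2)) \<in> borel_measurable (restrict_space borel {0..T} \<Otimes>\<^sub>M M)"
      by (simp add: case_prod_beta)
    from borel_measurable_extend_indicator[OF this] show ?thesis
      by (simp add: hd_def case_prod_beta)
  qed
  have h_m: "(\<lambda>(s, \<omega>). h s \<omega>) \<in> borel_measurable (borel \<Otimes>\<^sub>M M)"
  proof -
    have "(\<lambda>x. ennreal ((norm (\<Sum>l\<in>Q. c l *\<^sub>R H l (fst x) (snd x)))\<^sup>2)) \<in> borel_measurable (restrict_space borel {0..T} \<Otimes>\<^sub>M M)"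
      using Hm by (simp add: case_prod_beta)
    from borel_measurable_extend_indicator[OF this]
    have "(\<lambda>x. ennreal ((norm (\<Sum>l\<in>Q. c l *\<^sub>R H l (fst x) (snd x)))\<^sup>2) * indicator {0..T} (fst x) * indicator {r..t} (fst x)) \<in> borel_measurable (borel \<Otimes>\<^sub>M M)"
      by simp
    also have "(\<lambda>x. ennreal ((norm (\<Sum>l\<in>Q. c l *\<^sub>R H l (fst x) (snd x)))\<^sup>2) * indicator {0..T} (fst x) * indicator {r..t} (fst x)) = (\<lambda>(s, \<omega>). h s \<omega>)"
      using rt by (auto simp: h_def fun_eq_iff indicator_def)
    finally show ?thesis .
  qed
  have sw: "(\<lambda>(\<omega>, s). f s \<omega>) \<in> borel_measurable (M \<Otimes>\<^sub>M lborel)"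
    if "(\<lambda>(s, \<omega>). f s \<omega>) \<in> borel_measurable (borel \<Otimes>\<^sub>M M)" for f :: "real \<Rightarrow> 'w \<Rightarrow> ennreal"
  proof -
    have "(\<lambda>(s, \<omega>). f s \<omega>) \<in> borel_measurable (lborel \<Otimes>\<^sub>M M)"
      using that by (simp cong: measurable_cong_sets)
    from measurable_pair_swap[OF this] show ?thesis by simp
  qed
  \<comment> \<open>The errors of the approximating integrals at the times \<open>t\<close> and
    \<open>r\<close>; \<open>e2\<close> collects those of the integrands. Both tend to 0, while the
    estimate of \<open>?L\<close> holds for every \<open>k\<close>.\<close>
  define e1 where "e1 k = (\<Sum>l\<in>Q. \<alpha> l * (2 * (\<integral>\<^sup>+\<omega>. ennreal ((norm (X l k t \<omega> - I l t \<omega>))\<^sup>2) \<partial>M)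
    + 2 * (\<integral>\<^sup>+\<omega>. ennreal ((norm (X l k r \<omega> - I l r \<omega>))\<^sup>2) \<partial>M)))" for k
  define e2 where "e2 k = (\<Sum>l\<in>Q. \<alpha> l * (\<integral>\<^sup>+\<omega>. (\<integral>\<^sup>+s. hd l k s \<omega> \<partial>lborel) \<partial>M))" for k
  let ?L = "\<integral>\<^sup>+\<omega>. ennreal ((norm (\<Sum>l\<in>Q. c l *\<^sub>R (I l t \<omega> - I l r \<omega>)))\<^sup>2) \<partial>M"
  let ?R = "\<integral>\<^sup>+\<omega>. (\<integral>\<^sup>+s. h s \<omega> \<partial>lborel) \<partial>M"
  have mem: "t \<in> {0..T}" "r \<in> {0..T}" using rt by auto
  have bound: "?L \<le> 4 * ?R + (4 * e2 k + 2 * e1 k)" for k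
  proof -
    define S where "S \<omega> = (\<Sum>l\<in>Q. c l *\<^sub>R (X l k t \<omega> - X l k r \<omega>))" for \<omega>
    have Sm[measurable]: "S \<in> borel_measurable M"
      unfolding S_def using Xm mem by (intro borel_measurable_sum borel_measurable_scaleR borel_measurable_diff) auto
    have 1: "?L \<le> 2 * (\<integral>\<^sup>+\<omega>. ennreal ((norm (S \<omega>))\<^sup>2) \<partial>M) + 2 * e1 k"
    proof -
      have pw: "ennreal ((norm (\<Sum>l\<in>Q. c l *\<^sub>R (I l t \<omega> - I l r \<omega>)))\<^sup>2) \<le> 2 * ennreal ((norm (S \<omega>))\<^sup>2)
        + 2 * (\<Sum>l\<in>Q. \<alpha> l * (2 * ennreal ((norm (X l k t \<omega> - I l t \<omega>))\<^sup>2) + 2 * ennreal ((norm (X l k r \<omega> - I l r \<omega>))\<^sup>2)))" for \<omega>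
      proof -
        define d where "d l = (I l t \<omega> - I l r \<omega>) - (X l k t \<omega> - X l k r \<omega>)" for l
        have "(\<Sum>l\<in>Q. c l *\<^sub>R (I l t \<omega> - I l r \<omega>)) = S \<omega> + (\<Sum>l\<in>Q. c l *\<^sub>R d l)"
          unfolding S_def d_def by (simp add: sum.distrib[symmetric] scaleR_diff_right algebra_simps)
        then have "ennreal ((norm (\<Sum>l\<in>Q. c l *\<^sub>R (I l t \<omega> - I l r \<omega>)))\<^sup>2)
          \<le> 2 * ennreal ((norm (S \<omega>))\<^sup>2) + 2 * ennreal ((norm (\<Sum>l\<in>Q. c l *\<^sub>R d l))\<^sup>2)"
          using ennreal_norm_add_sq_le[of "S \<omega>" "\<Sum>l\<in>Q. c l *\<^sub>R d l"] by simp
        moreover have "ennreal ((norm (\<Sum>l\<in>Q. c l *\<^sub>R d l))\<^sup>2) \<le> (\<Sum>l\<in>Q. \<alpha> l * ennreal ((norm (d l))\<^sup>2))"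
          unfolding \<alpha>_def by (rule ennreal_norm_sum_sq_le)
        moreover have "ennreal ((norm (d l))\<^sup>2) \<le> 2 * ennreal ((norm (X l k t \<omega> - I l t \<omega>))\<^sup>2) + 2 * ennreal ((norm (X l k r \<omega> - I l r \<omega>))\<^sup>2)" for l
          using ennreal_norm_add_sq_le[of "I l t \<omega> - X l k t \<omega>" "X l k r \<omega> - I l r \<omega>"]
          unfolding d_def by (simp add: norm_minus_commute algebra_simps)
        ultimately show ?thesis
          by (meson add_left_mono mult_left_mono order_trans sum_mono zero_le)
      qed
      have "?L \<le> (\<integral>\<^sup>+\<omega>. 2 * ennreal ((norm (S \<omega>))\<^sup>2)
        + 2 * (\<Sum>l\<in>Q. \<alpha> l * (2 * ennreal ((norm (X l k t \<omega> - I l t \<omega>))\<^sup>2) + 2 * ennreal ((norm (X l k r \<omega> - I l r \<omega>))\<^sup>2))) \<partial>M)"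
        by (intro nn_integral_mono pw)
      also have "\<dots> = 2 * (\<integral>\<^sup>+\<omega>. ennreal ((norm (S \<omega>))\<^sup>2) \<partial>M) + 2 * e1 k"
        unfolding e1_def using Xm Im mem
        by (simp add: nn_integral_add nn_integral_cmult nn_integral_sum)
      finally show ?thesis .
    qed
    have 2: "(\<integral>\<^sup>+\<omega>. ennreal ((norm (S \<omega>))\<^sup>2) \<partial>M) \<le> 2 * ?R + 2 * e2 k"
    proof -
      have "(\<integral>\<^sup>+\<omega>. ennreal ((norm (S \<omega>))\<^sup>2) \<partial>M)
        \<le> (\<integral>\<^sup>+\<omega>. (\<integral>\<^sup>+s\<in>{r..t}. ennreal ((norm (\<Sum>l\<in>Q. c l *\<^sub>R V l k s \<omega>))\<^sup>2) \<partial>lborel) \<partial>M)"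
        unfolding S_def X_def V_def Ze
        by (rule simple_combination_bound[OF Q _ rt]) (use Z0 Ze in metis)
      also have "\<dots> \<le> (\<integral>\<^sup>+\<omega>. (\<integral>\<^sup>+s. 2 * h s \<omega> + 2 * (\<Sum>l\<in>Q. \<alpha> l * hd l k s \<omega>) \<partial>lborel) \<partial>M)"
      proof (intro nn_integral_mono)
        fix \<omega> s
        show "ennreal ((norm (\<Sum>l\<in>Q. c l *\<^sub>R V l k s \<omega>))\<^sup>2) * indicator {r..t} s \<le> 2 * h s \<omega> + 2 * (\<Sum>l\<in>Q. \<alpha> l * hd l k s \<omega>)"
        proof (cases "s \<in> {r..t}")
          case True
          then have ind: "indicator {r..t} s = (1::ennreal)" "indicator {0..T} s = (1::ennreal)" using rt by auto
          have "(\<Sum>l\<in>Q. c l *\<^sub>R V l k s \<omega>) = (\<Sum>l\<in>Q. c l *\<^sub>R H l s \<omega>) + (\<Sum>l\<in>Q. c l *\<^sub>R (V l k s \<omega> - H l s \<omega>))"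
            by (simp add: sum.distrib[symmetric] scaleR_diff_right)
          then have "ennreal ((norm (\<Sum>l\<in>Q. c l *\<^sub>R V l k s \<omega>))\<^sup>2) \<le> 2 * ennreal ((norm (\<Sum>l\<in>Q. c l *\<^sub>R H l s \<omega>))\<^sup>2)
            + 2 * ennreal ((norm (\<Sum>l\<in>Q. c l *\<^sub>R (V l k s \<omega> - H l s \<omega>)))\<^sup>2)"
            by (simp only: ennreal_norm_add_sq_le)
          also have "\<dots> \<le> 2 * ennreal ((norm (\<Sum>l\<in>Q. c l *\<^sub>R H l s \<omega>))\<^sup>2) + 2 * (\<Sum>l\<in>Q. \<alpha> l * ennreal ((norm (V l k s \<omega> - H l s \<omega>))\<^sup>2))"
            unfolding \<alpha>_def by (intro add_left_mono mult_left_mono ennreal_norm_sum_sq_le) auto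
          finally show ?thesis unfolding h_def hd_def ind by simp
        qed simp
      qed
      also have "\<dots> = (\<integral>\<^sup>+\<omega>. 2 * (\<integral>\<^sup>+s. h s \<omega> \<partial>lborel) + 2 * (\<Sum>l\<in>Q. \<alpha> l * (\<integral>\<^sup>+s. hd l k s \<omega> \<partial>lborel)) \<partial>M)"
      proof (rule nn_integral_cong)
        fix \<omega> assume "\<omega> \<in> space M"
        then have "(\<lambda>s. h s \<omega>) \<in> borel_measurable borel" "\<And>l. l \<in> Q \<Longrightarrow> (\<lambda>s. hd l k s \<omega>) \<in> borel_measurable borel"
          using measurable_compose[OF measurable_Pair2'[of \<omega> M borel] h_m] measurable_compose[OF measurable_Pair2'[of \<omega> M borel] hd_m] by auto
        then show "(\<integral>\<^sup>+s. 2 * h s \<omega> + 2 * (\<Sum>l\<in>Q. \<alpha> l * hd l k s \<omega>) \<partial>lborel)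
          = 2 * (\<integral>\<^sup>+s. h s \<omega> \<partial>lborel) + 2 * (\<Sum>l\<in>Q. \<alpha> l * (\<integral>\<^sup>+s. hd l k s \<omega> \<partial>lborel))"
          by (simp add: nn_integral_add nn_integral_cmult nn_integral_sum)
      qed
      also have "\<dots> = 2 * ?R + 2 * e2 k"
      proof -
        have "(\<lambda>\<omega>. \<integral>\<^sup>+s. h s \<omega> \<partial>lborel) \<in> borel_measurable M" "\<And>l. l \<in> Q \<Longrightarrow> (\<lambda>\<omega>. \<integral>\<^sup>+s. hd l k s \<omega> \<partial>lborel) \<in> borel_measurable M"
          using lborel.borel_measurable_nn_integral[OF sw[OF h_m]] lborel.borel_measurable_nn_integral[OF sw[OF hd_m]] by auto
        then show ?thesis unfolding e2_def
          by (simp add: nn_integral_add nn_integral_cmult nn_integral_sum)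
      qed
      finally show ?thesis .
    qed
    have "?L \<le> 2 * (2 * ?R + 2 * e2 k) + 2 * e1 k"
      by (rule order_trans[OF 1 add_right_mono[OF mult_left_mono[OF 2]]]) simp
    also have "\<dots> = 4 * ?R + (4 * e2 k + 2 * e1 k)"
      by (simp add: distrib_left mult.assoc[symmetric] add.assoc)
    finally show ?thesis .
  qed
  have e1: "e1 \<longlonglongrightarrow> (\<Sum>l\<in>Q. \<alpha> l * (2 * 0 + 2 * 0))"
    unfolding e1_def \<alpha>_def X_def using ZI mem
    by (intro tendsto_sum ennreal_tendsto_cmult tendsto_add) auto
  have e2: "e2 \<longlonglongrightarrow> (\<Sum>l\<in>Q. \<alpha> l * 0)"
    unfolding e2_def \<alpha>_def hd_def V_def using ZH by (intro tendsto_sum ennreal_tendsto_cmult) auto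
  have "(\<lambda>k. 4 * ?R + (4 * e2 k + 2 * e1 k)) \<longlonglongrightarrow> 4 * ?R + (4 * 0 + 2 * 0)"
    using e1 e2 by (intro tendsto_add ennreal_tendsto_cmult tendsto_const) auto
  then have "?L \<le> 4 * ?R + (4 * 0 + 2 * 0)"
    by (rule LIMSEQ_le_const) (use bound in blast)
  then show ?thesis unfolding h_def by simp
qed

end

section \<open>Representing pairs of laws on an atomless Polish probability space\<close>

text \<open>A point of the Cantor set, written in base 3 with the digits 0 and 2. In contrast to a
  binary expansion it determines the digits.\<close>

definition cantor_sum :: "(nat \<Rightarrow> bool) \<Rightarrow> real" where
  "cantor_sum a = (\<Sum>n. of_bool (a n) * 2 / 3 ^ Suc n)"

text \<open>Deletes the first digit of a point of the Cantor set; the threshold \<open>1 / 2\<close>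
  lies in the gap between \<open>1 / 3\<close> and \<open>2 / 3\<close>.\<close>

definition cantor_shift :: "real \<Rightarrow> real" where
  "cantor_shift r = (if 1 / 2 \<le> r then 3 * r - 2 else 3 * r)"

lemma summable_cantor: "summable (\<lambda>n. of_bool (a n) * 2 / 3 ^ Suc n :: real)"
proof (rule summable_comparison_test')
  show "summable (\<lambda>n. (2/3) * (1/3) ^ n :: real)"
    by (intro summable_mult summable_geometric) auto
qed (auto simp: field_simps)

lemma cantor_sum_nonneg: "0 \<le> cantor_sum a"
  unfolding cantor_sum_def by (intro suminf_nonneg summable_cantor) auto

lemma cantor_sum_le_1: "cantor_sum a \<le> 1"
proof -
  have "cantor_sum a \<le> (\<Sum>n. (2/3) * (1/3) ^ n :: real)"
    unfolding cantor_sum_def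
    by (intro suminf_le summable_cantor summable_mult summable_geometric) (auto simp: field_simps)
  also have "\<dots> = (2/3) * (1 / (1 - 1/3))"
    by (subst suminf_mult) (auto intro!: summable_geometric simp: suminf_geometric)
  finally show ?thesis by simp
qed

lemma cantor_sum_rec: "cantor_sum a = (if a 0 then 2 / 3 else 0) + cantor_sum (\<lambda>n. a (Suc n)) / 3"
proof -
  have "cantor_sum a = (\<Sum>n. of_bool (a (Suc n)) * 2 / 3 ^ Suc (Suc n)) + of_bool (a 0) * 2 / 3 ^ Suc 0"
    unfolding cantor_sum_def by (subst suminf_split_head[OF summable_cantor]) simp
  also have "(\<Sum>n. of_bool (a (Suc n)) * 2 / 3 ^ Suc (Suc n)) = (\<Sum>n. of_bool (a (Suc n)) * 2 / 3 ^ Suc n / 3 :: real)"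
    by (simp add: field_simps)
  also have "\<dots> = cantor_sum (\<lambda>n. a (Suc n)) / 3"
    unfolding cantor_sum_def by (rule suminf_divide[OF summable_cantor])
  finally show ?thesis by auto
qed

lemma cantor_sum_ge_half_iff: "1 / 2 \<le> cantor_sum a \<longleftrightarrow> a 0"
  using cantor_sum_rec[of a] cantor_sum_nonneg[of "\<lambda>n. a (Suc n)"] cantor_sum_le_1[of "\<lambda>n. a (Suc n)"]
  by (auto split: if_splits)

lemma cantor_shift_cantor_sum: "cantor_shift (cantor_sum a) = cantor_sum (\<lambda>n. a (Suc n))"
  unfolding cantor_shift_def cantor_sum_ge_half_iff using cantor_sum_rec[of a] by auto

lemma funpow_cantor_shift: "(cantor_shift ^^ n) (cantor_sum a) = cantor_sum (\<lambda>k. a (k + n))"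
  by (induction n) (auto simp: cantor_shift_cantor_sum)

lemma measurable_funpow_cantor_shift [measurable]: "cantor_shift ^^ n \<in> borel_measurable borel"
proof (induction n)
  case (Suc n)
  have [measurable]: "cantor_shift \<in> borel_measurable borel"
    unfolding cantor_shift_def[abs_def] by measurable
  show ?case using Suc by (auto intro: measurable_comp)
qed simp

text \<open>A vector is determined by the countably many comparisons of its coordinates with
  rationals. The answers become the digits of a Cantor point, and a Borel inverse recovers each
  coordinate as the supremum of the rationals below it.\<close>

lemma borel_embedding_real:
  obtains f :: "'a::euclidean_space \<Rightarrow> real" and g :: "real \<Rightarrow> 'a"
  where "f \<in> borel_measurable borel" "g \<in> borel_measurable borel" "\<And>x. g (f x) = x"
proof -
  define e :: "nat \<Rightarrow> 'a \<times> real" where "e = from_nat_into (Basis \<times> \<rat>)"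
  have rng: "range e = Basis \<times> \<rat>"
    unfolding e_def
  proof (rule range_from_nat_into)
    show "Basis \<times> \<rat> \<noteq> ({} :: ('a \<times> real) set)"
      using nonempty_Basis Rats_0 by blast
    show "countable (Basis \<times> \<rat> :: ('a \<times> real) set)"
      by (intro countable_SIGMA countable_finite countable_rat finite_Basis)
  qed
  define P where "P n x \<longleftrightarrow> snd (e n) < x \<bullet> fst (e n)" for n and x :: 'a
  define f where "f x = cantor_sum (\<lambda>n. P n x)" for x :: 'a
  \<comment> \<open>Extended reals are used because, for a real \<open>r\<close> outside the range
    of \<open>f\<close>, the selected rationals may be unbounded or there may be none.\<close>
  define h where "h i r = (SUP n\<in>{n. fst (e n) = i}. if 1 / 2 \<le> (cantor_shift ^^ n) r then ereal (snd (e n)) else -\<infinity>)" for i r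
  define g where "g r = (\<Sum>i\<in>Basis. real_of_ereal (h i r) *\<^sub>R i)" for r
  have "f \<in> borel_measurable borel"
    unfolding f_def cantor_sum_def P_def by measurable
  moreover have [measurable]: "h i \<in> borel_measurable borel" for i
    unfolding h_def by (intro borel_measurable_SUP) auto
  then have "g \<in> borel_measurable borel"
    unfolding g_def by measurable
  moreover have "g (f x) = x" for x
  proof -
    have "h i (f x) = ereal (x \<bullet> i)" if i: "i \<in> Basis" for i
    proof -
      have *: "1 / 2 \<le> (cantor_shift ^^ n) (f x) \<longleftrightarrow> snd (e n) < x \<bullet> fst (e n)" for n
        unfolding f_def funpow_cantor_shift cantor_sum_ge_half_iff by (simp add: P_def)
      show ?thesis
        unfolding h_def *
      proof (rule SUP_eqI)
        fix n assume "n \<in> {n. fst (e n) = i}"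
        then show "(if snd (e n) < x \<bullet> fst (e n) then ereal (snd (e n)) else - \<infinity>) \<le> ereal (x \<bullet> i)" by auto
      next
        fix y assume y: "\<And>n. n \<in> {n. fst (e n) = i} \<Longrightarrow> (if snd (e n) < x \<bullet> fst (e n) then ereal (snd (e n)) else - \<infinity>) \<le> y"
        show "ereal (x \<bullet> i) \<le> y"
        proof (rule ccontr)
          assume "\<not> ereal (x \<bullet> i) \<le> y"
          then have "y < ereal (x \<bullet> i)" by simp
          then obtain z where z: "y < ereal z" "ereal z < ereal (x \<bullet> i)"
            using ereal_dense2 by blast
          then obtain q where q: "q \<in> \<rat>" "z < q" "q < x \<bullet> i" using Rats_dense_in_real[of z "x \<bullet> i"] by auto
          then obtain n where "e n = (i, q)" using rng i by (metis (no_types, lifting) SigmaI rangeE)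
          with y[of n] q have "ereal q \<le> y" by simp
          from le_less_trans[OF this z(1)] q show False by simp
        qed
      qed
    qed
    then show ?thesis unfolding g_def by (simp add: euclidean_representation)
  qed
  ultimately show ?thesis using that by blast
qed

text \<open>Lebesgue measure on the open unit interval, pushed to the whole line: the carrier of an
  atomless Polish probability has to be the topological space, here the real line. The open interval
  is the domain on which the quantile function is used.\<close>

definition unit_interval_measure :: "real measure" where
  "unit_interval_measure = distr (restrict_space lborel {0<..<1}) borel (\<lambda>x. x)"

lemma prob_space_unit_interval: "prob_space unit_interval_measure"
  unfolding unit_interval_measure_def
  by (intro prob_space.prob_space_distr)
    (auto simp: emeasure_restrict_space space_restrict_space measurable_restrict_space1 intro!: prob_spaceI)

lemma sets_unit_interval [simp]: "sets unit_interval_measure = sets borel"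
  and space_unit_interval [simp]: "space unit_interval_measure = UNIV"
  by (simp_all add: unit_interval_measure_def)

lemma emeasure_unit_interval: "A \<in> sets borel \<Longrightarrow> emeasure unit_interval_measure A = emeasure lborel (A \<inter> {0<..<1})"
  unfolding unit_interval_measure_def
  by (subst emeasure_distr) (auto simp: emeasure_restrict_space space_restrict_space measurable_restrict_space1)

lemma measure_unit_interval_Ioc: "s \<le> t \<Longrightarrow> measure unit_interval_measure {s<..t} \<le> t - s"
proof -
  assume st: "s \<le> t"
  have "emeasure unit_interval_measure {s<..t} \<le> emeasure lborel {s<..t}"
    by (subst emeasure_unit_interval) (auto intro!: emeasure_mono)
  then have "emeasure unit_interval_measure {s<..t} \<le> ennreal (t - s)" using st by simp
  then show ?thesis using st by (simp add: measure_def enn2real_leI)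
qed

text \<open>The probability of the part of \<open>A\<close> below \<open>t\<close> is 1-Lipschitz in
  \<open>t\<close> and grows from 0 to the probability of \<open>A\<close>. By the intermediate
  value theorem some \<open>t\<close> cuts \<open>A\<close> in half.\<close>

lemma atomless_polish_unit_interval: "atomless_polish_prob (euclidean :: real topology) unit_interval_measure"
  unfolding atomless_polish_prob_def
proof (intro conjI ballI impI)
  interpret prob_space unit_interval_measure by (rule prob_space_unit_interval)
  show "completely_metrizable_space (euclidean :: real topology)" by (rule completely_metrizable_space_euclidean)
  show "separable_space (euclidean :: real topology)"
    unfolding separable_space_def
    by (intro exI[of _ "\<rat>"]) (auto simp: countable_rat Rats_closure_real)
  show "space unit_interval_measure = topspace (euclidean :: real topology)" by simp
  show "sets unit_interval_measure = sigma_sets (topspace (euclidean :: real topology)) {U. openin euclidean U}"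
    by (simp add: borel_def)
  show "prob_space unit_interval_measure" by (rule prob_space_unit_interval)
  fix A assume A: "A \<in> sets unit_interval_measure" "0 < prob A"
  then have [measurable]: "A \<in> sets borel" by simp
  define g where "g t = prob (A \<inter> {..t})" for t
  have g: "g s \<le> g t \<and> g t - g s \<le> t - s" if "s \<le> t" for s t
  proof -
    have "A \<inter> {..t} = (A \<inter> {..s}) \<union> (A \<inter> {s<..t})" using that by auto
    then have "g t = g s + prob (A \<inter> {s<..t})"
      unfolding g_def by (subst finite_measure_Union[symmetric]) auto
    moreover have "prob (A \<inter> {s<..t}) \<le> prob {s<..t}" by (intro finite_measure_mono) auto
    ultimately show ?thesis using measure_unit_interval_Ioc[OF that] by auto
  qed
  have "1-lipschitz_on UNIV g"
  proof (rule lipschitz_onI)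
    fix x y :: real show "dist (g x) (g y) \<le> 1 * dist x y"
      using g[of x y] g[of y x] by (cases "x \<le> y") (auto simp: dist_real_def)
  qed auto
  then have cont: "continuous_on {0..1} g" using lipschitz_on_continuous_on continuous_on_subset by blast
  have g0: "g 0 = 0"
  proof -
    have "A \<inter> {..0} \<inter> {0<..<1} = {}" by auto
    then show ?thesis unfolding g_def measure_def by (simp add: emeasure_unit_interval)
  qed
  have g1: "g 1 = prob A"
  proof -
    have "A \<inter> {..1} \<inter> {0<..<1} = A \<inter> {0<..<1}" by auto
    then show ?thesis unfolding g_def measure_def by (simp add: emeasure_unit_interval)
  qed
  obtain t where t: "g t = prob A / 2" using IVT'[of g 0 "prob A / 2" 1] g0 g1 A cont by auto
  then show "\<exists>B\<in>sets unit_interval_measure. B \<subseteq> A \<and> 0 < prob B \<and> prob B < prob A"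
    by (intro bexI[of _ "A \<inter> {..t}"]) (use A in \<open>auto simp: g_def\<close>)
qed

text \<open>Inverse transform sampling: the law is moved to the real line by the Borel embedding,
  sampled there as the quantile function of a uniform variable, and moved back.\<close>

lemma atomless_polish_representation:
  fixes Z :: "'w \<Rightarrow> 'b::euclidean_space"
  assumes M: "prob_space M" and Z[measurable]: "Z \<in> borel_measurable M"
  obtains Y where "Y \<in> borel_measurable unit_interval_measure"
    "distr unit_interval_measure borel Y = distr M borel Z"
proof -
  obtain f :: "'b \<Rightarrow> real" and g where fg[measurable]: "f \<in> borel_measurable borel" "g \<in> borel_measurable borel"
    and gf: "\<And>x. g (f x) = x" using borel_embedding_real by blast
  let ?N = "distr M borel (\<lambda>\<omega>. f (Z \<omega>))"
  interpret M: prob_space M by fact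
  have "real_distribution ?N" by (intro M.real_distribution_distr) auto
  then interpret cdf_distribution ?N unfolding cdf_distribution_def .
  \<comment> \<open>\<open>I\<close> is the quantile function of \<open>?N\<close>. Outside the open
    unit interval, where there is no mass, the value is set to 0.\<close>
  define Y where "Y u = (if u \<in> {0<..<1} then I u else 0)" for u :: real
  have Ym[measurable]: "Y \<in> borel_measurable borel"
    unfolding Y_def
    by (rule measurable_If_restrict_space_iff[THEN iffD2])
      (simp_all add: measurable_CI del: greaterThanLessThan_iff)
  have "distr unit_interval_measure borel Y = distr (restrict_space lborel {0<..<1}) borel Y"
    unfolding unit_interval_measure_def
    by (subst distr_distr) (auto simp: comp_def measurable_restrict_space1)
  also have "\<dots> = distr (restrict_space lborel {0<..<1}) borel I"
    by (intro distr_cong) (auto simp: Y_def space_restrict_space)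
  also have "\<dots> = ?N" by (rule distr_I_eq_M)
  finally have *: "distr unit_interval_measure borel Y = ?N" .
  have "distr unit_interval_measure borel (\<lambda>u. g (Y u)) = distr (distr unit_interval_measure borel Y) borel g"
    by (subst distr_distr) (auto simp: comp_def measurable_cong_sets[OF sets_unit_interval refl])
  also have "\<dots> = distr M borel Z"
    unfolding * by (subst distr_distr) (auto simp: comp_def gf)
  finally show ?thesis by (intro that[of "\<lambda>u. g (Y u)"]) (auto simp: measurable_cong_sets[OF sets_unit_interval refl])
qed

section \<open>Consequences of joint convexity\<close>

lemma P2_distr_iff:
  fixes Z :: "'w \<Rightarrow> 'a::euclidean_space"
  assumes "prob_space M" "Z \<in> borel_measurable M"
  shows "distr M borel Z \<in> P2 \<longleftrightarrow> integrable M (\<lambda>\<omega>. (norm (Z \<omega>))\<^sup>2)"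
  using prob_space.prob_space_distr[OF assms] assms
  by (simp add: P2_def integrable_distr_eq)

lemma moment2_distr:
  fixes Z :: "'w \<Rightarrow> 'a::euclidean_space"
  assumes "Z \<in> borel_measurable M"
  shows "moment2 (distr M borel Z) = (\<integral>\<omega>. (norm (Z \<omega>))\<^sup>2 \<partial>M)"
  unfolding moment2_def using assms by (subst integral_distr) auto

text \<open>The supporting functional at the intermediate point vanishes on the weighted sum of the two
  displacements, so the derivatives drop out of the definition of L-joint convexity.\<close>
lemma L_jointly_convexD:
  fixes \<phi> :: "'a::euclidean_space \<Rightarrow> 'a measure \<Rightarrow> real"
  assumes conv: "L_jointly_convex \<phi>" and M: "prob_space M"
    and X[measurable]: "X \<in> borel_measurable M" "Y \<in> borel_measurable M"
    and P2: "distr M borel X \<in> P2" "distr M borel Y \<in> P2"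
      "distr M borel (\<lambda>\<omega>. (1 - e) *\<^sub>R X \<omega> + e *\<^sub>R Y \<omega>) \<in> P2"
    and e: "0 \<le> e" "e \<le> 1"
  shows "\<phi> ((1 - e) *\<^sub>R x + e *\<^sub>R y) (distr M borel (\<lambda>\<omega>. (1 - e) *\<^sub>R X \<omega> + e *\<^sub>R Y \<omega>))
    \<le> (1 - e) * \<phi> x (distr M borel X) + e * \<phi> y (distr M borel Y)"
proof -
  let ?Q = unit_interval_measure
  \<comment> \<open>The pair is represented as a whole, because the law of the convex combination
    depends on the joint law and not only on the marginals.\<close>
  obtain V where V: "V \<in> borel_measurable ?Q"
    "distr ?Q borel V = distr M borel (\<lambda>\<omega>. (X \<omega>, Y \<omega>))"
    by (rule atomless_polish_representation[OF M, of "\<lambda>\<omega>. (X \<omega>, Y \<omega>)"]) auto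
  have V'[measurable]: "V \<in> ?Q \<rightarrow>\<^sub>M borel \<Otimes>\<^sub>M borel" using V(1) by (simp add: borel_prod)
  define Z where "Z u = (1 - e) *\<^sub>R fst (V u) + e *\<^sub>R snd (V u)" for u
  have tr: "distr ?Q borel (\<lambda>u. h (V u)) = distr M borel (\<lambda>\<omega>. h (X \<omega>, Y \<omega>))"
    if "h \<in> borel_measurable borel" for h :: "'a \<times> 'a \<Rightarrow> 'a"
  proof -
    have "distr ?Q borel (\<lambda>u. h (V u)) = distr (distr ?Q borel V) borel h"
      using that V(1) by (subst distr_distr) (auto simp: comp_def)
    also have "\<dots> = distr M borel (\<lambda>\<omega>. h (X \<omega>, Y \<omega>))"
      unfolding V(2) using that by (subst distr_distr) (auto simp: comp_def)
    finally show ?thesis .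
  qed
  have dX: "distr ?Q borel (\<lambda>u. fst (V u)) = distr M borel X"
    using tr[of fst] by (simp add: borel_measurable_continuous_onI continuous_on_fst)
  have dY: "distr ?Q borel (\<lambda>u. snd (V u)) = distr M borel Y"
    using tr[of snd] by (simp add: borel_measurable_continuous_onI continuous_on_snd)
  have dZ: "distr ?Q borel Z = distr M borel (\<lambda>\<omega>. (1 - e) *\<^sub>R X \<omega> + e *\<^sub>R Y \<omega>)"
    unfolding Z_def using tr[of "\<lambda>p. (1 - e) *\<^sub>R fst p + e *\<^sub>R snd p"]
    by (simp add: borel_measurable_continuous_onI continuous_intros)
  have meas: "(\<lambda>u. fst (V u)) \<in> borel_measurable ?Q" "(\<lambda>u. snd (V u)) \<in> borel_measurable ?Q" "Z \<in> borel_measurable ?Q"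
    unfolding Z_def by measurable
  from conv obtain Dx Dm where
    DD: "\<forall>x. \<forall>\<mu>\<in>P2. (GDERIV (\<lambda>z. \<phi> z \<mu>) x :> Dx x \<mu>) \<and> has_L_derivative (\<phi> x) \<mu> (Dm x \<mu>)" and
    sup0: "\<forall>x x'. \<forall>\<mu>\<in>P2. \<forall>\<mu>'\<in>P2. \<forall>(S :: real topology) Q.
          \<forall>X\<in>borel_measurable Q. \<forall>X'\<in>borel_measurable Q.
          atomless_polish_prob S Q \<and> distr Q borel X = \<mu> \<and> distr Q borel X' = \<mu>' \<longrightarrow>
          \<phi> x \<mu> - \<phi> x' \<mu>' \<le> Dx x \<mu> \<bullet> (x - x') + (\<integral>\<omega>. Dm x \<mu> (X \<omega>) \<bullet> (X \<omega> - X' \<omega>) \<partial>Q)"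
    unfolding L_jointly_convex_def by (elim exE conjE)
  have D: "has_L_derivative (\<phi> x) \<mu> (Dm x \<mu>)" if "\<mu> \<in> P2" for x \<mu> using DD that by blast
  have sup: "\<phi> x \<mu> - \<phi> x' \<mu>' \<le> Dx x \<mu> \<bullet> (x - x') + (\<integral>\<omega>. Dm x \<mu> (X \<omega>) \<bullet> (X \<omega> - X' \<omega>) \<partial>?Q)"
    if "\<mu> \<in> P2" "\<mu>' \<in> P2" "X \<in> borel_measurable ?Q" "X' \<in> borel_measurable ?Q"
      "distr ?Q borel X = \<mu>" "distr ?Q borel X' = \<mu>'" for x x' \<mu> \<mu>' X X'
    using sup0[rule_format, OF that(1-4)] atomless_polish_unit_interval that(5,6) by blast
  define z where "z = (1 - e) *\<^sub>R x + e *\<^sub>R y"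
  define \<nu> where "\<nu> = distr M borel (\<lambda>\<omega>. (1 - e) *\<^sub>R X \<omega> + e *\<^sub>R Y \<omega>)"
  let ?A = "\<integral>u. Dm z \<nu> (Z u) \<bullet> (fst (V u) - Z u) \<partial>?Q" and ?B = "\<integral>u. Dm z \<nu> (Z u) \<bullet> (snd (V u) - Z u) \<partial>?Q"
  \<comment> \<open>The integrability clause in the definition of the L-derivative permits merging
    the expectations \<open>?A\<close> and \<open>?B\<close> into one.\<close>
  have int: "integrable ?Q (\<lambda>u. Dm z \<nu> (Z u) \<bullet> (U u - Z u))"
    if "U \<in> borel_measurable ?Q" "distr ?Q borel U \<in> P2" for U
  proof -
    have LD: "has_L_derivative (\<phi> z) \<nu> (Dm z \<nu>)" using D P2(3) by (simp add: \<nu>_def)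
    have dZ': "distr ?Q borel Z = \<nu>" using dZ by (simp add: \<nu>_def)
    from LD[unfolded has_L_derivative_def, THEN conjunct2, rule_format, OF meas(3)
        conjI[OF atomless_polish_unit_interval dZ'], THEN conjunct1, rule_format, OF that]
    show ?thesis .
  qed
  have i1: "integrable ?Q (\<lambda>u. Dm z \<nu> (Z u) \<bullet> (fst (V u) - Z u))"
    and i2: "integrable ?Q (\<lambda>u. Dm z \<nu> (Z u) \<bullet> (snd (V u) - Z u))"
    using int[OF meas(1)] int[OF meas(2)] dX dY P2 by auto
  have neg: "(\<integral>u. Dm z \<nu> (Z u) \<bullet> (Z u - U u) \<partial>?Q) = - (\<integral>u. Dm z \<nu> (Z u) \<bullet> (U u - Z u) \<partial>?Q)" for U
    by (subst integral_minus[symmetric]) (simp add: inner_diff_right)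
  have "\<phi> z \<nu> - \<phi> x (distr M borel X) \<le> Dx z \<nu> \<bullet> (z - x) - ?A"
    using sup[OF P2(3) P2(1) meas(3) meas(1) dZ dX, of z x]
    unfolding neg[unfolded \<nu>_def] \<nu>_def by simp
  moreover have "\<phi> z \<nu> - \<phi> y (distr M borel Y) \<le> Dx z \<nu> \<bullet> (z - y) - ?B"
    using sup[OF P2(3) P2(2) meas(3) meas(2) dZ dY, of z y]
    unfolding neg[unfolded \<nu>_def] \<nu>_def by simp
  ultimately have "(1 - e) * (\<phi> z \<nu> - \<phi> x (distr M borel X)) + e * (\<phi> z \<nu> - \<phi> y (distr M borel Y))
    \<le> (1 - e) * (Dx z \<nu> \<bullet> (z - x) - ?A) + e * (Dx z \<nu> \<bullet> (z - y) - ?B)"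
    using e by (intro add_mono mult_left_mono) auto
  also have "\<dots> = Dx z \<nu> \<bullet> ((1 - e) *\<^sub>R (z - x) + e *\<^sub>R (z - y)) - ((1 - e) * ?A + e * ?B)"
    by (simp add: inner_add_right algebra_simps)
  also have "(1 - e) *\<^sub>R (z - x) + e *\<^sub>R (z - y) = 0"
    unfolding z_def by (simp add: algebra_simps)
  also have "(1 - e) * ?A + e * ?B = (\<integral>u. (1 - e) * (Dm z \<nu> (Z u) \<bullet> (fst (V u) - Z u)) + e * (Dm z \<nu> (Z u) \<bullet> (snd (V u) - Z u)) \<partial>?Q)"
    using i1 i2 by simp
  also have "\<dots> = (\<integral>u. Dm z \<nu> (Z u) \<bullet> ((1 - e) *\<^sub>R (fst (V u) - Z u) + e *\<^sub>R (snd (V u) - Z u)) \<partial>?Q)"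
    by (simp add: inner_add_right)
  also have "\<dots> = (\<integral>u. 0 \<partial>?Q)"
    by (intro Bochner_Integration.integral_cong refl) (simp add: Z_def algebra_simps)
  finally show ?thesis
    unfolding z_def[symmetric] \<nu>_def[symmetric] by (simp add: algebra_simps)
qed

lemma all_real_mult_le_imp_zero:
  fixes a :: real
  assumes "\<And>r. r * a \<le> c" shows "a = 0"
proof (rule ccontr)
  assume "a \<noteq> 0"
  then show False using assms[of "(\<bar>c\<bar> + 1) / a"] by simp
qed

lemma trace_transpose_mult: "trace (transpose A ** B) = (A :: real^'d^'n) \<bullet> B"
proof -
  have "trace (transpose A ** B) = (\<Sum>j\<in>UNIV. \<Sum>i\<in>UNIV. A $ i $ j * B $ i $ j)"
    by (simp add: trace_def transpose_def matrix_matrix_mult_def)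
  also have "\<dots> = (\<Sum>i\<in>UNIV. \<Sum>j\<in>UNIV. A $ i $ j * B $ i $ j)" by (rule sum.swap)
  finally show ?thesis by (simp add: inner_vec_def)
qed

lemma return_zero_P2: "distr unit_interval_measure borel (\<lambda>_. 0 :: 'a::euclidean_space) \<in> P2"
  using prob_space_unit_interval by (simp add: P2_distr_iff)

text \<open>Convexity for all multiples of \<open>p\<close> and \<open>q\<close> forces equality in the terms linear in them.\<close>
lemma hamiltonian_convex_imp_affine:
  assumes conv: "\<And>p q. L_jointly_convex (\<lambda>x \<mu>. hamiltonian b \<sigma> C t x \<mu> p q)" and e: "0 \<le> e" "e \<le> 1"
  shows "b t ((1 - e) *\<^sub>R x + e *\<^sub>R y) = (1 - e) *\<^sub>R b t x + e *\<^sub>R b t y"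
    and "\<sigma> t ((1 - e) *\<^sub>R x + e *\<^sub>R y) = (1 - e) *\<^sub>R \<sigma> t x + e *\<^sub>R \<sigma> t y"
proof -
  \<comment> \<open>Only the state variable is tested, so both variables are constantly 0; the
    measure is the Dirac mass at 0 at both end points and at the intermediate point.\<close>
  let ?z = "(1 - e) *\<^sub>R x + e *\<^sub>R y" and ?\<mu> = "distr unit_interval_measure borel (\<lambda>_. 0)"
  define B where "B = b t ?z - ((1 - e) *\<^sub>R b t x + e *\<^sub>R b t y)"
  define S where "S = \<sigma> t ?z - ((1 - e) *\<^sub>R \<sigma> t x + e *\<^sub>R \<sigma> t y)"
  define c where "c = (1 - e) * C t x ?\<mu> + e * C t y ?\<mu> - C t ?z ?\<mu>"
  have *: "B \<bullet> p + S \<bullet> q \<le> c" for p q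
    using L_jointly_convexD[OF conv[of p q] prob_space_unit_interval, of "\<lambda>_. 0" "\<lambda>_. 0" e x y]
      return_zero_P2 e
    unfolding hamiltonian_def trace_transpose_mult B_def S_def c_def
    by (simp add: algebra_simps inner_add_left inner_diff_left)
  \<comment> \<open>The test vector is a multiple of the defect \<open>B\<close> itself, so every
    real multiple of \<open>B \<bullet> B\<close> stays below the same constant.\<close>
  have "r * (B \<bullet> B) \<le> c" for r using *[of "r *\<^sub>R B" 0] by simp
  then have "B \<bullet> B = 0" by (rule all_real_mult_le_imp_zero)
  then show "b t ?z = (1 - e) *\<^sub>R b t x + e *\<^sub>R b t y" by (simp add: B_def)
  have "r * (S \<bullet> S) \<le> c" for r using *[of 0 "r *\<^sub>R S"] by simp
  then have "S \<bullet> S = 0" by (rule all_real_mult_le_imp_zero)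
  then show "\<sigma> t ?z = (1 - e) *\<^sub>R \<sigma> t x + e *\<^sub>R \<sigma> t y" by (simp add: S_def)
qed

lemma hamiltonian_convex_imp_cost_convex:
  assumes "\<And>p q. L_jointly_convex (\<lambda>x \<mu>. hamiltonian b \<sigma> C t x \<mu> p q)"
  shows "L_jointly_convex (C t)"
  using assms[of 0 0] unfolding hamiltonian_def trace_transpose_mult by simp

section \<open>Square-integrable random variables and the Wasserstein topology\<close>

definition square_integrable :: "'w measure \<Rightarrow> ('w \<Rightarrow> 'a::euclidean_space) \<Rightarrow> bool" where
  "square_integrable M X \<longleftrightarrow> X \<in> borel_measurable M \<and> integrable M (\<lambda>\<omega>. (norm (X \<omega>))\<^sup>2)"

lemma square_integrableD [dest]:
  "square_integrable M X \<Longrightarrow> X \<in> borel_measurable M"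
  "square_integrable M X \<Longrightarrow> integrable M (\<lambda>\<omega>. (norm (X \<omega>))\<^sup>2)"
  by (auto simp: square_integrable_def)

lemma square_integrable_add:
  assumes "square_integrable M X" "square_integrable M Y"
  shows "square_integrable M (\<lambda>\<omega>. X \<omega> + Y \<omega>)"
proof -
  note [measurable] = assms[THEN square_integrableD(1)]
  have "integrable M (\<lambda>\<omega>. (norm (X \<omega> + Y \<omega>))\<^sup>2)"
    by (rule Bochner_Integration.integrable_bound[of M "\<lambda>\<omega>. 2 * (norm (X \<omega>))\<^sup>2 + 2 * (norm (Y \<omega>))\<^sup>2"])
      (use assms[THEN square_integrableD(2)] norm_add_sq_le in auto)
  then show ?thesis by (simp add: square_integrable_def)
qed

lemma square_integrable_scaleR:
  "square_integrable M X \<Longrightarrow> square_integrable M (\<lambda>\<omega>. c *\<^sub>R X \<omega>)"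
  by (auto simp: square_integrable_def power_mult_distrib)

lemma square_integrable_diff:
  assumes "square_integrable M X" "square_integrable M Y"
  shows "square_integrable M (\<lambda>\<omega>. X \<omega> - Y \<omega>)"
  using square_integrable_add[OF assms(1) square_integrable_scaleR[OF assms(2), of "-1"]] by simp

lemma square_integrable_const: "finite_measure M \<Longrightarrow> square_integrable M (\<lambda>_. c)"
  by (auto simp: square_integrable_def finite_measure.integrable_const)

lemma square_integrable_norm_mult:
  assumes "square_integrable M X" "square_integrable M Y"
  shows "integrable M (\<lambda>\<omega>. norm (X \<omega>) * norm (Y \<omega>))"
proof -
  note [measurable] = assms[THEN square_integrableD(1)]
  have le: "norm (X \<omega>) * norm (Y \<omega>) \<le> (norm (X \<omega>))\<^sup>2 + (norm (Y \<omega>))\<^sup>2" for \<omega>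
    using sum_squares_bound[of "norm (X \<omega>)" "norm (Y \<omega>)"] mult_nonneg_nonneg[of "norm (X \<omega>)" "norm (Y \<omega>)"]
      norm_ge_zero[of "X \<omega>"] norm_ge_zero[of "Y \<omega>"] by linarith
  show ?thesis
    by (rule Bochner_Integration.integrable_bound[of M "\<lambda>\<omega>. (norm (X \<omega>))\<^sup>2 + (norm (Y \<omega>))\<^sup>2"])
      (use assms[THEN square_integrableD(2)] le in \<open>auto simp: abs_mult\<close>)
qed

lemma square_integrable_norm:
  assumes "finite_measure M" "square_integrable M X"
  shows "integrable M (\<lambda>\<omega>. norm (X \<omega>))"
  using square_integrable_norm_mult[OF assms(2) square_integrable_const[OF assms(1), of "1::real"]] by simp

lemma square_integrable_P2:
  "prob_space M \<Longrightarrow> square_integrable M X \<Longrightarrow> distr M borel X \<in> P2"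
  by (simp add: P2_distr_iff square_integrable_def)

text \<open>The joint law of \<open>X\<close> and \<open>Y\<close> is one of the couplings over
  which the infimum is taken.\<close>

lemma W2_distr_le:
  fixes X Y :: "'w \<Rightarrow> 'a::euclidean_space"
  assumes [measurable]: "X \<in> borel_measurable M" "Y \<in> borel_measurable M"
  shows "W2 (distr M borel X) (distr M borel Y) \<le> sqrt (\<integral>\<omega>. (norm (X \<omega> - Y \<omega>))\<^sup>2 \<partial>M)"
proof -
  let ?\<pi> = "distr M borel (\<lambda>\<omega>. (X \<omega>, Y \<omega>))"
  have [measurable]: "(\<lambda>\<omega>. (X \<omega>, Y \<omega>)) \<in> borel_measurable M" by measurable
  have [measurable]: "(fst :: 'a \<times> 'a \<Rightarrow> 'a) \<in> borel_measurable borel" "(snd :: 'a \<times> 'a \<Rightarrow> 'a) \<in> borel_measurable borel"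
    by (auto intro!: borel_measurable_continuous_onI continuous_intros)
  have "?\<pi> \<in> couplings (distr M borel X) (distr M borel Y)"
    unfolding couplings_def by (auto simp: distr_distr comp_def)
  then have "(INF \<pi>\<in>couplings (distr M borel X) (distr M borel Y). \<integral>z. (norm (fst z - snd z))\<^sup>2 \<partial>\<pi>)
    \<le> (\<integral>z. (norm (fst z - snd z))\<^sup>2 \<partial>?\<pi>)"
    by (intro cINF_lower bdd_belowI2[of _ 0]) auto
  also have "\<dots> = (\<integral>\<omega>. (norm (X \<omega> - Y \<omega>))\<^sup>2 \<partial>M)"
    by (subst integral_distr) auto
  finally show ?thesis unfolding W2_def by simp
qed

text \<open>The bridge from \<open>L^2\<close> to the Wasserstein topology: continuity in the
  measure is exploited by realizing measures as laws of variables that converge in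
  \<open>L^2\<close>.\<close>

lemma limitin_W2_distr:
  fixes X :: "'w \<Rightarrow> 'a::euclidean_space"
  assumes M: "prob_space M" and X: "square_integrable M X" and Xn: "\<And>n. square_integrable M (Xn n)"
    and lim: "((\<lambda>n. \<integral>\<omega>. (norm (Xn n \<omega> - X \<omega>))\<^sup>2 \<partial>M) \<longlongrightarrow> 0) Fl"
  shows "limitin W2_topology (\<lambda>n. distr M borel (Xn n)) (distr M borel X) Fl"
  unfolding limitin_def topspace_W2_topology openin_W2_topology
proof (intro conjI allI impI)
  show "distr M borel X \<in> P2" using M X by (rule square_integrable_P2)
  fix U :: "'a measure set" assume U: "W2_open U \<and> distr M borel X \<in> U"
  then obtain r where r: "r > 0" "\<forall>\<nu>\<in>P2. W2 (distr M borel X) \<nu> < r \<longrightarrow> \<nu> \<in> U"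
    unfolding W2_open_def by blast
  have "((\<lambda>n. sqrt (\<integral>\<omega>. (norm (Xn n \<omega> - X \<omega>))\<^sup>2 \<partial>M)) \<longlongrightarrow> sqrt 0) Fl"
    by (intro tendsto_real_sqrt lim)
  then have "\<forall>\<^sub>F n in Fl. sqrt (\<integral>\<omega>. (norm (Xn n \<omega> - X \<omega>))\<^sup>2 \<partial>M) < r"
    using r(1) by (auto dest: order_tendstoD)
  then show "\<forall>\<^sub>F n in Fl. distr M borel (Xn n) \<in> U"
  proof eventually_elim
    case (elim n)
    have "W2 (distr M borel X) (distr M borel (Xn n)) < r"
      using W2_distr_le[OF square_integrableD(1)[OF X] square_integrableD(1)[OF Xn[of n]]] elim
      by (simp add: norm_minus_commute)
    then show ?case using r(2) square_integrable_P2[OF M Xn] by blast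
  qed
qed

section \<open>Mixtures of laws as laws of randomized variables\<close>

definition switch :: "real \<Rightarrow> ('w \<Rightarrow> 'a) \<Rightarrow> ('w \<Rightarrow> 'a) \<Rightarrow> 'w \<times> real \<Rightarrow> 'a" where
  "switch s X Y p = (if snd p \<le> s then X (fst p) else Y (fst p))"

abbreviation randomized :: "'w measure \<Rightarrow> ('w \<times> real) measure" where
  "randomized M \<equiv> M \<Otimes>\<^sub>M unit_interval_measure"

lemma emeasure_unit_interval_le: "0 \<le> s \<Longrightarrow> s \<le> 1 \<Longrightarrow> emeasure unit_interval_measure {..s} = ennreal s"
proof -
  assume s: "0 \<le> s" "s \<le> 1"
  have "{..s} \<inter> {0<..<1} = (if s = 1 then {0<..<1} else {0<..s})" using s by auto
  then show ?thesis using s by (subst emeasure_unit_interval) auto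
qed

lemma measure_unit_interval_Ioc_eq:
  "0 \<le> s \<Longrightarrow> s \<le> t \<Longrightarrow> t \<le> 1 \<Longrightarrow> emeasure unit_interval_measure {s<..t} = ennreal (t - s)"
proof -
  assume s: "0 \<le> s" "s \<le> t" "t \<le> 1"
  have "{s<..t} \<inter> {0<..<1} = (if t = 1 then {s<..<t} else {s<..t})" using s by auto
  then show ?thesis using s by (subst emeasure_unit_interval) auto
qed

lemma emeasure_unit_interval_gt: "0 \<le> s \<Longrightarrow> s \<le> 1 \<Longrightarrow> emeasure unit_interval_measure {s<..} = ennreal (1 - s)"
proof -
  assume s: "0 \<le> s" "s \<le> 1"
  have "{s<..} \<inter> {0<..<1} = {s<..<1}" using s by auto
  then show ?thesis using s by (subst emeasure_unit_interval) auto
qed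

lemma prob_space_randomized: "prob_space M \<Longrightarrow> prob_space (randomized M)"
proof -
  assume "prob_space M"
  then interpret M: prob_space M .
  interpret U: prob_space unit_interval_measure by (rule prob_space_unit_interval)
  interpret pair_prob_space M unit_interval_measure ..
  show ?thesis by unfold_locales
qed

lemma measurable_switch [measurable]:
  assumes [measurable]: "X \<in> borel_measurable M" "Y \<in> borel_measurable M"
  shows "switch s X Y \<in> borel_measurable (randomized M)"
proof -
  have [measurable]: "snd \<in> randomized M \<rightarrow>\<^sub>M (borel :: real measure)"
    using measurable_snd[of M unit_interval_measure] by (simp cong: measurable_cong_sets)
  show ?thesis unfolding switch_def[abs_def] by measurable
qed

text \<open>An independent uniform variable selects \<open>X\<close> with probability
  \<open>s\<close> and \<open>Y\<close> otherwise. Hence moments and Wasserstein limits of mixtures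
  follow from \<open>L^2\<close> estimates on the enlarged space.\<close>

lemma mixture_distr:
  fixes X Y :: "'w \<Rightarrow> 'a::euclidean_space"
  assumes M: "prob_space M" and [measurable]: "X \<in> borel_measurable M" "Y \<in> borel_measurable M"
    and s: "0 \<le> s" "s \<le> 1"
  shows "mixture s (distr M borel X) (distr M borel Y) = distr (randomized M) borel (switch s X Y)"
proof -
  interpret M: prob_space M by fact
  interpret U: prob_space unit_interval_measure by (rule prob_space_unit_interval)
  let ?N = "distr (randomized M) borel (switch s X Y)"
  have eq: "ennreal s * emeasure (distr M borel X) A + ennreal (1 - s) * emeasure (distr M borel Y) A = emeasure ?N A"
    if [measurable]: "A \<in> sets borel" for A
  proof -
    have "emeasure ?N A = emeasure (randomized M) (switch s X Y -` A \<inter> space (randomized M))"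
      by (rule emeasure_distr) auto
    also have "switch s X Y -` A \<inter> space (randomized M) =
      (X -` A \<inter> space M) \<times> {..s} \<union> (Y -` A \<inter> space M) \<times> {s<..}"
      by (auto simp: switch_def space_pair_measure split: if_splits)
    also have "emeasure (randomized M) \<dots> = emeasure (randomized M) ((X -` A \<inter> space M) \<times> {..s})
       + emeasure (randomized M) ((Y -` A \<inter> space M) \<times> {s<..})"
      by (intro plus_emeasure[symmetric] pair_measureI) auto
    also have "\<dots> = emeasure M (X -` A \<inter> space M) * ennreal s + emeasure M (Y -` A \<inter> space M) * ennreal (1 - s)"
      using s by (simp add: U.emeasure_pair_measure_Times emeasure_unit_interval_le emeasure_unit_interval_gt)
    finally show ?thesis by (simp add: emeasure_distr mult.commute)
  qed
  have "mixture s (distr M borel X) (distr M borel Y) = measure_of UNIV (sets borel) (emeasure ?N)"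
    unfolding mixture_def
    by (rule measure_of_eq) (use eq sets.sigma_sets_eq[of borel] in \<open>auto simp: space_borel\<close>)
  also have "\<dots> = ?N" using measure_of_of_measure[of ?N] by simp
  finally show ?thesis .
qed

lemma integral_randomized_fst:
  fixes f :: "'w \<Rightarrow> 'b::{banach, second_countable_topology}"
  assumes M: "prob_space M" and f[measurable]: "f \<in> borel_measurable M"
  shows "integrable (randomized M) (\<lambda>p. f (fst p)) \<longleftrightarrow> integrable M f"
    "(\<integral>p. f (fst p) \<partial>randomized M) = (\<integral>\<omega>. f \<omega> \<partial>M)"
proof -
  interpret M: prob_space M by fact
  interpret U: prob_space unit_interval_measure by (rule prob_space_unit_interval)
  interpret pair_prob_space M unit_interval_measure ..
  have "distr (randomized M) M fst = M" by (rule U.distr_pair_fst)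
  then show "integrable (randomized M) (\<lambda>p. f (fst p)) \<longleftrightarrow> integrable M f"
    "(\<integral>p. f (fst p) \<partial>randomized M) = (\<integral>\<omega>. f \<omega> \<partial>M)"
    using integrable_distr_eq[of fst "randomized M" M f] integral_distr[of fst "randomized M" M f] by auto
qed

lemma square_integrable_switch:
  assumes M: "prob_space M" and X: "square_integrable M X" and Y: "square_integrable M Y"
  shows "square_integrable (randomized M) (switch s X Y)"
    "(\<integral>p. (norm (switch s X Y p))\<^sup>2 \<partial>randomized M) \<le> (\<integral>\<omega>. (norm (X \<omega>))\<^sup>2 \<partial>M) + (\<integral>\<omega>. (norm (Y \<omega>))\<^sup>2 \<partial>M)"
proof -
  note [measurable] = X[THEN square_integrableD(1)] Y[THEN square_integrableD(1)]
  have i: "integrable (randomized M) (\<lambda>p. (norm (X (fst p)))\<^sup>2)" "integrable (randomized M) (\<lambda>p. (norm (Y (fst p)))\<^sup>2)"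
    using integral_randomized_fst(1)[OF M, of "\<lambda>\<omega>. (norm (X \<omega>))\<^sup>2"] integral_randomized_fst(1)[OF M, of "\<lambda>\<omega>. (norm (Y \<omega>))\<^sup>2"]
      X[THEN square_integrableD(2)] Y[THEN square_integrableD(2)] by auto
  have le: "(norm (switch s X Y p))\<^sup>2 \<le> (norm (X (fst p)))\<^sup>2 + (norm (Y (fst p)))\<^sup>2" for p
    by (auto simp: switch_def)
  have int: "integrable (randomized M) (\<lambda>p. (norm (switch s X Y p))\<^sup>2)"
    by (rule Bochner_Integration.integrable_bound[OF Bochner_Integration.integrable_add[OF i]]) (use le in auto)
  then show "square_integrable (randomized M) (switch s X Y)" by (simp add: square_integrable_def)
  have "(\<integral>p. (norm (switch s X Y p))\<^sup>2 \<partial>randomized M) \<le> (\<integral>p. (norm (X (fst p)))\<^sup>2 + (norm (Y (fst p)))\<^sup>2 \<partial>randomized M)"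
    by (rule integral_mono[OF int Bochner_Integration.integrable_add[OF i]]) (rule le)
  then show "(\<integral>p. (norm (switch s X Y p))\<^sup>2 \<partial>randomized M) \<le> (\<integral>\<omega>. (norm (X \<omega>))\<^sup>2 \<partial>M) + (\<integral>\<omega>. (norm (Y \<omega>))\<^sup>2 \<partial>M)"
    using i integral_randomized_fst(2)[OF M, of "\<lambda>\<omega>. (norm (X \<omega>))\<^sup>2"] integral_randomized_fst(2)[OF M, of "\<lambda>\<omega>. (norm (Y \<omega>))\<^sup>2"] by simp
qed

lemma mixture_P2:
  assumes "prob_space M" "square_integrable M X" "square_integrable M Y" "0 \<le> s" "s \<le> 1"
  shows "mixture s (distr M borel X) (distr M borel Y) \<in> P2"
    "moment2 (mixture s (distr M borel X) (distr M borel Y)) \<le> (\<integral>\<omega>. (norm (X \<omega>))\<^sup>2 \<partial>M) + (\<integral>\<omega>. (norm (Y \<omega>))\<^sup>2 \<partial>M)"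
proof -
  note sq = square_integrable_switch[OF assms(1-3), of s]
  have eq: "mixture s (distr M borel X) (distr M borel Y) = distr (randomized M) borel (switch s X Y)"
    using assms by (intro mixture_distr) auto
  show "mixture s (distr M borel X) (distr M borel Y) \<in> P2"
    unfolding eq by (rule square_integrable_P2[OF prob_space_randomized[OF assms(1)] sq(1)])
  show "moment2 (mixture s (distr M borel X) (distr M borel Y)) \<le> (\<integral>\<omega>. (norm (X \<omega>))\<^sup>2 \<partial>M) + (\<integral>\<omega>. (norm (Y \<omega>))\<^sup>2 \<partial>M)"
    unfolding eq using sq by (subst moment2_distr) auto
qed

text \<open>All switched variables use the same uniform coordinate. Apart from the errors of
  \<open>Xn\<close> and \<open>Yn\<close>, two of them differ only when this coordinate falls
  between the thresholds \<open>s\<close> and \<open>sn n\<close>, an event of probability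
  \<open>\<bar>sn n - s\<bar>\<close> that is independent of \<open>X - Y\<close>.\<close>

lemma limitin_mixture:
  fixes X Y :: "'w \<Rightarrow> 'a::euclidean_space"
  assumes M: "prob_space M" and X: "square_integrable M X" and Y: "square_integrable M Y"
    and Xn: "\<And>n. square_integrable M (Xn n)" and Yn: "\<And>n. square_integrable M (Yn n)"
    and s: "s \<in> {0..1}" "\<And>n. sn n \<in> {0..1}"
    and limX: "((\<lambda>n. \<integral>\<omega>. (norm (Xn n \<omega> - X \<omega>))\<^sup>2 \<partial>M) \<longlongrightarrow> 0) Fl"
    and limY: "((\<lambda>n. \<integral>\<omega>. (norm (Yn n \<omega> - Y \<omega>))\<^sup>2 \<partial>M) \<longlongrightarrow> 0) Fl"
    and lims: "(sn \<longlongrightarrow> s) Fl"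
  shows "limitin W2_topology (\<lambda>n. mixture (sn n) (distr M borel (Xn n)) (distr M borel (Yn n)))
    (mixture s (distr M borel X) (distr M borel Y)) Fl"
proof -
  interpret M: prob_space M by fact
  interpret U: prob_space unit_interval_measure by (rule prob_space_unit_interval)
  interpret pair_prob_space M unit_interval_measure ..
  note [measurable] = X[THEN square_integrableD(1)] Y[THEN square_integrableD(1)] Xn[THEN square_integrableD(1)] Yn[THEN square_integrableD(1)]
  define K where "K = (\<integral>\<omega>. (norm (X \<omega> - Y \<omega>))\<^sup>2 \<partial>M)"
  have XY: "integrable M (\<lambda>\<omega>. (norm (X \<omega> - Y \<omega>))\<^sup>2)"
    using square_integrable_diff[OF X Y] by auto
  define B where "B n = {min s (sn n)<..max s (sn n)}" for n
  define g where "g n p = 2 * (norm (Xn n (fst p) - X (fst p)))\<^sup>2 + 2 * (norm (Yn n (fst p) - Y (fst p)))\<^sup>2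
     + 2 * (indicator (B n) (snd p) * (norm (X (fst p) - Y (fst p)))\<^sup>2)" for n and p :: "'w \<times> real"
  have le: "(norm (switch (sn n) (Xn n) (Yn n) p - switch s X Y p))\<^sup>2 \<le> g n p" for n p
  proof -
    have a: "(norm (Xn n (fst p) - Y (fst p)))\<^sup>2 \<le> 2 * (norm (Xn n (fst p) - X (fst p)))\<^sup>2 + 2 * (norm (X (fst p) - Y (fst p)))\<^sup>2"
      using norm_add_sq_le[of "Xn n (fst p) - X (fst p)" "X (fst p) - Y (fst p)"] by simp
    have b: "(norm (Yn n (fst p) - X (fst p)))\<^sup>2 \<le> 2 * (norm (Yn n (fst p) - Y (fst p)))\<^sup>2 + 2 * (norm (X (fst p) - Y (fst p)))\<^sup>2"
      using norm_add_sq_le[of "Yn n (fst p) - Y (fst p)" "Y (fst p) - X (fst p)"] by (simp add: norm_minus_commute)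
    consider "snd p \<le> s" "snd p \<le> sn n" | "snd p \<le> s" "sn n < snd p" | "s < snd p" "snd p \<le> sn n" | "s < snd p" "sn n < snd p"
      by linarith
    then show ?thesis
    proof cases
      case 1 then show ?thesis unfolding g_def switch_def by simp
    next
      case 2
      then have "snd p \<in> B n" by (auto simp: B_def)
      then have "g n p = 2 * (norm (Xn n (fst p) - X (fst p)))\<^sup>2 + 2 * (norm (Yn n (fst p) - Y (fst p)))\<^sup>2
          + 2 * (norm (X (fst p) - Y (fst p)))\<^sup>2" by (simp add: g_def)
      moreover have sw: "switch (sn n) (Xn n) (Yn n) p - switch s X Y p = Yn n (fst p) - X (fst p)"
        using 2 by (simp add: switch_def)
      ultimately show ?thesis
        unfolding sw using b zero_le_power2[of "norm (Xn n (fst p) - X (fst p))"] by linarith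
    next
      case 3
      then have "snd p \<in> B n" by (auto simp: B_def)
      then have "g n p = 2 * (norm (Xn n (fst p) - X (fst p)))\<^sup>2 + 2 * (norm (Yn n (fst p) - Y (fst p)))\<^sup>2
          + 2 * (norm (X (fst p) - Y (fst p)))\<^sup>2" by (simp add: g_def)
      moreover have sw: "switch (sn n) (Xn n) (Yn n) p - switch s X Y p = Xn n (fst p) - Y (fst p)"
        using 3 by (simp add: switch_def)
      ultimately show ?thesis
        unfolding sw using a zero_le_power2[of "norm (Yn n (fst p) - Y (fst p))"] by linarith
    next
      case 4 then show ?thesis unfolding g_def switch_def by simp
    qed
  qed
  have [measurable]: "B n \<in> sets unit_interval_measure" for n by (simp add: B_def)
  have iB: "integrable unit_interval_measure (indicator (B n) :: real \<Rightarrow> real)" for n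
    by (rule integrable_real_indicator) (simp_all add: B_def less_top[symmetric])
  have mB: "measure unit_interval_measure (B n) = \<bar>sn n - s\<bar>" for n
    unfolding measure_def B_def using s(1) s(2)[of n]
    by (subst measure_unit_interval_Ioc_eq) (auto simp: min_def max_def)
  have ind: "has_bochner_integral (randomized M) (\<lambda>p. indicator (B n) (snd p) * (norm (X (fst p) - Y (fst p)))\<^sup>2) (\<bar>sn n - s\<bar> * K)" for n
  proof -
    have "integrable (randomized M) (\<lambda>(x, y). (norm (X x - Y x))\<^sup>2 *\<^sub>R (indicator (B n) y :: real))"
      by (rule Fubini_integrable) (auto simp: XY iB)
    then have i: "integrable (randomized M) (\<lambda>p. indicator (B n) (snd p) * (norm (X (fst p) - Y (fst p)))\<^sup>2)"
      by (simp add: case_prod_beta' mult.commute)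
    have "(\<integral>p. indicator (B n) (snd p) * (norm (X (fst p) - Y (fst p)))\<^sup>2 \<partial>randomized M)
      = (\<integral>x. (\<integral>y. indicator (B n) y * (norm (X x - Y x))\<^sup>2 \<partial>unit_interval_measure) \<partial>M)"
      using integral_fst'[OF i, symmetric] by simp
    also have "\<dots> = \<bar>sn n - s\<bar> * K" unfolding K_def by (simp add: mB)
    finally show ?thesis using i by (simp add: has_bochner_integral_iff)
  qed
  have f: "has_bochner_integral (randomized M) (\<lambda>p. (norm (V (fst p)))\<^sup>2) (\<integral>\<omega>. (norm (V \<omega>))\<^sup>2 \<partial>M)"
    if "square_integrable M V" for V :: "'w \<Rightarrow> 'a"
  proof -
    have "(\<lambda>\<omega>. (norm (V \<omega>))\<^sup>2) \<in> borel_measurable M" "integrable M (\<lambda>\<omega>. (norm (V \<omega>))\<^sup>2)" using that by auto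
    then show ?thesis using integral_randomized_fst[OF M, of "\<lambda>\<omega>. (norm (V \<omega>))\<^sup>2"] by (simp add: has_bochner_integral_iff)
  qed
  have g: "has_bochner_integral (randomized M) (g n) (2 * (\<integral>\<omega>. (norm (Xn n \<omega> - X \<omega>))\<^sup>2 \<partial>M)
      + 2 * (\<integral>\<omega>. (norm (Yn n \<omega> - Y \<omega>))\<^sup>2 \<partial>M) + 2 * (\<bar>sn n - s\<bar> * K))" for n
    unfolding g_def
    by (intro has_bochner_integral_add has_bochner_integral_mult_right ind
        f[OF square_integrable_diff[OF Xn X]] f[OF square_integrable_diff[OF Yn Y]])
  have "limitin W2_topology (\<lambda>n. distr (randomized M) borel (switch (sn n) (Xn n) (Yn n)))
    (distr (randomized M) borel (switch s X Y)) Fl"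
  proof (rule limitin_W2_distr[OF prob_space_randomized[OF M]])
    show sq: "square_integrable (randomized M) (switch s X Y)" "square_integrable (randomized M) (switch (sn n) (Xn n) (Yn n))" for n
      by (rule square_integrable_switch(1)[OF M X Y], rule square_integrable_switch(1)[OF M Xn Yn])
    show "((\<lambda>n. \<integral>\<omega>. (norm (switch (sn n) (Xn n) (Yn n) \<omega> - switch s X Y \<omega>))\<^sup>2 \<partial>randomized M) \<longlongrightarrow> 0) Fl"
    proof (rule tendsto_sandwich)
      show "\<forall>\<^sub>F n in Fl. 0 \<le> (\<integral>\<omega>. (norm (switch (sn n) (Xn n) (Yn n) \<omega> - switch s X Y \<omega>))\<^sup>2 \<partial>randomized M)" by simp
      show "\<forall>\<^sub>F n in Fl. (\<integral>\<omega>. (norm (switch (sn n) (Xn n) (Yn n) \<omega> - switch s X Y \<omega>))\<^sup>2 \<partial>randomized M)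
        \<le> 2 * (\<integral>\<omega>. (norm (Xn n \<omega> - X \<omega>))\<^sup>2 \<partial>M)
      + 2 * (\<integral>\<omega>. (norm (Yn n \<omega> - Y \<omega>))\<^sup>2 \<partial>M) + 2 * (\<bar>sn n - s\<bar> * K)"
      proof (intro always_eventually allI)
        fix n
        have "(\<integral>\<omega>. (norm (switch (sn n) (Xn n) (Yn n) \<omega> - switch s X Y \<omega>))\<^sup>2 \<partial>randomized M) \<le> (\<integral>\<omega>. g n \<omega> \<partial>randomized M)"
          by (intro integral_mono le square_integrableD(2)[OF square_integrable_diff[OF sq(2) sq(1)]])
            (use g in \<open>auto simp: has_bochner_integral_iff\<close>)
        then show "(\<integral>\<omega>. (norm (switch (sn n) (Xn n) (Yn n) \<omega> - switch s X Y \<omega>))\<^sup>2 \<partial>randomized M)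
        \<le> 2 * (\<integral>\<omega>. (norm (Xn n \<omega> - X \<omega>))\<^sup>2 \<partial>M)
      + 2 * (\<integral>\<omega>. (norm (Yn n \<omega> - Y \<omega>))\<^sup>2 \<partial>M) + 2 * (\<bar>sn n - s\<bar> * K)"
          using g[of n] by (simp add: has_bochner_integral_iff)
      qed
      have "((\<lambda>n. \<bar>sn n - s\<bar>) \<longlongrightarrow> 0) Fl" using lims by (simp add: LIM_zero tendsto_rabs_zero)
      then have "((\<lambda>n. 2 * (\<integral>\<omega>. (norm (Xn n \<omega> - X \<omega>))\<^sup>2 \<partial>M)
      + 2 * (\<integral>\<omega>. (norm (Yn n \<omega> - Y \<omega>))\<^sup>2 \<partial>M) + 2 * (\<bar>sn n - s\<bar> * K)) \<longlongrightarrow> 2 * 0 + 2 * 0 + 2 * (0 * K)) Fl"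
        by (intro tendsto_intros limX limY)
      then show "((\<lambda>n. 2 * (\<integral>\<omega>. (norm (Xn n \<omega> - X \<omega>))\<^sup>2 \<partial>M)
      + 2 * (\<integral>\<omega>. (norm (Yn n \<omega> - Y \<omega>))\<^sup>2 \<partial>M) + 2 * (\<bar>sn n - s\<bar> * K)) \<longlongrightarrow> 0) Fl" by simp
    qed simp
  qed
  then show ?thesis using M s by (simp add: mixture_distr)
qed

section \<open>First variation of a mean-field cost\<close>

text \<open>A cost without time variable. The locale is instantiated by the terminal cost and by the
  running cost at each fixed time, always with the same \<open>\<kappa>\<close>, so that its
  estimates are uniform in time.\<close>

locale mean_field_cost =
  fixes \<phi> :: "'a::euclidean_space \<Rightarrow> 'a measure \<Rightarrow> real" and \<delta> :: "'a \<Rightarrow> 'a measure \<Rightarrow> 'a \<Rightarrow> real"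
    and \<delta>y :: "'a \<Rightarrow> 'a measure \<Rightarrow> 'a \<Rightarrow> 'a" and \<kappa> :: real
  assumes linear_derivative: "\<And>x. has_linear_derivative (\<phi> x) (\<delta> x)"
    and continuous_cost: "continuous_map state_measure_topology euclideanreal (\<lambda>(x, \<mu>). \<phi> x \<mu>)"
    and continuous_\<delta>: "continuous_map state_measure_point_topology euclideanreal (\<lambda>(x, \<mu>, y). \<delta> x \<mu> y)"
    and continuous_\<delta>y: "continuous_map state_measure_point_topology euclidean (\<lambda>(x, \<mu>, y). \<delta>y x \<mu> y)"
    and growth_cost: "\<And>x \<mu>. \<mu> \<in> P2 \<Longrightarrow> \<bar>\<phi> x \<mu>\<bar> \<le> \<kappa> * (1 + (norm x)\<^sup>2 + moment2 \<mu>)"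
    and growth_\<delta>: "\<And>x \<mu> y. \<mu> \<in> P2 \<Longrightarrow> \<bar>\<delta> x \<mu> y\<bar> \<le> \<kappa> * (1 + (norm x)\<^sup>2 + moment2 \<mu> + (norm y)\<^sup>2)"
    and growth_\<delta>y: "\<And>x \<mu> y. \<mu> \<in> P2 \<Longrightarrow> norm (\<delta>y x \<mu> y) \<le> \<kappa> * (1 + norm x + sqrt (moment2 \<mu>) + norm y)"
    and gderiv_\<delta>: "\<And>x \<mu> y. \<mu> \<in> P2 \<Longrightarrow> GDERIV (\<delta> x \<mu>) y :> \<delta>y x \<mu> y"
    and \<kappa>_pos: "\<kappa> > 0"
begin

lemma tendsto_cost:
  assumes "(x \<longlongrightarrow> l) Fl" "limitin W2_topology m \<mu> Fl"
  shows "((\<lambda>n. \<phi> (x n) (m n)) \<longlongrightarrow> \<phi> l \<mu>) Fl"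
proof -
  have "limitin state_measure_topology (\<lambda>n. (x n, m n)) (l, \<mu>) Fl"
    using assms by (simp add: limitin_pairwise comp_def)
  from continuous_map_limit[OF continuous_cost this] show ?thesis by (simp add: comp_def)
qed

lemma tendsto_\<delta>:
  assumes "(x \<longlongrightarrow> l) Fl" "limitin W2_topology m \<mu> Fl" "(y \<longlongrightarrow> k) Fl"
  shows "((\<lambda>n. \<delta> (x n) (m n) (y n)) \<longlongrightarrow> \<delta> l \<mu> k) Fl"
proof -
  have "limitin state_measure_point_topology (\<lambda>n. (x n, m n, y n)) (l, \<mu>, k) Fl"
    using assms by (simp add: limitin_pairwise comp_def)
  from continuous_map_limit[OF continuous_\<delta> this] show ?thesis by (simp add: comp_def)
qed

lemma tendsto_\<delta>y:
  assumes "(x \<longlongrightarrow> l) Fl" "limitin W2_topology m \<mu> Fl" "(y \<longlongrightarrow> k) Fl"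
  shows "((\<lambda>n. \<delta>y (x n) (m n) (y n)) \<longlongrightarrow> \<delta>y l \<mu> k) Fl"
proof -
  have "limitin state_measure_point_topology (\<lambda>n. (x n, m n, y n)) (l, \<mu>, k) Fl"
    using assms by (simp add: limitin_pairwise comp_def)
  from continuous_map_limit[OF continuous_\<delta>y this] show ?thesis by (simp add: comp_def)
qed

lemma limitin_W2_const: "\<mu> \<in> P2 \<Longrightarrow> limitin W2_topology (\<lambda>_. \<mu>) \<mu> Fl"
  by (simp add: topspace_W2_topology)

lemma measurable_cost: "\<mu> \<in> P2 \<Longrightarrow> X \<in> borel_measurable N \<Longrightarrow> (\<lambda>\<omega>. \<phi> (X \<omega>) \<mu>) \<in> borel_measurable N"
proof -
  assume \<mu>: "\<mu> \<in> P2" and X: "X \<in> borel_measurable N"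
  have "continuous_on UNIV (\<lambda>x. \<phi> x \<mu>)"
    unfolding continuous_on_def by (auto intro!: tendsto_cost limitin_W2_const \<mu> tendsto_ident_at)
  then show ?thesis using X by (intro measurable_compose[OF X] borel_measurable_continuous_onI)
qed

lemma measurable_\<delta>:
  "\<mu> \<in> P2 \<Longrightarrow> X \<in> borel_measurable N \<Longrightarrow> Y \<in> borel_measurable N \<Longrightarrow> (\<lambda>\<omega>. \<delta> (X \<omega>) \<mu> (Y \<omega>)) \<in> borel_measurable N"
proof -
  assume \<mu>: "\<mu> \<in> P2" and [measurable]: "X \<in> borel_measurable N" "Y \<in> borel_measurable N"
  have "continuous_on UNIV (\<lambda>p. \<delta> (fst p) \<mu> (snd p))"
    unfolding continuous_on_def by (intro ballI tendsto_\<delta> limitin_W2_const \<mu> tendsto_fst tendsto_snd tendsto_ident_at)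
  then have "(\<lambda>p. \<delta> (fst p) \<mu> (snd p)) \<in> borel_measurable borel" by (rule borel_measurable_continuous_onI)
  from measurable_compose[OF _ this, of "\<lambda>\<omega>. (X \<omega>, Y \<omega>)" N] show ?thesis by simp
qed

lemma measurable_\<delta>y:
  "\<mu> \<in> P2 \<Longrightarrow> Y \<in> borel_measurable N \<Longrightarrow> (\<lambda>\<omega>. \<delta>y x \<mu> (Y \<omega>)) \<in> borel_measurable N"
proof -
  assume \<mu>: "\<mu> \<in> P2" and Y: "Y \<in> borel_measurable N"
  have "continuous_on UNIV (\<delta>y x \<mu>)"
    unfolding continuous_on_def by (auto intro!: tendsto_\<delta>y limitin_W2_const \<mu> tendsto_ident_at)
  then show ?thesis using Y by (intro measurable_compose[OF Y] borel_measurable_continuous_onI)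
qed

lemma \<delta>_mean_value:
  assumes \<mu>: "\<mu> \<in> P2" and e: "0 < e"
  obtains z where "0 < z" "z < e" "\<delta> x \<mu> (a + e *\<^sub>R v) - \<delta> x \<mu> a = e * (\<delta>y x \<mu> (a + z *\<^sub>R v) \<bullet> v)"
proof -
  have "((\<lambda>r. \<delta> x \<mu> (a + r *\<^sub>R v)) has_real_derivative (\<delta>y x \<mu> (a + r *\<^sub>R v) \<bullet> v)) (at r)" for r
  proof -
    have 1: "((\<lambda>r. a + r *\<^sub>R v) has_derivative (\<lambda>h. h *\<^sub>R v)) (at r)"
      by (auto intro!: derivative_eq_intros)
    have 2: "(\<delta> x \<mu> has_derivative (\<lambda>h. h \<bullet> \<delta>y x \<mu> (a + r *\<^sub>R v))) (at (a + r *\<^sub>R v))"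
      using gderiv_\<delta>[OF \<mu>] by (simp add: gderiv_def)
    have "((\<lambda>r. \<delta> x \<mu> (a + r *\<^sub>R v)) has_derivative (\<lambda>h. (h *\<^sub>R v) \<bullet> \<delta>y x \<mu> (a + r *\<^sub>R v))) (at r)"
      using diff_chain_at[OF 1 2] by (simp only: comp_def)
    then show ?thesis
      unfolding has_field_derivative_def by (rule has_derivative_eq_rhs) (simp add: fun_eq_iff inner_commute)
  qed
  from MVT2[OF e this] obtain z where "0 < z" "z < e"
    "\<delta> x \<mu> (a + e *\<^sub>R v) - \<delta> x \<mu> (a + 0 *\<^sub>R v) = (e - 0) * (\<delta>y x \<mu> (a + z *\<^sub>R v) \<bullet> v)" by blast
  then show ?thesis by (intro that[of z]) auto
qed

section \<open>Difference quotients of the linear derivative in the point variable\<close>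

definition quotient :: "real \<Rightarrow> 'a \<Rightarrow> 'a measure \<Rightarrow> 'a \<Rightarrow> 'a \<Rightarrow> real" where
  "quotient e x \<mu> a b = (\<delta> x \<mu> (a + e *\<^sub>R (b - a)) - \<delta> x \<mu> a) / e"

lemma norm_interpolation_le:
  assumes "0 \<le> z" "z \<le> 1"
  shows "norm (a + z *\<^sub>R (b - a)) \<le> norm a + norm (b :: 'b::real_normed_vector)"
proof -
  have "a + z *\<^sub>R (b - a) = (1 - z) *\<^sub>R a + z *\<^sub>R b" by (simp add: algebra_simps)
  also have "norm \<dots> \<le> (1 - z) * norm a + z * norm b"
    using assms by (intro norm_triangle_le) auto
  also have "\<dots> \<le> 1 * norm a + 1 * norm b"
    using assms by (intro add_mono mult_right_mono) auto
  finally show ?thesis by simp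
qed

text \<open>By the mean value theorem the quotient is \<open>\<delta>y\<close> at an intermediate
  point paired with \<open>b - a\<close>, so the linear growth of \<open>\<delta>y\<close> bounds it
  independently of \<open>e\<close>. For random \<open>a\<close> and \<open>b\<close> with finite
  second moments the bound is integrable; it is the dominating function for the later limits in
  \<open>e\<close>.\<close>

lemma quotient_bound:
  assumes \<mu>: "\<mu> \<in> P2" "moment2 \<mu> \<le> R" and e: "0 < e" "e \<le> 1"
  shows "\<bar>quotient e x \<mu> a b\<bar> \<le> \<kappa> * (1 + norm x + sqrt R + (norm a + norm b)) * norm (b - a)"
proof -
  obtain z where z: "0 < z" "z < e" "\<delta> x \<mu> (a + e *\<^sub>R (b - a)) - \<delta> x \<mu> a = e * (\<delta>y x \<mu> (a + z *\<^sub>R (b - a)) \<bullet> (b - a))"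
    by (rule \<delta>_mean_value[OF \<mu>(1) e(1), of x a "b - a"])
  have "\<bar>quotient e x \<mu> a b\<bar> = \<bar>\<delta>y x \<mu> (a + z *\<^sub>R (b - a)) \<bullet> (b - a)\<bar>"
    using e unfolding quotient_def z by simp
  also have "\<dots> \<le> norm (\<delta>y x \<mu> (a + z *\<^sub>R (b - a))) * norm (b - a)"
    by (rule Cauchy_Schwarz_ineq2)
  also have "norm (\<delta>y x \<mu> (a + z *\<^sub>R (b - a))) \<le> \<kappa> * (1 + norm x + sqrt (moment2 \<mu>) + norm (a + z *\<^sub>R (b - a)))"
    by (rule growth_\<delta>y[OF \<mu>(1)])
  also have "\<dots> \<le> \<kappa> * (1 + norm x + sqrt R + (norm a + norm b))"
    using \<kappa>_pos \<mu>(2) z e norm_interpolation_le[of z a b] by (intro mult_left_mono add_mono real_sqrt_le_mono) auto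
  finally show ?thesis by (simp add: mult_right_mono)
qed

text \<open>State, measure and step vary together. The intermediate points of the mean value theorem
  tend to \<open>a\<close>, and joint continuity of \<open>\<delta>y\<close> gives the
  limit.\<close>

lemma quotient_tendsto:
  assumes x: "x \<longlonglongrightarrow> l" and m: "\<And>n. m n \<in> P2" "limitin W2_topology m \<mu> sequentially"
    and e: "\<And>n. 0 < e n" "e \<longlonglongrightarrow> 0"
  shows "(\<lambda>n. quotient (e n) (x n) (m n) a b) \<longlonglongrightarrow> \<delta>y l \<mu> a \<bullet> (b - a)"
proof -
  have "\<exists>z. 0 < z \<and> z < e n \<and> \<delta> (x n) (m n) (a + e n *\<^sub>R (b - a)) - \<delta> (x n) (m n) a = e n * (\<delta>y (x n) (m n) (a + z *\<^sub>R (b - a)) \<bullet> (b - a))" for n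
    using \<delta>_mean_value[OF m(1)[of n] e(1)[of n], of "x n" a "b - a"] by blast
  then obtain z where z: "\<And>n. 0 < z n" "\<And>n. z n < e n"
    "\<And>n. \<delta> (x n) (m n) (a + e n *\<^sub>R (b - a)) - \<delta> (x n) (m n) a = e n * (\<delta>y (x n) (m n) (a + z n *\<^sub>R (b - a)) \<bullet> (b - a))"
    by metis
  have z0: "z \<longlonglongrightarrow> 0"
    by (rule tendsto_sandwich[OF _ _ tendsto_const e(2)]) (use z in \<open>auto intro!: always_eventually less_imp_le\<close>)
  have "quotient (e n) (x n) (m n) a b = \<delta>y (x n) (m n) (a + z n *\<^sub>R (b - a)) \<bullet> (b - a)" for n
    using e(1)[of n] unfolding quotient_def z by simp
  moreover have "(\<lambda>n. a + z n *\<^sub>R (b - a)) \<longlonglongrightarrow> a + 0 *\<^sub>R (b - a)"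
    by (intro tendsto_intros z0)
  then have "(\<lambda>n. \<delta>y (x n) (m n) (a + z n *\<^sub>R (b - a)) \<bullet> (b - a)) \<longlonglongrightarrow> \<delta>y l \<mu> a \<bullet> (b - a)"
    by (intro tendsto_inner tendsto_const tendsto_\<delta>y x m) simp
  ultimately show ?thesis by simp
qed

lemma measurable_quotient:
  "\<mu> \<in> P2 \<Longrightarrow> X \<in> borel_measurable N \<Longrightarrow> A \<in> borel_measurable N \<Longrightarrow> B \<in> borel_measurable N \<Longrightarrow>
    (\<lambda>\<omega>. quotient e (X \<omega>) \<mu> (A \<omega>) (B \<omega>)) \<in> borel_measurable N"
  unfolding quotient_def by (intro borel_measurable_divide borel_measurable_diff measurable_\<delta>) auto

end

text \<open>\<open>A\<close> plays the role of the optimal state at one time and \<open>B\<close>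
  that of its competitor. The common moment bound \<open>S\<close> is a parameter, so that constants
  depending on \<open>\<kappa>\<close> and \<open>S\<close> alone serve for all times.\<close>

locale mean_field_variation = mean_field_cost +
  fixes M :: "'w measure" and A B :: "'w \<Rightarrow> 'a" and S :: real
  assumes M: "prob_space M" and A: "square_integrable M A" and B: "square_integrable M B"
    and S: "(\<integral>\<omega>. (norm (A \<omega>))\<^sup>2 \<partial>M) \<le> S" "(\<integral>\<omega>. (norm (B \<omega>))\<^sup>2 \<partial>M) \<le> S"
begin

sublocale prob_space M by (rule M)

lemma A_meas[measurable]: "A \<in> borel_measurable M" and B_meas[measurable]: "B \<in> borel_measurable M"
  using A B by auto

definition Z :: "real \<Rightarrow> 'w \<Rightarrow> 'a" where "Z e \<omega> = A \<omega> + e *\<^sub>R (B \<omega> - A \<omega>)"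

abbreviation \<mu> where "\<mu> \<equiv> distr M borel A"

lemma S_nonneg: "0 \<le> S"
  using S(1) by (rule order_trans[rotated]) simp

lemma square_integrable_Z: "square_integrable M (Z e)"
  unfolding Z_def by (intro square_integrable_add square_integrable_scaleR square_integrable_diff A B)

lemma Z_meas[measurable]: "Z e \<in> borel_measurable M"
  using square_integrable_Z by auto

lemma norm_sq_Z_le: "0 \<le> e \<Longrightarrow> e \<le> 1 \<Longrightarrow> (norm (Z e \<omega>))\<^sup>2 \<le> 2 * (norm (A \<omega>))\<^sup>2 + 2 * (norm (B \<omega>))\<^sup>2"
proof -
  assume e: "0 \<le> e" "e \<le> 1"
  have "(norm (Z e \<omega>))\<^sup>2 \<le> (norm (A \<omega>) + norm (B \<omega>))\<^sup>2"
    unfolding Z_def by (intro power_mono norm_interpolation_le e) auto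
  then show ?thesis using sum_squares_bound[of "norm (A \<omega>)" "norm (B \<omega>)"] by (simp add: power2_sum)
qed

lemma moment_Z_le: "0 \<le> e \<Longrightarrow> e \<le> 1 \<Longrightarrow> (\<integral>\<omega>. (norm (Z e \<omega>))\<^sup>2 \<partial>M) \<le> 4 * S"
proof -
  assume e: "0 \<le> e" "e \<le> 1"
  have "(\<integral>\<omega>. (norm (Z e \<omega>))\<^sup>2 \<partial>M) \<le> (\<integral>\<omega>. 2 * (norm (A \<omega>))\<^sup>2 + 2 * (norm (B \<omega>))\<^sup>2 \<partial>M)"
    using norm_sq_Z_le[OF e] A[THEN square_integrableD(2)] B[THEN square_integrableD(2)] square_integrable_Z[THEN square_integrableD(2)]
    by (intro integral_mono Bochner_Integration.integrable_add integrable_mult_right) auto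
  also have "\<dots> \<le> 4 * S" using S A[THEN square_integrableD(2)] B[THEN square_integrableD(2)] by (subst Bochner_Integration.integral_add) auto
  finally show ?thesis .
qed

lemma \<mu>_P2: "\<mu> \<in> P2" "distr M borel (Z e) \<in> P2"
  using square_integrable_P2[OF M] A square_integrable_Z by auto

text \<open>The bound adds \<open>4 * S\<close> for the interpolated variable and \<open>S\<close>
  for \<open>A\<close>.\<close>

lemma mix_P2:
  assumes "0 \<le> e" "e \<le> 1" "s \<in> {0..1}"
  shows "mixture s (distr M borel (Z e)) \<mu> \<in> P2" "moment2 (mixture s (distr M borel (Z e)) \<mu>) \<le> 5 * S"
  using mixture_P2[OF M square_integrable_Z A, of s e] moment_Z_le[OF assms(1,2)] S assms(3) by auto

lemma moment2_\<mu>_le: "moment2 \<mu> \<le> 5 * S"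
  using S(1) S_nonneg by (simp add: moment2_distr)

definition c1 where "c1 = (\<integral>\<omega>. norm (B \<omega> - A \<omega>) \<partial>M)"
definition c2 where "c2 = (\<integral>\<omega>. (norm (A \<omega>) + norm (B \<omega>)) * norm (B \<omega> - A \<omega>) \<partial>M)"
text \<open>The expectation of the bound in \<open>quotient_bound\<close> with
  \<open>norm x = r\<close> and \<open>R = 5 * S\<close>. It is affine in \<open>r\<close>, hence
  still integrable when a square-integrable state is inserted.\<close>

definition bnd where "bnd r = \<kappa> * ((1 + r + sqrt (5 * S)) * c1 + c2)"

lemma integrable_bounds:
  "integrable M (\<lambda>\<omega>. norm (B \<omega> - A \<omega>))"
  "integrable M (\<lambda>\<omega>. (norm (A \<omega>) + norm (B \<omega>)) * norm (B \<omega> - A \<omega>))"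
  using square_integrable_norm[OF finite_measure_axioms square_integrable_diff[OF B A]]
    square_integrable_norm_mult[OF A square_integrable_diff[OF B A]]
    square_integrable_norm_mult[OF B square_integrable_diff[OF B A]]
  by (auto simp: distrib_right)

lemma bnd_eq:
  "has_bochner_integral M (\<lambda>\<omega>. \<kappa> * (1 + r + sqrt (5 * S) + (norm (A \<omega>) + norm (B \<omega>))) * norm (B \<omega> - A \<omega>)) (bnd r)"
proof -
  have "has_bochner_integral M (\<lambda>\<omega>. \<kappa> * ((1 + r + sqrt (5 * S)) * norm (B \<omega> - A \<omega>) + (norm (A \<omega>) + norm (B \<omega>)) * norm (B \<omega> - A \<omega>))) (bnd r)"
    unfolding bnd_def c1_def c2_def
    by (intro has_bochner_integral_mult_right has_bochner_integral_add has_bochner_integral_integrable integrable_bounds)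
  then show ?thesis by (simp add: algebra_simps)
qed

lemma integral_quotient_bound:
  assumes "m \<in> P2" "moment2 m \<le> 5 * S" "0 < e" "e \<le> 1"
  shows "integrable M (\<lambda>\<omega>. quotient e x m (A \<omega>) (B \<omega>))"
    "\<bar>\<integral>\<omega>. quotient e x m (A \<omega>) (B \<omega>) \<partial>M\<bar> \<le> bnd (norm x)"
proof -
  note b = bnd_eq[of "norm x", unfolded has_bochner_integral_iff]
  show i: "integrable M (\<lambda>\<omega>. quotient e x m (A \<omega>) (B \<omega>))"
    by (rule Bochner_Integration.integrable_bound[OF conjunct1[OF b]])
      (use quotient_bound[OF assms] assms(1) in \<open>auto intro!: AE_I2 measurable_quotient order_trans[OF _ abs_ge_self]\<close>)
  have "\<bar>\<integral>\<omega>. quotient e x m (A \<omega>) (B \<omega>) \<partial>M\<bar> \<le> (\<integral>\<omega>. \<bar>quotient e x m (A \<omega>) (B \<omega>)\<bar> \<partial>M)"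
    by (rule integral_abs_bound)
  also have "\<dots> \<le> bnd (norm x)"
    unfolding conjunct2[OF b, symmetric]
    by (intro integral_mono) (use i b quotient_bound[OF assms] in auto)
  finally show "\<bar>\<integral>\<omega>. quotient e x m (A \<omega>) (B \<omega>) \<partial>M\<bar> \<le> bnd (norm x)" .
qed

lemma integral_quotient_tendsto:
  assumes x: "x \<longlonglongrightarrow> l" and m: "\<And>n. m n \<in> P2" "\<And>n. moment2 (m n) \<le> 5 * S" "limitin W2_topology m \<mu> sequentially"
    and e: "\<And>n. 0 < e n" "\<And>n. e n \<le> 1" "e \<longlonglongrightarrow> 0"
  shows "(\<lambda>n. \<integral>\<omega>. quotient (e n) (x n) (m n) (A \<omega>) (B \<omega>) \<partial>M) \<longlonglongrightarrow> (\<integral>\<omega>. \<delta>y l \<mu> (A \<omega>) \<bullet> (B \<omega> - A \<omega>) \<partial>M)"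
proof -
  obtain r where r: "\<And>n. norm (x n) \<le> r"
    using convergent_imp_Bseq[OF convergentI[OF x]] by (auto simp: Bseq_def)
  show ?thesis
  proof (rule integral_dominated_convergence[OF _ _ conjunct1[OF bnd_eq[of r, unfolded has_bochner_integral_iff]]])
    show "(\<lambda>\<omega>. \<delta>y l \<mu> (A \<omega>) \<bullet> (B \<omega> - A \<omega>)) \<in> borel_measurable M"
      using measurable_\<delta>y[OF \<mu>_P2(1) A_meas] by measurable
    show "(\<lambda>\<omega>. quotient (e n) (x n) (m n) (A \<omega>) (B \<omega>)) \<in> borel_measurable M" for n
      by (intro measurable_quotient m) auto
    show "AE \<omega> in M. (\<lambda>n. quotient (e n) (x n) (m n) (A \<omega>) (B \<omega>)) \<longlonglongrightarrow> \<delta>y l \<mu> (A \<omega>) \<bullet> (B \<omega> - A \<omega>)"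
      by (intro AE_I2 quotient_tendsto x m e)
    show "AE \<omega> in M. norm (quotient (e n) (x n) (m n) (A \<omega>) (B \<omega>))
      \<le> \<kappa> * (1 + r + sqrt (5 * S) + (norm (A \<omega>) + norm (B \<omega>))) * norm (B \<omega> - A \<omega>)" for n
    proof (intro AE_I2)
      fix \<omega>
      have "norm (quotient (e n) (x n) (m n) (A \<omega>) (B \<omega>)) \<le> \<kappa> * (1 + norm (x n) + sqrt (5 * S) + (norm (A \<omega>) + norm (B \<omega>))) * norm (B \<omega> - A \<omega>)"
        using quotient_bound[OF m(1,2) e(1,2)] by simp
      also have "\<dots> \<le> \<kappa> * (1 + r + sqrt (5 * S) + (norm (A \<omega>) + norm (B \<omega>))) * norm (B \<omega> - A \<omega>)"
        using r[of n] \<kappa>_pos by (intro mult_right_mono mult_left_mono add_mono) auto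
      finally show "norm (quotient (e n) (x n) (m n) (A \<omega>) (B \<omega>)) \<le> \<dots>" .
    qed
  qed
qed

text \<open>In the limit both components have law \<open>\<mu>\<close>, and a mixture of
  \<open>\<mu>\<close> with itself is \<open>\<mu>\<close>, because the switched variable then
  ignores the uniform coordinate.\<close>

lemma limitin_mix:
  assumes e: "\<And>n. 0 < e n" "\<And>n. e n \<le> 1" "e \<longlonglongrightarrow> 0" and s: "s \<in> {0..1}"
  shows "limitin W2_topology (\<lambda>n. mixture s (distr M borel (Z (e n))) \<mu>) \<mu> sequentially"
proof -
  have "limitin W2_topology (\<lambda>n. mixture s (distr M borel (Z (e n))) (distr M borel A)) (mixture s \<mu> \<mu>) sequentially"
  proof (rule limitin_mixture[OF M A A square_integrable_Z A s s])
    have "(\<lambda>n. (e n)\<^sup>2 * (\<integral>\<omega>. (norm (B \<omega> - A \<omega>))\<^sup>2 \<partial>M)) \<longlonglongrightarrow> 0\<^sup>2 * (\<integral>\<omega>. (norm (B \<omega> - A \<omega>))\<^sup>2 \<partial>M)"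
      by (intro tendsto_intros e(3))
    moreover have "(\<integral>\<omega>. (norm (Z (e n) \<omega> - A \<omega>))\<^sup>2 \<partial>M) = (e n)\<^sup>2 * (\<integral>\<omega>. (norm (B \<omega> - A \<omega>))\<^sup>2 \<partial>M)" for n
      by (simp add: Z_def power_mult_distrib)
    ultimately show "(\<lambda>n. \<integral>\<omega>. (norm (Z (e n) \<omega> - A \<omega>))\<^sup>2 \<partial>M) \<longlonglongrightarrow> 0" by simp
  qed auto
  moreover have "mixture s \<mu> \<mu> = \<mu>"
  proof -
    interpret U: prob_space unit_interval_measure by (rule prob_space_unit_interval)
    have "mixture s \<mu> \<mu> = distr (randomized M) borel (\<lambda>p. A (fst p))"
      using s by (subst mixture_distr[OF M]) (auto simp: switch_def[abs_def])
    also have "\<dots> = distr (distr (randomized M) M fst) borel A"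
      by (subst distr_distr) (auto simp: comp_def)
    also have "distr (randomized M) M fst = M" by (rule U.distr_pair_fst)
    finally show ?thesis .
  qed
  ultimately show ?thesis by simp
qed

text \<open>Unrelated to the terminal cost. This is the integrand, at mixing parameter
  \<open>s\<close>, of the linear derivative formula for the increment of \<open>\<phi> x\<close>
  from \<open>\<mu>\<close> to the law of \<open>Z e\<close>, divided by \<open>e\<close>.\<close>

definition G :: "real \<Rightarrow> 'a \<Rightarrow> real \<Rightarrow> real" where
  "G e x s = (\<integral>\<omega>. quotient e x (mixture s (distr M borel (Z e)) \<mu>) (A \<omega>) (B \<omega>) \<partial>M)"

text \<open>Supplies integrability in the mixing parameter. The mixtures move continuously in the
  Wasserstein topology, and the expectation follows by dominated convergence.\<close>

lemma G_continuous:
  assumes e: "0 < e" "e \<le> 1" shows "continuous_on {0..1} (G e x)"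
  unfolding continuous_on_sequentially
proof (intro allI ballI impI)
  fix s sn assume s: "s \<in> {0..1}" and sn: "(\<forall>n. sn n \<in> {0..1::real}) \<and> sn \<longlonglongrightarrow> s"
  let ?m = "\<lambda>s. mixture s (distr M borel (Z e)) \<mu>"
  have lim: "limitin W2_topology (\<lambda>n. ?m (sn n)) (?m s) sequentially"
    using s sn by (intro limitin_mixture[OF M square_integrable_Z A square_integrable_Z A]) auto
  show "(G e x \<circ> sn) \<longlonglongrightarrow> G e x s"
    unfolding comp_def G_def
  proof (rule integral_dominated_convergence[OF _ _ conjunct1[OF bnd_eq[of "norm x", unfolded has_bochner_integral_iff]]])
    show "(\<lambda>\<omega>. quotient e x (?m s) (A \<omega>) (B \<omega>)) \<in> borel_measurable M"
      "(\<lambda>\<omega>. quotient e x (?m (sn n)) (A \<omega>) (B \<omega>)) \<in> borel_measurable M" for n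
      using e s sn by (auto intro!: measurable_quotient mix_P2)
    show "AE \<omega> in M. (\<lambda>n. quotient e x (?m (sn n)) (A \<omega>) (B \<omega>)) \<longlonglongrightarrow> quotient e x (?m s) (A \<omega>) (B \<omega>)"
      unfolding quotient_def using e by (intro AE_I2 tendsto_intros tendsto_\<delta> lim) auto
    show "AE \<omega> in M. norm (quotient e x (?m (sn n)) (A \<omega>) (B \<omega>))
      \<le> \<kappa> * (1 + norm x + sqrt (5 * S) + (norm (A \<omega>) + norm (B \<omega>))) * norm (B \<omega> - A \<omega>)" for n
      using sn e by (auto intro!: AE_I2 quotient_bound mix_P2)
  qed
qed

lemma integrable_\<delta>_point:
  assumes "m \<in> P2" and Y: "square_integrable M Y"
  shows "integrable M (\<lambda>\<omega>. \<delta> x m (Y \<omega>))"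
  by (rule Bochner_Integration.integrable_bound[of M "\<lambda>\<omega>. \<kappa> * (1 + (norm x)\<^sup>2 + moment2 m + (norm (Y \<omega>))\<^sup>2)"])
    (use growth_\<delta>[OF assms(1)] Y assms(1) in \<open>auto intro!: AE_I2 measurable_\<delta> order_trans[OF _ abs_ge_self]\<close>)

text \<open>Both laws come from variables on \<open>M\<close>, so the difference of the two
  integrals in the linear derivative formula is one expectation of \<open>\<delta>\<close> at
  \<open>Z e\<close> minus \<open>\<delta>\<close> at \<open>A\<close>, which is \<open>e\<close>
  times a difference quotient.\<close>

lemma cost_increment:
  assumes e: "0 < e" "e \<le> 1"
  shows "\<phi> x (distr M borel (Z e)) - \<phi> x \<mu> = e * (LBINT s:{0..1}. G e x s)"
proof -
  have "\<phi> x (distr M borel (Z e)) - \<phi> x \<mu> =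
    (LBINT t:{0..1}. (\<integral>y. \<delta> x (mixture t (distr M borel (Z e)) \<mu>) y \<partial>distr M borel (Z e)) - (\<integral>y. \<delta> x (mixture t (distr M borel (Z e)) \<mu>) y \<partial>\<mu>))"
    using linear_derivative[of x] \<mu>_P2 unfolding has_linear_derivative_def by blast
  also have "\<dots> = (LBINT t:{0..1}. e * G e x t)"
  proof (rule set_lebesgue_integral_cong)
    show "\<forall>t. t \<in> {0..1} \<longrightarrow> (\<integral>y. \<delta> x (mixture t (distr M borel (Z e)) \<mu>) y \<partial>distr M borel (Z e)) - (\<integral>y. \<delta> x (mixture t (distr M borel (Z e)) \<mu>) y \<partial>\<mu>) = e * G e x t"
    proof (intro allI impI)
      fix t :: real assume t: "t \<in> {0..1}"
      let ?m = "mixture t (distr M borel (Z e)) \<mu>"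
      have m: "?m \<in> P2" using mix_P2 e t by auto
      have [measurable]: "(\<lambda>y. \<delta> x ?m y) \<in> borel_measurable borel" by (intro measurable_\<delta> m) auto
      have "(\<integral>y. \<delta> x ?m y \<partial>distr M borel (Z e)) - (\<integral>y. \<delta> x ?m y \<partial>\<mu>) = (\<integral>\<omega>. \<delta> x ?m (Z e \<omega>) \<partial>M) - (\<integral>\<omega>. \<delta> x ?m (A \<omega>) \<partial>M)"
        by (subst (1 2) integral_distr) auto
      also have "\<dots> = (\<integral>\<omega>. \<delta> x ?m (Z e \<omega>) - \<delta> x ?m (A \<omega>) \<partial>M)"
        using integrable_\<delta>_point[OF m] square_integrable_Z A by (intro Bochner_Integration.integral_diff[symmetric]) auto
      also have "\<dots> = (\<integral>\<omega>. e * quotient e x ?m (A \<omega>) (B \<omega>) \<partial>M)"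
        using e by (intro Bochner_Integration.integral_cong) (auto simp: quotient_def Z_def)
      finally show "(\<integral>y. \<delta> x ?m y \<partial>distr M borel (Z e)) - (\<integral>y. \<delta> x ?m y \<partial>\<mu>) = e * G e x t"
        by (simp add: G_def)
    qed
  qed simp
  finally show ?thesis by simp
qed

lemma G_bound: "0 < e \<Longrightarrow> e \<le> 1 \<Longrightarrow> s \<in> {0..1} \<Longrightarrow> \<bar>G e x s\<bar> \<le> bnd (norm x)"
  unfolding G_def by (intro integral_quotient_bound mix_P2) auto

lemma cost_quotient_bound:
  assumes e: "0 < e" "e \<le> 1"
  shows "\<bar>(\<phi> x (distr M borel (Z e)) - \<phi> x \<mu>) / e\<bar> \<le> bnd (norm x)"
proof -
  have "(\<phi> x (distr M borel (Z e)) - \<phi> x \<mu>) / e = (LBINT s:{0..1}. G e x s)"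
    using cost_increment[OF e] e by simp
  also have "\<bar>\<dots>\<bar> \<le> (\<integral>s. \<bar>indicator {0..1} s * G e x s\<bar> \<partial>lborel)"
    unfolding set_lebesgue_integral_def by (simp add: integral_abs_bound)
  also have "\<dots> \<le> (\<integral>s. indicator {0..1::real} s * bnd (norm x) \<partial>lborel)"
  proof (rule Bochner_Integration.integral_mono)
    have "integrable lborel (\<lambda>s. indicator {0..1} s *\<^sub>R G e x s)"
      using borel_integrable_compact[OF _ G_continuous[OF e, of x]] by simp
    then show "integrable lborel (\<lambda>s. \<bar>indicator {0..1} s * G e x s\<bar>)" by simp
    show "integrable lborel (\<lambda>s. indicator {0..1::real} s * bnd (norm x))" by simp
    fix s :: real
    show "\<bar>indicator {0..1} s * G e x s\<bar> \<le> indicator {0..1} s * bnd (norm x)"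
      using G_bound[OF e, of s x] by (auto simp: indicator_def)
  qed
  finally show ?thesis by simp
qed

text \<open>The limit is the directional derivative of \<open>\<phi> l\<close> at
  \<open>\<mu>\<close> along \<open>B - A\<close>. The state varies with \<open>n\<close> because
  \<open>Z (e n) \<omega>\<close> will be inserted for it.\<close>

lemma cost_quotient_tendsto:
  assumes e: "\<And>n. 0 < e n" "\<And>n. e n \<le> 1" "e \<longlonglongrightarrow> 0" and x: "x \<longlonglongrightarrow> l"
  shows "(\<lambda>n. (\<phi> (x n) (distr M borel (Z (e n))) - \<phi> (x n) \<mu>) / e n) \<longlonglongrightarrow> (\<integral>\<omega>. \<delta>y l \<mu> (A \<omega>) \<bullet> (B \<omega> - A \<omega>) \<partial>M)"
proof -
  let ?L = "\<integral>\<omega>. \<delta>y l \<mu> (A \<omega>) \<bullet> (B \<omega> - A \<omega>) \<partial>M"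
  obtain r where r: "\<And>n. norm (x n) \<le> r"
    using convergent_imp_Bseq[OF convergentI[OF x]] by (auto simp: Bseq_def)
  have c10: "0 \<le> c1" unfolding c1_def by simp
  have mono: "bnd (norm (x n)) \<le> bnd r" for n
    unfolding bnd_def using r[of n] \<kappa>_pos c10 by (intro mult_left_mono add_mono mult_right_mono) auto
  have "(\<lambda>n. LBINT s:{0..1}. G (e n) (x n) s) \<longlonglongrightarrow> (LBINT s:{0..1::real}. ?L)"
    unfolding set_lebesgue_integral_def
  proof (rule integral_dominated_convergence[where w="\<lambda>s. indicator {0..1} s * bnd r"])
    show "(\<lambda>s. indicator {0..1::real} s *\<^sub>R ?L) \<in> borel_measurable lborel" by simp
    show "(\<lambda>s. indicator {0..1} s *\<^sub>R G (e n) (x n) s) \<in> borel_measurable lborel" for n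
      using borel_measurable_continuous_on_indicator[OF _ G_continuous[OF e(1,2)]] by simp
    show "integrable lborel (\<lambda>s. indicator {0..1::real} s * bnd r)" by simp
    show "AE s in lborel. (\<lambda>n. indicator {0..1} s *\<^sub>R G (e n) (x n) s) \<longlonglongrightarrow> indicator {0..1} s *\<^sub>R ?L"
    proof (intro AE_I2)
      fix s :: real
      show "(\<lambda>n. indicator {0..1} s *\<^sub>R G (e n) (x n) s) \<longlonglongrightarrow> indicator {0..1} s *\<^sub>R ?L"
      proof (cases "s \<in> {0..1}")
        case True
        then have "(\<lambda>n. G (e n) (x n) s) \<longlonglongrightarrow> ?L"
          unfolding G_def using e(1,2) less_imp_le[OF e(1)]
          by (intro integral_quotient_tendsto[OF x] mix_P2 limitin_mix e) auto
        then show ?thesis by (intro tendsto_intros)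
      qed simp
    qed
    show "AE s in lborel. norm (indicator {0..1} s *\<^sub>R G (e n) (x n) s) \<le> indicator {0..1} s * bnd r" for n
    proof (intro AE_I2)
      fix s :: real
      show "norm (indicator {0..1} s *\<^sub>R G (e n) (x n) s) \<le> indicator {0..1} s * bnd r"
        using G_bound[OF e(1,2), of s n "x n"] mono[of n] by (auto simp: indicator_def)
    qed
  qed
  moreover have "(\<phi> (x n) (distr M borel (Z (e n))) - \<phi> (x n) \<mu>) / e n = (LBINT s:{0..1}. G (e n) (x n) s)" for n
    using cost_increment[OF e(1,2), of "x n" n] e(1)[of n] by simp
  moreover have "(LBINT s:{0..1::real}. ?L) = ?L" by (simp add: set_lebesgue_integral_def)
  ultimately show ?thesis by simp
qed

end

lemma (in prob_space) integrable_pair_fst_snd: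
  fixes f :: "'a \<Rightarrow> real"
  assumes f: "integrable M f"
  shows "integrable (M \<Otimes>\<^sub>M M) (\<lambda>p. f (fst p))" "integrable (M \<Otimes>\<^sub>M M) (\<lambda>p. f (snd p))"
proof -
  interpret P: pair_prob_space M M ..
  have "distr (M \<Otimes>\<^sub>M M) M fst = M" by (rule distr_pair_fst)
  then show 1: "integrable (M \<Otimes>\<^sub>M M) (\<lambda>p. f (fst p))"
    using integrable_distr_eq[of fst "M \<Otimes>\<^sub>M M" M f] f by auto
  show "integrable (M \<Otimes>\<^sub>M M) (\<lambda>p. f (snd p))"
    using P.integrable_product_swap[OF 1] by (simp add: case_prod_beta')
qed

section \<open>The remainder between the increments of cost and potential\<close>

context mean_field_variation
begin

lemma integrable_\<delta>_pair:
  assumes Y: "square_integrable M Y"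
  shows "integrable (M \<Otimes>\<^sub>M M) (\<lambda>p. \<delta> (A (snd p)) \<mu> (Y (fst p)))"
proof -
  note [measurable] = square_integrableD(1)[OF Y]
  show ?thesis
  proof (rule Bochner_Integration.integrable_bound[of _ "\<lambda>p. \<kappa> * (1 + (norm (A (snd p)))\<^sup>2 + moment2 \<mu> + (norm (Y (fst p)))\<^sup>2)"])
    interpret P: pair_prob_space M M ..
    show "integrable (M \<Otimes>\<^sub>M M) (\<lambda>p. \<kappa> * (1 + (norm (A (snd p)))\<^sup>2 + moment2 \<mu> + (norm (Y (fst p)))\<^sup>2))"
      using integrable_pair_fst_snd(1)[OF square_integrableD(2)[OF Y]] integrable_pair_fst_snd(2)[OF square_integrableD(2)[OF A]]
      by (intro integrable_mult_right Bochner_Integration.integrable_add) auto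
    show "(\<lambda>p. \<delta> (A (snd p)) \<mu> (Y (fst p))) \<in> borel_measurable (M \<Otimes>\<^sub>M M)"
      by (intro measurable_\<delta> \<mu>_P2) measurable
    show "AE p in M \<Otimes>\<^sub>M M. norm (\<delta> (A (snd p)) \<mu> (Y (fst p))) \<le> norm (\<kappa> * (1 + (norm (A (snd p)))\<^sup>2 + moment2 \<mu> + (norm (Y (fst p)))\<^sup>2))"
      using growth_\<delta>[OF \<mu>_P2(1)] by (intro AE_I2) (auto intro: order_trans[OF _ abs_ge_self])
  qed
qed

text \<open>The increment of the mean-field cost from \<open>A\<close> to \<open>Z e\<close> minus
  that of the potential with the measure frozen at \<open>\<mu>\<close>, written after the
  increments of \<open>\<phi>\<close> in the state have cancelled.\<close>

definition remainder :: "real \<Rightarrow> real" where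
  "remainder e = (\<integral>\<omega>. \<phi> (Z e \<omega>) (distr M borel (Z e)) - \<phi> (Z e \<omega>) \<mu> \<partial>M)
     - (\<integral>\<omega>. (\<integral>z. \<delta> z \<mu> (Z e \<omega>) - \<delta> z \<mu> (A \<omega>) \<partial>\<mu>) \<partial>M)"

text \<open>The integrand of \<open>remainder e / e\<close> once Fubini has made the state argument
  of \<open>\<delta>\<close> the outer variable of the second term. In this form the two terms have
  the same limit for every \<open>\<omega>\<close>.\<close>

definition remainder_integrand :: "real \<Rightarrow> 'w \<Rightarrow> real" where
  "remainder_integrand e \<omega> = (\<phi> (Z e \<omega>) (distr M borel (Z e)) - \<phi> (Z e \<omega>) \<mu>) / e
     - (\<integral>\<omega>'. quotient e (A \<omega>) \<mu> (A \<omega>') (B \<omega>') \<partial>M)"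

lemma bnd_mono: "r \<le> r' \<Longrightarrow> bnd r \<le> bnd r'"
proof -
  have "0 \<le> c1" unfolding c1_def by simp
  then show "r \<le> r' \<Longrightarrow> bnd r \<le> bnd r'"
    using \<kappa>_pos unfolding bnd_def by (intro mult_left_mono add_mono mult_right_mono) auto
qed

lemma bnd_affine: "bnd r = bnd 0 + \<kappa> * c1 * r"
  by (simp add: bnd_def algebra_simps)

lemma integral_norm_le:
  assumes "square_integrable M V" "(\<integral>\<omega>. (norm (V \<omega>))\<^sup>2 \<partial>M) \<le> S"
  shows "integrable M (\<lambda>\<omega>. norm (V \<omega>))" "(\<integral>\<omega>. norm (V \<omega>) \<partial>M) \<le> 1 + S"
proof -
  show i: "integrable M (\<lambda>\<omega>. norm (V \<omega>))"
    by (rule square_integrable_norm[OF finite_measure_axioms assms(1)])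
  have le: "x \<le> 1 + x\<^sup>2" for x :: real
  proof -
    have "2 * x \<le> 1 + x\<^sup>2" using sum_squares_bound[of 1 x] by simp
    then show ?thesis using zero_le_power2[of x] by linarith
  qed
  have "(\<integral>\<omega>. norm (V \<omega>) \<partial>M) \<le> (\<integral>\<omega>. 1 + (norm (V \<omega>))\<^sup>2 \<partial>M)"
    by (rule integral_mono[OF i]) (use square_integrableD(2)[OF assms(1)] le in auto)
  then show "(\<integral>\<omega>. norm (V \<omega>) \<partial>M) \<le> 1 + S"
    using assms(2) square_integrableD(2)[OF assms(1)] by (simp add: prob_space)
qed

text \<open>Twice \<open>bnd\<close>, with every ingredient estimated through
  \<open>\<kappa>\<close> and \<open>S\<close> only: first moments are at most \<open>1 + S\<close>,
  so \<open>c1\<close> is at most \<open>2 * (1 + S)\<close>, and \<open>c2\<close> is at most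
  \<open>4 * S\<close>. For the running cost it serves as dominating constant in time.\<close>

definition remainder_const :: real where
  "remainder_const = 2 * (\<kappa> * ((1 + 2 * (1 + S) + sqrt (5 * S)) * (2 * (1 + S)) + 4 * S))"

lemma bnd_bochner:
  "has_bochner_integral M (\<lambda>\<omega>. bnd (norm (A \<omega>) + norm (B \<omega>))) (bnd ((\<integral>\<omega>. norm (A \<omega>) \<partial>M) + (\<integral>\<omega>. norm (B \<omega>) \<partial>M)))"
proof -
  have "has_bochner_integral M (\<lambda>\<omega>. bnd 0 + \<kappa> * c1 * (norm (A \<omega>) + norm (B \<omega>)))
    (bnd 0 + \<kappa> * c1 * ((\<integral>\<omega>. norm (A \<omega>) \<partial>M) + (\<integral>\<omega>. norm (B \<omega>) \<partial>M)))"
    using integral_norm_le(1)[OF A S(1)] integral_norm_le(1)[OF B S(2)]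
    by (auto simp: has_bochner_integral_iff prob_space)
  then show ?thesis by (simp add: bnd_affine[symmetric])
qed

lemma bnd_integral_le:
  "2 * bnd ((\<integral>\<omega>. norm (A \<omega>) \<partial>M) + (\<integral>\<omega>. norm (B \<omega>) \<partial>M)) \<le> remainder_const"
proof -
  note iA = integral_norm_le[OF A S(1)] and iB = integral_norm_le[OF B S(2)]
  have "c1 \<le> (\<integral>\<omega>. norm (A \<omega>) + norm (B \<omega>) \<partial>M)"
    unfolding c1_def using iA(1) iB(1) integrable_bounds(1)
    by (intro integral_mono) (auto intro: order_trans[OF norm_triangle_ineq4])
  then have c1: "c1 \<le> 2 * (1 + S)" using iA iB by simp
  have "c2 \<le> (\<integral>\<omega>. 2 * (norm (A \<omega>))\<^sup>2 + 2 * (norm (B \<omega>))\<^sup>2 \<partial>M)"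
    unfolding c2_def
  proof (rule integral_mono[OF integrable_bounds(2)])
    fix \<omega>
    have "(norm (A \<omega>) + norm (B \<omega>)) * norm (B \<omega> - A \<omega>) \<le> (norm (A \<omega>) + norm (B \<omega>)) * (norm (A \<omega>) + norm (B \<omega>))"
      by (intro mult_left_mono) (auto intro: order_trans[OF norm_triangle_ineq4])
    also have "\<dots> \<le> 2 * (norm (A \<omega>))\<^sup>2 + 2 * (norm (B \<omega>))\<^sup>2"
      using sum_squares_bound[of "norm (A \<omega>)" "norm (B \<omega>)"] by (simp add: power2_eq_square algebra_simps)
    finally show "(norm (A \<omega>) + norm (B \<omega>)) * norm (B \<omega> - A \<omega>) \<le> 2 * (norm (A \<omega>))\<^sup>2 + 2 * (norm (B \<omega>))\<^sup>2" .
  qed (use A[THEN square_integrableD(2)] B[THEN square_integrableD(2)] in simp)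
  also have "\<dots> \<le> 4 * S"
    using S A[THEN square_integrableD(2)] B[THEN square_integrableD(2)] by (subst Bochner_Integration.integral_add) auto
  finally have c2: "c2 \<le> 4 * S" .
  have "0 \<le> c1" unfolding c1_def by simp
  moreover have "0 \<le> (\<integral>\<omega>. norm (A \<omega>) \<partial>M)" "0 \<le> (\<integral>\<omega>. norm (B \<omega>) \<partial>M)" by simp_all
  ultimately show ?thesis
    unfolding remainder_const_def bnd_def
    using iA(2) iB(2) c1 c2 \<kappa>_pos S_nonneg
    by (intro mult_left_mono add_mono mult_mono) auto
qed

lemma remainder_integrand_bound:
  assumes e: "0 < e" "e \<le> 1"
  shows "\<bar>remainder_integrand e \<omega>\<bar> \<le> 2 * bnd (norm (A \<omega>) + norm (B \<omega>))"
proof -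
  have "norm (Z e \<omega>) \<le> norm (A \<omega>) + norm (B \<omega>)"
    unfolding Z_def using e by (intro norm_interpolation_le) auto
  then have "\<bar>(\<phi> (Z e \<omega>) (distr M borel (Z e)) - \<phi> (Z e \<omega>) \<mu>) / e\<bar> \<le> bnd (norm (A \<omega>) + norm (B \<omega>))"
    using cost_quotient_bound[OF e] bnd_mono order_trans by blast
  moreover have "\<bar>\<integral>\<omega>'. quotient e (A \<omega>) \<mu> (A \<omega>') (B \<omega>') \<partial>M\<bar> \<le> bnd (norm (A \<omega>) + norm (B \<omega>))"
    by (rule order_trans[OF integral_quotient_bound(2)[OF \<mu>_P2(1) moment2_\<mu>_le e] bnd_mono]) simp
  ultimately show ?thesis unfolding remainder_integrand_def by linarith
qed

lemma measurable_integral_quotient: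
  "(\<lambda>\<omega>. \<integral>\<omega>'. quotient e (A \<omega>) \<mu> (A \<omega>') (B \<omega>') \<partial>M) \<in> borel_measurable M"
proof (rule borel_measurable_lebesgue_integral)
  have "(\<lambda>p. quotient e (A (fst p)) \<mu> (A (snd p)) (B (snd p))) \<in> borel_measurable (M \<Otimes>\<^sub>M M)"
    by (intro measurable_quotient \<mu>_P2) measurable
  then show "(\<lambda>(\<omega>, \<omega>'). quotient e (A \<omega>) \<mu> (A \<omega>') (B \<omega>')) \<in> borel_measurable (M \<Otimes>\<^sub>M M)"
    by (simp add: case_prod_beta')
qed

lemma remainder_integrand_measurable: "remainder_integrand e \<in> borel_measurable M"
  unfolding remainder_integrand_def[abs_def]
  by (intro borel_measurable_diff borel_measurable_divide measurable_cost measurable_integral_quotient \<mu>_P2) auto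

text \<open>The integral against \<open>\<mu>\<close> is an expectation over an independent copy of
  \<open>A\<close>. Exchanging the two copies leaves the state fixed and the point moving in the
  inner expectation, which is then \<open>e\<close> times an expected difference quotient.\<close>

lemma remainder_eq:
  assumes e: "0 < e" "e \<le> 1"
  shows "remainder e = e * (\<integral>\<omega>. remainder_integrand e \<omega> \<partial>M)"
proof -
  interpret P: pair_prob_space M M ..
  let ?Q = "\<lambda>\<omega>. \<integral>\<omega>'. quotient e (A \<omega>) \<mu> (A \<omega>') (B \<omega>') \<partial>M"
  let ?C = "\<lambda>\<omega>. (\<phi> (Z e \<omega>) (distr M borel (Z e)) - \<phi> (Z e \<omega>) \<mu>) / e"
  note ib = conjunct1[OF bnd_bochner[unfolded has_bochner_integral_iff]]
  have iQ: "integrable M ?Q"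
  proof (rule Bochner_Integration.integrable_bound[OF ib measurable_integral_quotient])
    show "AE \<omega> in M. norm (?Q \<omega>) \<le> norm (bnd (norm (A \<omega>) + norm (B \<omega>)))"
    proof (intro AE_I2)
      fix \<omega>
      have "\<bar>?Q \<omega>\<bar> \<le> bnd (norm (A \<omega>) + norm (B \<omega>))"
        by (rule order_trans[OF integral_quotient_bound(2)[OF \<mu>_P2(1) moment2_\<mu>_le e] bnd_mono]) simp
      then show "norm (?Q \<omega>) \<le> norm (bnd (norm (A \<omega>) + norm (B \<omega>)))" by simp
    qed
  qed
  have iR: "integrable M (remainder_integrand e)"
  proof (rule Bochner_Integration.integrable_bound[OF integrable_mult_right[OF ib, of 2] remainder_integrand_measurable])
    show "AE \<omega> in M. norm (remainder_integrand e \<omega>) \<le> norm (2 * bnd (norm (A \<omega>) + norm (B \<omega>)))"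
      using remainder_integrand_bound[OF e] by (intro AE_I2) (simp add: order_trans[OF _ abs_ge_self])
  qed
  have C: "?C \<omega> = remainder_integrand e \<omega> + ?Q \<omega>" for \<omega> by (simp add: remainder_integrand_def)
  have "(\<integral>\<omega>. \<phi> (Z e \<omega>) (distr M borel (Z e)) - \<phi> (Z e \<omega>) \<mu> \<partial>M) = (\<integral>\<omega>. e * ?C \<omega> \<partial>M)"
    using e by simp
  also have "\<dots> = e * ((\<integral>\<omega>. remainder_integrand e \<omega> \<partial>M) + (\<integral>\<omega>. ?Q \<omega> \<partial>M))"
    unfolding C using iQ iR by simp
  finally have 1: "(\<integral>\<omega>. \<phi> (Z e \<omega>) (distr M borel (Z e)) - \<phi> (Z e \<omega>) \<mu> \<partial>M) = e * ((\<integral>\<omega>. remainder_integrand e \<omega> \<partial>M) + (\<integral>\<omega>. ?Q \<omega> \<partial>M))" .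
  have "(\<integral>\<omega>. (\<integral>z. \<delta> z \<mu> (Z e \<omega>) - \<delta> z \<mu> (A \<omega>) \<partial>\<mu>) \<partial>M) = (\<integral>\<omega>. (\<integral>\<omega>'. \<delta> (A \<omega>') \<mu> (Z e \<omega>) - \<delta> (A \<omega>') \<mu> (A \<omega>) \<partial>M) \<partial>M)"
    by (intro Bochner_Integration.integral_cong refl integral_distr borel_measurable_diff measurable_\<delta> \<mu>_P2) auto
  also have "\<dots> = (\<integral>\<omega>'. (\<integral>\<omega>. \<delta> (A \<omega>') \<mu> (Z e \<omega>) - \<delta> (A \<omega>') \<mu> (A \<omega>) \<partial>M) \<partial>M)"
    using integrable_\<delta>_pair[OF square_integrable_Z, of e] integrable_\<delta>_pair[OF A]
    by (intro P.Fubini_integral[symmetric]) (simp add: case_prod_beta')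
  also have "\<dots> = (\<integral>\<omega>'. e * ?Q \<omega>' \<partial>M)"
  proof (intro Bochner_Integration.integral_cong refl)
    fix \<omega>'
    have "(\<integral>\<omega>. \<delta> (A \<omega>') \<mu> (Z e \<omega>) - \<delta> (A \<omega>') \<mu> (A \<omega>) \<partial>M) = (\<integral>\<omega>. e * quotient e (A \<omega>') \<mu> (A \<omega>) (B \<omega>) \<partial>M)"
      using e by (intro Bochner_Integration.integral_cong) (auto simp: quotient_def Z_def)
    then show "(\<integral>\<omega>. \<delta> (A \<omega>') \<mu> (Z e \<omega>) - \<delta> (A \<omega>') \<mu> (A \<omega>) \<partial>M) = e * ?Q \<omega>'" by simp
  qed
  finally show ?thesis unfolding remainder_def 1 using iQ by (simp add: algebra_simps)
qed

lemma remainder_bound: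
  assumes e: "0 < e" "e \<le> 1"
  shows "\<bar>remainder e / e\<bar> \<le> remainder_const"
proof -
  note b = bnd_bochner[unfolded has_bochner_integral_iff]
  have "remainder e / e = (\<integral>\<omega>. remainder_integrand e \<omega> \<partial>M)" using remainder_eq[OF e] e by simp
  also have "\<bar>\<dots>\<bar> \<le> (\<integral>\<omega>. \<bar>remainder_integrand e \<omega>\<bar> \<partial>M)" by (rule integral_abs_bound)
  also have "\<dots> \<le> (\<integral>\<omega>. 2 * bnd (norm (A \<omega>) + norm (B \<omega>)) \<partial>M)"
  proof (rule integral_mono)
    show "integrable M (\<lambda>\<omega>. \<bar>remainder_integrand e \<omega>\<bar>)"
      using conjunct1[OF b] remainder_integrand_bound[OF e] remainder_integrand_measurable
      by (intro Bochner_Integration.integrable_bound[OF integrable_mult_right[OF conjunct1[OF b], of 2]])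
        (auto intro!: AE_I2 simp: order_trans[OF _ abs_ge_self])
  qed (use b remainder_integrand_bound[OF e] in auto)
  also have "\<dots> = 2 * bnd ((\<integral>\<omega>. norm (A \<omega>) \<partial>M) + (\<integral>\<omega>. norm (B \<omega>) \<partial>M))" using b by simp
  finally show ?thesis using bnd_integral_le by simp
qed

text \<open>Here the choice of the potential pays off: for every \<open>\<omega>\<close>, the
  quotient of \<open>\<phi>\<close> in the measure at the state \<open>Z (e n) \<omega>\<close> and
  the expected quotient of \<open>\<delta>\<close> at the state \<open>A \<omega>\<close> converge
  to the same number \<open>?L\<close>.\<close>

lemma remainder_tendsto:
  assumes e: "\<And>n. 0 < e n" "\<And>n. e n \<le> 1" "e \<longlonglongrightarrow> 0"
  shows "(\<lambda>n. remainder (e n) / e n) \<longlonglongrightarrow> 0"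
proof -
  note ib = conjunct1[OF bnd_bochner[unfolded has_bochner_integral_iff]]
  have "(\<lambda>n. \<integral>\<omega>. remainder_integrand (e n) \<omega> \<partial>M) \<longlonglongrightarrow> (\<integral>\<omega>. 0 \<partial>M)"
  proof (rule integral_dominated_convergence[where w="\<lambda>\<omega>. 2 * bnd (norm (A \<omega>) + norm (B \<omega>))"])
    show "integrable M (\<lambda>\<omega>. 2 * bnd (norm (A \<omega>) + norm (B \<omega>)))" using ib by simp
    show "AE \<omega> in M. norm (remainder_integrand (e n) \<omega>) \<le> 2 * bnd (norm (A \<omega>) + norm (B \<omega>))" for n
      using remainder_integrand_bound[OF e(1,2)] by simp
    show "AE \<omega> in M. (\<lambda>n. remainder_integrand (e n) \<omega>) \<longlonglongrightarrow> 0"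
    proof (intro AE_I2)
      fix \<omega>
      let ?L = "\<integral>\<omega>'. \<delta>y (A \<omega>) \<mu> (A \<omega>') \<bullet> (B \<omega>' - A \<omega>') \<partial>M"
      have "(\<lambda>n. A \<omega> + e n *\<^sub>R (B \<omega> - A \<omega>)) \<longlonglongrightarrow> A \<omega> + 0 *\<^sub>R (B \<omega> - A \<omega>)"
        by (intro tendsto_intros e)
      then have "(\<lambda>n. Z (e n) \<omega>) \<longlonglongrightarrow> A \<omega>" by (simp add: Z_def)
      from cost_quotient_tendsto[OF e this]
      have "(\<lambda>n. (\<phi> (Z (e n) \<omega>) (distr M borel (Z (e n))) - \<phi> (Z (e n) \<omega>) \<mu>) / e n) \<longlonglongrightarrow> ?L" .
      moreover have "(\<lambda>n. \<integral>\<omega>'. quotient (e n) (A \<omega>) \<mu> (A \<omega>') (B \<omega>') \<partial>M) \<longlonglongrightarrow> ?L"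
        by (rule integral_quotient_tendsto[OF tendsto_const \<mu>_P2(1) moment2_\<mu>_le limitin_W2_const[OF \<mu>_P2(1)] e])
      ultimately show "(\<lambda>n. remainder_integrand (e n) \<omega>) \<longlonglongrightarrow> 0"
        unfolding remainder_integrand_def using tendsto_diff by fastforce
    qed
  qed (auto intro: remainder_integrand_measurable)
  moreover have "remainder (e n) / e n = (\<integral>\<omega>. remainder_integrand (e n) \<omega> \<partial>M)" for n
    using remainder_eq[OF e(1,2), of n] e(1)[of n] by simp
  ultimately show ?thesis by simp
qed

end

section \<open>Stieltjes integrals\<close>

locale stieltjes =
  fixes F :: "real \<Rightarrow> real"
  assumes F_mono: "\<And>x y. x \<le> y \<Longrightarrow> F x \<le> F y"
    and F_right_cont: "\<And>a. continuous (at_right a) F"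
    and F_neg: "\<And>x. x < 0 \<Longrightarrow> F x = 0"
begin

abbreviation \<mu> where "\<mu> \<equiv> interval_measure F"

lemma emeasure_Ioc: "a \<le> b \<Longrightarrow> emeasure \<mu> {a<..b} = ennreal (F b - F a)"
  by (rule emeasure_interval_measure_Ioc) (auto intro: F_mono F_right_cont)

lemma emeasure_Ioc_finite: "emeasure \<mu> {a<..b} < \<infinity>"
  by (cases "a \<le> b") (auto simp: emeasure_Ioc)

lemma measure_Ioc: "a \<le> b \<Longrightarrow> measure \<mu> {a<..b} = F b - F a"
  using emeasure_Ioc[of a b] F_mono[of a b] by (simp add: measure_def)

lemma F_nonneg: "0 \<le> F x"
  using F_mono[of "min (-1) x" x] F_neg[of "min (-1) x"] by auto

text \<open>Allows \<open>{0..t}\<close> to be replaced by \<open>{-1<..t}\<close>, whose mass is an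
  increment of \<open>F\<close>. The jump of \<open>F\<close> at 0 thus appears as mass at the point
  0.\<close>

lemma null_neg: "{-1<..<0} \<in> null_sets \<mu>"
proof -
  have "{-1<..<0::real} = (\<Union>k. {-1<..- 1 / real (Suc k)})"
  proof safe
    fix x :: real assume x: "x \<in> {-1<..<0}"
    then obtain k where "1 / real (Suc k) < - x" using reals_Archimedean[of "-x"] by (auto simp: inverse_eq_divide)
    then show "x \<in> (\<Union>k. {-1<..- 1 / real (Suc k)})" using x by (auto intro!: exI[of _ k])
  next
    fix x :: real and k assume x: "x \<in> {-1<..- 1 / real (Suc k)}"
    have "- 1 / real (Suc k) < 0" by simp
    then have "x < 0" using x unfolding greaterThanAtMost_iff by linarith
    then show "x \<in> {-1<..<0}" using x by simp
  qed
  moreover have "{-1<..- 1 / real (Suc k)} \<in> null_sets \<mu>" for k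
  proof -
    have "- 1 / real (Suc k) < 0" "-1 \<le> - 1 / real (Suc k)" by (auto simp: field_simps)
    then show ?thesis by (intro null_setsI) (auto simp: emeasure_Ioc F_neg)
  qed
  ultimately show ?thesis using null_sets_UN[of "\<lambda>k. {-1<..- 1 / real (Suc k)}" \<mu>] by simp
qed

text \<open>The first term accounts for the jump at time 0; in the others \<open>f\<close> is taken
  at the right end point of each cell.\<close>

definition stieltjes_sum :: "(real \<Rightarrow> real) \<Rightarrow> real \<Rightarrow> nat \<Rightarrow> real" where
  "stieltjes_sum f t n = f 0 * F 0 + (\<Sum>i<n. f (t * Suc i / n) * (F (t * Suc i / n) - F (t * i / n)))"

text \<open>Continuing \<open>f\<close> constantly to the left of 0 changes the integrand only on a
  null set, and it turns the closed interval into a union of half-open cells.\<close>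

lemma set_integral_eq_extended:
  fixes f :: "real \<Rightarrow> real"
  assumes f: "continuous_on {0..t} f" and t: "0 \<le> t"
  shows "(LINT s:{0..t}|\<mu>. f s) = (\<integral>s. indicator {-1<..t} s * f (max 0 s) \<partial>\<mu>)"
    "(\<lambda>s. indicator {-1<..t} s * f (max 0 s)) \<in> borel_measurable borel"
proof -
  have "continuous_on {-1..t} (\<lambda>s. f (max 0 s))"
    by (rule continuous_on_compose2[OF f]) (use t in \<open>auto intro!: continuous_intros\<close>)
  then have "(\<lambda>s. indicator {-1..t} s *\<^sub>R f (max 0 s)) \<in> borel_measurable borel"
    by (intro borel_measurable_continuous_on_indicator) auto
  then have "(\<lambda>s. indicator {-1<..t} s * (indicator {-1..t} s *\<^sub>R f (max 0 s))) \<in> borel_measurable borel"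
    by measurable
  also have "(\<lambda>s. indicator {-1<..t} s * (indicator {-1..t} s *\<^sub>R f (max 0 s))) = (\<lambda>s. indicator {-1<..t} s * f (max 0 s))"
    by (auto simp: fun_eq_iff indicator_def)
  finally show m: "(\<lambda>s. indicator {-1<..t} s * f (max 0 s)) \<in> borel_measurable borel" .
  have "(\<lambda>s. indicator {0..t} s *\<^sub>R f s) \<in> borel_measurable borel"
    by (intro borel_measurable_continuous_on_indicator f) auto
  moreover have "AE s in \<mu>. indicator {0..t} s *\<^sub>R f s = indicator {-1<..t} s * f (max 0 s)"
    using AE_not_in[OF null_neg] by eventually_elim (auto simp: indicator_def)
  ultimately show "(LINT s:{0..t}|\<mu>. f s) = (\<integral>s. indicator {-1<..t} s * f (max 0 s) \<partial>\<mu>)"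
    unfolding set_lebesgue_integral_def using m by (intro integral_cong_AE) auto
qed

text \<open>The sums are integrals of step functions that converge pointwise and are bounded by the
  maximum of \<open>f\<close>. As they are finite and linear in \<open>F\<close>, they later yield
  linearity in the integrator, measurability in a parameter and the bound by
  \<open>F t\<close>.\<close>

lemma stieltjes_sum_tendsto:
  assumes f: "continuous_on {0..t} f" and t: "0 \<le> t"
  shows "(\<lambda>n. stieltjes_sum f t (Suc n)) \<longlonglongrightarrow> (LINT s:{0..t}|\<mu>. f s)"
proof -
  obtain B where B: "\<And>s. s \<in> {0..t} \<Longrightarrow> \<bar>f s\<bar> \<le> B"
  proof -
    obtain B where "\<forall>x\<in>f ` {0..t}. norm x \<le> B"
      using compact_imp_bounded[OF compact_continuous_image[OF f compact_Icc]] unfolding bounded_iff by blast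
    then show ?thesis by (intro that[of B]) auto
  qed
  have B0: "0 \<le> B" using B[of 0] t by auto
  \<comment> \<open>The step function whose integral is \<open>stieltjes_sum f t n\<close>; its
    first term covers the points up to 0, where the continued integrand equals
    \<open>f 0\<close>.\<close>
  define g where "g n s = f 0 * indicator {-1<..0} s + (\<Sum>i<n. f (t * Suc i / n) * indicator {t * i / n<..t * Suc i / n} s)" for n s
  have step: "t * i / n \<le> t * Suc i / n" for i n :: nat using t by (intro divide_right_mono mult_left_mono) auto
  have g_int: "has_bochner_integral \<mu> (g n) (stieltjes_sum f t n)" for n
  proof -
    have ind: "has_bochner_integral \<mu> (indicator {a<..b} :: real \<Rightarrow> real) (F b - F a)" if "a \<le> b" for a b
      using has_bochner_integral_real_indicator[of "{a<..b}" \<mu>] emeasure_Ioc_finite that by (simp add: measure_Ioc)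
    have "has_bochner_integral \<mu> (g n) (f 0 * (F 0 - F (-1)) + (\<Sum>i<n. f (t * Suc i / n) * (F (t * Suc i / n) - F (t * i / n))))"
      unfolding g_def by (intro has_bochner_integral_add has_bochner_integral_sum has_bochner_integral_mult_right ind step) auto
    then show ?thesis by (simp add: stieltjes_sum_def F_neg)
  qed
  have g_val: "\<exists>\<rho>\<in>{0..t}. g (Suc n) s = f \<rho> \<and> \<bar>\<rho> - max 0 s\<bar> \<le> t / Suc n" if s: "s \<in> {-1<..t}" for s n
  proof (cases "s \<le> 0")
    case True
    then have "indicator {t * i / Suc n<..t * Suc i / Suc n} s = (0::real)" for i
    proof -
      have "0 \<le> t * real i / real (Suc n)" using t by (intro divide_nonneg_nonneg mult_nonneg_nonneg) auto
      then have "\<not> t * real i / real (Suc n) < s" using True by linarith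
      then show ?thesis by (simp del: of_nat_Suc)
    qed
    then have "g (Suc n) s = f 0" using True s by (simp add: g_def)
    then show ?thesis using True t by (intro bexI[of _ 0]) auto
  next
    case False
    then have s0: "0 < s" "0 < t" "s \<le> t" using s by auto
    \<comment> \<open>The cells are closed on the right, so the index of the cell containing
      \<open>s\<close> is a ceiling minus one.\<close>
    define j where "j = nat (\<lceil>s * Suc n / t\<rceil> - 1)"
    have pos: "0 < s * Suc n / t" using s0 by auto
    have ce: "real j + 1 = of_int \<lceil>s * Suc n / t\<rceil>" using pos unfolding j_def by (simp add: le_of_int_ceiling)
    have j1: "real j < s * Suc n / t" "s * Suc n / t \<le> real j + 1" using ce by linarith+
    have "s * real (Suc n) \<le> t * real (Suc n)" using s0 by (intro mult_right_mono) auto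
    then have "s * Suc n / t \<le> real (Suc n)" using s0 by (simp add: pos_divide_le_eq mult.commute del: of_nat_Suc)
    then have jn: "j < Suc n" using j1 by (simp add: of_nat_less_iff[symmetric, where 'a=real] del: of_nat_less_iff of_nat_Suc)
    have lo: "t * j / Suc n < s" and hi: "s \<le> t * Suc j / Suc n"
    proof -
      have "real j * t < s * real (Suc n)" using j1(1) s0 by (simp only: pos_less_divide_eq)
      then show "t * j / Suc n < s" by (simp add: pos_divide_less_eq mult.commute del: of_nat_Suc)
      have "s * real (Suc n) \<le> (real j + 1) * t" using j1(2) s0 by (simp only: pos_divide_le_eq)
      then have "s * real (Suc n) \<le> t * real (Suc j)" by (simp add: mult.commute add.commute)
      then show "s \<le> t * Suc j / Suc n" by (simp add: pos_le_divide_eq del: of_nat_Suc)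
    qed
    have "indicator {t * i / Suc n<..t * Suc i / Suc n} s = (if i = j then 1 else 0 :: real)" for i
    proof -
      consider "i < j" | "i = j" | "j < i" by linarith
      then show ?thesis
      proof cases
        case 1
        then have "t * Suc i / Suc n \<le> t * j / Suc n" using s0 by (intro divide_right_mono mult_left_mono) auto
        then show ?thesis using lo 1 by auto
      next
        case 2 then show ?thesis using lo hi by auto
      next
        case 3
        then have "t * Suc j / Suc n \<le> t * i / Suc n" using s0 by (intro divide_right_mono mult_left_mono) auto
        then show ?thesis using hi 3 by auto
      qed
    qed
    then have "g (Suc n) s = f (t * Suc j / Suc n)"
      using s0 jn unfolding g_def by (simp add: if_distrib[of "\<lambda>x. _ * x"] sum.delta cong: if_cong del: of_nat_Suc)
    moreover have "t * Suc j / Suc n \<in> {0..t}"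
      using s0 jn mult_left_mono[of "real (Suc j) / real (Suc n)" 1 t] by simp
    moreover have "\<bar>t * Suc j / Suc n - max 0 s\<bar> \<le> t / Suc n"
    proof -
      have "t * Suc j / Suc n = t * j / Suc n + t / Suc n" by (simp only: of_nat_Suc distrib_left add_divide_distrib mult_1_right add.commute)
      then show ?thesis using lo hi s0 by linarith
    qed
    ultimately show ?thesis by blast
  qed
  have g_out: "g n s = 0" if "s \<notin> {-1<..t}" for n s
  proof -
    have "indicator {t * i / n<..t * Suc i / n} s = (0::real)" if "i < n" for i
    proof -
      have "0 \<le> t * i / n" "t * Suc i / n \<le> t"
        using t \<open>i < n\<close> mult_left_mono[of "real (Suc i) / real n" 1 t] by simp_all
      then show ?thesis using \<open>s \<notin> {-1<..t}\<close> by (auto simp: indicator_def)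
    qed
    then have "(\<Sum>i<n. f (t * Suc i / n) * indicator {t * i / n<..t * Suc i / n} s) = 0"
      by (intro sum.neutral ballI) (simp only: lessThan_iff mult_zero_right)
    moreover have "indicator {-1<..0} s = (0::real)" using that t by (auto simp: indicator_def)
    ultimately show ?thesis by (simp only: g_def)
  qed
  have "(\<lambda>n. \<integral>s. g (Suc n) s \<partial>\<mu>) \<longlonglongrightarrow> (\<integral>s. indicator {-1<..t} s * f (max 0 s) \<partial>\<mu>)"
  proof (rule integral_dominated_convergence[where w="\<lambda>s. B * indicator {-1<..t} s"])
    show "(\<lambda>s. indicator {-1<..t} s * f (max 0 s)) \<in> borel_measurable \<mu>"
      using set_integral_eq_extended(2)[OF f t] by simp
    show "g (Suc n) \<in> borel_measurable \<mu>" for n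
      using g_int[of "Suc n"] by (simp add: has_bochner_integral_iff borel_measurable_integrable)
    show "integrable \<mu> (\<lambda>s. B * indicator {-1<..t} s)"
      using emeasure_Ioc_finite by (intro integrable_mult_right integrable_real_indicator) auto
    show "AE s in \<mu>. (\<lambda>n. g (Suc n) s) \<longlonglongrightarrow> indicator {-1<..t} s * f (max 0 s)"
    proof (intro AE_I2)
      fix s
      show "(\<lambda>n. g (Suc n) s) \<longlonglongrightarrow> indicator {-1<..t} s * f (max 0 s)"
      proof (cases "s \<in> {-1<..t}")
        case False then show ?thesis using g_out by simp
      next
        case True
        then obtain \<rho> where \<rho>: "\<And>n. \<rho> n \<in> {0..t}" "\<And>n. g (Suc n) s = f (\<rho> n)" "\<And>n. \<bar>\<rho> n - max 0 s\<bar> \<le> t / Suc n"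
          using g_val[of s] by metis
        have "(\<lambda>n. t * (1 / Suc n)) \<longlonglongrightarrow> t * 0" by (intro tendsto_mult tendsto_const LIMSEQ_Suc lim_1_over_n)
        then have "(\<lambda>n. t / Suc n) \<longlonglongrightarrow> 0" by simp
        then have "(\<lambda>n. \<rho> n - max 0 s) \<longlonglongrightarrow> 0" by (rule Lim_null_comparison[rotated]) (use \<rho>(3) in simp)
        then have "\<rho> \<longlonglongrightarrow> max 0 s" by (simp add: LIM_zero_iff)
        moreover have "max 0 s \<in> {0..t}" using True t by auto
        ultimately have "(\<lambda>n. f (\<rho> n)) \<longlonglongrightarrow> f (max 0 s)"
          using f \<rho>(1) unfolding continuous_on_sequentially comp_def by blast
        then show ?thesis using True \<rho>(2) by simp
      qed
    qed
    show "AE s in \<mu>. norm (g (Suc n) s) \<le> B * indicator {-1<..t} s" for n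
    proof (intro AE_I2)
      fix s show "norm (g (Suc n) s) \<le> B * indicator {-1<..t} s"
        using g_val[of s n] g_out[of s "Suc n"] B B0 by (cases "s \<in> {-1<..t}") auto
    qed
  qed
  then show ?thesis
    using g_int by (simp add: set_integral_eq_extended(1)[OF f t] has_bochner_integral_iff)
qed

text \<open>For the sums, the increments of \<open>F\<close> are nonnegative and telescope to
  \<open>B * F t\<close>; the bound survives the limit.\<close>

lemma stieltjes_bound:
  assumes f: "continuous_on {0..t} f" and t: "0 \<le> t" and B: "\<And>s. s \<in> {0..t} \<Longrightarrow> \<bar>f s\<bar> \<le> B"
  shows "\<bar>LINT s:{0..t}|\<mu>. f s\<bar> \<le> B * F t"
proof -
  have "\<bar>stieltjes_sum f t (Suc n)\<bar> \<le> B * F t" for n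
  proof -
    have node: "t * Suc i / Suc n \<in> {0..t}" if "i < Suc n" for i
      using t that mult_left_mono[of "real (Suc i) / real (Suc n)" 1 t] by simp
    have inc: "0 \<le> F (t * Suc i / Suc n) - F (t * i / Suc n)" for i
      using F_mono[of "t * i / Suc n" "t * Suc i / Suc n"] t by (simp add: divide_right_mono mult_left_mono)
    have "\<bar>stieltjes_sum f t (Suc n)\<bar> \<le> \<bar>f 0 * F 0\<bar> + (\<Sum>i<Suc n. \<bar>f (t * Suc i / Suc n) * (F (t * Suc i / Suc n) - F (t * i / Suc n))\<bar>)"
      unfolding stieltjes_sum_def by (rule order_trans[OF abs_triangle_ineq add_left_mono[OF sum_abs]])
    also have "\<dots> \<le> B * F 0 + (\<Sum>i<Suc n. B * (F (t * Suc i / Suc n) - F (t * i / Suc n)))"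
    proof (intro add_mono sum_mono)
      show "\<bar>f 0 * F 0\<bar> \<le> B * F 0" using B[of 0] t F_nonneg[of 0] by (simp add: abs_mult mult_right_mono)
      fix i assume "i \<in> {..<Suc n}"
      then show "\<bar>f (t * Suc i / Suc n) * (F (t * Suc i / Suc n) - F (t * i / Suc n))\<bar> \<le> B * (F (t * Suc i / Suc n) - F (t * i / Suc n))"
        using B[OF node] inc[of i] by (simp add: abs_mult mult_right_mono del: of_nat_Suc)
    qed
    also have "\<dots> = B * F 0 + B * (F (t * Suc n / Suc n) - F (t * 0 / Suc n))"
      by (simp only: sum_distrib_left[symmetric] sum_lessThan_telescope[of "\<lambda>i. F (t * real i / real (Suc n))"] of_nat_0)
    also have "\<dots> = B * F t" by (simp add: algebra_simps del: of_nat_Suc)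
    finally show ?thesis .
  qed
  then show ?thesis
    using tendsto_upperbound[OF tendsto_rabs[OF stieltjes_sum_tendsto[OF f t]]] by simp
qed

end

lemma stieltjes_combination:
  assumes "stieltjes F1" "stieltjes F2" and c: "0 \<le> c1" "0 \<le> c2"
  shows "stieltjes (\<lambda>s. c1 * F1 s + c2 * F2 s)"
proof -
  interpret F1: stieltjes F1 by fact
  interpret F2: stieltjes F2 by fact
  show ?thesis
    by unfold_locales
      (auto intro!: add_mono mult_left_mono F1.F_mono F2.F_mono c continuous_intros F1.F_right_cont F2.F_right_cont simp: F1.F_neg F2.F_neg)
qed

text \<open>Linearity in the integrator is evident for the approximating sums, and limits are
  unique.\<close>

lemma stieltjes_integral_combination:
  fixes f :: "real \<Rightarrow> real"
  assumes F: "stieltjes F1" "stieltjes F2" and c: "0 \<le> c1" "0 \<le> c2"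
    and f: "continuous_on {0..t} f" and t: "0 \<le> t"
  shows "(LINT s:{0..t}|interval_measure (\<lambda>s. c1 * F1 s + c2 * F2 s). f s)
    = c1 * (LINT s:{0..t}|interval_measure F1. f s) + c2 * (LINT s:{0..t}|interval_measure F2. f s)"
proof (rule LIMSEQ_unique)
  interpret F1: stieltjes F1 by fact
  interpret F2: stieltjes F2 by fact
  interpret F: stieltjes "\<lambda>s. c1 * F1 s + c2 * F2 s" by (rule stieltjes_combination[OF F c])
  show "(\<lambda>n. F.stieltjes_sum f t (Suc n)) \<longlonglongrightarrow> (LINT s:{0..t}|interval_measure (\<lambda>s. c1 * F1 s + c2 * F2 s). f s)"
    by (rule F.stieltjes_sum_tendsto[OF f t])
  have "F.stieltjes_sum f t n = c1 * F1.stieltjes_sum f t n + c2 * F2.stieltjes_sum f t n" for n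
    unfolding F.stieltjes_sum_def F1.stieltjes_sum_def F2.stieltjes_sum_def
    by (simp add: sum_distrib_left sum.distrib[symmetric] algebra_simps)
  then show "(\<lambda>n. F.stieltjes_sum f t (Suc n)) \<longlonglongrightarrow> c1 * (LINT s:{0..t}|interval_measure F1. f s) + c2 * (LINT s:{0..t}|interval_measure F2. f s)"
    using F1.stieltjes_sum_tendsto[OF f t] F2.stieltjes_sum_tendsto[OF f t] by (auto intro!: tendsto_intros)
qed

text \<open>Each approximating sum involves only finitely many values of the integrator.\<close>

lemma measurable_stieltjes_integral:
  fixes f :: "real \<Rightarrow> real"
  assumes F: "\<And>\<omega>. \<omega> \<in> space M \<Longrightarrow> stieltjes (F \<omega>)" and m: "\<And>s. 0 \<le> s \<Longrightarrow> s \<le> t \<Longrightarrow> (\<lambda>\<omega>. F \<omega> s) \<in> borel_measurable M"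
    and f: "continuous_on {0..t} f" and t: "0 \<le> t"
  shows "(\<lambda>\<omega>. LINT s:{0..t}|interval_measure (F \<omega>). f s) \<in> borel_measurable M"
proof (rule borel_measurable_LIMSEQ_real)
  fix \<omega> assume "\<omega> \<in> space M"
  then interpret stieltjes "F \<omega>" by (rule F)
  show "(\<lambda>n. f 0 * F \<omega> 0 + (\<Sum>i<Suc n. f (t * Suc i / Suc n) * (F \<omega> (t * Suc i / Suc n) - F \<omega> (t * i / Suc n))))
    \<longlonglongrightarrow> (LINT s:{0..t}|interval_measure (F \<omega>). f s)"
    using stieltjes_sum_tendsto[OF f t] unfolding stieltjes_sum_def .
next
  fix n :: nat
  show "(\<lambda>\<omega>. f 0 * F \<omega> 0 + (\<Sum>i<Suc n. f (t * Suc i / Suc n) * (F \<omega> (t * Suc i / Suc n) - F \<omega> (t * i / Suc n)))) \<in> borel_measurable M"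
  proof (intro borel_measurable_add borel_measurable_times borel_measurable_const borel_measurable_sum borel_measurable_diff m)
    have le: "t * real i / real (Suc n) \<le> t" if "i \<le> Suc n" for i
      using mult_left_mono[of "real i / real (Suc n)" 1 t] t that by simp
    fix i assume "i \<in> {..<Suc n}"
    then show "0 \<le> t * Suc i / Suc n" "t * Suc i / Suc n \<le> t" "0 \<le> t * i / Suc n" "t * i / Suc n \<le> t"
      using t le[of i] le[of "Suc i"] by auto
  qed (use t in auto)
qed

section \<open>The controlled state\<close>

definition right_continuous_on :: "real \<Rightarrow> (real \<Rightarrow> 'a::topological_space) \<Rightarrow> bool" where
  "right_continuous_on T f \<longleftrightarrow> (\<forall>t\<in>{0..<T}. (f \<longlongrightarrow> f t) (at_right t))"

lemma cadlag_imp_right_continuous: "cadlag_on T f \<Longrightarrow> right_continuous_on T f"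
  by (simp add: cadlag_on_def right_continuous_on_def)

text \<open>For \<open>t\<close> in \<open>{0..T}\<close>, the first point strictly above
  \<open>t\<close> of the grid with mesh \<open>1 / Suc n\<close>, capped at \<open>T\<close>. It
  approaches \<open>t\<close> from the right and equals \<open>t\<close> when \<open>t = T\<close>,
  so right continuity suffices for convergence along it.\<close>

definition dyadic_above :: "real \<Rightarrow> nat \<Rightarrow> real \<Rightarrow> real" where
  "dyadic_above T n t = min T ((real (nat \<lfloor>t * Suc n\<rfloor>) + 1) / Suc n)"

lemma dyadic_above_tendsto:
  assumes f: "right_continuous_on T f" and t: "t \<in> {0..T}"
  shows "(\<lambda>n. f (dyadic_above T n t)) \<longlonglongrightarrow> f t"
proof -
  have bounds: "t < (real (nat \<lfloor>t * Suc n\<rfloor>) + 1) / Suc n" "(real (nat \<lfloor>t * Suc n\<rfloor>) + 1) / Suc n \<le> t + 1 / Suc n" for n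
  proof -
    have "0 \<le> t * real (Suc n)" using t by auto
    then have r: "real (nat \<lfloor>t * Suc n\<rfloor>) = of_int \<lfloor>t * Suc n\<rfloor>" by (simp del: of_nat_Suc)
    have 1: "t * real (Suc n) < real (nat \<lfloor>t * Suc n\<rfloor>) + 1" unfolding r by linarith
    have 2: "real (nat \<lfloor>t * Suc n\<rfloor>) + 1 \<le> t * real (Suc n) + 1" unfolding r by linarith
    show "t < (real (nat \<lfloor>t * Suc n\<rfloor>) + 1) / Suc n" using 1 by (simp add: pos_less_divide_eq del: of_nat_Suc)
    have "t + 1 / Suc n = (t * real (Suc n) + 1) / Suc n" by (simp add: add_divide_distrib del: of_nat_Suc)
    then show "(real (nat \<lfloor>t * Suc n\<rfloor>) + 1) / Suc n \<le> t + 1 / Suc n"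
      using divide_right_mono[OF 2, of "real (Suc n)"] by simp
  qed
  show ?thesis
  proof (cases "t = T")
    case True
    then have "dyadic_above T n t = t" for n using bounds(1)[of n] by (simp add: dyadic_above_def)
    then show ?thesis by simp
  next
    case False
    then have tT: "t < T" using t by auto
    have "filterlim (\<lambda>n. dyadic_above T n t) (at_right t) sequentially"
      unfolding filterlim_at
    proof
      show "\<forall>\<^sub>F n in sequentially. dyadic_above T n t \<in> {t<..} \<and> dyadic_above T n t \<noteq> t"
      proof (intro always_eventually allI)
        fix n
        have "t < dyadic_above T n t" using bounds(1)[of n] tT by (simp add: dyadic_above_def)
        then show "dyadic_above T n t \<in> {t<..} \<and> dyadic_above T n t \<noteq> t" by simp
      qed
      show "(\<lambda>n. dyadic_above T n t) \<longlonglongrightarrow> t"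
      proof (rule tendsto_sandwich)
        show "\<forall>\<^sub>F n in sequentially. t \<le> dyadic_above T n t"
          using bounds(1) tT by (auto simp: dyadic_above_def less_imp_le)
        show "\<forall>\<^sub>F n in sequentially. dyadic_above T n t \<le> t + 1 / real (Suc n)"
          using bounds(2) by (auto simp: dyadic_above_def min_le_iff_disj)
        have "(\<lambda>n. t + 1 / real (Suc n)) \<longlonglongrightarrow> t + 0"
          by (intro tendsto_add tendsto_const LIMSEQ_Suc lim_1_over_n)
        then show "(\<lambda>n. t + 1 / real (Suc n)) \<longlonglongrightarrow> t" by simp
      qed simp
    qed
    moreover have "(f \<longlongrightarrow> f t) (at_right t)" using f t tT by (auto simp: right_continuous_on_def)
    ultimately show ?thesis by (rule filterlim_compose[rotated])
  qed
qed

text \<open>The process is a limit of processes that are constant in time on the cells of a grid.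
  Each of these selects, by a measurable index, one of countably many measurable functions.\<close>

lemma measurable_right_continuous:
  fixes g :: "real \<Rightarrow> 'w \<Rightarrow> 'b::metric_space"
  assumes m: "\<And>t. t \<in> {0..T} \<Longrightarrow> g t \<in> borel_measurable N" and T: "0 \<le> T"
    and rc: "\<And>\<omega>. \<omega> \<in> space N \<Longrightarrow> right_continuous_on T (\<lambda>t. g t \<omega>)"
  shows "(\<lambda>p. g (fst p) (snd p)) \<in> borel_measurable (restrict_space borel {0..T} \<Otimes>\<^sub>M N)"
proof (rule borel_measurable_LIMSEQ_metric)
  fix n
  let ?R = "restrict_space borel {0..T} \<Otimes>\<^sub>M N"
  define h where "h k p = g (min T ((real k + 1) / Suc n)) (snd p)" for k :: nat and p :: "real \<times> 'w"
  define j where "j p = nat \<lfloor>fst p * Suc n\<rfloor>" for p :: "real \<times> 'w"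
  have "h k \<in> borel_measurable ?R" for k
    unfolding h_def by (rule measurable_compose[OF measurable_snd m]) (use T in auto)
  moreover have "j \<in> ?R \<rightarrow>\<^sub>M count_space UNIV"
  proof -
    have [measurable]: "fst \<in> borel_measurable ?R"
      by (rule measurable_compose[OF measurable_fst measurable_restrict_space1]) simp
    have "(\<lambda>p. \<lfloor>fst p * Suc n\<rfloor>) \<in> ?R \<rightarrow>\<^sub>M count_space UNIV" by measurable
    from measurable_compose[OF this, of nat "count_space UNIV"] show ?thesis by (simp add: j_def[abs_def])
  qed
  ultimately have "(\<lambda>p. h (j p) p) \<in> borel_measurable ?R" by (rule measurable_compose_countable)
  then show "(\<lambda>p. g (dyadic_above T n (fst p)) (snd p)) \<in> borel_measurable ?R"
    by (simp add: h_def j_def dyadic_above_def)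
next
  fix p assume "p \<in> space (restrict_space borel {0..T} \<Otimes>\<^sub>M N)"
  then have "fst p \<in> {0..T}" "snd p \<in> space N" by (auto simp: space_pair_measure space_restrict_space)
  then show "(\<lambda>n. g (dyadic_above T n (fst p)) (snd p)) \<longlonglongrightarrow> g (fst p) (snd p)"
    using dyadic_above_tendsto[OF rc] by blast
qed

text \<open>Bisection: boundedness passes from two adjacent intervals to their union, and near each
  point it follows from the two one-sided limits.\<close>

lemma cadlag_bounded:
  fixes f :: "real \<Rightarrow> 'a::real_normed_vector"
  assumes f: "cadlag_on T f" and T: "0 \<le> T"
  obtains B where "\<And>t. t \<in> {0..T} \<Longrightarrow> norm (f t) \<le> B"
proof -
  define P where "P a b \<longleftrightarrow> (\<exists>B. \<forall>t. a \<le> t \<and> t \<le> b \<and> 0 \<le> t \<and> t \<le> T \<longrightarrow> norm (f t) \<le> B)" for a b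
  have "P 0 T"
    using T
  proof (induction rule: Bolzano)
    case (trans a b c)
    then obtain B B' where B: "\<And>t. a \<le> t \<Longrightarrow> t \<le> b \<Longrightarrow> 0 \<le> t \<Longrightarrow> t \<le> T \<Longrightarrow> norm (f t) \<le> B"
      and B': "\<And>t. b \<le> t \<Longrightarrow> t \<le> c \<Longrightarrow> 0 \<le> t \<Longrightarrow> t \<le> T \<Longrightarrow> norm (f t) \<le> B'" unfolding P_def by blast
    have "norm (f t) \<le> max B B'" if "a \<le> t \<and> t \<le> c \<and> 0 \<le> t \<and> t \<le> T" for t
      using B[of t] B'[of t] that by (cases "t \<le> b") auto
    then show ?case unfolding P_def by blast
  next
    case (local x)
    have right: "\<exists>d>0. \<exists>B. \<forall>t. x < t \<and> t < x + d \<and> t \<le> T \<longrightarrow> norm (f t) \<le> B"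
    proof (cases "x < T")
      case True
      then have "(f \<longlongrightarrow> f x) (at_right x)" using f local by (auto simp: cadlag_on_def)
      then have "\<forall>\<^sub>F t in at_right x. dist (f t) (f x) < 1" by (rule tendstoD) simp
      then obtain b where b: "b > x" "\<And>t. x < t \<Longrightarrow> t < b \<Longrightarrow> dist (f t) (f x) < 1"
        unfolding eventually_at_right_field by blast
      have "norm (f t) \<le> norm (f x) + 1" if "x < t" "t < x + (b - x)" for t
        using b(2)[of t] that norm_triangle_ineq2[of "f t" "f x"] by (simp add: dist_norm)
      then show ?thesis using b(1) by (intro exI[of _ "b - x"]) auto
    next
      case False then show ?thesis by (intro exI[of _ 1]) auto
    qed
    have left: "\<exists>d>0. \<exists>B. \<forall>t. x - d < t \<and> t < x \<and> 0 \<le> t \<longrightarrow> norm (f t) \<le> B"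
    proof (cases "0 < x")
      case True
      then obtain l where "(f \<longlongrightarrow> l) (at_left x)" using f local unfolding cadlag_on_def by (meson greaterThanAtMost_iff)
      then have "\<forall>\<^sub>F t in at_left x. dist (f t) l < 1" by (rule tendstoD) simp
      then obtain b where b: "b < x" "\<And>t. b < t \<Longrightarrow> t < x \<Longrightarrow> dist (f t) l < 1"
        unfolding eventually_at_left_field by blast
      have "norm (f t) \<le> norm l + 1" if "x - (x - b) < t" "t < x" for t
        using b(2)[of t] that norm_triangle_ineq2[of "f t" l] by (simp add: dist_norm)
      then show ?thesis using b(1) by (intro exI[of _ "x - b"]) auto
    next
      case False then show ?thesis by (intro exI[of _ 1]) auto
    qed
    obtain d B where d: "d > 0" "\<And>t. x < t \<Longrightarrow> t < x + d \<Longrightarrow> t \<le> T \<Longrightarrow> norm (f t) \<le> B" using right by blast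
    obtain d' B' where d': "d' > 0" "\<And>t. x - d' < t \<Longrightarrow> t < x \<Longrightarrow> 0 \<le> t \<Longrightarrow> norm (f t) \<le> B'" using left by blast
    show ?case
    proof (intro exI[of _ "min d d'"] conjI allI impI)
      show "0 < min d d'" using d d' by simp
      fix a b assume ab: "a \<le> x \<and> x \<le> b \<and> b - a < min d d'"
      have "norm (f t) \<le> max (norm (f x)) (max B B')" if "a \<le> t \<and> t \<le> b \<and> 0 \<le> t \<and> t \<le> T" for t
      proof -
        have "t < x + d" "x - d' < t" using that ab by linarith+
        then consider "t = x" | "x < t" "t < x + d" | "t < x" "x - d' < t" by linarith
        then show ?thesis using d(2)[of t] d'(2)[of t] that by cases auto
      qed
      then show "P a b" unfolding P_def by blast
    qed
  qed
  then show ?thesis using that unfolding P_def by (meson atLeastAtMost_iff)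
qed

section \<open>An integrated Gronwall inequality\<close>

lemma nn_integral_sq_le:
  fixes f :: "real \<Rightarrow> ennreal"
  assumes f[measurable]: "f \<in> borel_measurable borel" and t: "0 \<le> t"
  shows "(\<integral>\<^sup>+s\<in>{0..t}. f s \<partial>lborel)\<^sup>2 \<le> ennreal t * (\<integral>\<^sup>+s\<in>{0..t}. (f s)\<^sup>2 \<partial>lborel)"
proof -
  have "(\<integral>\<^sup>+s. (indicator {0..t} s) * (f s * indicator {0..t} s) \<partial>lborel)\<^sup>2
    \<le> (\<integral>\<^sup>+s. (indicator {0..t} s)\<^sup>2 \<partial>lborel) * (\<integral>\<^sup>+s. (f s * indicator {0..t} s)\<^sup>2 \<partial>lborel)"
    by (rule Cauchy_Schwarz_nn_integral) auto
  moreover have "(\<integral>\<^sup>+s. (indicator {0..t} s)\<^sup>2 \<partial>lborel) = ennreal t"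
  proof -
    have "(\<lambda>s. (indicator {0..t} s)\<^sup>2 :: ennreal) = indicator {0..t}" by (auto simp: fun_eq_iff indicator_def)
    then show ?thesis using t by simp
  qed
  moreover have "(\<lambda>s. (f s * indicator {0..t} s)\<^sup>2) = (\<lambda>s. (f s)\<^sup>2 * indicator {0..t} s)"
    "(\<lambda>s. (indicator {0..t} s) * (f s * indicator {0..t} s)) = (\<lambda>s. f s * indicator {0..t} s)"
    by (auto simp: fun_eq_iff indicator_def)
  ultimately show ?thesis by simp
qed

text \<open>Integrating the inequality against \<open>exp (- 2 c t)\<close> absorbs half of the left-hand side.\<close>
lemma gronwall_integral:
  fixes x a :: "real \<Rightarrow> ennreal"
  assumes [measurable]: "x \<in> borel_measurable borel" "a \<in> borel_measurable borel" and c: "0 < c"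
    and fin: "(\<integral>\<^sup>+t\<in>{0..T}. x t \<partial>lborel) < \<infinity>"
    and le: "\<And>t. t \<in> {0..T} \<Longrightarrow> x t \<le> a t + ennreal c * (\<integral>\<^sup>+s\<in>{0..t}. x s \<partial>lborel)"
  shows "(\<integral>\<^sup>+t\<in>{0..T}. x t \<partial>lborel) \<le> ennreal (2 * exp (2 * c * T)) * (\<integral>\<^sup>+t\<in>{0..T}. a t \<partial>lborel)"
proof -
  \<comment> \<open>With the exponent \<open>2 * c\<close>, the tail integral of \<open>w\<close>
    carries the factor \<open>1 / (2 * c)\<close>; together with the factor \<open>c\<close> of the
    inequality it leaves one half.\<close>
  define w where "w t = ennreal (exp (- (2 * c) * t))" for t
  have w[measurable]: "w \<in> borel_measurable borel" unfolding w_def by measurable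
  define X where "X = (\<integral>\<^sup>+t. w t * (x t * indicator {0..T} t) \<partial>lborel)"
  define Aa where "Aa = (\<integral>\<^sup>+t. w t * (a t * indicator {0..T} t) \<partial>lborel)"
  have w1: "w t \<le> 1" if "0 \<le> t" for t
  proof -
    have "exp (- (2 * c) * t) \<le> 1" using that c by simp
    then show ?thesis unfolding w_def using ennreal_leI[of _ 1] by simp
  qed
  have X_fin: "X < \<infinity>"
  proof (rule order.strict_trans1[OF _ fin])
    show "X \<le> (\<integral>\<^sup>+t\<in>{0..T}. x t \<partial>lborel)"
      unfolding X_def
    proof (rule nn_integral_mono)
      fix t show "w t * (x t * indicator {0..T} t) \<le> x t * indicator {0..T} t"
        using mult_right_mono[OF w1, of t "x t"] by (auto simp: indicator_def)
    qed
  qed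
  have tail: "(\<integral>\<^sup>+t. w t * indicator {s..} t \<partial>lborel) = ennreal (1 / (2 * c)) * w s" for s
  proof -
    have "(\<integral>\<^sup>+t. ennreal (exp (- (2 * c) * t)) * indicator {s..} t \<partial>lborel) = ennreal (0 - (- exp (- (2 * c) * s) / (2 * c)))"
    proof (rule nn_integral_FTC_atLeast)
      show "DERIV (\<lambda>t. - exp (- (2 * c) * t) / (2 * c)) t :> exp (- (2 * c) * t)" for t
        using c by (auto intro!: derivative_eq_intros)
      have "((\<lambda>t. exp (- (2 * c) * t)) \<longlongrightarrow> 0) at_top"
      proof (rule filterlim_compose[OF exp_at_bot])
        show "LIM t at_top. - (2 * c) * t :> at_bot"
          by (rule filterlim_tendsto_neg_mult_at_bot[OF tendsto_const _ filterlim_ident]) (use c in simp)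
      qed
      then have "((\<lambda>t. - exp (- (2 * c) * t) / (2 * c)) \<longlongrightarrow> - 0 / (2 * c)) at_top"
        using c by (intro tendsto_intros) auto
      then show "((\<lambda>t. - exp (- (2 * c) * t) / (2 * c)) \<longlongrightarrow> 0) at_top" by simp
    qed auto
    then show ?thesis using c by (simp add: w_def ennreal_mult'[symmetric])
  qed
  have "X \<le> (\<integral>\<^sup>+t. w t * (a t * indicator {0..T} t) + ennreal c * (\<integral>\<^sup>+s. (w t * indicator {s..} t) * (x s * indicator {0..T} s) \<partial>lborel) \<partial>lborel)"
    unfolding X_def
  proof (rule nn_integral_mono)
    fix t
    show "w t * (x t * indicator {0..T} t) \<le> w t * (a t * indicator {0..T} t) + ennreal c * (\<integral>\<^sup>+s. (w t * indicator {s..} t) * (x s * indicator {0..T} s) \<partial>lborel)"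
    proof (cases "t \<in> {0..T}")
      case True
      have "w t * x t \<le> w t * (a t + ennreal c * (\<integral>\<^sup>+s\<in>{0..t}. x s \<partial>lborel))"
        by (intro mult_left_mono le True) auto
      also have "\<dots> = w t * a t + ennreal c * (\<integral>\<^sup>+s. w t * (x s * indicator {0..t} s) \<partial>lborel)"
        by (simp add: distrib_left nn_integral_cmult mult_ac)
      also have "(\<integral>\<^sup>+s. w t * (x s * indicator {0..t} s) \<partial>lborel) = (\<integral>\<^sup>+s. (w t * indicator {s..} t) * (x s * indicator {0..T} s) \<partial>lborel)"
        using True by (intro nn_integral_cong) (auto simp: indicator_def)
      finally show ?thesis using True by simp
    qed simp
  qed
  also have "\<dots> = Aa + ennreal c * (\<integral>\<^sup>+t. (\<integral>\<^sup>+s. (w t * indicator {s..} t) * (x s * indicator {0..T} s) \<partial>lborel) \<partial>lborel)"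
    unfolding Aa_def
    by (subst nn_integral_add) (auto simp: nn_integral_cmult atLeast_def indicator_def cong: if_cong intro!: borel_measurable_times lborel.borel_measurable_nn_integral)
  also have "(\<integral>\<^sup>+t. (\<integral>\<^sup>+s. (w t * indicator {s..} t) * (x s * indicator {0..T} s) \<partial>lborel) \<partial>lborel)
    = (\<integral>\<^sup>+s. (\<integral>\<^sup>+t. (w t * indicator {s..} t) * (x s * indicator {0..T} s) \<partial>lborel) \<partial>lborel)"
    by (rule lborel_pair.Fubini'[symmetric]) (simp add: indicator_def atLeast_def cong: if_cong)
  also have "\<dots> = (\<integral>\<^sup>+s. ennreal (1 / (2 * c)) * (w s * (x s * indicator {0..T} s)) \<partial>lborel)"
  proof (rule nn_integral_cong)
    fix s
    have "(\<integral>\<^sup>+t. (w t * indicator {s..} t) * (x s * indicator {0..T} s) \<partial>lborel) = (\<integral>\<^sup>+t. w t * indicator {s..} t \<partial>lborel) * (x s * indicator {0..T} s)"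
      by (rule nn_integral_multc) simp
    then show "(\<integral>\<^sup>+t. (w t * indicator {s..} t) * (x s * indicator {0..T} s) \<partial>lborel) = ennreal (1 / (2 * c)) * (w s * (x s * indicator {0..T} s))"
      unfolding tail by (simp only: mult.assoc)
  qed
  also have "\<dots> = ennreal (1 / (2 * c)) * X"
    unfolding X_def by (rule nn_integral_cmult) simp
  also have "ennreal c * (ennreal (1 / (2 * c)) * X) = ennreal (1 / 2) * X"
    using c by (simp add: mult.assoc[symmetric] ennreal_mult'[symmetric])
  finally have X1: "X \<le> Aa + ennreal (1 / 2) * X" .
  \<comment> \<open>Absorbing half of \<open>X\<close> requires \<open>X\<close> to be finite, which
    the assumption \<open>fin\<close> provides.\<close>
  have X2: "X \<le> 2 * Aa"
  proof (cases Aa)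
    case (real r)
    obtain y where y: "X = ennreal y" "0 \<le> y" using X_fin by (cases X) auto
    have "ennreal (r + 1 / 2 * y) = ennreal r + ennreal (1 / 2 * y)"
      by (rule ennreal_plus) (use real y in auto)
    also have "ennreal (1 / 2 * y) = ennreal (1 / 2) * ennreal y"
      by (rule ennreal_mult) (use y in auto)
    finally have "ennreal y \<le> ennreal (r + 1 / 2 * y)"
      using X1 unfolding y(1) real(2) by (simp only:)
    then have "y \<le> r + 1 / 2 * y"
      by (rule ennreal_le_iff[THEN iffD1, rotated]) (use y real in auto)
    then have "y \<le> 2 * r" by simp
    then have "ennreal y \<le> ennreal (2 * r)" by (rule ennreal_leI)
    then show ?thesis using y real by (simp add: ennreal_mult')
  qed (simp add: ennreal_mult_top)
  have "(\<integral>\<^sup>+t\<in>{0..T}. x t \<partial>lborel) \<le> (\<integral>\<^sup>+t. ennreal (exp (2 * c * T)) * (w t * (x t * indicator {0..T} t)) \<partial>lborel)"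
  proof (rule nn_integral_mono)
    fix t
    show "x t * indicator {0..T} t \<le> ennreal (exp (2 * c * T)) * (w t * (x t * indicator {0..T} t))"
    proof (cases "t \<in> {0..T}")
      case True
      have "1 \<le> exp (2 * c * T) * exp (- (2 * c) * t)"
        using True c by (simp add: exp_add[symmetric] mult_left_mono)
      then have "1 \<le> ennreal (exp (2 * c * T)) * w t"
        unfolding w_def by (simp add: ennreal_mult'[symmetric] ennreal_1[symmetric] del: ennreal_1)
      then have "1 * x t \<le> ennreal (exp (2 * c * T)) * w t * x t" by (rule mult_right_mono) simp
      then show ?thesis using True by (simp add: mult.assoc)
    qed simp
  qed
  also have "\<dots> = ennreal (exp (2 * c * T)) * X"
    unfolding X_def by (rule nn_integral_cmult) simp
  also have "\<dots> \<le> ennreal (exp (2 * c * T)) * (2 * Aa)" by (intro mult_left_mono X2) simp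
  also have "\<dots> \<le> ennreal (exp (2 * c * T)) * (2 * (\<integral>\<^sup>+t\<in>{0..T}. a t \<partial>lborel))"
  proof (intro mult_left_mono)
    show "Aa \<le> (\<integral>\<^sup>+t\<in>{0..T}. a t \<partial>lborel)"
      unfolding Aa_def
    proof (rule nn_integral_mono)
      fix t show "w t * (a t * indicator {0..T} t) \<le> a t * indicator {0..T} t"
        using mult_right_mono[OF w1, of t "a t"] by (auto simp: indicator_def)
    qed
  qed auto
  also have "\<dots> = ennreal (2 * exp (2 * c * T)) * (\<integral>\<^sup>+t\<in>{0..T}. a t \<partial>lborel)"
    by (simp add: ennreal_mult' mult_ac)
  finally show ?thesis .
qed

lemma ennreal_add_sq_le: "(a + b)\<^sup>2 \<le> 2 * a\<^sup>2 + 2 * (b::ennreal)\<^sup>2"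
proof (cases a; cases b)
  fix r s assume rs: "0 \<le> r" "a = ennreal r" "0 \<le> s" "b = ennreal s"
  have "(r + s)\<^sup>2 \<le> 2 * r\<^sup>2 + 2 * s\<^sup>2"
    using sum_squares_bound[of r s] by (simp add: power2_sum)
  then have "ennreal ((r + s)\<^sup>2) \<le> ennreal (2 * r\<^sup>2 + 2 * s\<^sup>2)" by (rule ennreal_leI)
  moreover have "ennreal ((r + s)\<^sup>2) = (a + b)\<^sup>2"
    using rs by (simp add: ennreal_power[symmetric] ennreal_plus[symmetric] del: ennreal_plus)
  moreover have "ennreal (2 * r\<^sup>2 + 2 * s\<^sup>2) = 2 * a\<^sup>2 + 2 * b\<^sup>2"
    using rs by (simp add: ennreal_mult' ennreal_power)
  ultimately show ?thesis by simp
qed (auto simp: power2_eq_square ennreal_mult_top ennreal_top_mult)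

section \<open>Singular controls as Stieltjes integrators\<close>

definition control_path :: "real \<Rightarrow> (real \<Rightarrow> 'w \<Rightarrow> real^'m) \<Rightarrow> 'm \<Rightarrow> 'w \<Rightarrow> real \<Rightarrow> real" where
  "control_path T \<xi> j \<omega> s = (if s < 0 then 0 else \<xi> (min s T) \<omega> $ j)"

lemma control_measure_eq: "control_measure T \<xi> j \<omega> = interval_measure (control_path T \<xi> j \<omega>)"
  unfolding control_measure_def control_path_def[abs_def] ..

lemma admissible_controlsD:
  assumes "\<xi> \<in> admissible_controls T M F"
  shows "t \<in> {0..T} \<Longrightarrow> \<xi> t \<in> borel_measurable (F t)" "\<omega> \<in> space M \<Longrightarrow> cadlag_on T (\<lambda>t. \<xi> t \<omega>)"
    "\<omega> \<in> space M \<Longrightarrow> t \<in> {0..T} \<Longrightarrow> 0 \<le> \<xi> t \<omega> $ j" "\<omega> \<in> space M \<Longrightarrow> mono_on {0..T} (\<lambda>t. \<xi> t \<omega> $ j)"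
    "integrable M (\<lambda>\<omega>. (norm (\<xi> T \<omega>))\<^sup>2)"
  using assms unfolding admissible_controls_def by blast+

text \<open>Being 0 before time 0 and frozen after \<open>T\<close>, the path of a control is a
  distribution function on the whole line. A jump at \<open>T\<close> is included, and the freezing
  gives right continuity from \<open>T\<close> on.\<close>

lemma stieltjes_control_path:
  assumes \<xi>: "\<xi> \<in> admissible_controls T M F" and \<omega>: "\<omega> \<in> space M" and T: "0 < T"
  shows "stieltjes (control_path T \<xi> j \<omega>)"
proof
  have cad: "cadlag_on T (\<lambda>t. \<xi> t \<omega>)" and nn: "\<And>t. t \<in> {0..T} \<Longrightarrow> 0 \<le> \<xi> t \<omega> $ j"
    and mono: "mono_on {0..T} (\<lambda>t. \<xi> t \<omega> $ j)"
    using admissible_controlsD[OF \<xi>] \<omega> by blast+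
  show "control_path T \<xi> j \<omega> x \<le> control_path T \<xi> j \<omega> y" if "x \<le> y" for x y
  proof (cases "x < 0")
    case True
    then show ?thesis using nn[of "min y T"] T by (auto simp: control_path_def)
  next
    case False
    then show ?thesis using that T by (auto simp: control_path_def intro!: mono_onD[OF mono])
  qed
  show "control_path T \<xi> j \<omega> x = 0" if "x < 0" for x using that by (simp add: control_path_def)
  show "continuous (at_right a) (control_path T \<xi> j \<omega>)" for a
    unfolding continuous_within
  proof -
    consider "a < 0" | "0 \<le> a" "a < T" | "T \<le> a" by linarith
    then show "(control_path T \<xi> j \<omega> \<longlongrightarrow> control_path T \<xi> j \<omega> a) (at_right a)"
    proof cases
      case 1
      have "\<forall>\<^sub>F s in at_right a. control_path T \<xi> j \<omega> s = control_path T \<xi> j \<omega> a"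
        unfolding eventually_at_right_field using 1 by (intro exI[of _ 0]) (auto simp: control_path_def)
      then show ?thesis by (rule tendsto_eventually)
    next
      case 2
      have "((\<lambda>s. \<xi> s \<omega>) \<longlongrightarrow> \<xi> a \<omega>) (at_right a)" using cad 2 by (auto simp: cadlag_on_def)
      then have "((\<lambda>s. \<xi> s \<omega> $ j) \<longlongrightarrow> \<xi> a \<omega> $ j) (at_right a)" by (rule tendsto_vec_nth)
      moreover have "\<forall>\<^sub>F s in at_right a. \<xi> s \<omega> $ j = control_path T \<xi> j \<omega> s"
        unfolding eventually_at_right_field using 2 by (intro exI[of _ T]) (auto simp: control_path_def)
      ultimately have "(control_path T \<xi> j \<omega> \<longlongrightarrow> \<xi> a \<omega> $ j) (at_right a)" by (rule Lim_transform_eventually)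
      moreover have "control_path T \<xi> j \<omega> a = \<xi> a \<omega> $ j" using 2 by (simp add: control_path_def)
      ultimately show ?thesis by simp
    next
      case 3
      have "\<forall>\<^sub>F s in at_right a. control_path T \<xi> j \<omega> s = control_path T \<xi> j \<omega> a"
        unfolding eventually_at_right_field using 3 T by (intro exI[of _ "a + 1"]) (auto simp: control_path_def min_def)
      then show ?thesis by (rule tendsto_eventually)
    qed
  qed
qed

lemma control_path_le:
  assumes "\<xi> \<in> admissible_controls T M F" "\<omega> \<in> space M" "0 < T" "t \<le> T"
  shows "control_path T \<xi> j \<omega> t \<le> norm (\<xi> T \<omega>)"
proof -
  interpret stieltjes "control_path T \<xi> j \<omega>" by (rule stieltjes_control_path[OF assms(1-3)])
  have "control_path T \<xi> j \<omega> t \<le> control_path T \<xi> j \<omega> T" by (rule F_mono) fact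
  also have "\<dots> = \<xi> T \<omega> $ j" using assms by (simp add: control_path_def)
  also have "\<dots> \<le> norm (\<xi> T \<omega>)" using component_le_norm_cart[of "\<xi> T \<omega>" j] by simp
  finally show ?thesis .
qed

lemma control_path_combination:
  "control_path T (\<lambda>t \<omega>. c *\<^sub>R \<xi> t \<omega> + d *\<^sub>R \<eta> t \<omega>) j \<omega> = (\<lambda>s. c * control_path T \<xi> j \<omega> s + d * control_path T \<eta> j \<omega> s)"
  by (auto simp: control_path_def)

lemma control_integral_combination:
  assumes "\<xi> \<in> admissible_controls T M F" "\<eta> \<in> admissible_controls T M F" "\<omega> \<in> space M" "0 < T"
    and "0 \<le> c" "0 \<le> d" and f: "continuous_on {0..T} f" and t: "t \<in> {0..T}"
  shows "(LINT s:{0..t}|control_measure T (\<lambda>t \<omega>. c *\<^sub>R \<xi> t \<omega> + d *\<^sub>R \<eta> t \<omega>) j \<omega>. f s)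
    = c * (LINT s:{0..t}|control_measure T \<xi> j \<omega>. f s) + d * (LINT s:{0..t}|control_measure T \<eta> j \<omega>. (f s :: real))"
  unfolding control_measure_eq control_path_combination
  by (rule stieltjes_integral_combination) (use assms in \<open>auto intro: stieltjes_control_path continuous_on_subset\<close>)

lemma control_integral_bound:
  assumes "\<xi> \<in> admissible_controls T M F" "\<omega> \<in> space M" "0 < T"
    and f: "continuous_on {0..T} f" and t: "t \<in> {0..T}" and B: "\<And>s. s \<in> {0..T} \<Longrightarrow> \<bar>f s\<bar> \<le> B"
  shows "\<bar>LINT s:{0..t}|control_measure T \<xi> j \<omega>. f s\<bar> \<le> B * norm (\<xi> T \<omega>)"
proof -
  interpret stieltjes "control_path T \<xi> j \<omega>" by (rule stieltjes_control_path[OF assms(1-3)])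
  have "0 \<le> B" by (rule order_trans[OF abs_ge_zero B[of 0]]) (use assms(3) in simp)
  have "\<bar>LINT s:{0..t}|control_measure T \<xi> j \<omega>. f s\<bar> \<le> B * control_path T \<xi> j \<omega> t"
    unfolding control_measure_eq using f t B by (intro stieltjes_bound) (auto intro: continuous_on_subset)
  also have "\<dots> \<le> B * norm (\<xi> T \<omega>)"
    using control_path_le[OF assms(1-3)] t \<open>0 \<le> B\<close> by (intro mult_left_mono) auto
  finally show ?thesis .
qed

lemma admissible_controls_combination:
  fixes \<xi> \<eta> :: "real \<Rightarrow> 'w \<Rightarrow> real^'m"
  assumes \<xi>: "\<xi> \<in> admissible_controls T M F" and \<eta>: "\<eta> \<in> admissible_controls T M F" and c: "0 \<le> c" "0 \<le> d"
    and M: "\<And>X :: 'w \<Rightarrow> real^'m. X \<in> borel_measurable (F T) \<Longrightarrow> X \<in> borel_measurable M" and T: "0 < T"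
  shows "(\<lambda>t \<omega>. c *\<^sub>R \<xi> t \<omega> + d *\<^sub>R \<eta> t \<omega>) \<in> admissible_controls T M F"
proof -
  have m: "\<xi> T \<in> borel_measurable M" "\<eta> T \<in> borel_measurable M"
    using M[OF admissible_controlsD(1)[OF \<xi>, of T]] M[OF admissible_controlsD(1)[OF \<eta>, of T]] T by simp_all
  have "square_integrable M (\<lambda>\<omega>. c *\<^sub>R \<xi> T \<omega> + d *\<^sub>R \<eta> T \<omega>)"
    using m admissible_controlsD(5)[OF \<xi>] admissible_controlsD(5)[OF \<eta>]
    by (intro square_integrable_add square_integrable_scaleR) (simp_all add: square_integrable_def)
  moreover have "cadlag_on T (\<lambda>t. c *\<^sub>R \<xi> t \<omega> + d *\<^sub>R \<eta> t \<omega>)" if "\<omega> \<in> space M" for \<omega>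
  proof -
    note 1 = admissible_controlsD(2)[OF \<xi> that] admissible_controlsD(2)[OF \<eta> that]
    show ?thesis
      unfolding cadlag_on_def
    proof (intro conjI ballI)
      fix t assume t: "t \<in> {0..<T}"
      have "((\<lambda>t. \<xi> t \<omega>) \<longlongrightarrow> \<xi> t \<omega>) (at_right t)" "((\<lambda>t. \<eta> t \<omega>) \<longlongrightarrow> \<eta> t \<omega>) (at_right t)"
        using 1 t unfolding cadlag_on_def by blast+
      then show "((\<lambda>t. c *\<^sub>R \<xi> t \<omega> + d *\<^sub>R \<eta> t \<omega>) \<longlongrightarrow> c *\<^sub>R \<xi> t \<omega> + d *\<^sub>R \<eta> t \<omega>) (at_right t)"
        by (intro tendsto_intros)
    next
      fix t assume "t \<in> {0<..T}"
      then obtain l l' where "((\<lambda>t. \<xi> t \<omega>) \<longlongrightarrow> l) (at_left t)" "((\<lambda>t. \<eta> t \<omega>) \<longlongrightarrow> l') (at_left t)"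
        using 1 unfolding cadlag_on_def by blast
      then show "\<exists>l. ((\<lambda>t. c *\<^sub>R \<xi> t \<omega> + d *\<^sub>R \<eta> t \<omega>) \<longlongrightarrow> l) (at_left t)"
        by (intro exI[of _ "c *\<^sub>R l + d *\<^sub>R l'"] tendsto_intros)
    qed
  qed
  moreover have "mono_on {0..T} (\<lambda>t. (c *\<^sub>R \<xi> t \<omega> + d *\<^sub>R \<eta> t \<omega>) $ j)" if "\<omega> \<in> space M" for \<omega> j
  proof (rule mono_onI)
    fix r s assume "r \<in> {0..T}" "s \<in> {0..T}" "r \<le> s"
    then have "\<xi> r \<omega> $ j \<le> \<xi> s \<omega> $ j" "\<eta> r \<omega> $ j \<le> \<eta> s \<omega> $ j"
      using mono_onD[OF admissible_controlsD(4)[OF \<xi> that]] mono_onD[OF admissible_controlsD(4)[OF \<eta> that]] by blast+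
    then show "(c *\<^sub>R \<xi> r \<omega> + d *\<^sub>R \<eta> r \<omega>) $ j \<le> (c *\<^sub>R \<xi> s \<omega> + d *\<^sub>R \<eta> s \<omega>) $ j"
      using c by (simp add: add_mono mult_left_mono)
  qed
  moreover have "0 \<le> (c *\<^sub>R \<xi> t \<omega> + d *\<^sub>R \<eta> t \<omega>) $ j" if "\<omega> \<in> space M" "t \<in> {0..T}" for t \<omega> j
    using c admissible_controlsD(3)[OF \<xi> that] admissible_controlsD(3)[OF \<eta> that] by simp
  moreover have "(\<lambda>\<omega>. c *\<^sub>R \<xi> t \<omega> + d *\<^sub>R \<eta> t \<omega>) \<in> borel_measurable (F t)" if "t \<in> {0..T}" for t
    using admissible_controlsD(1)[OF \<xi> that] admissible_controlsD(1)[OF \<eta> that] by measurable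
  ultimately show ?thesis
    unfolding admissible_controls_def square_integrable_def by blast
qed

lemma (in filtered_brownian) ito_measurable:
  assumes "is_ito_integral T M F W H I" and t: "t \<in> {0..T}"
  shows "I t \<in> borel_measurable M"
proof -
  have "I t \<in> borel_measurable (F t)" using assms unfolding is_ito_integral_def by blast
  then show ?thesis by (rule measurable_F_imp_M[OF t])
qed

text \<open>The integral is characterized at each time as an \<open>L^2\<close> limit, and at time 0
  all simple integrals vanish since the partition points are nonnegative.\<close>

lemma ito_integral_zero:
  assumes fb: "filtered_brownian M T F W" and ito: "is_ito_integral T M F W H I" and T: "0 < T"
  shows "AE \<omega> in M. I 0 \<omega> = 0"
proof -
  interpret filtered_brownian M T F W by fact
  obtain Z where Z: "\<And>k. simple_process T M F (Z k)"
    and lim: "(\<lambda>k. \<integral>\<^sup>+\<omega>. ennreal ((norm (simple_integral W (Z k) 0 \<omega> - I 0 \<omega>))\<^sup>2) \<partial>M) \<longlonglongrightarrow> 0"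
  proof -
    from ito have "\<exists>Z. (\<forall>k. simple_process T M F (Z k)) \<and>
        (\<forall>t\<in>{0..T}. (\<lambda>k. \<integral>\<^sup>+\<omega>. ennreal ((norm (simple_integral W (Z k) t \<omega> - I t \<omega>))\<^sup>2) \<partial>M) \<longlonglongrightarrow> 0)"
      unfolding is_ito_integral_def by blast
    then obtain Z where "\<And>k. simple_process T M F (Z k)"
      "\<forall>t\<in>{0..T}. (\<lambda>k. \<integral>\<^sup>+\<omega>. ennreal ((norm (simple_integral W (Z k) t \<omega> - I t \<omega>))\<^sup>2) \<partial>M) \<longlonglongrightarrow> 0"
      by blast
    then show ?thesis using T by (intro that[of Z]) auto
  qed
  have "simple_integral W (Z k) 0 \<omega> = 0" for k \<omega>
  proof -
    obtain n \<tau> A where Zk: "Z k = (n, \<tau>, A)" by (cases "Z k") auto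
    have "min 0 (\<tau> i) = 0" if "i \<le> n" for i using Z[of k] that unfolding Zk by auto
    then show ?thesis unfolding Zk by (simp add: Suc_leI)
  qed
  then have "(\<lambda>k::nat. \<integral>\<^sup>+\<omega>. ennreal ((norm (I 0 \<omega>))\<^sup>2) \<partial>M) \<longlonglongrightarrow> 0" using lim by simp
  then have "(\<integral>\<^sup>+\<omega>. ennreal ((norm (I 0 \<omega>))\<^sup>2) \<partial>M) = 0" by (simp add: LIMSEQ_const_iff)
  moreover have "I 0 \<in> borel_measurable M"
    using ito_measurable[OF ito, of 0] T by simp
  ultimately show ?thesis by (simp add: nn_integral_0_iff_AE)
qed

context filtered_brownian
begin

lemma ito_combination_moment:
  fixes H :: "'i \<Rightarrow> real \<Rightarrow> 'w \<Rightarrow> real^'d^'n"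
  assumes Q: "finite Q" and ito: "\<And>l. l \<in> Q \<Longrightarrow> is_ito_integral T M F W (H l) (I l)"
    and t: "t \<in> {0..T}" and T: "0 < T"
  shows "(\<integral>\<^sup>+\<omega>. ennreal ((norm (\<Sum>l\<in>Q. c l *\<^sub>R I l t \<omega>))\<^sup>2) \<partial>M)
    \<le> 4 * (\<integral>\<^sup>+\<omega>. (\<integral>\<^sup>+s\<in>{0..t}. ennreal ((norm (\<Sum>l\<in>Q. c l *\<^sub>R H l s \<omega>))\<^sup>2) \<partial>lborel) \<partial>M)"
proof -
  have "AE \<omega> in M. \<forall>l\<in>Q. I l 0 \<omega> = 0"
    using ito_integral_zero[OF filtered_brownian_axioms ito T] Q by (simp add: AE_finite_all)
  then have "(\<integral>\<^sup>+\<omega>. ennreal ((norm (\<Sum>l\<in>Q. c l *\<^sub>R I l t \<omega>))\<^sup>2) \<partial>M)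
    = (\<integral>\<^sup>+\<omega>. ennreal ((norm (\<Sum>l\<in>Q. c l *\<^sub>R (I l t \<omega> - I l 0 \<omega>)))\<^sup>2) \<partial>M)"
    by (intro nn_integral_cong_AE) (auto elim!: eventually_mono)
  then show ?thesis using ito_combination_bound[OF Q ito, where r=0 and t=t and c=c] t by simp
qed

lemma ito_moment:
  assumes ito: "is_ito_integral T M F W H I" and t: "t \<in> {0..T}" and T: "0 < T"
  shows "(\<integral>\<^sup>+\<omega>. ennreal ((norm (I t \<omega>))\<^sup>2) \<partial>M) \<le> 4 * (\<integral>\<^sup>+\<omega>. (\<integral>\<^sup>+s\<in>{0..t}. ennreal ((norm (H s \<omega>))\<^sup>2) \<partial>lborel) \<partial>M)"
  using ito_combination_moment[where Q="{()}" and H="\<lambda>_. H" and I="\<lambda>_. I" and t=t and c="\<lambda>_. 1"] assms by simp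

lemma ito_increment_moment:
  assumes ito: "is_ito_integral T M F W H I" and "0 \<le> r" "r \<le> t" "t \<le> T"
  shows "(\<integral>\<^sup>+\<omega>. ennreal ((norm (I t \<omega> - I r \<omega>))\<^sup>2) \<partial>M) \<le> 4 * (\<integral>\<^sup>+\<omega>. (\<integral>\<^sup>+s\<in>{r..t}. ennreal ((norm (H s \<omega>))\<^sup>2) \<partial>lborel) \<partial>M)"
  using ito_combination_bound[where Q="{()}" and H="\<lambda>_. H" and I="\<lambda>_. I" and r=r and t=t and c="\<lambda>_. 1"] assms by simp

text \<open>Almost sure continuity becomes a property of every path once the process is set to 0 on
  a null set. Joint measurability in time and outcome then follows from right continuity.\<close>

lemma ito_continuous_version:
  assumes ito: "is_ito_integral T M F W H I"
  obtains J where "\<And>t. t \<in> {0..T} \<Longrightarrow> J t \<in> borel_measurable M"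
    "\<And>\<omega>. right_continuous_on T (\<lambda>t. J t \<omega>)" "AE \<omega> in M. \<forall>t. J t \<omega> = I t \<omega>"
proof -
  have "AE \<omega> in M. continuous_on {0..T} (\<lambda>t. I t \<omega>)" using ito by (simp add: is_ito_integral_def)
  then obtain N where N: "{\<omega>\<in>space M. \<not> continuous_on {0..T} (\<lambda>t. I t \<omega>)} \<subseteq> N" "emeasure M N = 0" "N \<in> sets M"
    by (rule AE_E)
  define J where "J t \<omega> = (if \<omega> \<in> space M - N then I t \<omega> else 0)" for t \<omega>
  show ?thesis
  proof (rule that[of J])
    fix t assume "t \<in> {0..T}"
    then have [measurable]: "I t \<in> borel_measurable M"
      by (rule ito_measurable[OF ito])
    show "J t \<in> borel_measurable M" unfolding J_def using N by measurable
  next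
    fix \<omega>
    show "right_continuous_on T (\<lambda>t. J t \<omega>)"
    proof (cases "\<omega> \<in> space M - N")
      case True
      then have c: "continuous_on {0..T} (\<lambda>t. I t \<omega>)" using N by auto
      show ?thesis
        unfolding right_continuous_on_def
      proof
        fix t assume t: "t \<in> {0..<T}"
        then have "((\<lambda>t. I t \<omega>) \<longlongrightarrow> I t \<omega>) (at t within {0..T})"
          using c by (auto simp: continuous_on_def)
        then have "((\<lambda>t. I t \<omega>) \<longlongrightarrow> I t \<omega>) (at t within {t..T})" by (rule tendsto_within_subset) (use t in auto)
        then have "((\<lambda>t. I t \<omega>) \<longlongrightarrow> I t \<omega>) (at_right t)"
          using t at_within_Icc_at_right[of t T] by simp
        then show "((\<lambda>t. J t \<omega>) \<longlongrightarrow> J t \<omega>) (at_right t)" using True by (simp add: J_def)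
      qed
    next
      case False
      then have "J t \<omega> = 0" for t unfolding J_def by (rule if_not_P)
      then show ?thesis by (simp add: right_continuous_on_def)
    qed
  next
    have "AE \<omega> in M. \<omega> \<notin> N" using N by (intro AE_not_in) auto
    then show "AE \<omega> in M. \<forall>t. J t \<omega> = I t \<omega>"
      by (rule AE_mp) (auto intro!: AE_I2 simp: J_def)
  qed
qed

end

locale controlled_diffusion = filtered_brownian M T F W
  for M :: "'w measure" and T :: real and F :: "real \<Rightarrow> 'w measure" and W :: "real \<Rightarrow> 'w \<Rightarrow> real^'d" +
  fixes b :: "real \<Rightarrow> real^'n \<Rightarrow> real^'n" and \<sigma> :: "real \<Rightarrow> real^'n \<Rightarrow> real^'d^'n"
    and \<zeta> :: "real \<Rightarrow> real^'m^'n" and x0 :: "real^'n" and L :: real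
  assumes T: "0 < T"
    and b_meas: "(\<lambda>(t, x). b t x) \<in> borel_measurable (restrict_space borel {0..T} \<Otimes>\<^sub>M borel)"
    and b_lipschitz: "\<And>t. t \<in> {0..T} \<Longrightarrow> L-lipschitz_on UNIV (b t)"
    and \<sigma>_lipschitz: "\<And>t. t \<in> {0..T} \<Longrightarrow> L-lipschitz_on UNIV (\<sigma> t)"
    and \<zeta>_cont: "continuous_on {0..T} \<zeta>"
begin

lemma L_nonneg: "0 \<le> L"
  using b_lipschitz[of 0] T by (auto intro: lipschitz_on_nonneg)

lemma b_diff_le: "t \<in> {0..T} \<Longrightarrow> norm (b t x - b t y) \<le> L * norm (x - y)"
  using lipschitz_onD[OF b_lipschitz, of t x y] by (simp add: dist_norm)

lemma \<sigma>_diff_le: "t \<in> {0..T} \<Longrightarrow> norm (\<sigma> t x - \<sigma> t y) \<le> L * norm (x - y)"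
  using lipschitz_onD[OF \<sigma>_lipschitz, of t x y] by (simp add: dist_norm)

definition control_process :: "(real \<Rightarrow> 'w \<Rightarrow> real^'m) \<Rightarrow> real \<Rightarrow> 'w \<Rightarrow> real^'n" where
  "control_process \<xi> t \<omega> = (\<chi> i. \<Sum>j\<in>UNIV. LINT s:{0..t}|control_measure T \<xi> j \<omega>. \<zeta> s $ i $ j)"

lemma control_process_bound:
  obtains c where "0 \<le> c" "\<And>(\<xi> :: real \<Rightarrow> 'w \<Rightarrow> real^'m) \<omega> t. \<xi> \<in> admissible_controls T M F \<Longrightarrow> \<omega> \<in> space M \<Longrightarrow> t \<in> {0..T} \<Longrightarrow>
    norm (control_process \<xi> t \<omega>) \<le> c * norm (\<xi> T \<omega>)"
proof -
  obtain B where "\<forall>x\<in>\<zeta> ` {0..T}. norm x \<le> B"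
    using compact_imp_bounded[OF compact_continuous_image[OF \<zeta>_cont compact_Icc]] unfolding bounded_iff by blast
  then have B: "\<And>s. s \<in> {0..T} \<Longrightarrow> norm (\<zeta> s) \<le> B" by auto
  have Bc: "\<bar>\<zeta> s $ i $ j\<bar> \<le> B" if "s \<in> {0..T}" for s i j
    using B[OF that] Finite_Cartesian_Product.norm_nth_le[of "\<zeta> s" i] component_le_norm_cart[of "\<zeta> s $ i" j] by linarith
  have c: "continuous_on {0..T} (\<lambda>s. \<zeta> s $ i $ j)" for i j
    by (intro continuous_intros \<zeta>_cont)
  have B0: "0 \<le> B" by (rule order_trans[OF norm_ge_zero B[of 0]]) (use T in simp)
  show ?thesis
  proof (rule that[of "real (CARD('n)) * (real (CARD('m)) * B)"])
    fix \<xi> :: "real \<Rightarrow> 'w \<Rightarrow> real^'m" and \<omega> t assume a: "\<xi> \<in> admissible_controls T M F" "\<omega> \<in> space M" "t \<in> {0..T}"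
    have "norm (control_process \<xi> t \<omega>) \<le> (\<Sum>i\<in>UNIV. \<bar>control_process \<xi> t \<omega> $ i\<bar>)" by (rule norm_le_l1_cart)
    also have "\<dots> \<le> (\<Sum>i\<in>(UNIV :: 'n set). \<Sum>j\<in>(UNIV :: 'm set). B * norm (\<xi> T \<omega>))"
      unfolding control_process_def vec_lambda_beta
      by (intro sum_mono order_trans[OF sum_abs] control_integral_bound[OF a(1,2) T c a(3) Bc])
    finally show "norm (control_process \<xi> t \<omega>) \<le> real (CARD('n)) * (real (CARD('m)) * B) * norm (\<xi> T \<omega>)"
      by (simp add: mult.assoc)
  qed (use B0 in auto)
qed

end

text \<open>The intervals shrink to the null set \<open>{t}\<close>, and the integrand restricted to
  \<open>{0..T}\<close> dominates.\<close>

lemma nn_integral_Icc_right_tendsto: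
  fixes f :: "real \<Rightarrow> ennreal"
  assumes [measurable]: "f \<in> borel_measurable borel" and fin: "(\<integral>\<^sup>+s\<in>{0..T}. f s \<partial>lborel) < \<infinity>"
    and t: "0 \<le> t" and S: "\<And>n. t < S n" "\<And>n. S n < T" "S \<longlonglongrightarrow> t"
  shows "(\<lambda>n. \<integral>\<^sup>+s\<in>{t..S n}. f s \<partial>lborel) \<longlonglongrightarrow> 0"
proof -
  have "(\<lambda>n. \<integral>\<^sup>+s\<in>{t..S n}. f s \<partial>lborel) \<longlonglongrightarrow> (\<integral>\<^sup>+s. 0 \<partial>(lborel :: real measure))"
  proof (rule nn_integral_dominated_convergence[where w="\<lambda>s. f s * indicator {0..T} s"])
    show "AE s in lborel. f s * indicator {t..S n} s \<le> f s * indicator {0..T} s" for n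
    proof (intro AE_I2)
      fix s show "f s * indicator {t..S n} s \<le> f s * indicator {0..T} s"
        using t S(2)[of n] by (auto simp: indicator_def)
    qed
    show "AE s in lborel. (\<lambda>n. f s * indicator {t..S n} s) \<longlonglongrightarrow> 0"
      using AE_lborel_singleton[of t]
    proof eventually_elim
      case (elim s)
      have "\<forall>\<^sub>F n in sequentially. f s * indicator {t..S n} s = 0"
      proof (cases "s < t")
        case True then show ?thesis by simp
      next
        case False
        then have "t < s" using elim by simp
        with S(3) have "\<forall>\<^sub>F n in sequentially. S n < s" by (rule order_tendstoD(2))
        then show ?thesis by eventually_elim auto
      qed
      then show ?case by (rule tendsto_eventually)
    qed
  qed (use fin in auto)
  then show ?thesis by simp
qed

section \<open>Second moments of the state and their continuity in time\<close>

locale controlled_state = controlled_diffusion M T F W b \<sigma> \<zeta> x0 L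
  for M :: "'w measure" and T F and W :: "real \<Rightarrow> 'w \<Rightarrow> real^'d"
    and b :: "real \<Rightarrow> real^'n \<Rightarrow> real^'n" and \<sigma> and \<zeta> :: "real \<Rightarrow> real^'m^'n" and x0 L +
  fixes \<xi> :: "real \<Rightarrow> 'w \<Rightarrow> real^'m" and X :: "real \<Rightarrow> 'w \<Rightarrow> real^'n"
  assumes \<xi>: "\<xi> \<in> admissible_controls T M F" and sol: "solves_state_equation T M F W b \<sigma> \<zeta> x0 \<xi> X"
begin

lemma X_measurable: "t \<in> {0..T} \<Longrightarrow> X t \<in> borel_measurable M"
proof -
  assume t: "t \<in> {0..T}"
  then have "X t \<in> borel_measurable (F t)" using sol unfolding solves_state_equation_def by blast
  then show ?thesis by (rule measurable_F_imp_M[OF t])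
qed

lemma X_cadlag: "\<omega> \<in> space M \<Longrightarrow> cadlag_on T (\<lambda>t. X t \<omega>)"
  using sol unfolding solves_state_equation_def by blast

lemma X_right_continuous: "\<omega> \<in> space M \<Longrightarrow> right_continuous_on T (\<lambda>t. X t \<omega>)"
  by (intro cadlag_imp_right_continuous X_cadlag)

lemma X_joint: "(\<lambda>p. X (fst p) (snd p)) \<in> borel_measurable (restrict_space borel {0..T} \<Otimes>\<^sub>M M)"
  using T by (intro measurable_right_continuous X_measurable X_right_continuous) auto

lemma state_equation:
  obtains I where "is_ito_integral T M F W (\<lambda>s \<omega>. \<sigma> s (X s \<omega>)) I"
    "AE \<omega> in M. \<forall>t\<in>{0..T}. X t \<omega> = x0 + (LBINT s:{0..t}. b s (X s \<omega>)) + I t \<omega> + control_process \<xi> t \<omega>"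
  using sol unfolding solves_state_equation_def control_process_def by blast

lemma drift_integrable: "AE \<omega> in M. set_integrable lborel {0..T} (\<lambda>s. b s (X s \<omega>))"
  using sol unfolding solves_state_equation_def by blast

definition Xsq :: "real \<Rightarrow> 'w \<Rightarrow> ennreal" where
  "Xsq s \<omega> = ennreal ((norm (X s \<omega>))\<^sup>2) * indicator {0..T} s"

lemma Xsq_joint[measurable]: "(\<lambda>p. Xsq (fst p) (snd p)) \<in> borel_measurable (borel \<Otimes>\<^sub>M M)"
proof -
  have "(\<lambda>p. ennreal ((norm (X (fst p) (snd p)))\<^sup>2)) \<in> borel_measurable (restrict_space borel {0..T} \<Otimes>\<^sub>M M)"
    using X_joint by measurable
  from borel_measurable_extend_indicator[OF this] show ?thesis by (simp add: Xsq_def)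
qed

lemma section_measurable:
  assumes "(\<lambda>p. f (fst p) (snd p)) \<in> borel_measurable (borel \<Otimes>\<^sub>M M)" "\<omega> \<in> space M"
  shows "(\<lambda>s::real. f s \<omega> :: ennreal) \<in> borel_measurable borel"
  using measurable_compose[OF measurable_Pair2'[OF assms(2), of borel] assms(1)] by simp

lemma X_path: "\<omega> \<in> space M \<Longrightarrow> (\<lambda>s. X s \<omega>) \<in> borel_measurable (restrict_space borel {0..T})"
  using measurable_compose[OF measurable_Pair2'[of \<omega> M "restrict_space borel {0..T}"] X_joint] by simp

lemma b_const_measurable: "(\<lambda>s. b s y) \<in> borel_measurable (restrict_space borel {0..T})"
  using measurable_compose[OF measurable_Pair2'[of y borel "restrict_space borel {0..T}"] b_meas] by simp

definition \<beta> :: ennreal where "\<beta> = (\<integral>\<^sup>+s\<in>{0..T}. ennreal (norm (b s 0)) \<partial>lborel)"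

lemma measurable_indicator_restrict:
  assumes "f \<in> borel_measurable (restrict_space borel {0..T})"
  shows "(\<lambda>s. (f s :: ennreal) * indicator {0..T} s) \<in> borel_measurable borel"
  using assms by (subst (asm) borel_measurable_restrict_space_iff_ennreal) auto

text \<open>A single path suffices: the drift along it is integrable, the path is bounded by some
  \<open>B\<close>, and by the Lipschitz condition \<open>b s 0\<close> differs from the drift along
  it by at most \<open>L * B\<close>.\<close>

lemma \<beta>_finite: "\<beta> < \<infinity>"
proof -
  have "\<exists>\<omega>\<in>space M. set_integrable lborel {0..T} (\<lambda>s. b s (X s \<omega>))"
  proof (rule ccontr)
    assume "\<not> ?thesis"
    then have "AE \<omega> in M. False" using drift_integrable by (elim AE_mp) (auto intro!: AE_I2)
    then show False by simp
  qed
  then obtain \<omega> where \<omega>: "\<omega> \<in> space M" "set_integrable lborel {0..T} (\<lambda>s. b s (X s \<omega>))" by blast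
  obtain B where B: "\<And>t. t \<in> {0..T} \<Longrightarrow> norm (X t \<omega>) \<le> B"
    using cadlag_bounded[OF X_cadlag[OF \<omega>(1)]] T by (meson less_imp_le)
  have B0: "0 \<le> B" by (rule order_trans[OF norm_ge_zero B[of 0]]) (use T in simp)
  have i: "integrable lborel (\<lambda>s. indicator {0..T} s *\<^sub>R b s (X s \<omega>))" using \<omega>(2) by (simp add: set_integrable_def)
  then have fin: "(\<integral>\<^sup>+s. ennreal (norm (indicator {0..T} s *\<^sub>R b s (X s \<omega>))) \<partial>lborel) < \<infinity>"
    by (simp add: integrable_iff_bounded)
  have "\<beta> \<le> (\<integral>\<^sup>+s. ennreal (norm (indicator {0..T} s *\<^sub>R b s (X s \<omega>))) + ennreal (L * B) * indicator {0..T} s \<partial>lborel)"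
    unfolding \<beta>_def
  proof (rule nn_integral_mono)
    fix s
    show "ennreal (norm (b s 0)) * indicator {0..T} s \<le> ennreal (norm (indicator {0..T} s *\<^sub>R b s (X s \<omega>))) + ennreal (L * B) * indicator {0..T} s"
    proof (cases "s \<in> {0..T}")
      case True
      have "norm (b s 0) \<le> norm (b s (X s \<omega>)) + norm (b s 0 - b s (X s \<omega>))"
        using norm_triangle_ineq[of "b s (X s \<omega>)" "b s 0 - b s (X s \<omega>)"] by simp
      also have "\<dots> \<le> norm (b s (X s \<omega>)) + L * B"
        using b_diff_le[OF True, of 0 "X s \<omega>"] mult_left_mono[OF B[OF True] L_nonneg] by simp
      finally have "ennreal (norm (b s 0)) \<le> ennreal (norm (b s (X s \<omega>)) + L * B)" by (rule ennreal_leI)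
      also have "\<dots> = ennreal (norm (b s (X s \<omega>))) + ennreal (L * B)" using L_nonneg B0 by (simp add: ennreal_plus)
      finally show ?thesis using True by simp
    qed simp
  qed
  also have "\<dots> = (\<integral>\<^sup>+s. ennreal (norm (indicator {0..T} s *\<^sub>R b s (X s \<omega>))) \<partial>lborel) + ennreal (L * B) * ennreal T"
  proof -
    have m: "(\<lambda>s. ennreal (norm (indicator {0..T} s *\<^sub>R b s (X s \<omega>)))) \<in> borel_measurable lborel"
      by (rule measurable_compose[OF borel_measurable_integrable[OF i], of "\<lambda>v. ennreal (norm v)" borel]) simp
    have "(\<integral>\<^sup>+s. ennreal (L * B) * indicator {0..T} s \<partial>lborel) = ennreal (L * B) * ennreal T"
      using T by (simp add: nn_integral_cmult)
    moreover have "(\<lambda>s. ennreal (L * B) * indicator {0..T} s) \<in> borel_measurable lborel" by measurable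
    ultimately show ?thesis by (simp only: nn_integral_add[OF m])
  qed
  also have "\<dots> < \<infinity>" using fin by (simp add: ennreal_mult_less_top)
  finally show ?thesis .
qed

definition q :: "'w \<Rightarrow> real \<Rightarrow> ennreal" where "q \<omega> t = (\<integral>\<^sup>+s\<in>{0..t}. Xsq s \<omega> \<partial>lborel)"

lemma q_mono: "s \<le> t \<Longrightarrow> q \<omega> s \<le> q \<omega> t"
  unfolding q_def by (intro nn_integral_mono) (auto simp: indicator_def)

lemma q_measurable: "(\<lambda>\<omega>. q \<omega> T) \<in> borel_measurable M"
proof -
  have "(\<lambda>p. Xsq (fst p) (snd p)) \<in> borel_measurable (lborel \<Otimes>\<^sub>M M)" using Xsq_joint by (simp cong: measurable_cong_sets)
  from measurable_compose[OF measurable_pair_swap' this] show ?thesis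
    unfolding q_def by (intro lborel.borel_measurable_nn_integral) (simp add: case_prod_beta')
qed

text \<open>The Lipschitz condition splits the drift into \<open>b s 0\<close>, collected in
  \<open>\<beta>\<close>, and a multiple of the norm of the state. Cauchy-Schwarz in time turns the
  latter into the integral of the square at the price of a factor \<open>T\<close>.\<close>

lemma drift_sq_bound:
  assumes \<omega>: "\<omega> \<in> space M" "set_integrable lborel {0..T} (\<lambda>s. b s (X s \<omega>))" and t: "t \<in> {0..T}"
  shows "ennreal ((norm (LBINT s:{0..t}. b s (X s \<omega>)))\<^sup>2) \<le> 2 * \<beta>\<^sup>2 + ennreal (2 * L\<^sup>2 * T) * q \<omega> t"
proof -
  define f where "f s = ennreal (norm (X s \<omega>)) * indicator {0..T} s" for s
  have f_m: "f \<in> borel_measurable borel"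
    unfolding f_def using X_path[OF \<omega>(1)] by (intro measurable_indicator_restrict) measurable
  have b0_m: "(\<lambda>s. ennreal (norm (b s 0)) * indicator {0..T} s) \<in> borel_measurable borel"
    using b_const_measurable by (intro measurable_indicator_restrict) measurable
  have "integrable lborel (\<lambda>s. indicator {0..t} s *\<^sub>R b s (X s \<omega>))"
    using set_integrable_subset[OF \<omega>(2), of "{0..t}"] t by (simp add: set_integrable_def)
  then have "ennreal (norm (LBINT s:{0..t}. b s (X s \<omega>))) \<le> (\<integral>\<^sup>+s. ennreal (norm (indicator {0..t} s *\<^sub>R b s (X s \<omega>))) \<partial>lborel)"
    unfolding set_lebesgue_integral_def by (rule integral_norm_bound_ennreal)
  also have "\<dots> \<le> (\<integral>\<^sup>+s. ennreal (norm (b s 0)) * indicator {0..T} s + ennreal L * (f s * indicator {0..t} s) \<partial>lborel)"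
  proof (rule nn_integral_mono)
    fix s
    show "ennreal (norm (indicator {0..t} s *\<^sub>R b s (X s \<omega>))) \<le> ennreal (norm (b s 0)) * indicator {0..T} s + ennreal L * (f s * indicator {0..t} s)"
    proof (cases "s \<in> {0..t}")
      case True
      then have sT: "s \<in> {0..T}" using t by auto
      have "norm (b s (X s \<omega>)) \<le> norm (b s 0) + norm (b s (X s \<omega>) - b s 0)"
        using norm_triangle_ineq[of "b s 0" "b s (X s \<omega>) - b s 0"] by simp
      also have "\<dots> \<le> norm (b s 0) + L * norm (X s \<omega>)" using b_diff_le[OF sT, of "X s \<omega>" 0] by simp
      finally have "ennreal (norm (b s (X s \<omega>))) \<le> ennreal (norm (b s 0) + L * norm (X s \<omega>))" by (rule ennreal_leI)
      also have "\<dots> = ennreal (norm (b s 0)) + ennreal L * ennreal (norm (X s \<omega>))"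
        using L_nonneg by (simp add: ennreal_plus ennreal_mult')
      finally show ?thesis using True sT by (simp add: f_def)
    qed simp
  qed
  also have "\<dots> = \<beta> + ennreal L * (\<integral>\<^sup>+s\<in>{0..t}. f s \<partial>lborel)"
    unfolding \<beta>_def using f_m b0_m by (subst nn_integral_add) (auto simp: nn_integral_cmult)
  finally have 1: "ennreal (norm (LBINT s:{0..t}. b s (X s \<omega>))) \<le> \<beta> + ennreal L * (\<integral>\<^sup>+s\<in>{0..t}. f s \<partial>lborel)" .
  have "ennreal ((norm (LBINT s:{0..t}. b s (X s \<omega>)))\<^sup>2) = (ennreal (norm (LBINT s:{0..t}. b s (X s \<omega>))))\<^sup>2"
    by (simp add: ennreal_power)
  also have "\<dots> \<le> (\<beta> + ennreal L * (\<integral>\<^sup>+s\<in>{0..t}. f s \<partial>lborel))\<^sup>2"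
    using 1 by (rule power_mono) simp
  also have "\<dots> \<le> 2 * \<beta>\<^sup>2 + 2 * (ennreal L * (\<integral>\<^sup>+s\<in>{0..t}. f s \<partial>lborel))\<^sup>2"
    by (rule ennreal_add_sq_le)
  also have "(ennreal L * (\<integral>\<^sup>+s\<in>{0..t}. f s \<partial>lborel))\<^sup>2 = (ennreal L)\<^sup>2 * (\<integral>\<^sup>+s\<in>{0..t}. f s \<partial>lborel)\<^sup>2"
    by (rule power_mult_distrib)
  also have "(ennreal L)\<^sup>2 * (\<integral>\<^sup>+s\<in>{0..t}. f s \<partial>lborel)\<^sup>2 \<le> ennreal (L\<^sup>2) * (ennreal T * (\<integral>\<^sup>+s\<in>{0..t}. (f s)\<^sup>2 \<partial>lborel))"
  proof (rule mult_mono)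
    have "(\<integral>\<^sup>+s\<in>{0..t}. f s \<partial>lborel)\<^sup>2 \<le> ennreal t * (\<integral>\<^sup>+s\<in>{0..t}. (f s)\<^sup>2 \<partial>lborel)"
      using t by (intro nn_integral_sq_le f_m) auto
    also have "\<dots> \<le> ennreal T * (\<integral>\<^sup>+s\<in>{0..t}. (f s)\<^sup>2 \<partial>lborel)" using t by (intro mult_right_mono ennreal_leI) auto
    finally show "(\<integral>\<^sup>+s\<in>{0..t}. f s \<partial>lborel)\<^sup>2 \<le> ennreal T * (\<integral>\<^sup>+s\<in>{0..t}. (f s)\<^sup>2 \<partial>lborel)" .
  qed (use L_nonneg in \<open>auto simp: ennreal_power\<close>)
  also have "(\<integral>\<^sup>+s\<in>{0..t}. (f s)\<^sup>2 \<partial>lborel) = q \<omega> t"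
    unfolding q_def f_def Xsq_def
    by (intro nn_integral_cong) (auto simp: indicator_def ennreal_power)
  also have "2 * (ennreal (L\<^sup>2) * (ennreal T * q \<omega> t)) = ennreal (2 * L\<^sup>2 * T) * q \<omega> t"
    using T by (simp add: ennreal_mult' mult.assoc)
  finally show ?thesis by (simp add: add_left_mono mult_left_mono)
qed

text \<open>All moment estimates are pathwise Gronwall estimates with the Ito integral as inhomogeneity,
  so no localization by stopping times is needed.\<close>
lemma state_moments:
  obtains R where "0 \<le> R" "\<And>t. t \<in> {0..T} \<Longrightarrow> (\<integral>\<^sup>+\<omega>. ennreal ((norm (X t \<omega>))\<^sup>2) \<partial>M) \<le> ennreal R"
    "(\<integral>\<^sup>+\<omega>. q \<omega> T \<partial>M) < \<infinity>"
proof -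
  obtain I where ito: "is_ito_integral T M F W (\<lambda>s \<omega>. \<sigma> s (X s \<omega>)) I"
    and eq: "AE \<omega> in M. \<forall>t\<in>{0..T}. X t \<omega> = x0 + (LBINT s:{0..t}. b s (X s \<omega>)) + I t \<omega> + control_process \<xi> t \<omega>"
    by (rule state_equation)
  obtain J where J: "\<And>t. t \<in> {0..T} \<Longrightarrow> J t \<in> borel_measurable M"
    "\<And>\<omega>. right_continuous_on T (\<lambda>t. J t \<omega>)" "AE \<omega> in M. \<forall>t. J t \<omega> = I t \<omega>"
    using ito_continuous_version[OF ito] by blast
  obtain c where c: "0 \<le> c" "\<And>(\<xi> :: real \<Rightarrow> 'w \<Rightarrow> real^'m) \<omega> t. \<xi> \<in> admissible_controls T M F \<Longrightarrow> \<omega> \<in> space M \<Longrightarrow> t \<in> {0..T} \<Longrightarrow>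
    norm (control_process \<xi> t \<omega>) \<le> c * norm (\<xi> T \<omega>)"
  proof (rule control_process_bound)
    fix c assume "0 \<le> c" "\<And>(\<xi> :: real \<Rightarrow> 'w \<Rightarrow> real^'m) \<omega> t. \<xi> \<in> admissible_controls T M F \<Longrightarrow> \<omega> \<in> space M \<Longrightarrow> t \<in> {0..T} \<Longrightarrow>
      norm (control_process \<xi> t \<omega>) \<le> c * norm (\<xi> T \<omega>)"
    then show ?thesis by (rule that)
  qed
  have \<xi>T[measurable]: "\<xi> T \<in> borel_measurable M"
    by (rule measurable_F_imp_M[OF _ admissible_controlsD(1)[OF \<xi>]]) (use T in auto)
  define h where "h = (\<integral>\<^sup>+\<omega>. (\<integral>\<^sup>+s\<in>{0..T}. ennreal ((norm (\<sigma> s (X s \<omega>)))\<^sup>2) \<partial>lborel) \<partial>M)"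
  have h: "h < \<infinity>" using ito unfolding h_def is_ito_integral_def by blast
  \<comment> \<open>Everything on the right-hand side except the integral of the squared state. Each
    4 stems from splitting the state into four summands by two applications of the inequality for
    the square of a sum; the 8 contains in addition the factor 2 from
    \<open>drift_sq_bound\<close>.\<close>
  define a where "a t \<omega> = (4 * ennreal ((norm x0)\<^sup>2) + 8 * \<beta>\<^sup>2 + 4 * ennreal (c\<^sup>2) * ennreal ((norm (\<xi> T \<omega>))\<^sup>2) + 4 * ennreal ((norm (J t \<omega>))\<^sup>2)) * indicator {0..T} t" for t \<omega>
  have a_joint: "(\<lambda>p. a (fst p) (snd p)) \<in> borel_measurable (borel \<Otimes>\<^sub>M M)"
  proof -
    have [measurable]: "(\<lambda>p. J (fst p) (snd p)) \<in> borel_measurable (restrict_space borel {0..T} \<Otimes>\<^sub>M M)"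
      using T by (intro measurable_right_continuous J) auto
    have "(\<lambda>p. 4 * ennreal ((norm x0)\<^sup>2) + 8 * \<beta>\<^sup>2 + 4 * ennreal (c\<^sup>2) * ennreal ((norm (\<xi> T (snd p)))\<^sup>2) + 4 * ennreal ((norm (J (fst p) (snd p)))\<^sup>2))
      \<in> borel_measurable (restrict_space borel {0..T} \<Otimes>\<^sub>M M)" by measurable
    then show ?thesis unfolding a_def by (rule borel_measurable_extend_indicator) simp
  qed
  \<comment> \<open>Four times the factor in \<open>drift_sq_bound\<close>; the added 1 makes the
    constant positive also for \<open>L = 0\<close>.\<close>
  define C0 where "C0 = 8 * L\<^sup>2 * T + 1"
  have C0: "0 < C0" using T unfolding C0_def by (intro add_nonneg_pos) auto
  have path: "AE \<omega> in M. \<forall>t\<in>{0..T}. Xsq t \<omega> \<le> a t \<omega> + ennreal C0 * q \<omega> t"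
    using eq J(3) drift_integrable AE_space
  proof eventually_elim
    case (elim \<omega>)
    show ?case
    proof
      fix t assume t: "t \<in> {0..T}"
      let ?B = "LBINT s:{0..t}. b s (X s \<omega>)" and ?A = "control_process \<xi> t \<omega>"
      have "X t \<omega> = (x0 + ?B) + (J t \<omega> + ?A)" using elim t by (simp add: add.assoc)
      then have "ennreal ((norm (X t \<omega>))\<^sup>2) \<le> 2 * ennreal ((norm (x0 + ?B))\<^sup>2) + 2 * ennreal ((norm (J t \<omega> + ?A))\<^sup>2)"
        using ennreal_norm_add_sq_le[of "x0 + ?B" "J t \<omega> + ?A"] by simp
      also have "\<dots> \<le> 2 * (2 * ennreal ((norm x0)\<^sup>2) + 2 * ennreal ((norm ?B)\<^sup>2)) + 2 * (2 * ennreal ((norm (J t \<omega>))\<^sup>2) + 2 * ennreal ((norm ?A)\<^sup>2))"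
        by (intro add_mono mult_left_mono ennreal_norm_add_sq_le) auto
      also have "\<dots> \<le> 2 * (2 * ennreal ((norm x0)\<^sup>2) + 2 * (2 * \<beta>\<^sup>2 + ennreal (2 * L\<^sup>2 * T) * q \<omega> t))
        + 2 * (2 * ennreal ((norm (J t \<omega>))\<^sup>2) + 2 * (ennreal (c\<^sup>2) * ennreal ((norm (\<xi> T \<omega>))\<^sup>2)))"
      proof (intro add_mono mult_left_mono order_refl drift_sq_bound t)
        have "(norm ?A)\<^sup>2 \<le> (c * norm (\<xi> T \<omega>))\<^sup>2" using c(2)[OF \<xi> _ t] elim by (intro power_mono) auto
        then show "ennreal ((norm ?A)\<^sup>2) \<le> ennreal (c\<^sup>2) * ennreal ((norm (\<xi> T \<omega>))\<^sup>2)"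
          by (simp add: power_mult_distrib ennreal_mult'[symmetric] ennreal_leI)
      qed (use elim in auto)
      also have "\<dots> = 4 * ennreal ((norm x0)\<^sup>2) + 8 * \<beta>\<^sup>2 + 4 * ennreal (c\<^sup>2) * ennreal ((norm (\<xi> T \<omega>))\<^sup>2) + 4 * ennreal ((norm (J t \<omega>))\<^sup>2)
        + 4 * ennreal (2 * L\<^sup>2 * T) * q \<omega> t"
        by (simp add: distrib_left mult.assoc[symmetric] add_ac)
      also have "4 * ennreal (2 * L\<^sup>2 * T) * q \<omega> t \<le> ennreal C0 * q \<omega> t"
      proof (rule mult_right_mono)
        have "4 * ennreal (2 * L\<^sup>2 * T) = ennreal (8 * L\<^sup>2 * T)" by (simp add: ennreal_mult'' ennreal_numeral[symmetric] ennreal_mult'[symmetric] mult.assoc del: ennreal_numeral)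
        also have "\<dots> \<le> ennreal C0" unfolding C0_def by (rule ennreal_leI) simp
        finally show "4 * ennreal (2 * L\<^sup>2 * T) \<le> ennreal C0" .
      qed simp
      finally show "Xsq t \<omega> \<le> a t \<omega> + ennreal C0 * q \<omega> t"
        using t by (simp add: Xsq_def a_def add_left_mono)
    qed
  qed
  define k where "k = ennreal (2 * exp (2 * C0 * T))"
  have qT: "AE \<omega> in M. q \<omega> T \<le> k * (\<integral>\<^sup>+t\<in>{0..T}. a t \<omega> \<partial>lborel)"
    using path AE_space
  proof eventually_elim
    case (elim \<omega>)
    \<comment> \<open>Paths are bounded, so the finiteness that Gronwall requires holds for each
      outcome before any moment is known to exist.\<close>
    obtain B where B: "\<And>t. t \<in> {0..T} \<Longrightarrow> norm (X t \<omega>) \<le> B"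
      using cadlag_bounded[OF X_cadlag[OF elim(2)]] T by (meson less_imp_le)
    have "(\<integral>\<^sup>+t\<in>{0..T}. Xsq t \<omega> \<partial>lborel) \<le> (\<integral>\<^sup>+t. ennreal (B\<^sup>2) * indicator {0..T} t \<partial>lborel)"
    proof (rule nn_integral_mono)
      fix t
      show "Xsq t \<omega> * indicator {0..T} t \<le> ennreal (B\<^sup>2) * indicator {0..T} t"
        using power_mono[OF B norm_ge_zero, of t 2] by (auto simp: Xsq_def indicator_def intro!: ennreal_leI)
    qed
    also have "\<dots> < \<infinity>" using T by (simp add: nn_integral_cmult ennreal_mult_less_top)
    finally have fin: "(\<integral>\<^sup>+t\<in>{0..T}. Xsq t \<omega> \<partial>lborel) < \<infinity>" .
    show ?case
      unfolding k_def q_def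
    proof (rule gronwall_integral[OF _ _ C0 fin])
      show "(\<lambda>t. Xsq t \<omega>) \<in> borel_measurable borel" "(\<lambda>t. a t \<omega>) \<in> borel_measurable borel"
        using section_measurable[OF Xsq_joint elim(2)] section_measurable[OF a_joint elim(2)] by auto
    qed (use elim(1) in \<open>auto simp: q_def\<close>)
  qed
  \<comment> \<open>A bound, uniform in time, for the expectation of \<open>a t\<close>. In the last
    term one 4 is inherited from \<open>a\<close> and the other comes from the second moment bound
    for the Ito integral.\<close>
  define Ka where "Ka = 4 * ennreal ((norm x0)\<^sup>2) + 8 * \<beta>\<^sup>2 + 4 * ennreal (c\<^sup>2) * (\<integral>\<^sup>+\<omega>. ennreal ((norm (\<xi> T \<omega>))\<^sup>2) \<partial>M) + 4 * (4 * h)"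
  have Ka: "Ka < \<infinity>"
  proof -
    have "(\<integral>\<^sup>+\<omega>. ennreal ((norm (\<xi> T \<omega>))\<^sup>2) \<partial>M) < \<infinity>"
      using admissible_controlsD(5)[OF \<xi>] by (simp add: integrable_iff_bounded)
    then show ?thesis using h \<beta>_finite unfolding Ka_def by (simp add: ennreal_mult_less_top power2_eq_square)
  qed
  have Ea: "(\<integral>\<^sup>+\<omega>. a t \<omega> \<partial>M) \<le> Ka" if t: "t \<in> {0..T}" for t
  proof -
    have [measurable]: "J t \<in> borel_measurable M" using J(1)[OF t] .
    have "(\<integral>\<^sup>+\<omega>. ennreal ((norm (J t \<omega>))\<^sup>2) \<partial>M) = (\<integral>\<^sup>+\<omega>. ennreal ((norm (I t \<omega>))\<^sup>2) \<partial>M)"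
      by (rule nn_integral_cong_AE) (use J(3) in eventually_elim, simp)
    also have "\<dots> \<le> 4 * (\<integral>\<^sup>+\<omega>. (\<integral>\<^sup>+s\<in>{0..t}. ennreal ((norm (\<sigma> s (X s \<omega>)))\<^sup>2) \<partial>lborel) \<partial>M)"
      by (rule ito_moment[OF ito t T])
    also have "\<dots> \<le> 4 * h"
      unfolding h_def using t by (intro mult_left_mono nn_integral_mono) (auto simp: indicator_def)
    finally have "4 * (\<integral>\<^sup>+\<omega>. ennreal ((norm (J t \<omega>))\<^sup>2) \<partial>M) \<le> 4 * (4 * h)" by (intro mult_left_mono) auto
    moreover have "(\<integral>\<^sup>+\<omega>. a t \<omega> \<partial>M) = 4 * ennreal ((norm x0)\<^sup>2) + 8 * \<beta>\<^sup>2 + 4 * ennreal (c\<^sup>2) * (\<integral>\<^sup>+\<omega>. ennreal ((norm (\<xi> T \<omega>))\<^sup>2) \<partial>M) + 4 * (\<integral>\<^sup>+\<omega>. ennreal ((norm (J t \<omega>))\<^sup>2) \<partial>M)"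
      using t unfolding a_def by (simp add: nn_integral_add nn_integral_cmult emeasure_space_1)
    ultimately show ?thesis unfolding Ka_def by (simp add: add_left_mono)
  qed
  define Ia where "Ia = (\<integral>\<^sup>+\<omega>. (\<integral>\<^sup>+t\<in>{0..T}. a t \<omega> \<partial>lborel) \<partial>M)"
  have a_swap: "(\<lambda>p. a (snd p) (fst p)) \<in> borel_measurable (M \<Otimes>\<^sub>M lborel)"
  proof -
    have "(\<lambda>p. a (fst p) (snd p)) \<in> borel_measurable (lborel \<Otimes>\<^sub>M M)" using a_joint by (simp cong: measurable_cong_sets)
    from measurable_compose[OF measurable_pair_swap' this] show ?thesis by (simp add: case_prod_beta')
  qed
  have a_path_m: "(\<lambda>\<omega>. \<integral>\<^sup>+t\<in>{0..T}. a t \<omega> \<partial>lborel) \<in> borel_measurable M"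
    using a_swap by (intro lborel.borel_measurable_nn_integral) (simp add: case_prod_beta')
  have "Ia = (\<integral>\<^sup>+t. (\<integral>\<^sup>+\<omega>. a t \<omega> * indicator {0..T} t \<partial>M) \<partial>lborel)"
  proof -
    interpret P: pair_sigma_finite lborel M by unfold_locales
    have "(\<lambda>p. a (fst p) (snd p) * indicator {0..T} (fst p)) \<in> borel_measurable (lborel \<Otimes>\<^sub>M M)"
      using a_joint by (simp cong: measurable_cong_sets)
    from P.Fubini[OF this] show ?thesis unfolding Ia_def by simp
  qed
  also have "\<dots> \<le> (\<integral>\<^sup>+t. Ka * indicator {0..T} t \<partial>lborel)"
    using Ea by (intro nn_integral_mono) (auto simp: indicator_def)
  also have "\<dots> = Ka * ennreal T" using T by (simp add: nn_integral_cmult)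
  finally have Ia: "Ia < \<infinity>" using Ka by (auto simp: ennreal_mult_less_top intro: order.strict_trans1)
  have "(\<integral>\<^sup>+\<omega>. q \<omega> T \<partial>M) \<le> (\<integral>\<^sup>+\<omega>. k * (\<integral>\<^sup>+t\<in>{0..T}. a t \<omega> \<partial>lborel) \<partial>M)"
    using qT by (rule nn_integral_mono_AE)
  also have "\<dots> = k * Ia" unfolding Ia_def by (rule nn_integral_cmult[OF a_path_m])
  finally have Eq: "(\<integral>\<^sup>+\<omega>. q \<omega> T \<partial>M) \<le> k * Ia" .
  have kI: "k * Ia < \<infinity>" using Ia by (simp add: k_def ennreal_mult_less_top)
  define R where "R = Ka + ennreal C0 * (k * Ia)"
  have R: "R < \<infinity>" using Ka kI by (simp add: R_def ennreal_mult_less_top)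
  have "(\<integral>\<^sup>+\<omega>. ennreal ((norm (X t \<omega>))\<^sup>2) \<partial>M) \<le> R" if t: "t \<in> {0..T}" for t
  proof -
    have [measurable]: "J t \<in> borel_measurable M" using J(1)[OF t] .
    have a_m[measurable]: "a t \<in> borel_measurable M" unfolding a_def by measurable
    note q_measurable[measurable]
    have "(\<integral>\<^sup>+\<omega>. ennreal ((norm (X t \<omega>))\<^sup>2) \<partial>M) \<le> (\<integral>\<^sup>+\<omega>. a t \<omega> + ennreal C0 * q \<omega> T \<partial>M)"
    proof (rule nn_integral_mono_AE)
      show "AE \<omega> in M. ennreal ((norm (X t \<omega>))\<^sup>2) \<le> a t \<omega> + ennreal C0 * q \<omega> T"
        using path
      proof eventually_elim
        case (elim \<omega>)
        then have "Xsq t \<omega> \<le> a t \<omega> + ennreal C0 * q \<omega> t" using t by blast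
        also have "\<dots> \<le> a t \<omega> + ennreal C0 * q \<omega> T" using t by (intro add_left_mono mult_left_mono q_mono) auto
        finally show ?case using t by (simp add: Xsq_def)
      qed
    qed
    also have "\<dots> = (\<integral>\<^sup>+\<omega>. a t \<omega> \<partial>M) + ennreal C0 * (\<integral>\<^sup>+\<omega>. q \<omega> T \<partial>M)"
      by (simp add: nn_integral_add nn_integral_cmult)
    also have "\<dots> \<le> R" unfolding R_def by (intro add_mono mult_left_mono Ea t Eq) auto
    finally show ?thesis .
  qed
  moreover have "R = ennreal (enn2real R)" using R by simp
  ultimately show ?thesis
    using Eq kI by (intro that[of "enn2real R"]) (auto intro: order.strict_trans1)
qed

end

lemma (in prob_space) tonelli_time:
  fixes f :: "real \<Rightarrow> 'a \<Rightarrow> ennreal"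
  assumes f: "(\<lambda>p. f (fst p) (snd p)) \<in> borel_measurable (borel \<Otimes>\<^sub>M M)"
  shows "(\<integral>\<^sup>+\<omega>. (\<integral>\<^sup>+s\<in>{a..b}. f s \<omega> \<partial>lborel) \<partial>M) = (\<integral>\<^sup>+s\<in>{a..b}. (\<integral>\<^sup>+\<omega>. f s \<omega> \<partial>M) \<partial>lborel)"
    "(\<lambda>\<omega>. \<integral>\<^sup>+s\<in>{a..b}. f s \<omega> \<partial>lborel) \<in> borel_measurable M"
    "(\<lambda>s. \<integral>\<^sup>+\<omega>. f s \<omega> \<partial>M) \<in> borel_measurable borel"
proof -
  interpret P: pair_sigma_finite lborel M by unfold_locales
  have g: "(\<lambda>p. f (fst p) (snd p) * indicator {a..b} (fst p)) \<in> borel_measurable (lborel \<Otimes>\<^sub>M M)"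
    using f by (simp cong: measurable_cong_sets)
  have fs: "f s \<in> borel_measurable M" for s
    using measurable_compose[OF measurable_Pair1'[of s borel M] f] by simp
  show "(\<integral>\<^sup>+\<omega>. (\<integral>\<^sup>+s\<in>{a..b}. f s \<omega> \<partial>lborel) \<partial>M) = (\<integral>\<^sup>+s\<in>{a..b}. (\<integral>\<^sup>+\<omega>. f s \<omega> \<partial>M) \<partial>lborel)"
    using P.Fubini[OF g] fs by (simp add: nn_integral_multc)
  have "(\<lambda>p. f (snd p) (fst p) * indicator {a..b} (snd p)) \<in> borel_measurable (M \<Otimes>\<^sub>M lborel)"
    using measurable_compose[OF measurable_pair_swap' g] by (simp add: case_prod_beta')
  then show "(\<lambda>\<omega>. \<integral>\<^sup>+s\<in>{a..b}. f s \<omega> \<partial>lborel) \<in> borel_measurable M"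
    by (intro lborel.borel_measurable_nn_integral) (simp add: case_prod_beta')
  show "(\<lambda>s. \<integral>\<^sup>+\<omega>. f s \<omega> \<partial>M) \<in> borel_measurable borel"
    using f by (intro borel_measurable_nn_integral) (simp add: case_prod_beta')
qed

context controlled_state
begin

lemma state_square_integrable:
  obtains R where "\<And>t. t \<in> {0..T} \<Longrightarrow> square_integrable M (X t)" "\<And>t. t \<in> {0..T} \<Longrightarrow> (\<integral>\<omega>. (norm (X t \<omega>))\<^sup>2 \<partial>M) \<le> R"
proof -
  obtain R where R: "0 \<le> R" "\<And>t. t \<in> {0..T} \<Longrightarrow> (\<integral>\<^sup>+\<omega>. ennreal ((norm (X t \<omega>))\<^sup>2) \<partial>M) \<le> ennreal R"
    using state_moments by blast
  show ?thesis
  proof (rule that[of R])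
    fix t assume t: "t \<in> {0..T}"
    have [measurable]: "X t \<in> borel_measurable M" by (rule X_measurable[OF t])
    have "(\<integral>\<^sup>+\<omega>. ennreal ((norm (X t \<omega>))\<^sup>2) \<partial>M) < \<infinity>"
      by (rule order.strict_trans1[OF R(2)[OF t]]) simp
    then have i: "integrable M (\<lambda>\<omega>. (norm (X t \<omega>))\<^sup>2)" by (simp add: integrable_iff_bounded)
    then show "square_integrable M (X t)" by (simp add: square_integrable_def)
    have "ennreal (\<integral>\<omega>. (norm (X t \<omega>))\<^sup>2 \<partial>M) \<le> ennreal R"
      using R(2)[OF t] nn_integral_eq_integral[OF i] by simp
    then show "(\<integral>\<omega>. (norm (X t \<omega>))\<^sup>2 \<partial>M) \<le> R" using R(1) by simp
  qed
qed

lemma ennreal_norm_diff_sq_le: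
  "ennreal ((norm (x - y :: 'v::real_normed_vector))\<^sup>2) \<le> 2 * ennreal ((norm x)\<^sup>2) + 2 * ennreal ((norm y)\<^sup>2)"
  using ennreal_norm_add_sq_le[of x "- y"] by simp

text \<open>The state without its Ito part, \<open>V\<close>, has a square that is bounded over all
  times by one variable of finite expectation, so right-continuous paths and dominated convergence
  settle it. The Ito part is not bounded in this way, but the second moment of its increment is
  controlled by the integrand over \<open>{t..S n}\<close>, an interval that shrinks to a
  point.\<close>

lemma state_increment_tendsto:
  assumes t: "0 \<le> t" and S: "\<And>n. t < S n" "\<And>n. S n < T" "S \<longlonglongrightarrow> t"
  shows "(\<lambda>n. \<integral>\<^sup>+\<omega>. ennreal ((norm (X (S n) \<omega> - X t \<omega>))\<^sup>2) \<partial>M) \<longlonglongrightarrow> 0"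
proof -
  have tT: "t \<in> {0..T}" "t < T" "t \<in> {0..<T}" using t S(1)[of 0] S(2)[of 0] by auto
  have ST: "S n \<in> {0..T}" for n using t S(1)[of n] S(2)[of n] by auto
  obtain I where ito: "is_ito_integral T M F W (\<lambda>s \<omega>. \<sigma> s (X s \<omega>)) I"
    and eq: "AE \<omega> in M. \<forall>t\<in>{0..T}. X t \<omega> = x0 + (LBINT s:{0..t}. b s (X s \<omega>)) + I t \<omega> + control_process \<xi> t \<omega>"
    by (rule state_equation)
  obtain J where J: "\<And>t. t \<in> {0..T} \<Longrightarrow> J t \<in> borel_measurable M"
    "\<And>\<omega>. right_continuous_on T (\<lambda>t. J t \<omega>)" "AE \<omega> in M. \<forall>t. J t \<omega> = I t \<omega>"
    using ito_continuous_version[OF ito] by blast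
  obtain c where c: "0 \<le> c" "\<And>(\<xi> :: real \<Rightarrow> 'w \<Rightarrow> real^'m) \<omega> t. \<xi> \<in> admissible_controls T M F \<Longrightarrow> \<omega> \<in> space M \<Longrightarrow> t \<in> {0..T} \<Longrightarrow>
    norm (control_process \<xi> t \<omega>) \<le> c * norm (\<xi> T \<omega>)"
  proof (rule control_process_bound)
    fix c assume "0 \<le> c" "\<And>(\<xi> :: real \<Rightarrow> 'w \<Rightarrow> real^'m) \<omega> t. \<xi> \<in> admissible_controls T M F \<Longrightarrow> \<omega> \<in> space M \<Longrightarrow> t \<in> {0..T} \<Longrightarrow>
      norm (control_process \<xi> t \<omega>) \<le> c * norm (\<xi> T \<omega>)"
    then show ?thesis by (rule that)
  qed
  have \<xi>T[measurable]: "\<xi> T \<in> borel_measurable M"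
    by (rule measurable_F_imp_M[OF _ admissible_controlsD(1)[OF \<xi>]]) (use T in auto)
  define V where "V s \<omega> = X s \<omega> - J s \<omega>" for s \<omega>
  have V_m: "V s \<in> borel_measurable M" if "s \<in> {0..T}" for s
    unfolding V_def using X_measurable[OF that] J(1)[OF that] by measurable
  define \<Theta> where "\<Theta> \<omega> = 2 * (2 * ennreal ((norm x0)\<^sup>2) + 2 * (2 * \<beta>\<^sup>2 + ennreal (2 * L\<^sup>2 * T) * q \<omega> T))
        + 2 * (ennreal (c\<^sup>2) * ennreal ((norm (\<xi> T \<omega>))\<^sup>2))" for \<omega>
  have \<Theta>_m[measurable]: "\<Theta> \<in> borel_measurable M" unfolding \<Theta>_def using q_measurable by measurable
  have V_le: "AE \<omega> in M. \<forall>s\<in>{0..T}. ennreal ((norm (V s \<omega>))\<^sup>2) \<le> \<Theta> \<omega>"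
    using eq J(3) drift_integrable AE_space
  proof eventually_elim
    case (elim \<omega>)
    show ?case
    proof
      fix s assume s: "s \<in> {0..T}"
      let ?B = "LBINT r:{0..s}. b r (X r \<omega>)" and ?A = "control_process \<xi> s \<omega>"
      have "V s \<omega> = (x0 + ?B) + ?A" using elim s by (simp add: V_def)
      then have "ennreal ((norm (V s \<omega>))\<^sup>2) \<le> 2 * ennreal ((norm (x0 + ?B))\<^sup>2) + 2 * ennreal ((norm ?A)\<^sup>2)"
        using ennreal_norm_add_sq_le[of "x0 + ?B" "?A"] by simp
      also have "\<dots> \<le> 2 * (2 * ennreal ((norm x0)\<^sup>2) + 2 * ennreal ((norm ?B)\<^sup>2)) + 2 * ennreal ((norm ?A)\<^sup>2)"
        by (intro add_mono mult_left_mono ennreal_norm_add_sq_le) auto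
      also have "\<dots> \<le> \<Theta> \<omega>"
        unfolding \<Theta>_def
      proof (intro add_mono mult_left_mono order_refl)
        have "ennreal ((norm ?B)\<^sup>2) \<le> 2 * \<beta>\<^sup>2 + ennreal (2 * L\<^sup>2 * T) * q \<omega> s"
          by (rule drift_sq_bound[OF _ _ s]) (use elim in auto)
        also have "\<dots> \<le> 2 * \<beta>\<^sup>2 + ennreal (2 * L\<^sup>2 * T) * q \<omega> T"
          using s by (intro add_left_mono mult_left_mono q_mono) auto
        finally show "ennreal ((norm ?B)\<^sup>2) \<le> 2 * \<beta>\<^sup>2 + ennreal (2 * L\<^sup>2 * T) * q \<omega> T" .
        have "(norm ?A)\<^sup>2 \<le> (c * norm (\<xi> T \<omega>))\<^sup>2" using c(2)[OF \<xi> _ s] elim by (intro power_mono) auto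
        then show "ennreal ((norm ?A)\<^sup>2) \<le> ennreal (c\<^sup>2) * ennreal ((norm (\<xi> T \<omega>))\<^sup>2)"
          by (simp add: power_mult_distrib ennreal_mult'[symmetric] ennreal_leI)
      qed auto
      finally show "ennreal ((norm (V s \<omega>))\<^sup>2) \<le> \<Theta> \<omega>" .
    qed
  qed
  have \<Theta>_fin: "(\<integral>\<^sup>+\<omega>. 4 * \<Theta> \<omega> \<partial>M) < \<infinity>"
  proof -
    have 1: "(\<integral>\<^sup>+\<omega>. q \<omega> T \<partial>M) < \<infinity>" using state_moments by blast
    have 2: "(\<integral>\<^sup>+\<omega>. ennreal ((norm (\<xi> T \<omega>))\<^sup>2) \<partial>M) < \<infinity>"
      using admissible_controlsD(5)[OF \<xi>] by (simp add: integrable_iff_bounded)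
    have "(\<integral>\<^sup>+\<omega>. \<Theta> \<omega> \<partial>M) = 2 * (2 * ennreal ((norm x0)\<^sup>2) + 2 * (2 * \<beta>\<^sup>2 + ennreal (2 * L\<^sup>2 * T) * (\<integral>\<^sup>+\<omega>. q \<omega> T \<partial>M)))
        + 2 * (ennreal (c\<^sup>2) * (\<integral>\<^sup>+\<omega>. ennreal ((norm (\<xi> T \<omega>))\<^sup>2) \<partial>M))"
      unfolding \<Theta>_def using q_measurable by (simp add: nn_integral_add nn_integral_cmult emeasure_space_1)
    also have "\<dots> < \<infinity>" using 1 2 \<beta>_finite by (simp add: ennreal_mult_less_top power2_eq_square)
    finally show ?thesis by (simp add: nn_integral_cmult ennreal_mult_less_top)
  qed
  have V_lim: "(\<lambda>n. \<integral>\<^sup>+\<omega>. ennreal ((norm (V (S n) \<omega> - V t \<omega>))\<^sup>2) \<partial>M) \<longlonglongrightarrow> (\<integral>\<^sup>+\<omega>. 0 \<partial>M)"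
  proof (rule nn_integral_dominated_convergence[where w="\<lambda>\<omega>. 4 * \<Theta> \<omega>"])
    show "(\<lambda>\<omega>. ennreal ((norm (V (S n) \<omega> - V t \<omega>))\<^sup>2)) \<in> borel_measurable M" for n
      using V_m[OF ST[of n]] V_m[OF tT(1)] by measurable
    show "AE \<omega> in M. ennreal ((norm (V (S n) \<omega> - V t \<omega>))\<^sup>2) \<le> 4 * \<Theta> \<omega>" for n
      using V_le
    proof eventually_elim
      case (elim \<omega>)
      have "ennreal ((norm (V (S n) \<omega> - V t \<omega>))\<^sup>2) \<le> 2 * ennreal ((norm (V (S n) \<omega>))\<^sup>2) + 2 * ennreal ((norm (V t \<omega>))\<^sup>2)"
        by (rule ennreal_norm_diff_sq_le)
      also have "\<dots> \<le> 2 * \<Theta> \<omega> + 2 * \<Theta> \<omega>" using elim ST[of n] tT(1) by (intro add_mono mult_left_mono) auto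
      also have "\<dots> = 4 * \<Theta> \<omega>" by (simp add: distrib_right[symmetric])
      finally show ?case .
    qed
    show "AE \<omega> in M. (\<lambda>n. ennreal ((norm (V (S n) \<omega> - V t \<omega>))\<^sup>2)) \<longlonglongrightarrow> 0"
    proof (rule AE_I2)
      fix \<omega> assume \<omega>: "\<omega> \<in> space M"
      have r: "filterlim S (at_right t) sequentially"
        unfolding filterlim_at using S by (auto intro!: always_eventually dest: less_imp_neq)
      have "((\<lambda>s. V s \<omega>) \<longlongrightarrow> V t \<omega>) (at_right t)"
        unfolding V_def using X_right_continuous[OF \<omega>] J(2)[of \<omega>] tT(3)
        by (intro tendsto_diff) (simp_all only: right_continuous_on_def)
      from filterlim_compose[OF this r] have "(\<lambda>n. V (S n) \<omega>) \<longlonglongrightarrow> V t \<omega>" .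
      then have "(\<lambda>n. (norm (V (S n) \<omega> - V t \<omega>))\<^sup>2) \<longlonglongrightarrow> (norm (V t \<omega> - V t \<omega>))\<^sup>2"
        by (intro tendsto_intros)
      then have "(\<lambda>n. ennreal ((norm (V (S n) \<omega> - V t \<omega>))\<^sup>2)) \<longlonglongrightarrow> ennreal 0" by (intro tendsto_ennrealI) simp
      then show "(\<lambda>n. ennreal ((norm (V (S n) \<omega> - V t \<omega>))\<^sup>2)) \<longlonglongrightarrow> 0" by simp
    qed
  qed (use \<Theta>_fin in auto)
  define hh where "hh s = (\<integral>\<^sup>+\<omega>. ennreal ((norm (\<sigma> s (X s \<omega>)))\<^sup>2) * indicator {0..T} s \<partial>M)" for s
  have H_m: "(\<lambda>p. ennreal ((norm (\<sigma> (fst p) (X (fst p) (snd p))))\<^sup>2) * indicator {0..T} (fst p)) \<in> borel_measurable (borel \<Otimes>\<^sub>M M)"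
  proof (rule borel_measurable_extend_indicator)
    have "(\<lambda>(s, \<omega>). \<sigma> s (X s \<omega>)) \<in> borel_measurable (restrict_space borel {0..T} \<Otimes>\<^sub>M M)"
      using ito unfolding is_ito_integral_def by blast
    then show "(\<lambda>p. ennreal ((norm (\<sigma> (fst p) (X (fst p) (snd p))))\<^sup>2)) \<in> borel_measurable (restrict_space borel {0..T} \<Otimes>\<^sub>M M)"
      by (simp add: case_prod_beta')
  qed simp
  note tH = tonelli_time[of "\<lambda>s \<omega>. ennreal ((norm (\<sigma> s (X s \<omega>)))\<^sup>2) * indicator {0..T} s", OF H_m]
  have hh_fin: "(\<integral>\<^sup>+s\<in>{0..T}. hh s \<partial>lborel) < \<infinity>"
  proof -
    have "(\<integral>\<^sup>+s\<in>{0..T}. hh s \<partial>lborel) = (\<integral>\<^sup>+\<omega>. (\<integral>\<^sup>+s\<in>{0..T}. ennreal ((norm (\<sigma> s (X s \<omega>)))\<^sup>2) \<partial>lborel) \<partial>M)"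
      unfolding hh_def tH(1)[symmetric] by (intro nn_integral_cong) (auto simp: indicator_def)
    also have "\<dots> < \<infinity>" using ito unfolding is_ito_integral_def by blast
    finally show ?thesis .
  qed
  have hh_lim: "(\<lambda>n. \<integral>\<^sup>+s\<in>{t..S n}. hh s \<partial>lborel) \<longlonglongrightarrow> 0"
    by (rule nn_integral_Icc_right_tendsto[OF _ hh_fin t S]) (use tH(3) in \<open>simp add: hh_def[abs_def]\<close>)
  have J_le: "(\<integral>\<^sup>+\<omega>. ennreal ((norm (J (S n) \<omega> - J t \<omega>))\<^sup>2) \<partial>M) \<le> 4 * (\<integral>\<^sup>+s\<in>{t..S n}. hh s \<partial>lborel)" for n
  proof -
    have "(\<integral>\<^sup>+\<omega>. ennreal ((norm (J (S n) \<omega> - J t \<omega>))\<^sup>2) \<partial>M) = (\<integral>\<^sup>+\<omega>. ennreal ((norm (I (S n) \<omega> - I t \<omega>))\<^sup>2) \<partial>M)"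
      by (rule nn_integral_cong_AE) (use J(3) in eventually_elim, simp)
    also have "\<dots> \<le> 4 * (\<integral>\<^sup>+\<omega>. (\<integral>\<^sup>+s\<in>{t..S n}. ennreal ((norm (\<sigma> s (X s \<omega>)))\<^sup>2) \<partial>lborel) \<partial>M)"
      using t S(1)[of n] S(2)[of n] by (intro ito_increment_moment[OF ito]) auto
    also have "(\<integral>\<^sup>+\<omega>. (\<integral>\<^sup>+s\<in>{t..S n}. ennreal ((norm (\<sigma> s (X s \<omega>)))\<^sup>2) \<partial>lborel) \<partial>M) = (\<integral>\<^sup>+s\<in>{t..S n}. hh s \<partial>lborel)"
      unfolding hh_def tH(1)[symmetric] using t S(2)[of n] by (intro nn_integral_cong) (auto simp: indicator_def)
    finally show ?thesis .
  qed
  show ?thesis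
  proof (rule tendsto_sandwich[OF _ _ tendsto_const])
    show "\<forall>\<^sub>F n in sequentially. (0::ennreal) \<le> (\<integral>\<^sup>+\<omega>. ennreal ((norm (X (S n) \<omega> - X t \<omega>))\<^sup>2) \<partial>M)" by simp
    show "\<forall>\<^sub>F n in sequentially. (\<integral>\<^sup>+\<omega>. ennreal ((norm (X (S n) \<omega> - X t \<omega>))\<^sup>2) \<partial>M)
      \<le> 2 * (\<integral>\<^sup>+\<omega>. ennreal ((norm (V (S n) \<omega> - V t \<omega>))\<^sup>2) \<partial>M) + 2 * (4 * (\<integral>\<^sup>+s\<in>{t..S n}. hh s \<partial>lborel))"
    proof (intro always_eventually allI)
      fix n
      have [measurable]: "V (S n) \<in> borel_measurable M" "V t \<in> borel_measurable M" "J (S n) \<in> borel_measurable M" "J t \<in> borel_measurable M"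
        using V_m J(1) ST tT(1) by auto
      have "(\<integral>\<^sup>+\<omega>. ennreal ((norm (X (S n) \<omega> - X t \<omega>))\<^sup>2) \<partial>M)
        \<le> (\<integral>\<^sup>+\<omega>. 2 * ennreal ((norm (V (S n) \<omega> - V t \<omega>))\<^sup>2) + 2 * ennreal ((norm (J (S n) \<omega> - J t \<omega>))\<^sup>2) \<partial>M)"
      proof (rule nn_integral_mono)
        fix \<omega>
        have "X (S n) \<omega> - X t \<omega> = (V (S n) \<omega> - V t \<omega>) + (J (S n) \<omega> - J t \<omega>)" by (simp add: V_def)
        then show "ennreal ((norm (X (S n) \<omega> - X t \<omega>))\<^sup>2) \<le> 2 * ennreal ((norm (V (S n) \<omega> - V t \<omega>))\<^sup>2) + 2 * ennreal ((norm (J (S n) \<omega> - J t \<omega>))\<^sup>2)"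
          by (simp only: ennreal_norm_add_sq_le)
      qed
      also have "\<dots> = 2 * (\<integral>\<^sup>+\<omega>. ennreal ((norm (V (S n) \<omega> - V t \<omega>))\<^sup>2) \<partial>M) + 2 * (\<integral>\<^sup>+\<omega>. ennreal ((norm (J (S n) \<omega> - J t \<omega>))\<^sup>2) \<partial>M)"
        by (simp add: nn_integral_add nn_integral_cmult)
      also have "\<dots> \<le> 2 * (\<integral>\<^sup>+\<omega>. ennreal ((norm (V (S n) \<omega> - V t \<omega>))\<^sup>2) \<partial>M) + 2 * (4 * (\<integral>\<^sup>+s\<in>{t..S n}. hh s \<partial>lborel))"
        by (intro add_left_mono mult_left_mono J_le) auto
      finally show "(\<integral>\<^sup>+\<omega>. ennreal ((norm (X (S n) \<omega> - X t \<omega>))\<^sup>2) \<partial>M)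
      \<le> 2 * (\<integral>\<^sup>+\<omega>. ennreal ((norm (V (S n) \<omega> - V t \<omega>))\<^sup>2) \<partial>M) + 2 * (4 * (\<integral>\<^sup>+s\<in>{t..S n}. hh s \<partial>lborel))" .
    qed
    have "(\<lambda>n. 2 * (\<integral>\<^sup>+\<omega>. ennreal ((norm (V (S n) \<omega> - V t \<omega>))\<^sup>2) \<partial>M) + 2 * (4 * (\<integral>\<^sup>+s\<in>{t..S n}. hh s \<partial>lborel))) \<longlonglongrightarrow> 2 * (\<integral>\<^sup>+\<omega>. 0 \<partial>M) + 2 * (4 * 0)"
      by (intro tendsto_add ennreal_tendsto_cmult V_lim hh_lim) auto
    then show "(\<lambda>n. 2 * (\<integral>\<^sup>+\<omega>. ennreal ((norm (V (S n) \<omega> - V t \<omega>))\<^sup>2) \<partial>M) + 2 * (4 * (\<integral>\<^sup>+s\<in>{t..S n}. hh s \<partial>lborel))) \<longlonglongrightarrow> 0" by simp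
  qed
qed

lemma state_L2_right_continuous:
  assumes t: "t \<in> {0..<T}"
  shows "((\<lambda>s. \<integral>\<omega>. (norm (X s \<omega> - X t \<omega>))\<^sup>2 \<partial>M) \<longlongrightarrow> 0) (at_right t)"
proof (rule tendsto_at_right_sequentially[of t T])
  show "t < T" using t by simp
  fix S assume S: "\<And>n. t < S n" "\<And>n. S n < T" "S \<longlonglongrightarrow> t"
  obtain R where sq: "\<And>t. t \<in> {0..T} \<Longrightarrow> square_integrable M (X t)" using state_square_integrable by blast
  have "ennreal (\<integral>\<omega>. (norm (X (S n) \<omega> - X t \<omega>))\<^sup>2 \<partial>M) = (\<integral>\<^sup>+\<omega>. ennreal ((norm (X (S n) \<omega> - X t \<omega>))\<^sup>2) \<partial>M)" for n
    using t S(1)[of n] S(2)[of n]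
    by (intro nn_integral_eq_integral[symmetric] square_integrableD(2)[OF square_integrable_diff[OF sq sq]]) auto
  then have "(\<lambda>n. ennreal (\<integral>\<omega>. (norm (X (S n) \<omega> - X t \<omega>))\<^sup>2 \<partial>M)) \<longlonglongrightarrow> ennreal 0"
    using state_increment_tendsto[of t S] t S by simp
  then show "(\<lambda>n. \<integral>\<omega>. (norm (X (S n) \<omega> - X t \<omega>))\<^sup>2 \<partial>M) \<longlonglongrightarrow> 0"
    by (rule tendsto_ennrealD) auto
qed

end

lemma (in controlled_state) state_second_moment:
  "\<exists>R\<ge>0. \<forall>t\<in>{0..T}. (\<integral>\<^sup>+\<omega>. ennreal ((norm (X t \<omega>))\<^sup>2) \<partial>M) \<le> ennreal R"
proof (rule state_moments)
  fix R assume "0 \<le> R" "\<And>t. t \<in> {0..T} \<Longrightarrow> (\<integral>\<^sup>+\<omega>. ennreal ((norm (X t \<omega>))\<^sup>2) \<partial>M) \<le> ennreal R"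
  then show ?thesis by (intro exI[of _ R]) simp
qed

section \<open>Affine dependence of the state on the control\<close>

context controlled_diffusion
begin

lemma control_process_combination:
  assumes "\<xi> \<in> admissible_controls T M F" "\<eta> \<in> admissible_controls T M F" "\<omega> \<in> space M"
    and "0 \<le> c" "0 \<le> d" and t: "t \<in> {0..T}"
  shows "control_process (\<lambda>t \<omega>. c *\<^sub>R \<xi> t \<omega> + d *\<^sub>R \<eta> t \<omega>) t \<omega> = c *\<^sub>R control_process \<xi> t \<omega> + d *\<^sub>R control_process \<eta> t \<omega>"
proof -
  have cont: "continuous_on {0..T} (\<lambda>s. \<zeta> s $ i $ j)" for i j by (intro continuous_intros \<zeta>_cont)
  have "(LINT s:{0..t}|control_measure T (\<lambda>t \<omega>. c *\<^sub>R \<xi> t \<omega> + d *\<^sub>R \<eta> t \<omega>) j \<omega>. \<zeta> s $ i $ j)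
    = c * (LINT s:{0..t}|control_measure T \<xi> j \<omega>. \<zeta> s $ i $ j) + d * (LINT s:{0..t}|control_measure T \<eta> j \<omega>. \<zeta> s $ i $ j)" for i j
    by (rule control_integral_combination[OF assms(1-3) T assms(4,5) cont t])
  then show ?thesis
    unfolding control_process_def by (simp add: vec_eq_iff sum.distrib sum_distrib_left)
qed

lemma admissible_convex:
  assumes "\<xi> \<in> admissible_controls T M F" "\<eta> \<in> admissible_controls T M F" "0 \<le> c" "0 \<le> d"
  shows "(\<lambda>t \<omega>. c *\<^sub>R \<xi> t \<omega> + d *\<^sub>R \<eta> t \<omega>) \<in> admissible_controls T M F"
  using T by (intro admissible_controls_combination assms measurable_F_imp_M[of T]) auto

text \<open>Let \<open>P\<close> be the combination of \<open>X\<close> and \<open>Y\<close>. Since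
  the coefficients are affine, the combined drifts and diffusions are \<open>b\<close> and
  \<open>\<sigma>\<close> at \<open>P\<close>, so the second moment of \<open>D = Z - P\<close>
  obeys a Gronwall inequality without inhomogeneity: the drift is estimated along paths, the Ito
  part in expectation.\<close>

theorem state_affine:
  assumes b_aff: "\<And>t x y. t \<in> {0..T} \<Longrightarrow> b t ((1 - e) *\<^sub>R x + e *\<^sub>R y) = (1 - e) *\<^sub>R b t x + e *\<^sub>R b t y"
    and \<sigma>_aff: "\<And>t x y. t \<in> {0..T} \<Longrightarrow> \<sigma> t ((1 - e) *\<^sub>R x + e *\<^sub>R y) = (1 - e) *\<^sub>R \<sigma> t x + e *\<^sub>R \<sigma> t y"
    and e: "0 \<le> e" "e \<le> 1"
    and \<xi>: "\<xi> \<in> admissible_controls T M F" and \<eta>: "\<eta> \<in> admissible_controls T M F"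
    and X: "solves_state_equation T M F W b \<sigma> \<zeta> x0 \<xi> X" and Y: "solves_state_equation T M F W b \<sigma> \<zeta> x0 \<eta> Y"
    and Z: "solves_state_equation T M F W b \<sigma> \<zeta> x0 (\<lambda>t \<omega>. (1 - e) *\<^sub>R \<xi> t \<omega> + e *\<^sub>R \<eta> t \<omega>) Z"
    and t: "t \<in> {0..T}"
  shows "AE \<omega> in M. Z t \<omega> = (1 - e) *\<^sub>R X t \<omega> + e *\<^sub>R Y t \<omega>"
proof -
  let ?\<zeta> = "\<lambda>t \<omega>. (1 - e) *\<^sub>R \<xi> t \<omega> + e *\<^sub>R \<eta> t \<omega>"
  have \<zeta>': "?\<zeta> \<in> admissible_controls T M F" using e by (intro admissible_convex \<xi> \<eta>) auto
  interpret X: controlled_state M T F W b \<sigma> \<zeta> x0 L \<xi> X by unfold_locales (fact \<xi> X)+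
  interpret Y: controlled_state M T F W b \<sigma> \<zeta> x0 L \<eta> Y by unfold_locales (fact \<eta> Y)+
  interpret Z: controlled_state M T F W b \<sigma> \<zeta> x0 L ?\<zeta> Z by unfold_locales (fact \<zeta>' Z)+
  define P where "P s \<omega> = (1 - e) *\<^sub>R X s \<omega> + e *\<^sub>R Y s \<omega>" for s \<omega>
  define D where "D s \<omega> = Z s \<omega> - P s \<omega>" for s \<omega>
  obtain IX where IX: "is_ito_integral T M F W (\<lambda>s \<omega>. \<sigma> s (X s \<omega>)) IX"
    "AE \<omega> in M. \<forall>t\<in>{0..T}. X t \<omega> = x0 + (LBINT s:{0..t}. b s (X s \<omega>)) + IX t \<omega> + control_process \<xi> t \<omega>"
    by (rule X.state_equation)
  obtain IY where IY: "is_ito_integral T M F W (\<lambda>s \<omega>. \<sigma> s (Y s \<omega>)) IY"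
    "AE \<omega> in M. \<forall>t\<in>{0..T}. Y t \<omega> = x0 + (LBINT s:{0..t}. b s (Y s \<omega>)) + IY t \<omega> + control_process \<eta> t \<omega>"
    by (rule Y.state_equation)
  obtain IZ where IZ: "is_ito_integral T M F W (\<lambda>s \<omega>. \<sigma> s (Z s \<omega>)) IZ"
    "AE \<omega> in M. \<forall>t\<in>{0..T}. Z t \<omega> = x0 + (LBINT s:{0..t}. b s (Z s \<omega>)) + IZ t \<omega> + control_process ?\<zeta> t \<omega>"
    by (rule Z.state_equation)
  \<comment> \<open>The Ito integrals belonging to \<open>Z\<close>, \<open>X\<close> and
    \<open>Y\<close> enter with the weights 1, \<open>- (1 - e)\<close> and \<open>- e\<close>, so
    that the bound for linear combinations applies to all three at once.\<close>
  define cc where "cc l = (if l = 0 then 1 else if l = 1 then - (1 - e) else - e)" for l :: nat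
  define II where "II l = (if l = 0 then IZ else if l = 1 then IX else IY)" for l :: nat
  define HH where "HH l s \<omega> = (if l = 0 then \<sigma> s (Z s \<omega>) else if l = 1 then \<sigma> s (X s \<omega>) else \<sigma> s (Y s \<omega>))" for l :: nat and s \<omega>
  define N where "N s \<omega> = IZ s \<omega> - (1 - e) *\<^sub>R IX s \<omega> - e *\<^sub>R IY s \<omega>" for s \<omega>
  have D_joint: "(\<lambda>p. D (fst p) (snd p)) \<in> borel_measurable (restrict_space borel {0..T} \<Otimes>\<^sub>M M)"
    unfolding D_def P_def using X.X_joint Y.X_joint Z.X_joint by measurable
  define Dsq where "Dsq s \<omega> = ennreal ((norm (D s \<omega>))\<^sup>2) * indicator {0..T} s" for s \<omega>
  have Dsq_joint: "(\<lambda>p. Dsq (fst p) (snd p)) \<in> borel_measurable (borel \<Otimes>\<^sub>M M)"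
    unfolding Dsq_def
  proof (rule borel_measurable_extend_indicator)
    show "(\<lambda>p. ennreal ((norm (D (fst p) (snd p)))\<^sup>2)) \<in> borel_measurable (restrict_space borel {0..T} \<Otimes>\<^sub>M M)"
      using D_joint by measurable
  qed simp
  define d where "d s = (\<integral>\<^sup>+\<omega>. Dsq s \<omega> \<partial>M)" for s
  note tn = tonelli_time[of Dsq, OF Dsq_joint]
  have d_m: "d \<in> borel_measurable borel" using tn(3) by (simp add: d_def[abs_def])
  have N_le: "(\<integral>\<^sup>+\<omega>. ennreal ((norm (N s \<omega>))\<^sup>2) \<partial>M) \<le> ennreal (4 * L\<^sup>2) * (\<integral>\<^sup>+r\<in>{0..s}. d r \<partial>lborel)" if s: "s \<in> {0..T}" for s
  proof -
    have itoQ: "is_ito_integral T M F W (HH l) (II l)" if "l \<in> {0, 1, 2}" for l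
      using that IX(1) IY(1) IZ(1) by (auto simp: HH_def[abs_def] II_def)
    have "(\<integral>\<^sup>+\<omega>. ennreal ((norm (\<Sum>l\<in>{0, 1, 2}. cc l *\<^sub>R II l s \<omega>))\<^sup>2) \<partial>M)
      \<le> 4 * (\<integral>\<^sup>+\<omega>. (\<integral>\<^sup>+r\<in>{0..s}. ennreal ((norm (\<Sum>l\<in>{0, 1, 2}. cc l *\<^sub>R HH l r \<omega>))\<^sup>2) \<partial>lborel) \<partial>M)"
      by (rule ito_combination_moment[OF _ itoQ s T]) auto
    also have "\<dots> \<le> 4 * (\<integral>\<^sup>+\<omega>. ennreal (L\<^sup>2) * (\<integral>\<^sup>+r\<in>{0..s}. Dsq r \<omega> \<partial>lborel) \<partial>M)"
    proof (intro mult_left_mono nn_integral_mono)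
      fix \<omega> assume \<omega>: "\<omega> \<in> space M"
      have "(\<integral>\<^sup>+r\<in>{0..s}. ennreal ((norm (\<Sum>l\<in>{0, 1, 2}. cc l *\<^sub>R HH l r \<omega>))\<^sup>2) \<partial>lborel) \<le> (\<integral>\<^sup>+r. ennreal (L\<^sup>2) * (Dsq r \<omega> * indicator {0..s} r) \<partial>lborel)"
      proof (rule nn_integral_mono)
        fix r
        show "ennreal ((norm (\<Sum>l\<in>{0, 1, 2}. cc l *\<^sub>R HH l r \<omega>))\<^sup>2) * indicator {0..s} r \<le> ennreal (L\<^sup>2) * (Dsq r \<omega> * indicator {0..s} r)"
        proof (cases "r \<in> {0..s}")
          case True
          then have r: "r \<in> {0..T}" using s by auto
          have "(\<Sum>l\<in>{0, 1, 2}. cc l *\<^sub>R HH l r \<omega>) = \<sigma> r (Z r \<omega>) - ((1 - e) *\<^sub>R \<sigma> r (X r \<omega>) + e *\<^sub>R \<sigma> r (Y r \<omega>))"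
            by (simp add: cc_def HH_def scaleR_left_diff_distrib)
          also have "\<dots> = \<sigma> r (Z r \<omega>) - \<sigma> r (P r \<omega>)" unfolding P_def by (simp only: \<sigma>_aff[OF r])
          finally have "norm (\<Sum>l\<in>{0, 1, 2}. cc l *\<^sub>R HH l r \<omega>) \<le> L * norm (D r \<omega>)"
            using \<sigma>_diff_le[OF r] by (simp add: D_def)
          then have "(norm (\<Sum>l\<in>{0, 1, 2}. cc l *\<^sub>R HH l r \<omega>))\<^sup>2 \<le> (L * norm (D r \<omega>))\<^sup>2" by (rule power_mono) simp
          then have "ennreal ((norm (\<Sum>l\<in>{0, 1, 2}. cc l *\<^sub>R HH l r \<omega>))\<^sup>2) \<le> ennreal (L\<^sup>2) * ennreal ((norm (D r \<omega>))\<^sup>2)"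
            by (simp only: power_mult_distrib ennreal_mult'[symmetric] ennreal_leI zero_le_power2)
          then show ?thesis using True r by (simp add: Dsq_def)
        qed simp
      qed
      also have "\<dots> = ennreal (L\<^sup>2) * (\<integral>\<^sup>+r\<in>{0..s}. Dsq r \<omega> \<partial>lborel)"
        using X.section_measurable[OF Dsq_joint \<omega>] by (simp add: nn_integral_cmult)
      finally show "(\<integral>\<^sup>+r\<in>{0..s}. ennreal ((norm (\<Sum>l\<in>{0, 1, 2}. cc l *\<^sub>R HH l r \<omega>))\<^sup>2) \<partial>lborel) \<le> ennreal (L\<^sup>2) * (\<integral>\<^sup>+r\<in>{0..s}. Dsq r \<omega> \<partial>lborel)" .
    qed simp
    also have "(\<integral>\<^sup>+\<omega>. ennreal (L\<^sup>2) * (\<integral>\<^sup>+r\<in>{0..s}. Dsq r \<omega> \<partial>lborel) \<partial>M) = ennreal (L\<^sup>2) * (\<integral>\<^sup>+r\<in>{0..s}. d r \<partial>lborel)"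
      unfolding d_def tn(1)[symmetric] by (rule nn_integral_cmult[OF tn(2)])
    also have "4 * (ennreal (L\<^sup>2) * (\<integral>\<^sup>+r\<in>{0..s}. d r \<partial>lborel)) = ennreal (4 * L\<^sup>2) * (\<integral>\<^sup>+r\<in>{0..s}. d r \<partial>lborel)"
      by (simp add: ennreal_mult' mult.assoc)
    also have "(\<lambda>\<omega>. \<Sum>l\<in>{0, 1, 2}. cc l *\<^sub>R II l s \<omega>) = N s"
      by (simp add: cc_def II_def N_def fun_eq_iff scaleR_left_diff_distrib)
    then have "(\<integral>\<^sup>+\<omega>. ennreal ((norm (\<Sum>l\<in>{0, 1, 2}. cc l *\<^sub>R II l s \<omega>))\<^sup>2) \<partial>M) = (\<integral>\<^sup>+\<omega>. ennreal ((norm (N s \<omega>))\<^sup>2) \<partial>M)"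
      by (metis (no_types))
    finally show ?thesis .
  qed
  have path: "AE \<omega> in M. \<forall>s\<in>{0..T}. Dsq s \<omega> \<le> ennreal (2 * L\<^sup>2 * T) * (\<integral>\<^sup>+r\<in>{0..s}. Dsq r \<omega> \<partial>lborel) + 2 * ennreal ((norm (N s \<omega>))\<^sup>2)"
    using IX(2) IY(2) IZ(2) X.drift_integrable Y.drift_integrable Z.drift_integrable AE_space
  proof eventually_elim
    case (elim \<omega>)
    show ?case
    proof
      fix s assume s: "s \<in> {0..T}"
      define f where "f r = ennreal (norm (D r \<omega>)) * indicator {0..T} r" for r
      have f_m: "f \<in> borel_measurable borel"
      proof -
        have "(\<lambda>r. D r \<omega>) \<in> borel_measurable (restrict_space borel {0..T})"
          using measurable_compose[OF measurable_Pair2'[OF elim(7), of "restrict_space borel {0..T}"] D_joint] by simp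
        then show ?thesis unfolding f_def by (intro X.measurable_indicator_restrict) measurable
      qed
      define g where "g r = b r (Z r \<omega>) - (1 - e) *\<^sub>R b r (X r \<omega>) - e *\<^sub>R b r (Y r \<omega>)" for r
      have si: "set_integrable lborel {0..s} (\<lambda>r. b r (X r \<omega>))" "set_integrable lborel {0..s} (\<lambda>r. b r (Y r \<omega>))" "set_integrable lborel {0..s} (\<lambda>r. b r (Z r \<omega>))"
        using elim(4-6) s by (auto intro: set_integrable_subset)
      have gi: "set_integrable lborel {0..s} g"
        unfolding g_def using si by (intro set_integral_diff set_integrable_scaleR_right) auto
      have "(LBINT r:{0..s}. g r) = (LBINT r:{0..s}. b r (Z r \<omega>)) - (1 - e) *\<^sub>R (LBINT r:{0..s}. b r (X r \<omega>)) - e *\<^sub>R (LBINT r:{0..s}. b r (Y r \<omega>))"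
        unfolding g_def using si by (simp add: set_integral_diff set_integrable_scaleR_right)
      moreover have "control_process ?\<zeta> s \<omega> = (1 - e) *\<^sub>R control_process \<xi> s \<omega> + e *\<^sub>R control_process \<eta> s \<omega>"
        using e by (intro control_process_combination[OF \<xi> \<eta> elim(7) _ _ s]) auto
      moreover have "Z s \<omega> = x0 + (LBINT r:{0..s}. b r (Z r \<omega>)) + IZ s \<omega> + control_process ?\<zeta> s \<omega>"
        "X s \<omega> = x0 + (LBINT r:{0..s}. b r (X r \<omega>)) + IX s \<omega> + control_process \<xi> s \<omega>"
        "Y s \<omega> = x0 + (LBINT r:{0..s}. b r (Y r \<omega>)) + IY s \<omega> + control_process \<eta> s \<omega>"
        using elim(1-3) s by blast+
      ultimately have "D s \<omega> = (LBINT r:{0..s}. g r) + N s \<omega>"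
        unfolding D_def P_def N_def by (simp add: algebra_simps)
      then have "ennreal ((norm (D s \<omega>))\<^sup>2) \<le> 2 * ennreal ((norm (LBINT r:{0..s}. g r))\<^sup>2) + 2 * ennreal ((norm (N s \<omega>))\<^sup>2)"
        by (simp only: ennreal_norm_add_sq_le)
      also have "ennreal ((norm (LBINT r:{0..s}. g r))\<^sup>2) \<le> ennreal (L\<^sup>2) * (ennreal T * (\<integral>\<^sup>+r\<in>{0..s}. Dsq r \<omega> \<partial>lborel))"
      proof -
        have "ennreal (norm (LBINT r:{0..s}. g r)) \<le> (\<integral>\<^sup>+r. ennreal (norm (indicator {0..s} r *\<^sub>R g r)) \<partial>lborel)"
          using gi unfolding set_lebesgue_integral_def set_integrable_def by (rule integral_norm_bound_ennreal)
        also have "\<dots> \<le> (\<integral>\<^sup>+r. ennreal L * (f r * indicator {0..s} r) \<partial>lborel)"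
        proof (rule nn_integral_mono)
          fix r
          show "ennreal (norm (indicator {0..s} r *\<^sub>R g r)) \<le> ennreal L * (f r * indicator {0..s} r)"
          proof (cases "r \<in> {0..s}")
            case True
            then have r: "r \<in> {0..T}" using s by auto
            have "g r = b r (Z r \<omega>) - b r (P r \<omega>)" unfolding g_def P_def b_aff[OF r] by simp
            then have "norm (g r) \<le> L * norm (D r \<omega>)" using b_diff_le[OF r] by (simp add: D_def)
            then have "ennreal (norm (g r)) \<le> ennreal L * ennreal (norm (D r \<omega>))"
              using L_nonneg by (simp add: ennreal_mult'[symmetric] ennreal_leI)
            then show ?thesis using True r by (simp add: f_def)
          qed simp
        qed
        also have "\<dots> = ennreal L * (\<integral>\<^sup>+r\<in>{0..s}. f r \<partial>lborel)" using f_m by (simp add: nn_integral_cmult)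
        finally have "(ennreal (norm (LBINT r:{0..s}. g r)))\<^sup>2 \<le> (ennreal L * (\<integral>\<^sup>+r\<in>{0..s}. f r \<partial>lborel))\<^sup>2"
          by (rule power_mono) simp
        also have "\<dots> = ennreal (L\<^sup>2) * (\<integral>\<^sup>+r\<in>{0..s}. f r \<partial>lborel)\<^sup>2"
          using L_nonneg by (simp add: power_mult_distrib ennreal_power)
        also have "\<dots> \<le> ennreal (L\<^sup>2) * (ennreal T * (\<integral>\<^sup>+r\<in>{0..s}. (f r)\<^sup>2 \<partial>lborel))"
        proof (rule mult_left_mono)
          have "(\<integral>\<^sup>+r\<in>{0..s}. f r \<partial>lborel)\<^sup>2 \<le> ennreal s * (\<integral>\<^sup>+r\<in>{0..s}. (f r)\<^sup>2 \<partial>lborel)"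
            using s by (intro nn_integral_sq_le f_m) auto
          also have "\<dots> \<le> ennreal T * (\<integral>\<^sup>+r\<in>{0..s}. (f r)\<^sup>2 \<partial>lborel)" using s by (intro mult_right_mono ennreal_leI) auto
          finally show "(\<integral>\<^sup>+r\<in>{0..s}. f r \<partial>lborel)\<^sup>2 \<le> ennreal T * (\<integral>\<^sup>+r\<in>{0..s}. (f r)\<^sup>2 \<partial>lborel)" .
        qed simp
        also have "(\<integral>\<^sup>+r\<in>{0..s}. (f r)\<^sup>2 \<partial>lborel) = (\<integral>\<^sup>+r\<in>{0..s}. Dsq r \<omega> \<partial>lborel)"
          unfolding f_def Dsq_def by (intro nn_integral_cong) (auto simp: indicator_def ennreal_power)
        finally show ?thesis by (simp add: ennreal_power)
      qed
      then have "2 * ennreal ((norm (LBINT r:{0..s}. g r))\<^sup>2) + 2 * ennreal ((norm (N s \<omega>))\<^sup>2)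
        \<le> 2 * (ennreal (L\<^sup>2) * (ennreal T * (\<integral>\<^sup>+r\<in>{0..s}. Dsq r \<omega> \<partial>lborel))) + 2 * ennreal ((norm (N s \<omega>))\<^sup>2)"
        by (intro add_right_mono mult_left_mono) auto
      also have "2 * (ennreal (L\<^sup>2) * (ennreal T * (\<integral>\<^sup>+r\<in>{0..s}. Dsq r \<omega> \<partial>lborel))) = ennreal (2 * L\<^sup>2 * T) * (\<integral>\<^sup>+r\<in>{0..s}. Dsq r \<omega> \<partial>lborel)"
        using T by (simp add: ennreal_mult' mult.assoc)
      finally show "Dsq s \<omega> \<le> ennreal (2 * L\<^sup>2 * T) * (\<integral>\<^sup>+r\<in>{0..s}. Dsq r \<omega> \<partial>lborel) + 2 * ennreal ((norm (N s \<omega>))\<^sup>2)"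
        using s by (simp add: Dsq_def)
    qed
  qed
  \<comment> \<open>The first term comes from the drift, the second is twice the factor
    \<open>4 * L\<^sup>2\<close> of the Ito part, and the 1 ensures positivity.\<close>
  define c where "c = 2 * L\<^sup>2 * T + 8 * L\<^sup>2 + 1"
  have c: "0 < c" using T unfolding c_def by (intro add_nonneg_pos add_nonneg_nonneg) auto
  have d_le: "d s \<le> 0 + ennreal c * (\<integral>\<^sup>+r\<in>{0..s}. d r \<partial>lborel)" if s: "s \<in> {0..T}" for s
  proof -
    have [measurable]: "N s \<in> borel_measurable M"
      unfolding N_def using ito_measurable[OF IX(1) s] ito_measurable[OF IY(1) s] ito_measurable[OF IZ(1) s] by measurable
    have "d s \<le> (\<integral>\<^sup>+\<omega>. ennreal (2 * L\<^sup>2 * T) * (\<integral>\<^sup>+r\<in>{0..s}. Dsq r \<omega> \<partial>lborel) + 2 * ennreal ((norm (N s \<omega>))\<^sup>2) \<partial>M)"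
      unfolding d_def using path by (intro nn_integral_mono_AE) (use s in \<open>auto elim: eventually_mono\<close>)
    also have "\<dots> = ennreal (2 * L\<^sup>2 * T) * (\<integral>\<^sup>+r\<in>{0..s}. d r \<partial>lborel) + 2 * (\<integral>\<^sup>+\<omega>. ennreal ((norm (N s \<omega>))\<^sup>2) \<partial>M)"
      unfolding d_def tn(1)[symmetric] using tn(2) by (simp add: nn_integral_add nn_integral_cmult)
    also have "\<dots> \<le> ennreal (2 * L\<^sup>2 * T) * (\<integral>\<^sup>+r\<in>{0..s}. d r \<partial>lborel) + 2 * (ennreal (4 * L\<^sup>2) * (\<integral>\<^sup>+r\<in>{0..s}. d r \<partial>lborel))"
      by (intro add_left_mono mult_left_mono N_le s) auto
    also have "\<dots> = ennreal (2 * L\<^sup>2 * T + 8 * L\<^sup>2) * (\<integral>\<^sup>+r\<in>{0..s}. d r \<partial>lborel)"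
    proof -
      have "2 * ennreal (4 * L\<^sup>2) = ennreal (8 * L\<^sup>2)" by (simp add: ennreal_mult' mult.assoc[symmetric])
      then show ?thesis using T by (simp add: ennreal_plus distrib_right mult.assoc[symmetric])
    qed
    also have "\<dots> \<le> ennreal c * (\<integral>\<^sup>+r\<in>{0..s}. d r \<partial>lborel)"
      unfolding c_def by (intro mult_right_mono ennreal_leI) auto
    finally show ?thesis by simp
  qed
  have d_fin: "(\<integral>\<^sup>+s\<in>{0..T}. d s \<partial>lborel) < \<infinity>"
  proof -
    obtain RX where RX: "0 \<le> RX" "\<And>t. t \<in> {0..T} \<Longrightarrow> (\<integral>\<^sup>+\<omega>. ennreal ((norm (X t \<omega>))\<^sup>2) \<partial>M) \<le> ennreal RX" using X.state_second_moment by blast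
    obtain RY where RY: "0 \<le> RY" "\<And>t. t \<in> {0..T} \<Longrightarrow> (\<integral>\<^sup>+\<omega>. ennreal ((norm (Y t \<omega>))\<^sup>2) \<partial>M) \<le> ennreal RY" using Y.state_second_moment by blast
    obtain RZ where RZ: "0 \<le> RZ" "\<And>t. t \<in> {0..T} \<Longrightarrow> (\<integral>\<^sup>+\<omega>. ennreal ((norm (Z t \<omega>))\<^sup>2) \<partial>M) \<le> ennreal RZ" using Z.state_second_moment by blast
    have "d s \<le> 2 * ennreal RZ + 2 * (2 * ennreal RX + 2 * ennreal RY)" if s: "s \<in> {0..T}" for s
    proof -
      have [measurable]: "X s \<in> borel_measurable M" "Y s \<in> borel_measurable M" "Z s \<in> borel_measurable M"
        using X.X_measurable[OF s] Y.X_measurable[OF s] Z.X_measurable[OF s] by auto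
      have "d s \<le> (\<integral>\<^sup>+\<omega>. 2 * ennreal ((norm (Z s \<omega>))\<^sup>2) + 2 * (2 * ennreal ((norm (X s \<omega>))\<^sup>2) + 2 * ennreal ((norm (Y s \<omega>))\<^sup>2)) \<partial>M)"
        unfolding d_def
      proof (rule nn_integral_mono)
        fix \<omega>
        have "Dsq s \<omega> \<le> 2 * ennreal ((norm (Z s \<omega>))\<^sup>2) + 2 * ennreal ((norm (P s \<omega>))\<^sup>2)"
          using X.ennreal_norm_diff_sq_le[of "Z s \<omega>" "P s \<omega>"] s by (simp add: Dsq_def D_def)
        also have "ennreal ((norm (P s \<omega>))\<^sup>2) \<le> 2 * ennreal ((norm ((1 - e) *\<^sub>R X s \<omega>))\<^sup>2) + 2 * ennreal ((norm (e *\<^sub>R Y s \<omega>))\<^sup>2)"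
          unfolding P_def by (rule ennreal_norm_add_sq_le)
        also have "\<dots> \<le> 2 * ennreal ((norm (X s \<omega>))\<^sup>2) + 2 * ennreal ((norm (Y s \<omega>))\<^sup>2)"
          using e by (intro add_mono mult_left_mono ennreal_leI power_mono) (auto simp: mult_left_le_one_le)
        finally show "Dsq s \<omega> \<le> 2 * ennreal ((norm (Z s \<omega>))\<^sup>2) + 2 * (2 * ennreal ((norm (X s \<omega>))\<^sup>2) + 2 * ennreal ((norm (Y s \<omega>))\<^sup>2))"
          by (simp add: add_left_mono mult_left_mono)
      qed
      also have "\<dots> = 2 * (\<integral>\<^sup>+\<omega>. ennreal ((norm (Z s \<omega>))\<^sup>2) \<partial>M) + 2 * (2 * (\<integral>\<^sup>+\<omega>. ennreal ((norm (X s \<omega>))\<^sup>2) \<partial>M) + 2 * (\<integral>\<^sup>+\<omega>. ennreal ((norm (Y s \<omega>))\<^sup>2) \<partial>M))"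
        by (simp add: nn_integral_add nn_integral_cmult)
      also have "\<dots> \<le> 2 * ennreal RZ + 2 * (2 * ennreal RX + 2 * ennreal RY)"
        by (intro add_mono mult_left_mono RX RY RZ s) auto
      finally show ?thesis .
    qed
    then have "(\<integral>\<^sup>+s\<in>{0..T}. d s \<partial>lborel) \<le> (\<integral>\<^sup>+s. (2 * ennreal RZ + 2 * (2 * ennreal RX + 2 * ennreal RY)) * indicator {0..T} s \<partial>lborel)"
      by (intro nn_integral_mono) (auto simp: indicator_def)
    also have "\<dots> = (2 * ennreal RZ + 2 * (2 * ennreal RX + 2 * ennreal RY)) * ennreal T"
      using T by (simp add: nn_integral_cmult)
    also have "\<dots> < \<infinity>" by (simp add: ennreal_mult_less_top)
    finally show ?thesis .
  qed
  \<comment> \<open>Gronwall with inhomogeneity 0; the required finiteness rests on the moment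
    bounds for the three states.\<close>
  have "(\<integral>\<^sup>+s\<in>{0..T}. d s \<partial>lborel) \<le> ennreal (2 * exp (2 * c * T)) * (\<integral>\<^sup>+s\<in>{0..T}. 0 \<partial>(lborel :: real measure))"
    by (rule gronwall_integral[OF d_m _ c d_fin d_le]) auto
  then have d0: "(\<integral>\<^sup>+s\<in>{0..T}. d s \<partial>lborel) = 0" by simp
  have "(\<integral>\<^sup>+s\<in>{0..t}. d s \<partial>lborel) \<le> (\<integral>\<^sup>+s\<in>{0..T}. d s \<partial>lborel)"
    using t by (intro nn_integral_mono) (auto simp: indicator_def)
  then have "(\<integral>\<^sup>+s\<in>{0..t}. d s \<partial>lborel) = 0" using d0 by simp
  \<comment> \<open>Inserting the vanishing integral into the inequality itself gives the claim at
    every time, not only at almost every one.\<close>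
  then have "d t = 0" using d_le[OF t] by simp
  moreover have "Dsq t \<in> borel_measurable M"
    using measurable_compose[OF measurable_Pair1'[of t borel M] Dsq_joint] by simp
  ultimately have "AE \<omega> in M. Dsq t \<omega> = 0" unfolding d_def by (simp add: nn_integral_0_iff_AE)
  then show ?thesis using t by (auto simp: Dsq_def D_def P_def elim!: eventually_mono)
qed

end

section \<open>Running costs\<close>

context mean_field_cost
begin

lemma integrable_cost:
  assumes M: "prob_space M" and Y: "square_integrable M Y" and \<nu>: "\<nu> \<in> P2"
  shows "integrable M (\<lambda>\<omega>. \<phi> (Y \<omega>) \<nu>)"
    "(\<integral>\<omega>. \<bar>\<phi> (Y \<omega>) \<nu>\<bar> \<partial>M) \<le> \<kappa> * (1 + (\<integral>\<omega>. (norm (Y \<omega>))\<^sup>2 \<partial>M) + moment2 \<nu>)"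
proof -
  interpret prob_space M by fact
  have b: "has_bochner_integral M (\<lambda>\<omega>. \<kappa> * (1 + (norm (Y \<omega>))\<^sup>2 + moment2 \<nu>)) (\<kappa> * (1 + (\<integral>\<omega>. (norm (Y \<omega>))\<^sup>2 \<partial>M) + moment2 \<nu>))"
    using square_integrableD(2)[OF Y] by (simp add: has_bochner_integral_iff prob_space)
  have m: "(\<lambda>\<omega>. \<phi> (Y \<omega>) \<nu>) \<in> borel_measurable M"
    by (intro measurable_cost \<nu> square_integrableD(1)[OF Y])
  show i: "integrable M (\<lambda>\<omega>. \<phi> (Y \<omega>) \<nu>)"
    by (rule Bochner_Integration.integrable_bound[OF _ m, of "\<lambda>\<omega>. \<kappa> * (1 + (norm (Y \<omega>))\<^sup>2 + moment2 \<nu>)"])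
      (use b growth_cost[OF \<nu>] in \<open>auto simp: has_bochner_integral_iff intro!: AE_I2 order_trans[OF _ abs_ge_self]\<close>)
  have "(\<integral>\<omega>. \<bar>\<phi> (Y \<omega>) \<nu>\<bar> \<partial>M) \<le> (\<integral>\<omega>. \<kappa> * (1 + (norm (Y \<omega>))\<^sup>2 + moment2 \<nu>) \<partial>M)"
    by (rule integral_mono) (use i b growth_cost[OF \<nu>] in \<open>auto simp: has_bochner_integral_iff\<close>)
  then show "(\<integral>\<omega>. \<bar>\<phi> (Y \<omega>) \<nu>\<bar> \<partial>M) \<le> \<kappa> * (1 + (\<integral>\<omega>. (norm (Y \<omega>))\<^sup>2 \<partial>M) + moment2 \<nu>)"
    unfolding has_bochner_integral_integral_eq[OF b] .
qed

lemma integrable_\<delta>_measure: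
  assumes \<nu>: "\<nu> \<in> P2"
  shows "integrable \<nu> (\<lambda>z. \<delta> z \<nu> y)" "\<bar>\<integral>z. \<delta> z \<nu> y \<partial>\<nu>\<bar> \<le> \<kappa> * (1 + 2 * moment2 \<nu> + (norm y)\<^sup>2)"
proof -
  interpret prob_space \<nu> using \<nu> by (simp add: P2_def)
  have s[measurable_cong]: "sets \<nu> = sets borel" and i2: "integrable \<nu> (\<lambda>z. (norm z)\<^sup>2)" using \<nu> by (auto simp: P2_def)
  have b: "has_bochner_integral \<nu> (\<lambda>z. \<kappa> * (1 + (norm z)\<^sup>2 + moment2 \<nu> + (norm y)\<^sup>2)) (\<kappa> * (1 + moment2 \<nu> + moment2 \<nu> + (norm y)\<^sup>2))"
    using i2 by (simp add: has_bochner_integral_iff prob_space moment2_def)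
  have m: "(\<lambda>z. \<delta> z \<nu> y) \<in> borel_measurable \<nu>"
    by (intro measurable_\<delta> \<nu>) measurable
  show i: "integrable \<nu> (\<lambda>z. \<delta> z \<nu> y)"
    by (rule Bochner_Integration.integrable_bound[OF _ m, of "\<lambda>z. \<kappa> * (1 + (norm z)\<^sup>2 + moment2 \<nu> + (norm y)\<^sup>2)"])
      (use b growth_\<delta>[OF \<nu>] in \<open>auto simp: has_bochner_integral_iff intro!: AE_I2 order_trans[OF _ abs_ge_self]\<close>)
  have "\<bar>\<integral>z. \<delta> z \<nu> y \<partial>\<nu>\<bar> \<le> (\<integral>z. \<bar>\<delta> z \<nu> y\<bar> \<partial>\<nu>)" by (rule integral_abs_bound)
  also have "\<dots> \<le> (\<integral>z. \<kappa> * (1 + (norm z)\<^sup>2 + moment2 \<nu> + (norm y)\<^sup>2) \<partial>\<nu>)"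
    by (rule integral_mono) (use i b growth_\<delta>[OF \<nu>] in \<open>auto simp: has_bochner_integral_iff\<close>)
  also have "\<dots> = \<kappa> * (1 + 2 * moment2 \<nu> + (norm y)\<^sup>2)"
    unfolding has_bochner_integral_integral_eq[OF b] by simp
  finally show "\<bar>\<integral>z. \<delta> z \<nu> y \<partial>\<nu>\<bar> \<le> \<kappa> * (1 + 2 * moment2 \<nu> + (norm y)\<^sup>2)" .
qed

lemma measurable_\<delta>_integral:
  assumes \<nu>: "\<nu> \<in> P2" and Y: "Y \<in> borel_measurable N"
  shows "(\<lambda>\<omega>. \<integral>z. \<delta> z \<nu> (Y \<omega>) \<partial>\<nu>) \<in> borel_measurable N"
proof -
  interpret prob_space \<nu> using \<nu> by (simp add: P2_def)
  have s[measurable_cong]: "sets \<nu> = sets borel" using \<nu> by (auto simp: P2_def)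
  have [measurable]: "Y \<in> borel_measurable N" by fact
  have "(\<lambda>p. \<delta> (snd p) \<nu> (Y (fst p))) \<in> borel_measurable (N \<Otimes>\<^sub>M \<nu>)"
    by (intro measurable_\<delta> \<nu>) measurable
  then show ?thesis by (intro borel_measurable_lebesgue_integral) (simp add: case_prod_beta')
qed

lemma integrable_\<delta>_integral:
  assumes M: "prob_space M" and Y: "square_integrable M Y" and \<nu>: "\<nu> \<in> P2"
  shows "integrable M (\<lambda>\<omega>. \<integral>z. \<delta> z \<nu> (Y \<omega>) \<partial>\<nu>)"
    "(\<integral>\<omega>. \<bar>\<integral>z. \<delta> z \<nu> (Y \<omega>) \<partial>\<nu>\<bar> \<partial>M) \<le> \<kappa> * (1 + 2 * moment2 \<nu> + (\<integral>\<omega>. (norm (Y \<omega>))\<^sup>2 \<partial>M))"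
proof -
  interpret prob_space M by fact
  have b: "has_bochner_integral M (\<lambda>\<omega>. \<kappa> * (1 + 2 * moment2 \<nu> + (norm (Y \<omega>))\<^sup>2)) (\<kappa> * (1 + 2 * moment2 \<nu> + (\<integral>\<omega>. (norm (Y \<omega>))\<^sup>2 \<partial>M)))"
    using square_integrableD(2)[OF Y] by (simp add: has_bochner_integral_iff prob_space)
  show i: "integrable M (\<lambda>\<omega>. \<integral>z. \<delta> z \<nu> (Y \<omega>) \<partial>\<nu>)"
    by (rule Bochner_Integration.integrable_bound[OF _ measurable_\<delta>_integral[OF \<nu> square_integrableD(1)[OF Y]], of "\<lambda>\<omega>. \<kappa> * (1 + 2 * moment2 \<nu> + (norm (Y \<omega>))\<^sup>2)"])
      (use b integrable_\<delta>_measure(2)[OF \<nu>] in \<open>auto simp: has_bochner_integral_iff intro!: AE_I2 order_trans[OF _ abs_ge_self]\<close>)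
  have "(\<integral>\<omega>. \<bar>\<integral>z. \<delta> z \<nu> (Y \<omega>) \<partial>\<nu>\<bar> \<partial>M) \<le> (\<integral>\<omega>. \<kappa> * (1 + 2 * moment2 \<nu> + (norm (Y \<omega>))\<^sup>2) \<partial>M)"
    by (rule integral_mono) (use i b integrable_\<delta>_measure(2)[OF \<nu>] in \<open>auto simp: has_bochner_integral_iff\<close>)
  then show "(\<integral>\<omega>. \<bar>\<integral>z. \<delta> z \<nu> (Y \<omega>) \<partial>\<nu>\<bar> \<partial>M) \<le> \<kappa> * (1 + 2 * moment2 \<nu> + (\<integral>\<omega>. (norm (Y \<omega>))\<^sup>2 \<partial>M))"
    unfolding has_bochner_integral_integral_eq[OF b] .
qed

lemma integrable_potential:
  assumes M: "prob_space M" and Y: "square_integrable M Y" and \<nu>: "\<nu> \<in> P2"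
  shows "integrable M (\<lambda>\<omega>. potential \<phi> \<delta> (Y \<omega>) \<nu>)"
    "(\<integral>\<omega>. potential \<phi> \<delta> (Y \<omega>) \<nu> \<partial>M) = (\<integral>\<omega>. \<phi> (Y \<omega>) \<nu> \<partial>M) + (\<integral>\<omega>. (\<integral>z. \<delta> z \<nu> (Y \<omega>) \<partial>\<nu>) \<partial>M)"
  unfolding potential_def using integrable_cost(1)[OF assms] integrable_\<delta>_integral(1)[OF assms] by auto

end

context mean_field_variation
begin

lemma remainder_alt:
  "remainder e = ((\<integral>\<omega>. \<phi> (Z e \<omega>) (distr M borel (Z e)) \<partial>M) - (\<integral>\<omega>. \<phi> (A \<omega>) \<mu> \<partial>M))
    - ((\<integral>\<omega>. potential \<phi> \<delta> (Z e \<omega>) \<mu> \<partial>M) - (\<integral>\<omega>. potential \<phi> \<delta> (A \<omega>) \<mu> \<partial>M))"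
proof -
  note iZ = integrable_cost(1)[OF M square_integrable_Z]
  have "(\<integral>\<omega>. (\<integral>z. \<delta> z \<mu> (Z e \<omega>) - \<delta> z \<mu> (A \<omega>) \<partial>\<mu>) \<partial>M) = (\<integral>\<omega>. (\<integral>z. \<delta> z \<mu> (Z e \<omega>) \<partial>\<mu>) - (\<integral>z. \<delta> z \<mu> (A \<omega>) \<partial>\<mu>) \<partial>M)"
    by (intro Bochner_Integration.integral_cong refl Bochner_Integration.integral_diff integrable_\<delta>_measure \<mu>_P2)
  also have "\<dots> = (\<integral>\<omega>. (\<integral>z. \<delta> z \<mu> (Z e \<omega>) \<partial>\<mu>) \<partial>M) - (\<integral>\<omega>. (\<integral>z. \<delta> z \<mu> (A \<omega>) \<partial>\<mu>) \<partial>M)"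
    by (intro Bochner_Integration.integral_diff integrable_\<delta>_integral M square_integrable_Z A \<mu>_P2)
  finally show ?thesis
    unfolding remainder_def
    using iZ[OF \<mu>_P2(1)] iZ[OF \<mu>_P2(2)] integrable_potential(2)[OF M square_integrable_Z \<mu>_P2(1)] integrable_potential(2)[OF M A \<mu>_P2(1)]
    by simp
qed

end

text \<open>What the cost estimates need to know about a state process. These properties pass
  directly to interpolations of two processes, which agree with a given solution of the state
  equation only almost surely at each time.\<close>

definition L2_process :: "'w measure \<Rightarrow> real \<Rightarrow> real \<Rightarrow> (real \<Rightarrow> 'w \<Rightarrow> 'a::euclidean_space) \<Rightarrow> bool" where
  "L2_process M T R Y \<longleftrightarrow>
     (\<forall>t\<in>{0..T}. square_integrable M (Y t) \<and> (\<integral>\<omega>. (norm (Y t \<omega>))\<^sup>2 \<partial>M) \<le> R) \<and>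
     (\<forall>\<omega>\<in>space M. right_continuous_on T (\<lambda>t. Y t \<omega>)) \<and>
     (\<forall>t\<in>{0..<T}. ((\<lambda>s. \<integral>\<omega>. (norm (Y s \<omega> - Y t \<omega>))\<^sup>2 \<partial>M) \<longlongrightarrow> 0) (at_right t))"

lemma L2_processD:
  assumes "L2_process M T R Y"
  shows "t \<in> {0..T} \<Longrightarrow> square_integrable M (Y t)" "t \<in> {0..T} \<Longrightarrow> (\<integral>\<omega>. (norm (Y t \<omega>))\<^sup>2 \<partial>M) \<le> R"
    "\<omega> \<in> space M \<Longrightarrow> right_continuous_on T (\<lambda>t. Y t \<omega>)"
    "t \<in> {0..<T} \<Longrightarrow> ((\<lambda>s. \<integral>\<omega>. (norm (Y s \<omega> - Y t \<omega>))\<^sup>2 \<partial>M) \<longlongrightarrow> 0) (at_right t)"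
  using assms unfolding L2_process_def by blast+

lemma L2_process_mono: "L2_process M T R Y \<Longrightarrow> R \<le> R' \<Longrightarrow> L2_process M T R' Y"
  unfolding L2_process_def by (meson order_trans)

lemma eventually_in_time: "t \<in> {0..<T} \<Longrightarrow> \<forall>\<^sub>F s in at_right t. s \<in> {0..T::real}"
  unfolding eventually_at_right_field by (intro exI[of _ T]) auto

lemma L2_process_interpolation:
  fixes A B :: "real \<Rightarrow> 'w \<Rightarrow> 'a::euclidean_space"
  assumes M: "prob_space M" and A: "L2_process M T R A" and B: "L2_process M T R B" and e: "0 \<le> e" "e \<le> 1"
  shows "L2_process M T (4 * R) (\<lambda>t \<omega>. A t \<omega> + e *\<^sub>R (B t \<omega> - A t \<omega>))"
  unfolding L2_process_def
proof (intro conjI ballI)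
  fix t assume t: "t \<in> {0..T}"
  note sA = L2_processD(1,2)[OF A t] and sB = L2_processD(1,2)[OF B t]
  show sq: "square_integrable M (\<lambda>\<omega>. A t \<omega> + e *\<^sub>R (B t \<omega> - A t \<omega>))"
    by (intro square_integrable_add square_integrable_scaleR square_integrable_diff sA sB)
  have "(\<integral>\<omega>. (norm (A t \<omega> + e *\<^sub>R (B t \<omega> - A t \<omega>)))\<^sup>2 \<partial>M) \<le> (\<integral>\<omega>. 2 * (norm (A t \<omega>))\<^sup>2 + 2 * (norm (B t \<omega>))\<^sup>2 \<partial>M)"
  proof (rule integral_mono)
    fix \<omega>
    have "A t \<omega> + e *\<^sub>R (B t \<omega> - A t \<omega>) = (1 - e) *\<^sub>R A t \<omega> + e *\<^sub>R B t \<omega>" by (simp add: algebra_simps)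
    then have "(norm (A t \<omega> + e *\<^sub>R (B t \<omega> - A t \<omega>)))\<^sup>2 \<le> 2 * (norm ((1 - e) *\<^sub>R A t \<omega>))\<^sup>2 + 2 * (norm (e *\<^sub>R B t \<omega>))\<^sup>2"
      using norm_add_sq_le[of "(1 - e) *\<^sub>R A t \<omega>" "e *\<^sub>R B t \<omega>"] by (simp only:)
    also have "\<dots> \<le> 2 * (norm (A t \<omega>))\<^sup>2 + 2 * (norm (B t \<omega>))\<^sup>2"
      using e by (intro add_mono mult_left_mono power_mono) (auto simp: mult_left_le_one_le)
    finally show "(norm (A t \<omega> + e *\<^sub>R (B t \<omega> - A t \<omega>)))\<^sup>2 \<le> 2 * (norm (A t \<omega>))\<^sup>2 + 2 * (norm (B t \<omega>))\<^sup>2" .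
  qed (use square_integrableD(2)[OF sq] square_integrableD(2)[OF sA(1)] square_integrableD(2)[OF sB(1)] in auto)
  also have "\<dots> \<le> 4 * R"
    using sA(2) sB(2) square_integrableD(2)[OF sA(1)] square_integrableD(2)[OF sB(1)]
    by (subst Bochner_Integration.integral_add) auto
  finally show "(\<integral>\<omega>. (norm (A t \<omega> + e *\<^sub>R (B t \<omega> - A t \<omega>)))\<^sup>2 \<partial>M) \<le> 4 * R" .
next
  fix \<omega> assume "\<omega> \<in> space M"
  then show "right_continuous_on T (\<lambda>t. A t \<omega> + e *\<^sub>R (B t \<omega> - A t \<omega>))"
    using L2_processD(3)[OF A] L2_processD(3)[OF B] unfolding right_continuous_on_def by (auto intro!: tendsto_intros)
next
  fix t assume t: "t \<in> {0..<T}"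
  then have t': "t \<in> {0..T}" by auto
  show "((\<lambda>s. \<integral>\<omega>. (norm ((A s \<omega> + e *\<^sub>R (B s \<omega> - A s \<omega>)) - (A t \<omega> + e *\<^sub>R (B t \<omega> - A t \<omega>))))\<^sup>2 \<partial>M) \<longlongrightarrow> 0) (at_right t)"
  proof (rule tendsto_sandwich[OF _ _ tendsto_const])
    show "\<forall>\<^sub>F s in at_right t. 0 \<le> (\<integral>\<omega>. (norm ((A s \<omega> + e *\<^sub>R (B s \<omega> - A s \<omega>)) - (A t \<omega> + e *\<^sub>R (B t \<omega> - A t \<omega>))))\<^sup>2 \<partial>M)" by simp
    show "\<forall>\<^sub>F s in at_right t. (\<integral>\<omega>. (norm ((A s \<omega> + e *\<^sub>R (B s \<omega> - A s \<omega>)) - (A t \<omega> + e *\<^sub>R (B t \<omega> - A t \<omega>))))\<^sup>2 \<partial>M)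
      \<le> 2 * (\<integral>\<omega>. (norm (A s \<omega> - A t \<omega>))\<^sup>2 \<partial>M) + 2 * (\<integral>\<omega>. (norm (B s \<omega> - B t \<omega>))\<^sup>2 \<partial>M)"
      using eventually_in_time[OF t]
    proof eventually_elim
      case (elim s)
      note dA = square_integrable_diff[OF L2_processD(1)[OF A elim] L2_processD(1)[OF A t']]
      note dB = square_integrable_diff[OF L2_processD(1)[OF B elim] L2_processD(1)[OF B t']]
      have eq: "(A s \<omega> + e *\<^sub>R (B s \<omega> - A s \<omega>)) - (A t \<omega> + e *\<^sub>R (B t \<omega> - A t \<omega>)) = (1 - e) *\<^sub>R (A s \<omega> - A t \<omega>) + e *\<^sub>R (B s \<omega> - B t \<omega>)" for \<omega>
        by (simp add: algebra_simps)
      have "(\<integral>\<omega>. (norm ((1 - e) *\<^sub>R (A s \<omega> - A t \<omega>) + e *\<^sub>R (B s \<omega> - B t \<omega>)))\<^sup>2 \<partial>M)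
        \<le> (\<integral>\<omega>. 2 * (norm (A s \<omega> - A t \<omega>))\<^sup>2 + 2 * (norm (B s \<omega> - B t \<omega>))\<^sup>2 \<partial>M)"
      proof (rule integral_mono)
        show "integrable M (\<lambda>\<omega>. (norm ((1 - e) *\<^sub>R (A s \<omega> - A t \<omega>) + e *\<^sub>R (B s \<omega> - B t \<omega>)))\<^sup>2)"
          by (intro square_integrableD(2) square_integrable_add square_integrable_scaleR dA dB)
        fix \<omega>
        have "(norm ((1 - e) *\<^sub>R (A s \<omega> - A t \<omega>) + e *\<^sub>R (B s \<omega> - B t \<omega>)))\<^sup>2 \<le> 2 * (norm ((1 - e) *\<^sub>R (A s \<omega> - A t \<omega>)))\<^sup>2 + 2 * (norm (e *\<^sub>R (B s \<omega> - B t \<omega>)))\<^sup>2"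
          by (rule norm_add_sq_le)
        also have "\<dots> \<le> 2 * (norm (A s \<omega> - A t \<omega>))\<^sup>2 + 2 * (norm (B s \<omega> - B t \<omega>))\<^sup>2"
          using e by (intro add_mono mult_left_mono power_mono) (auto simp: mult_left_le_one_le)
        finally show "(norm ((1 - e) *\<^sub>R (A s \<omega> - A t \<omega>) + e *\<^sub>R (B s \<omega> - B t \<omega>)))\<^sup>2 \<le> 2 * (norm (A s \<omega> - A t \<omega>))\<^sup>2 + 2 * (norm (B s \<omega> - B t \<omega>))\<^sup>2" .
      qed (use square_integrableD(2)[OF dA] square_integrableD(2)[OF dB] in auto)
      then show ?case
        unfolding eq using square_integrableD(2)[OF dA] square_integrableD(2)[OF dB] by simp
    qed
    have "((\<lambda>s. 2 * (\<integral>\<omega>. (norm (A s \<omega> - A t \<omega>))\<^sup>2 \<partial>M) + 2 * (\<integral>\<omega>. (norm (B s \<omega> - B t \<omega>))\<^sup>2 \<partial>M)) \<longlongrightarrow> 2 * 0 + 2 * 0) (at_right t)"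
      by (intro tendsto_intros L2_processD(4)[OF A t] L2_processD(4)[OF B t])
    then show "((\<lambda>s. 2 * (\<integral>\<omega>. (norm (A s \<omega> - A t \<omega>))\<^sup>2 \<partial>M) + 2 * (\<integral>\<omega>. (norm (B s \<omega> - B t \<omega>))\<^sup>2 \<partial>M)) \<longlongrightarrow> 0) (at_right t)" by simp
  qed
qed

lemma law_right_continuous:
  assumes M: "prob_space M" and V: "L2_process M T R V" and t: "t \<in> {0..<T}"
  shows "limitin W2_topology (\<lambda>s. distr M borel (V s)) (distr M borel (V t)) (at_right t)"
proof -
  \<comment> \<open>Outside the time interval nothing is known about \<open>V\<close>, while
    \<open>limitin_W2_distr\<close> asks for square integrability at every index.\<close>
  define V' where "V' s = (if s \<in> {0..T} then V s else V t)" for s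
  have t': "t \<in> {0..T}" using t by auto
  have ev: "\<forall>\<^sub>F s in at_right t. V' s = V s"
    using eventually_in_time[OF t] by eventually_elim (simp add: V'_def)
  have "limitin W2_topology (\<lambda>s. distr M borel (V' s)) (distr M borel (V t)) (at_right t)"
  proof (rule limitin_W2_distr[OF M L2_processD(1)[OF V t']])
    show "square_integrable M (V' s)" for s
      using L2_processD(1)[OF V] t' by (simp add: V'_def)
    show "((\<lambda>s. \<integral>\<omega>. (norm (V' s \<omega> - V t \<omega>))\<^sup>2 \<partial>M) \<longlongrightarrow> 0) (at_right t)"
      by (rule Lim_transform_eventually[OF L2_processD(4)[OF V t]]) (use ev in \<open>eventually_elim, simp\<close>)
  qed
  moreover have "\<forall>\<^sub>F s in at_right t. distr M borel (V' s) = distr M borel (V s)"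
    using ev by eventually_elim simp
  ultimately show ?thesis by (rule limitin_transform_eventually[rotated])
qed

lemma limitin_time: "t \<in> {0..<T} \<Longrightarrow> limitin (top_of_set {0..T::real}) (\<lambda>s. s) t (at_right t)"
  using eventually_in_time[of t T] by (auto simp: limitin_subtopology tendsto_ident_at)

text \<open>The bound \<open>K\<close> on the expected absolute values is uniform over a bounded
  time interval, which makes the integrand integrable for the product measure.\<close>

lemma (in prob_space) fubini_time:
  fixes f :: "real \<Rightarrow> 'a \<Rightarrow> real"
  assumes m: "(\<lambda>p. f (fst p) (snd p)) \<in> borel_measurable (restrict_space borel {0..T} \<Otimes>\<^sub>M M)"
    and i: "\<And>t. t \<in> {0..T} \<Longrightarrow> integrable M (f t)" and K: "\<And>t. t \<in> {0..T} \<Longrightarrow> (\<integral>\<omega>. \<bar>f t \<omega>\<bar> \<partial>M) \<le> K" and T: "0 \<le> T"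
  shows "integrable M (\<lambda>\<omega>. LBINT t:{0..T}. f t \<omega>)"
    "(\<integral>\<omega>. (LBINT t:{0..T}. f t \<omega>) \<partial>M) = (LBINT t:{0..T}. (\<integral>\<omega>. f t \<omega> \<partial>M))"
    "set_integrable lborel {0..T} (\<lambda>t. \<integral>\<omega>. f t \<omega> \<partial>M)"
proof -
  interpret P: pair_sigma_finite lborel M by unfold_locales
  define g where "g t \<omega> = indicator {0..T} t * f t \<omega>" for t \<omega>
  have g_m: "case_prod g \<in> borel_measurable (lborel \<Otimes>\<^sub>M M)"
  proof -
    let ?R = "restrict_space (borel \<Otimes>\<^sub>M M) ({0..T} \<times> space M)"
    have "(\<lambda>x. x) \<in> ?R \<rightarrow>\<^sub>M (restrict_space borel {0..T} \<Otimes>\<^sub>M M)"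
    proof (rule measurable_pair)
      show "fst \<circ> (\<lambda>x. x) \<in> ?R \<rightarrow>\<^sub>M restrict_space borel {0..T}"
        by (intro measurable_restrict_space2) (auto simp: comp_def space_restrict_space intro: measurable_restrict_space1)
      show "snd \<circ> (\<lambda>x. x) \<in> ?R \<rightarrow>\<^sub>M M" by (auto simp: comp_def intro: measurable_restrict_space1)
    qed
    from measurable_compose[OF this m]
    have "(\<lambda>p. indicator ({0..T} \<times> space M) p *\<^sub>R f (fst p) (snd p)) \<in> borel_measurable (borel \<Otimes>\<^sub>M M)"
      by (subst (asm) borel_measurable_restrict_space_iff) auto
    then have "case_prod g \<in> borel_measurable (borel \<Otimes>\<^sub>M M)"
      by (subst measurable_cong[where g="\<lambda>p. indicator ({0..T} \<times> space M) p *\<^sub>R f (fst p) (snd p)"])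
        (auto simp: space_pair_measure indicator_def g_def)
    then show ?thesis by (simp cong: measurable_cong_sets)
  qed
  have g_i: "integrable (lborel \<Otimes>\<^sub>M M) (case_prod g)"
  proof (rule integrableI_bounded[OF g_m])
    have "(\<integral>\<^sup>+p. ennreal (norm (case_prod g p)) \<partial>(lborel \<Otimes>\<^sub>M M)) = (\<integral>\<^sup>+t. (\<integral>\<^sup>+\<omega>. ennreal (norm (g t \<omega>)) \<partial>M) \<partial>lborel)"
    proof -
      have "(\<lambda>p. ennreal (norm (case_prod g p))) \<in> borel_measurable (lborel \<Otimes>\<^sub>M M)" using g_m by measurable
      from nn_integral_fst[OF this] show ?thesis by simp
    qed
    also have "\<dots> \<le> (\<integral>\<^sup>+t. ennreal K * indicator {0..T} t \<partial>lborel)"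
    proof (rule nn_integral_mono)
      fix t show "(\<integral>\<^sup>+\<omega>. ennreal (norm (g t \<omega>)) \<partial>M) \<le> ennreal K * indicator {0..T} t"
      proof (cases "t \<in> {0..T}")
        case True
        then have "(\<integral>\<^sup>+\<omega>. ennreal (norm (g t \<omega>)) \<partial>M) = ennreal (\<integral>\<omega>. \<bar>f t \<omega>\<bar> \<partial>M)"
          using i[OF True] by (subst nn_integral_eq_integral[symmetric]) (auto simp: g_def)
        then show ?thesis using K[OF True] True by (simp add: ennreal_leI)
      qed (simp add: g_def)
    qed
    also have "\<dots> < \<infinity>" using T by (simp add: nn_integral_cmult ennreal_mult_less_top)
    finally show "(\<integral>\<^sup>+p. ennreal (norm (case_prod g p)) \<partial>(lborel \<Otimes>\<^sub>M M)) < \<infinity>" .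
  qed
  have gt: "(\<integral>t. g t \<omega> \<partial>lborel) = (LBINT t:{0..T}. f t \<omega>)" for \<omega>
    by (simp add: set_lebesgue_integral_def g_def)
  have go: "(\<integral>\<omega>. g t \<omega> \<partial>M) = indicator {0..T} t *\<^sub>R (\<integral>\<omega>. f t \<omega> \<partial>M)" for t
    by (simp add: g_def)
  show "integrable M (\<lambda>\<omega>. LBINT t:{0..T}. f t \<omega>)"
    using P.integrable_snd[OF g_i] by (simp add: gt)
  show "set_integrable lborel {0..T} (\<lambda>t. \<integral>\<omega>. f t \<omega> \<partial>M)"
    using P.integrable_fst[OF g_i] by (simp add: go set_integrable_def)
  show "(\<integral>\<omega>. (LBINT t:{0..T}. f t \<omega>) \<partial>M) = (LBINT t:{0..T}. (\<integral>\<omega>. f t \<omega> \<partial>M))"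
    using P.Fubini_integral[OF g_i] by (simp add: gt go set_lebesgue_integral_def)
qed

locale mean_field_running_cost =
  fixes T \<kappa> :: real and C :: "real \<Rightarrow> 'a::euclidean_space \<Rightarrow> 'a measure \<Rightarrow> real"
    and \<delta>C :: "real \<Rightarrow> 'a \<Rightarrow> 'a measure \<Rightarrow> 'a \<Rightarrow> real" and \<delta>Cy :: "real \<Rightarrow> 'a \<Rightarrow> 'a measure \<Rightarrow> 'a \<Rightarrow> 'a"
  assumes T: "0 < T"
    and cost_at: "\<And>t. t \<in> {0..T} \<Longrightarrow> mean_field_cost (C t) (\<delta>C t) (\<delta>Cy t) \<kappa>"
    and continuous_C: "continuous_map (prod_topology (top_of_set {0..T}) state_measure_topology) euclideanreal (\<lambda>(t, x, \<mu>). C t x \<mu>)"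
    and continuous_\<delta>C: "continuous_map (prod_topology (top_of_set {0..T}) state_measure_point_topology) euclideanreal (\<lambda>(t, x, \<mu>, y). \<delta>C t x \<mu> y)"
begin

text \<open>Joint continuity of \<open>C\<close> turns right continuity of the path and of the law
  into right continuity of the cost in time, from which its joint measurability is derived.\<close>

lemma cost_right_continuous:
  assumes M: "prob_space M" and Y: "right_continuous_on T Y" and V: "L2_process M T R V"
  shows "right_continuous_on T (\<lambda>t. C t (Y t) (distr M borel (V t)))"
  unfolding right_continuous_on_def
proof
  fix t assume t: "t \<in> {0..<T}"
  have "limitin (prod_topology (top_of_set {0..T}) state_measure_topology) (\<lambda>s. (s, Y s, distr M borel (V s))) (t, Y t, distr M borel (V t)) (at_right t)"
    using limitin_time[OF t] law_right_continuous[OF M V t] Y t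
    by (simp add: limitin_pairwise comp_def right_continuous_on_def)
  from continuous_map_limit[OF continuous_C this]
  show "((\<lambda>t. C t (Y t) (distr M borel (V t))) \<longlongrightarrow> C t (Y t) (distr M borel (V t))) (at_right t)"
    by (simp add: comp_def)
qed

lemma \<delta>_right_continuous:
  assumes M: "prob_space M" and X: "right_continuous_on T X" and Y: "right_continuous_on T Y" and V: "L2_process M T R V"
  shows "right_continuous_on T (\<lambda>t. \<delta>C t (X t) (distr M borel (V t)) (Y t))"
  unfolding right_continuous_on_def
proof
  fix t assume t: "t \<in> {0..<T}"
  have "limitin (prod_topology (top_of_set {0..T}) state_measure_point_topology) (\<lambda>s. (s, X s, distr M borel (V s), Y s)) (t, X t, distr M borel (V t), Y t) (at_right t)"
    using limitin_time[OF t] law_right_continuous[OF M V t] X Y t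
    by (simp add: limitin_pairwise comp_def right_continuous_on_def)
  from continuous_map_limit[OF continuous_\<delta>C this]
  show "((\<lambda>t. \<delta>C t (X t) (distr M borel (V t)) (Y t)) \<longlongrightarrow> \<delta>C t (X t) (distr M borel (V t)) (Y t)) (at_right t)"
    by (simp add: comp_def)
qed

lemma cost_joint:
  assumes M: "prob_space M" and Y: "L2_process M T R Y" and V: "L2_process M T R' V"
  shows "(\<lambda>p. C (fst p) (Y (fst p) (snd p)) (distr M borel (V (fst p)))) \<in> borel_measurable (restrict_space borel {0..T} \<Otimes>\<^sub>M M)"
proof (rule measurable_right_continuous)
  fix t assume t: "t \<in> {0..T}"
  interpret c: mean_field_cost "C t" "\<delta>C t" "\<delta>Cy t" \<kappa> by (rule cost_at[OF t])
  show "(\<lambda>\<omega>. C t (Y t \<omega>) (distr M borel (V t))) \<in> borel_measurable M"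
    by (intro c.measurable_cost square_integrable_P2[OF M] square_integrableD(1) L2_processD(1)[OF Y t] L2_processD(1)[OF V t])
qed (use T cost_right_continuous[OF M L2_processD(3)[OF Y] V] in auto)

text \<open>The measure of integration varies with time. It is replaced by \<open>M\<close>, acting
  on a second copy of the outcome, so that a parameter integral with respect to a fixed measure
  results.\<close>

lemma \<delta>_integral_joint:
  assumes M: "prob_space M" and Y: "L2_process M T R Y" and A: "L2_process M T R' A"
  shows "(\<lambda>p. \<integral>z. \<delta>C (fst p) z (distr M borel (A (fst p))) (Y (fst p) (snd p)) \<partial>distr M borel (A (fst p))) \<in> borel_measurable (restrict_space borel {0..T} \<Otimes>\<^sub>M M)"
proof -
  interpret prob_space M by fact
  let ?R = "restrict_space borel {0..T}"
  have "(\<lambda>p. \<delta>C (fst p) (A (fst p) (snd (snd p))) (distr M borel (A (fst p))) (Y (fst p) (fst (snd p)))) \<in> borel_measurable (?R \<Otimes>\<^sub>M (M \<Otimes>\<^sub>M M))"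
  proof (rule measurable_right_continuous)
    fix t assume t: "t \<in> {0..T}"
    interpret c: mean_field_cost "C t" "\<delta>C t" "\<delta>Cy t" \<kappa> by (rule cost_at[OF t])
    have [measurable]: "A t \<in> borel_measurable M" "Y t \<in> borel_measurable M"
      using square_integrableD(1)[OF L2_processD(1)[OF A t]] square_integrableD(1)[OF L2_processD(1)[OF Y t]] by auto
    show "(\<lambda>p. \<delta>C t (A t (snd p)) (distr M borel (A t)) (Y t (fst p))) \<in> borel_measurable (M \<Otimes>\<^sub>M M)"
      by (intro c.measurable_\<delta> square_integrable_P2[OF M] L2_processD(1)[OF A t]) measurable
  next
    fix p assume "p \<in> space (M \<Otimes>\<^sub>M M)"
    then show "right_continuous_on T (\<lambda>t. \<delta>C t (A t (snd p)) (distr M borel (A t)) (Y t (fst p)))"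
      by (intro \<delta>_right_continuous[OF M _ _ A] L2_processD(3)[OF A] L2_processD(3)[OF Y]) (auto simp: space_pair_measure)
  qed (use T in auto)
  from measurable_compose[OF _ this, of "\<lambda>p. (fst (fst p), snd (fst p), snd p)" "(?R \<Otimes>\<^sub>M M) \<Otimes>\<^sub>M M"]
  have "(\<lambda>p. \<delta>C (fst (fst p)) (A (fst (fst p)) (snd p)) (distr M borel (A (fst (fst p)))) (Y (fst (fst p)) (snd (fst p)))) \<in> borel_measurable ((?R \<Otimes>\<^sub>M M) \<Otimes>\<^sub>M M)"
    by simp
  then have "(\<lambda>p. \<integral>\<omega>'. \<delta>C (fst p) (A (fst p) \<omega>') (distr M borel (A (fst p))) (Y (fst p) (snd p)) \<partial>M) \<in> borel_measurable (?R \<Otimes>\<^sub>M M)"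
    by (intro borel_measurable_lebesgue_integral) (simp add: case_prod_beta')
  then show ?thesis
  proof (rule measurable_cong[THEN iffD1, rotated])
    fix p assume "p \<in> space (?R \<Otimes>\<^sub>M M)"
    then have t: "fst p \<in> {0..T}" by (auto simp: space_pair_measure space_restrict_space)
    interpret c: mean_field_cost "C (fst p)" "\<delta>C (fst p)" "\<delta>Cy (fst p)" \<kappa> by (rule cost_at[OF t])
    show "(\<integral>\<omega>'. \<delta>C (fst p) (A (fst p) \<omega>') (distr M borel (A (fst p))) (Y (fst p) (snd p)) \<partial>M)
      = (\<integral>z. \<delta>C (fst p) z (distr M borel (A (fst p))) (Y (fst p) (snd p)) \<partial>distr M borel (A (fst p)))"
      by (rule integral_distr[symmetric, OF square_integrableD(1)[OF L2_processD(1)[OF A t]]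
            c.measurable_\<delta>[OF square_integrable_P2[OF M L2_processD(1)[OF A t]]]]) auto
  qed
qed

lemma cost_fubini:
  assumes M: "prob_space M" and Y: "L2_process M T R Y" and V: "L2_process M T R' V"
  defines "f \<equiv> \<lambda>t \<omega>. C t (Y t \<omega>) (distr M borel (V t))"
  shows "integrable M (\<lambda>\<omega>. LBINT t:{0..T}. f t \<omega>)"
    "(\<integral>\<omega>. (LBINT t:{0..T}. f t \<omega>) \<partial>M) = (LBINT t:{0..T}. (\<integral>\<omega>. f t \<omega> \<partial>M))"
    "set_integrable lborel {0..T} (\<lambda>t. \<integral>\<omega>. f t \<omega> \<partial>M)"
proof -
  interpret prob_space M by fact
  have m: "(\<lambda>p. f (fst p) (snd p)) \<in> borel_measurable (restrict_space borel {0..T} \<Otimes>\<^sub>M M)"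
    unfolding f_def by (rule cost_joint[OF M Y V])
  have i: "integrable M (f t)" "(\<integral>\<omega>. \<bar>f t \<omega>\<bar> \<partial>M) \<le> \<kappa> * (1 + R + R')" if t: "t \<in> {0..T}" for t
  proof -
    interpret c: mean_field_cost "C t" "\<delta>C t" "\<delta>Cy t" \<kappa> by (rule cost_at[OF t])
    note P = square_integrable_P2[OF M L2_processD(1)[OF V t]]
    note ii = c.integrable_cost[OF M L2_processD(1)[OF Y t] P]
    show "integrable M (f t)" unfolding f_def by (rule ii(1))
    have "(\<integral>\<omega>. \<bar>f t \<omega>\<bar> \<partial>M) \<le> \<kappa> * (1 + (\<integral>\<omega>. (norm (Y t \<omega>))\<^sup>2 \<partial>M) + moment2 (distr M borel (V t)))"
      unfolding f_def by (rule ii(2))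
    also have "\<dots> \<le> \<kappa> * (1 + R + R')"
      using c.\<kappa>_pos L2_processD(2)[OF Y t] L2_processD(2)[OF V t] square_integrableD(1)[OF L2_processD(1)[OF V t]]
      by (intro mult_left_mono add_mono) (auto simp: moment2_distr)
    finally show "(\<integral>\<omega>. \<bar>f t \<omega>\<bar> \<partial>M) \<le> \<kappa> * (1 + R + R')" .
  qed
  show "integrable M (\<lambda>\<omega>. LBINT t:{0..T}. f t \<omega>)"
    "(\<integral>\<omega>. (LBINT t:{0..T}. f t \<omega>) \<partial>M) = (LBINT t:{0..T}. (\<integral>\<omega>. f t \<omega> \<partial>M))"
    "set_integrable lborel {0..T} (\<lambda>t. \<integral>\<omega>. f t \<omega> \<partial>M)"
    using fubini_time[OF m i] T by auto
qed

lemma potential_fubini: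
  assumes M: "prob_space M" and Y: "L2_process M T R Y" and A: "L2_process M T R' A"
  defines "f \<equiv> \<lambda>t \<omega>. potential (C t) (\<delta>C t) (Y t \<omega>) (distr M borel (A t))"
  shows "integrable M (\<lambda>\<omega>. LBINT t:{0..T}. f t \<omega>)"
    "(\<integral>\<omega>. (LBINT t:{0..T}. f t \<omega>) \<partial>M) = (LBINT t:{0..T}. (\<integral>\<omega>. f t \<omega> \<partial>M))"
    "set_integrable lborel {0..T} (\<lambda>t. \<integral>\<omega>. f t \<omega> \<partial>M)"
proof -
  interpret prob_space M by fact
  have m: "(\<lambda>p. f (fst p) (snd p)) \<in> borel_measurable (restrict_space borel {0..T} \<Otimes>\<^sub>M M)"
    unfolding f_def potential_def by (intro borel_measurable_add cost_joint[OF M Y A] \<delta>_integral_joint[OF M Y A])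
  have i: "integrable M (f t)" "(\<integral>\<omega>. \<bar>f t \<omega>\<bar> \<partial>M) \<le> \<kappa> * (1 + R + R') + \<kappa> * (1 + 2 * R' + R)" if t: "t \<in> {0..T}" for t
  proof -
    interpret c: mean_field_cost "C t" "\<delta>C t" "\<delta>Cy t" \<kappa> by (rule cost_at[OF t])
    note P = square_integrable_P2[OF M L2_processD(1)[OF A t]]
    note ii = c.integrable_cost[OF M L2_processD(1)[OF Y t] P]
    note jj = c.integrable_\<delta>_integral[OF M L2_processD(1)[OF Y t] P]
    show "integrable M (f t)" unfolding f_def by (rule c.integrable_potential(1)[OF M L2_processD(1)[OF Y t] P])
    have m2: "moment2 (distr M borel (A t)) \<le> R'"
      using L2_processD(2)[OF A t] square_integrableD(1)[OF L2_processD(1)[OF A t]] by (simp add: moment2_distr)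
    have "(\<integral>\<omega>. \<bar>f t \<omega>\<bar> \<partial>M) \<le> (\<integral>\<omega>. \<bar>C t (Y t \<omega>) (distr M borel (A t))\<bar> + \<bar>\<integral>z. \<delta>C t z (distr M borel (A t)) (Y t \<omega>) \<partial>distr M borel (A t)\<bar> \<partial>M)"
      unfolding f_def potential_def using ii(1) jj(1) by (intro integral_mono) auto
    also have "\<dots> = (\<integral>\<omega>. \<bar>C t (Y t \<omega>) (distr M borel (A t))\<bar> \<partial>M) + (\<integral>\<omega>. \<bar>\<integral>z. \<delta>C t z (distr M borel (A t)) (Y t \<omega>) \<partial>distr M borel (A t)\<bar> \<partial>M)"
      using ii(1) jj(1) by (intro Bochner_Integration.integral_add) auto
    also have "\<dots> \<le> \<kappa> * (1 + (\<integral>\<omega>. (norm (Y t \<omega>))\<^sup>2 \<partial>M) + moment2 (distr M borel (A t))) + \<kappa> * (1 + 2 * moment2 (distr M borel (A t)) + (\<integral>\<omega>. (norm (Y t \<omega>))\<^sup>2 \<partial>M))"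
      by (rule add_mono[OF ii(2) jj(2)])
    also have "\<dots> \<le> \<kappa> * (1 + R + R') + \<kappa> * (1 + 2 * R' + R)"
      using c.\<kappa>_pos L2_processD(2)[OF Y t] m2 by (intro add_mono mult_left_mono) auto
    finally show "(\<integral>\<omega>. \<bar>f t \<omega>\<bar> \<partial>M) \<le> \<kappa> * (1 + R + R') + \<kappa> * (1 + 2 * R' + R)" .
  qed
  show "integrable M (\<lambda>\<omega>. LBINT t:{0..T}. f t \<omega>)"
    "(\<integral>\<omega>. (LBINT t:{0..T}. f t \<omega>) \<partial>M) = (LBINT t:{0..T}. (\<integral>\<omega>. f t \<omega> \<partial>M))"
    "set_integrable lborel {0..T} (\<lambda>t. \<integral>\<omega>. f t \<omega> \<partial>M)"
    using fubini_time[OF m i] T by auto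
qed

definition running_cost :: "'w measure \<Rightarrow> (real \<Rightarrow> 'w \<Rightarrow> 'a) \<Rightarrow> real" where
  "running_cost M Y = (LBINT t:{0..T}. (\<integral>\<omega>. C t (Y t \<omega>) (distr M borel (Y t)) \<partial>M))"

definition running_potential :: "'w measure \<Rightarrow> (real \<Rightarrow> 'w \<Rightarrow> 'a) \<Rightarrow> (real \<Rightarrow> 'w \<Rightarrow> 'a) \<Rightarrow> real" where
  "running_potential M A Y = (LBINT t:{0..T}. (\<integral>\<omega>. potential (C t) (\<delta>C t) (Y t \<omega>) (distr M borel (A t)) \<partial>M))"

text \<open>At each time the integrand is the remainder of \<open>C t\<close> divided by the step.
  It tends to 0 and is bounded by a constant free of \<open>t\<close>, so the limit may be taken
  under the time integral.\<close>

lemma running_remainder_tendsto: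
  fixes A B :: "real \<Rightarrow> 'w \<Rightarrow> 'a" and Y :: "nat \<Rightarrow> real \<Rightarrow> 'w \<Rightarrow> 'a"
  assumes M: "prob_space M" and A: "L2_process M T R A" and B: "L2_process M T R B"
    and e: "\<And>n. 0 < e n" "\<And>n. e n \<le> 1" "e \<longlonglongrightarrow> 0"
  defines "Y \<equiv> \<lambda>n t \<omega>. A t \<omega> + e n *\<^sub>R (B t \<omega> - A t \<omega>)"
  shows "(\<lambda>n. ((running_cost M (Y n) - running_cost M A) - (running_potential M A (Y n) - running_potential M A A)) / e n) \<longlonglongrightarrow> 0"
proof -
  have Yn: "L2_process M T (4 * R) (Y n)" for n
    unfolding Y_def using e(1)[of n] e(2)[of n] by (intro L2_process_interpolation[OF M A B]) auto
  define rem where "rem n t = (((\<integral>\<omega>. C t (Y n t \<omega>) (distr M borel (Y n t)) \<partial>M) - (\<integral>\<omega>. C t (A t \<omega>) (distr M borel (A t)) \<partial>M))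
    - ((\<integral>\<omega>. potential (C t) (\<delta>C t) (Y n t \<omega>) (distr M borel (A t)) \<partial>M) - (\<integral>\<omega>. potential (C t) (\<delta>C t) (A t \<omega>) (distr M borel (A t)) \<partial>M))) / e n" for n t
  note iY = cost_fubini(3)[OF M Yn Yn] and iA = cost_fubini(3)[OF M A A]
    and pY = potential_fubini(3)[OF M Yn A] and pA = potential_fubini(3)[OF M A A]
  have int: "set_integrable lborel {0..T} (rem n)" for n
    unfolding rem_def using iY[of n] iA pY[of n] pA by (intro set_integrable_divide set_integral_diff) auto
  have eq: "((running_cost M (Y n) - running_cost M A) - (running_potential M A (Y n) - running_potential M A A)) / e n = (LBINT t:{0..T}. rem n t)" for n
    unfolding rem_def running_cost_def running_potential_def using iY[of n] iA pY[of n] pA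
    by (simp add: set_integral_diff)
  have remt: "\<bar>rem n t\<bar> \<le> 2 * (\<kappa> * ((1 + 2 * (1 + R) + sqrt (5 * R)) * (2 * (1 + R)) + 4 * R))" "(\<lambda>n. rem n t) \<longlonglongrightarrow> 0"
    if t: "t \<in> {0..T}" for n t
  proof -
    interpret c: mean_field_cost "C t" "\<delta>C t" "\<delta>Cy t" \<kappa> by (rule cost_at[OF t])
    interpret v: mean_field_variation "C t" "\<delta>C t" "\<delta>Cy t" \<kappa> M "A t" "B t" R
      by (rule mean_field_variation.intro[OF cost_at[OF t] mean_field_variation_axioms.intro
            [OF M L2_processD(1)[OF A t] L2_processD(1)[OF B t] L2_processD(2)[OF A t] L2_processD(2)[OF B t]]])
    have Z: "v.Z (e n) = Y n t" for n by (simp add: v.Z_def[abs_def] Y_def fun_eq_iff)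
    have r: "rem n t = v.remainder (e n) / e n" for n
      unfolding rem_def v.remainder_alt Z ..
    show "\<bar>rem n t\<bar> \<le> 2 * (\<kappa> * ((1 + 2 * (1 + R) + sqrt (5 * R)) * (2 * (1 + R)) + 4 * R))"
      unfolding r using v.remainder_bound[OF e(1)[of n] e(2)[of n]] by (simp only: v.remainder_const_def)
    show "(\<lambda>n. rem n t) \<longlonglongrightarrow> 0" unfolding r by (rule v.remainder_tendsto[OF e])
  qed
  have "(\<lambda>n. LBINT t:{0..T}. rem n t) \<longlonglongrightarrow> (\<integral>t. 0 \<partial>(lborel :: real measure))"
    unfolding set_lebesgue_integral_def
  \<comment> \<open>The constant is \<open>remainder_const\<close> for \<open>S = R\<close>.\<close>
  proof (rule integral_dominated_convergence[where w="\<lambda>t. indicator {0..T} t * (2 * (\<kappa> * ((1 + 2 * (1 + R) + sqrt (5 * R)) * (2 * (1 + R)) + 4 * R)))"])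
    show "(\<lambda>t. indicator {0..T} t *\<^sub>R rem n t) \<in> borel_measurable lborel" for n
      using int[of n] unfolding set_integrable_def by (rule borel_measurable_integrable)
    show "integrable lborel (\<lambda>t. indicator {0..T} t * (2 * (\<kappa> * ((1 + 2 * (1 + R) + sqrt (5 * R)) * (2 * (1 + R)) + 4 * R))))"
      by (rule integrable_mult_left) (use T in \<open>auto intro!: integrable_real_indicator\<close>)
    show "AE t in lborel. (\<lambda>n. indicator {0..T} t *\<^sub>R rem n t) \<longlonglongrightarrow> 0"
      using remt(2) by (auto simp: indicator_def)
    show "AE t in lborel. norm (indicator {0..T} t *\<^sub>R rem n t) \<le> indicator {0..T} t * (2 * (\<kappa> * ((1 + 2 * (1 + R) + sqrt (5 * R)) * (2 * (1 + R)) + 4 * R)))" for n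
    proof (intro AE_I2)
      fix t show "norm (indicator {0..T} t *\<^sub>R rem n t) \<le> indicator {0..T} t * (2 * (\<kappa> * ((1 + 2 * (1 + R) + sqrt (5 * R)) * (2 * (1 + R)) + 4 * R)))"
        using remt(1)[of t n] by (cases "t \<in> {0..T}") auto
    qed
  qed simp
  then show ?thesis unfolding eq by simp
qed

end

section \<open>Sufficiency of the first-order condition\<close>

text \<open>Joint convexity is applied for each outcome separately, with the states
  \<open>A \<omega>\<close> and \<open>B \<omega>\<close> and with the laws of \<open>A\<close> and
  \<open>B\<close>, and then integrated.\<close>

lemma (in mean_field_cost) expectation_convex:
  assumes conv: "L_jointly_convex \<phi>" and M: "prob_space M" and A: "square_integrable M A" and B: "square_integrable M B"
    and e: "0 \<le> e" "e \<le> 1"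
  shows "(\<integral>\<omega>. \<phi> (A \<omega> + e *\<^sub>R (B \<omega> - A \<omega>)) (distr M borel (\<lambda>\<omega>. A \<omega> + e *\<^sub>R (B \<omega> - A \<omega>))) \<partial>M)
    \<le> (1 - e) * (\<integral>\<omega>. \<phi> (A \<omega>) (distr M borel A) \<partial>M) + e * (\<integral>\<omega>. \<phi> (B \<omega>) (distr M borel B) \<partial>M)"
proof -
  have eq: "A \<omega> + e *\<^sub>R (B \<omega> - A \<omega>) = (1 - e) *\<^sub>R A \<omega> + e *\<^sub>R B \<omega>" for \<omega> by (simp add: algebra_simps)
  let ?Z = "\<lambda>\<omega>. (1 - e) *\<^sub>R A \<omega> + e *\<^sub>R B \<omega>"
  have Z: "square_integrable M ?Z" by (intro square_integrable_add square_integrable_scaleR A B)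
  note P = square_integrable_P2[OF M]
  note iA = integrable_cost(1)[OF M A P[OF A]] and iB = integrable_cost(1)[OF M B P[OF B]] and iZ = integrable_cost(1)[OF M Z P[OF Z]]
  have "(\<integral>\<omega>. \<phi> (?Z \<omega>) (distr M borel ?Z) \<partial>M) \<le> (\<integral>\<omega>. (1 - e) * \<phi> (A \<omega>) (distr M borel A) + e * \<phi> (B \<omega>) (distr M borel B) \<partial>M)"
    by (rule integral_mono[OF iZ])
      (use iA iB in \<open>auto intro!: L_jointly_convexD[OF conv M square_integrableD(1)[OF A] square_integrableD(1)[OF B] P[OF A] P[OF B] P[OF Z] e]\<close>)
  also have "\<dots> = (1 - e) * (\<integral>\<omega>. \<phi> (A \<omega>) (distr M borel A) \<partial>M) + e * (\<integral>\<omega>. \<phi> (B \<omega>) (distr M borel B) \<partial>M)"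
    using iA iB by simp
  finally show ?thesis unfolding eq .
qed

lemma (in mean_field_cost) expectation_potential_cong_AE:
  assumes M: "prob_space M" and Y: "square_integrable M Y" and Z: "square_integrable M Z" and \<nu>: "\<nu> \<in> P2"
    and eq: "AE \<omega> in M. Y \<omega> = Z \<omega>"
  shows "(\<integral>\<omega>. potential \<phi> \<delta> (Y \<omega>) \<nu> \<partial>M) = (\<integral>\<omega>. potential \<phi> \<delta> (Z \<omega>) \<nu> \<partial>M)"
  by (rule integral_cong_AE[OF borel_measurable_integrable[OF integrable_potential(1)[OF M Y \<nu>]]
        borel_measurable_integrable[OF integrable_potential(1)[OF M Z \<nu>]]])
    (use eq in \<open>eventually_elim, simp\<close>)

context mean_field_running_cost
begin

lemma running_cost_convex:
  assumes conv: "\<And>t. t \<in> {0..T} \<Longrightarrow> L_jointly_convex (C t)" and M: "prob_space M"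
    and A: "L2_process M T R A" and B: "L2_process M T R B" and e: "0 \<le> e" "e \<le> 1"
  shows "running_cost M (\<lambda>t \<omega>. A t \<omega> + e *\<^sub>R (B t \<omega> - A t \<omega>)) \<le> (1 - e) * running_cost M A + e * running_cost M B"
proof -
  note Y = L2_process_interpolation[OF M A B e]
  note iA = cost_fubini(3)[OF M A A] and iB = cost_fubini(3)[OF M B B] and iY = cost_fubini(3)[OF M Y Y]
  have iA': "set_integrable lborel {0..T} (\<lambda>t. (1 - e) * (\<integral>\<omega>. C t (A t \<omega>) (distr M borel (A t)) \<partial>M))"
    using iA by (intro set_integrable_mult_right) simp
  have iB': "set_integrable lborel {0..T} (\<lambda>t. e * (\<integral>\<omega>. C t (B t \<omega>) (distr M borel (B t)) \<partial>M))"
    using iB by (intro set_integrable_mult_right) simp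
  have "running_cost M (\<lambda>t \<omega>. A t \<omega> + e *\<^sub>R (B t \<omega> - A t \<omega>)) \<le>
    (LBINT t:{0..T}. (1 - e) * (\<integral>\<omega>. C t (A t \<omega>) (distr M borel (A t)) \<partial>M) + e * (\<integral>\<omega>. C t (B t \<omega>) (distr M borel (B t)) \<partial>M))"
    unfolding running_cost_def
  proof (rule set_integral_mono[OF iY set_integral_add(1)[OF iA' iB']])
    fix t assume t: "t \<in> {0..T}"
    interpret c: mean_field_cost "C t" "\<delta>C t" "\<delta>Cy t" \<kappa> by (rule cost_at[OF t])
    show "(\<integral>\<omega>. C t (A t \<omega> + e *\<^sub>R (B t \<omega> - A t \<omega>)) (distr M borel (\<lambda>\<omega>. A t \<omega> + e *\<^sub>R (B t \<omega> - A t \<omega>))) \<partial>M)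
      \<le> (1 - e) * (\<integral>\<omega>. C t (A t \<omega>) (distr M borel (A t)) \<partial>M) + e * (\<integral>\<omega>. C t (B t \<omega>) (distr M borel (B t)) \<partial>M)"
      by (rule c.expectation_convex[OF conv[OF t] M L2_processD(1)[OF A t] L2_processD(1)[OF B t] e])
  qed
  also have "\<dots> = (1 - e) * running_cost M A + e * running_cost M B"
    unfolding running_cost_def set_integral_add(2)[OF iA' iB'] by simp
  finally show ?thesis .
qed

text \<open>Lets an interpolated process take the place of the state that belongs to the
  interpolated control.\<close>

lemma running_potential_cong_AE:
  assumes M: "prob_space M" and A: "L2_process M T R A" and Y: "L2_process M T R' Y" and Z: "L2_process M T R'' Z"
    and eq: "\<And>t. t \<in> {0..T} \<Longrightarrow> AE \<omega> in M. Y t \<omega> = Z t \<omega>"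
  shows "running_potential M A Y = running_potential M A Z"
  unfolding running_potential_def
proof (rule set_lebesgue_integral_cong)
  show "\<forall>t. t \<in> {0..T} \<longrightarrow> (\<integral>\<omega>. potential (C t) (\<delta>C t) (Y t \<omega>) (distr M borel (A t)) \<partial>M)
    = (\<integral>\<omega>. potential (C t) (\<delta>C t) (Z t \<omega>) (distr M borel (A t)) \<partial>M)"
  proof (intro allI impI)
    fix t assume t: "t \<in> {0..T}"
    interpret c: mean_field_cost "C t" "\<delta>C t" "\<delta>Cy t" \<kappa> by (rule cost_at[OF t])
    show "(\<integral>\<omega>. potential (C t) (\<delta>C t) (Y t \<omega>) (distr M borel (A t)) \<partial>M) = (\<integral>\<omega>. potential (C t) (\<delta>C t) (Z t \<omega>) (distr M borel (A t)) \<partial>M)"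
      by (rule c.expectation_potential_cong_AE[OF M L2_processD(1)[OF Y t] L2_processD(1)[OF Z t] square_integrable_P2[OF M L2_processD(1)[OF A t]] eq[OF t]])
  qed
qed simp

lemma expected_cost:
  assumes M: "prob_space M" and Y: "L2_process M T R Y" and G: "mean_field_cost G \<delta>G \<delta>Gy \<kappa>" and k: "integrable M k"
  shows "(\<integral>\<omega>. (LBINT t:{0..T}. C t (Y t \<omega>) (distr M borel (Y t))) + G (Y T \<omega>) (distr M borel (Y T)) + k \<omega> \<partial>M)
    = running_cost M Y + (\<integral>\<omega>. G (Y T \<omega>) (distr M borel (Y T)) \<partial>M) + (\<integral>\<omega>. k \<omega> \<partial>M)"
proof -
  interpret g: mean_field_cost G \<delta>G \<delta>Gy \<kappa> by (rule G)
  have TT: "T \<in> {0..T}" using T by simp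
  note Yt = L2_processD(1)[OF Y TT]
  note iG = g.integrable_cost(1)[OF M Yt square_integrable_P2[OF M Yt]]
  show ?thesis
    unfolding running_cost_def cost_fubini(2)[OF M Y Y, symmetric]
    using cost_fubini(1)[OF M Y Y] iG k by simp
qed

lemma expected_potential:
  assumes M: "prob_space M" and A: "L2_process M T R A" and Y: "L2_process M T R' Y" and G: "mean_field_cost G \<delta>G \<delta>Gy \<kappa>"
    and k: "integrable M k" and \<mu>: "\<forall>t\<in>{0..T}. \<mu> t = distr M borel (A t)"
  shows "(\<integral>\<omega>. (LBINT t:{0..T}. potential (C t) (\<delta>C t) (Y t \<omega>) (\<mu> t)) + potential G \<delta>G (Y T \<omega>) (\<mu> T) + k \<omega> \<partial>M)
    = running_potential M A Y + (\<integral>\<omega>. potential G \<delta>G (Y T \<omega>) (distr M borel (A T)) \<partial>M) + (\<integral>\<omega>. k \<omega> \<partial>M)"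
proof -
  interpret g: mean_field_cost G \<delta>G \<delta>Gy \<kappa> by (rule G)
  have TT: "T \<in> {0..T}" using T by simp
  note iG = g.integrable_potential(1)[OF M L2_processD(1)[OF Y TT] square_integrable_P2[OF M L2_processD(1)[OF A TT]]]
  have eq: "(LBINT t:{0..T}. potential (C t) (\<delta>C t) (Y t \<omega>) (\<mu> t)) = (LBINT t:{0..T}. potential (C t) (\<delta>C t) (Y t \<omega>) (distr M borel (A t)))" for \<omega>
    by (rule set_lebesgue_integral_cong) (auto simp: \<mu>)
  show ?thesis
    unfolding eq bspec[OF \<mu> TT] running_potential_def potential_fubini(2)[OF M Y A, symmetric]
    using potential_fubini(1)[OF M Y A] iG k by simp
qed

text \<open>\<open>k\<close> and \<open>l\<close> stand for the expected control costs. These are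
  affine along the interpolation and contribute no remainder, so the argument can be carried out for
  the two state processes alone.\<close>

lemma first_order_condition_imp_optimal:
  assumes M: "prob_space M" and A: "L2_process M T R A" and B: "L2_process M T R B" and G: "mean_field_cost G \<delta>G \<delta>Gy \<kappa>"
    and conv: "\<And>t. t \<in> {0..T} \<Longrightarrow> L_jointly_convex (C t)" "L_jointly_convex G"
    and first_order: "\<And>e. 0 < e \<Longrightarrow> e \<le> 1 \<Longrightarrow>
      running_potential M A A + (\<integral>\<omega>. potential G \<delta>G (A T \<omega>) (distr M borel (A T)) \<partial>M) + k
      \<le> running_potential M A (\<lambda>t \<omega>. A t \<omega> + e *\<^sub>R (B t \<omega> - A t \<omega>))
        + (\<integral>\<omega>. potential G \<delta>G (A T \<omega> + e *\<^sub>R (B T \<omega> - A T \<omega>)) (distr M borel (A T)) \<partial>M) + ((1 - e) * k + e * l)"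
  shows "running_cost M A + (\<integral>\<omega>. G (A T \<omega>) (distr M borel (A T)) \<partial>M) + k
    \<le> running_cost M B + (\<integral>\<omega>. G (B T \<omega>) (distr M borel (B T)) \<partial>M) + l"
proof -
  have TT: "T \<in> {0..T}" using T by simp
  interpret v: mean_field_variation G \<delta>G \<delta>Gy \<kappa> M "A T" "B T" R
    by (rule mean_field_variation.intro[OF G mean_field_variation_axioms.intro
          [OF M L2_processD(1)[OF A TT] L2_processD(1)[OF B TT] L2_processD(2)[OF A TT] L2_processD(2)[OF B TT]]])
  define e where "e n = 1 / real (Suc n)" for n
  have e: "0 < e n" "e n \<le> 1" for n by (auto simp: e_def)
  have e0: "e \<longlonglongrightarrow> 0" unfolding e_def[abs_def] by (rule LIMSEQ_Suc[OF lim_1_over_n])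
  define Y where "Y n = (\<lambda>t \<omega>. A t \<omega> + e n *\<^sub>R (B t \<omega> - A t \<omega>))" for n
  have Z: "v.Z (e n) = (\<lambda>\<omega>. A T \<omega> + e n *\<^sub>R (B T \<omega> - A T \<omega>))" for n by (simp add: v.Z_def[abs_def])
  define r where "r n = ((running_cost M (Y n) - running_cost M A) - (running_potential M A (Y n) - running_potential M A A)) / e n" for n
  have "r \<longlonglongrightarrow> 0" unfolding r_def[abs_def] Y_def by (rule running_remainder_tendsto[OF M A B e e0])
  from tendsto_add[OF this v.remainder_tendsto[OF e e0]]
  have lim: "(\<lambda>n. r n + v.remainder (e n) / e n) \<longlonglongrightarrow> 0" by simp
  have bound: "r n + v.remainder (e n) / e n \<le>
    (running_cost M B + (\<integral>\<omega>. G (B T \<omega>) (distr M borel (B T)) \<partial>M) + l) - (running_cost M A + (\<integral>\<omega>. G (A T \<omega>) (distr M borel (A T)) \<partial>M) + k)" (is "_ \<le> ?D") for n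
  proof -
    have le: "0 \<le> e n" using e(1)[of n] by simp
    have 1: "running_cost M (Y n) \<le> (1 - e n) * running_cost M A + e n * running_cost M B"
      unfolding Y_def by (rule running_cost_convex[OF conv(1) M A B le e(2)])
    have 2: "(\<integral>\<omega>. G (v.Z (e n) \<omega>) (distr M borel (v.Z (e n))) \<partial>M) \<le>
      (1 - e n) * (\<integral>\<omega>. G (A T \<omega>) (distr M borel (A T)) \<partial>M) + e n * (\<integral>\<omega>. G (B T \<omega>) (distr M borel (B T)) \<partial>M)"
      unfolding Z by (rule v.expectation_convex[OF conv(2) M L2_processD(1)[OF A TT] L2_processD(1)[OF B TT] le e(2)])
    have 3: "running_potential M A A + (\<integral>\<omega>. potential G \<delta>G (A T \<omega>) (distr M borel (A T)) \<partial>M) + k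
      \<le> running_potential M A (Y n) + (\<integral>\<omega>. potential G \<delta>G (v.Z (e n) \<omega>) (distr M borel (A T)) \<partial>M) + ((1 - e n) * k + e n * l)"
      unfolding Y_def Z by (rule first_order[OF e])
    have "e n * r n = (running_cost M (Y n) - running_cost M A) - (running_potential M A (Y n) - running_potential M A A)"
      using e(1)[of n] by (simp add: r_def)
    \<comment> \<open>The left-hand side is the increment of the costs minus that of the potentials.
      The former is bounded above by convexity, facts 1 and 2; the latter is bounded below by
      \<open>e n * (k - l)\<close>, fact 3.\<close>
    then have "e n * r n + v.remainder (e n) \<le> e n * ?D"
      using 1 2 3 unfolding v.remainder_alt by (simp add: algebra_simps)
    then have "(e n * r n + v.remainder (e n)) / e n \<le> ?D"
      using e(1)[of n] by (simp add: pos_divide_le_eq mult.commute)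
    then show ?thesis using e(1)[of n] by (simp add: add_divide_distrib)
  qed
  have "0 \<le> ?D" by (rule LIMSEQ_le_const2[OF lim]) (use bound in blast)
  then show ?thesis by simp
qed

end

section \<open>Control costs\<close>

lemma continuous_on_Icc_component_bound:
  fixes K :: "real \<Rightarrow> real^'m"
  assumes K: "continuous_on {0..T} K"
  shows "\<exists>B. \<forall>s\<in>{0..T}. \<forall>j. \<bar>K s $ j\<bar> \<le> B"
proof -
  have "bounded (K ` {0..T})" by (intro compact_imp_bounded compact_continuous_image K compact_Icc)
  then obtain B where B: "\<forall>s\<in>{0..T}. norm (K s) \<le> B" unfolding bounded_iff by auto
  then have "\<bar>K s $ j\<bar> \<le> B" if "s \<in> {0..T}" for s j using component_le_norm_cart[of "K s" j] B that by (meson order_trans)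
  then show ?thesis by blast
qed

context controlled_diffusion
begin

lemma control_cost_combination:
  assumes K: "continuous_on {0..T} K" and "\<xi> \<in> admissible_controls T M F" "\<eta> \<in> admissible_controls T M F" "\<omega> \<in> space M" "0 \<le> c" "0 \<le> d"
  shows "control_cost T K (\<lambda>t \<omega>. c *\<^sub>R \<xi> t \<omega> + d *\<^sub>R \<eta> t \<omega>) \<omega> = c * control_cost T K \<xi> \<omega> + d * control_cost T K \<eta> \<omega>"
proof -
  have "(LINT s:{0..T}|control_measure T (\<lambda>t \<omega>. c *\<^sub>R \<xi> t \<omega> + d *\<^sub>R \<eta> t \<omega>) j \<omega>. K s $ j)
    = c * (LINT s:{0..T}|control_measure T \<xi> j \<omega>. K s $ j) + d * (LINT s:{0..T}|control_measure T \<eta> j \<omega>. K s $ j)" for j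
    by (rule control_integral_combination[OF assms(2-4) T assms(5,6) continuous_on_component[OF K]]) (use T in simp)
  then show ?thesis unfolding control_cost_def by (simp add: sum.distrib sum_distrib_left)
qed

text \<open>Each component is bounded by the maximum of \<open>K\<close> times the norm of
  \<open>\<xi> T\<close>, because the total mass of a monotone control is its terminal value; and
  \<open>\<xi> T\<close> is square-integrable.\<close>

lemma integrable_control_cost:
  assumes K: "continuous_on {0..T} K" and \<xi>: "\<xi> \<in> admissible_controls T M F"
  shows "integrable M (control_cost T K \<xi>)"
proof -
  obtain B where B: "\<And>s j. s \<in> {0..T} \<Longrightarrow> \<bar>K s $ j\<bar> \<le> B" using continuous_on_Icc_component_bound[OF K] by blast
  have Kj: "continuous_on {0..T} (\<lambda>s. K s $ j)" for j by (rule continuous_on_component[OF K])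
  have \<xi>M: "\<xi> t \<in> borel_measurable M" if "t \<in> {0..T}" for t
    by (rule measurable_F_imp_M[OF that admissible_controlsD(1)[OF \<xi> that]])
  have sq: "square_integrable M (\<xi> T)"
    using \<xi>M[of T] T admissible_controlsD(5)[OF \<xi>] by (simp add: square_integrable_def)
  have "integrable M (\<lambda>\<omega>. LINT s:{0..T}|control_measure T \<xi> j \<omega>. K s $ j)" for j
  proof (rule Bochner_Integration.integrable_bound[where f="\<lambda>\<omega>. B * norm (\<xi> T \<omega>)"])
    show "integrable M (\<lambda>\<omega>. B * norm (\<xi> T \<omega>))"
      using square_integrable_norm[OF finite_measure_axioms sq] by simp
    show "(\<lambda>\<omega>. LINT s:{0..T}|control_measure T \<xi> j \<omega>. K s $ j) \<in> borel_measurable M"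
      unfolding control_measure_eq
    proof (rule measurable_stieltjes_integral[OF stieltjes_control_path[OF \<xi> _ T] _ Kj])
      fix s assume s: "0 \<le> s" "s \<le> T"
      then have "\<xi> s \<in> borel_measurable M" by (intro \<xi>M) auto
      then show "(\<lambda>\<omega>. control_path T \<xi> j \<omega> s) \<in> borel_measurable M"
        using s by (simp add: control_path_def borel_measurable_vec_nth_compose)
    qed (use T in auto)
    show "AE \<omega> in M. norm (LINT s:{0..T}|control_measure T \<xi> j \<omega>. K s $ j) \<le> norm (B * norm (\<xi> T \<omega>))"
    proof (rule AE_I2)
      fix \<omega> assume "\<omega> \<in> space M"
      have "\<bar>LINT s:{0..T}|control_measure T \<xi> j \<omega>. K s $ j\<bar> \<le> B * norm (\<xi> T \<omega>)"
        by (rule control_integral_bound[OF \<xi> \<open>\<omega> \<in> space M\<close> T Kj _ B]) (use T in auto)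
      then show "norm (LINT s:{0..T}|control_measure T \<xi> j \<omega>. K s $ j) \<le> norm (B * norm (\<xi> T \<omega>))" by simp
    qed
  qed
  then show ?thesis unfolding control_cost_def[abs_def] by (intro Bochner_Integration.integrable_sum)
qed

end

lemma (in controlled_state) L2_process_state: "\<exists>R. L2_process M T R X"
proof (rule state_square_integrable)
  fix R assume R: "\<And>t. t \<in> {0..T} \<Longrightarrow> square_integrable M (X t)" "\<And>t. t \<in> {0..T} \<Longrightarrow> (\<integral>\<omega>. (norm (X t \<omega>))\<^sup>2 \<partial>M) \<le> R"
  show ?thesis
    unfolding L2_process_def
    by (intro exI[of _ R] conjI ballI R X_right_continuous state_L2_right_continuous)
qed

text \<open>Joint continuity including the time variable yields the continuity demanded of the cost
  at a fixed time.\<close>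

lemma continuous_map_slice:
  assumes "continuous_map (prod_topology (top_of_set S) X) Y f" "t \<in> S"
  shows "continuous_map X Y (\<lambda>p. f (t, p))"
  using continuous_map_compose[OF _ assms(1), of X "\<lambda>p. (t, p)"] assms(2)
  by (simp add: continuous_map_pairedI comp_def)

theorem theorem3p1:
  fixes T \<kappa> :: real
    and M :: "'w measure" and F :: "real \<Rightarrow> 'w measure"
    and W :: "real \<Rightarrow> 'w \<Rightarrow> real^'d"
    and b :: "real \<Rightarrow> real^'n \<Rightarrow> real^'n"
    and \<sigma> :: "real \<Rightarrow> real^'n \<Rightarrow> real^'d^'n"
    and \<zeta> :: "real \<Rightarrow> real^'m^'n"
    and K :: "real \<Rightarrow> real^'m"
    and x0 :: "real^'n"
    and C :: "real \<Rightarrow> real^'n \<Rightarrow> (real^'n) measure \<Rightarrow> real"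
    and G :: "real^'n \<Rightarrow> (real^'n) measure \<Rightarrow> real"
    and \<delta>C :: "real \<Rightarrow> real^'n \<Rightarrow> (real^'n) measure \<Rightarrow> real^'n \<Rightarrow> real"
    and \<delta>G :: "real^'n \<Rightarrow> (real^'n) measure \<Rightarrow> real^'n \<Rightarrow> real"
    and Cx :: "real \<Rightarrow> real^'n \<Rightarrow> (real^'n) measure \<Rightarrow> real^'n"
    and Gx :: "real^'n \<Rightarrow> (real^'n) measure \<Rightarrow> real^'n"
    and \<delta>Cy :: "real \<Rightarrow> real^'n \<Rightarrow> (real^'n) measure \<Rightarrow> real^'n \<Rightarrow> real^'n"
    and \<delta>Gy :: "real^'n \<Rightarrow> (real^'n) measure \<Rightarrow> real^'n \<Rightarrow> real^'n"
    and X :: "(real \<Rightarrow> 'w \<Rightarrow> real^'m) \<Rightarrow> real \<Rightarrow> 'w \<Rightarrow> real^'n"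
    and \<xi>s :: "real \<Rightarrow> 'w \<Rightarrow> real^'m"
    and \<mu>s :: "real \<Rightarrow> (real^'n) measure"
  assumes T: "T > 0"
    and space: "prob_space M" "complete_measure M" "usual_filtration T M F"
    and W: "brownian_motion T M F W"
    and b_meas: "(\<lambda>(t, x). b t x) \<in> borel_measurable (restrict_space borel {0..T} \<Otimes>\<^sub>M borel)"
    and \<sigma>_meas: "(\<lambda>(t, x). \<sigma> t x) \<in> borel_measurable (restrict_space borel {0..T} \<Otimes>\<^sub>M borel)"
    and \<zeta>_meas: "\<zeta> \<in> borel_measurable (restrict_space borel {0..T})"
    and C_meas: "(\<lambda>(t, x, \<mu>). C t x \<mu>) \<in>
      borel_measurable (restrict_space borel {0..T} \<Otimes>\<^sub>M borel \<Otimes>\<^sub>M borel_P2)"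
    and G_meas: "(\<lambda>(x, \<mu>). G x \<mu>) \<in> borel_measurable (borel \<Otimes>\<^sub>M borel_P2)"
    and K: "continuous_on {0..T} K" "\<forall>t\<in>{0..T}. \<forall>j. 0 \<le> K t $ j"
    and X: "\<forall>\<xi>\<in>admissible_controls T M F. solves_state_equation T M F W b \<sigma> \<zeta> x0 \<xi> (X \<xi>)"
    and A1: "\<exists>L. \<forall>t\<in>{0..T}. L-lipschitz_on UNIV (b t) \<and> L-lipschitz_on UNIV (\<sigma> t)"
    and A2: "continuous_on {0..T} \<zeta>"
    and A3: "\<forall>t\<in>{0..T}. \<forall>x. has_linear_derivative (C t x) (\<delta>C t x)"
      "\<forall>x. has_linear_derivative (G x) (\<delta>G x)"
    and \<kappa>: "\<kappa> > 0"
    and A4_continuous: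
      "continuous_map (prod_topology (top_of_set {0..T}) state_measure_topology) euclideanreal
        (\<lambda>(t, x, \<mu>). C t x \<mu>)"
      "continuous_map state_measure_topology euclideanreal (\<lambda>(x, \<mu>). G x \<mu>)"
      "continuous_map (prod_topology (top_of_set {0..T}) state_measure_point_topology) euclideanreal
        (\<lambda>(t, x, \<mu>, y). \<delta>C t x \<mu> y)"
      "continuous_map state_measure_point_topology euclideanreal (\<lambda>(x, \<mu>, y). \<delta>G x \<mu> y)"
    and A4_growth: "\<forall>t\<in>{0..T}. \<forall>x. \<forall>\<mu>\<in>P2. \<forall>y.
      \<bar>C t x \<mu>\<bar> + \<bar>G x \<mu>\<bar> + \<bar>\<delta>C t x \<mu> y\<bar> + \<bar>\<delta>G x \<mu> y\<bar>
        \<le> \<kappa> * (1 + (norm x)\<^sup>2 + moment2 \<mu> + (norm y)\<^sup>2)"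
    and A5_derivatives:
      "\<forall>t\<in>{0..T}. \<forall>x. \<forall>\<mu>\<in>P2. GDERIV (\<lambda>z. C t z \<mu>) x :> Cx t x \<mu>"
      "\<forall>x. \<forall>\<mu>\<in>P2. GDERIV (\<lambda>z. G z \<mu>) x :> Gx x \<mu>"
      "\<forall>t\<in>{0..T}. \<forall>x. \<forall>\<mu>\<in>P2. \<forall>y. GDERIV (\<lambda>z. \<delta>C t x \<mu> z) y :> \<delta>Cy t x \<mu> y"
      "\<forall>x. \<forall>\<mu>\<in>P2. \<forall>y. GDERIV (\<lambda>z. \<delta>G x \<mu> z) y :> \<delta>Gy x \<mu> y"
    and A5_continuous:
      "continuous_map (prod_topology (top_of_set {0..T}) state_measure_topology) euclidean
        (\<lambda>(t, x, \<mu>). Cx t x \<mu>)"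
      "continuous_map state_measure_topology euclidean (\<lambda>(x, \<mu>). Gx x \<mu>)"
      "continuous_map (prod_topology (top_of_set {0..T}) state_measure_point_topology) euclidean
        (\<lambda>(t, x, \<mu>, y). \<delta>Cy t x \<mu> y)"
      "continuous_map state_measure_point_topology euclidean (\<lambda>(x, \<mu>, y). \<delta>Gy x \<mu> y)"
    and A5_growth: "\<forall>t\<in>{0..T}. \<forall>x. \<forall>\<mu>\<in>P2. \<forall>y.
      norm (Cx t x \<mu>) + norm (Gx x \<mu>) + norm (\<delta>Cy t x \<mu> y) + norm (\<delta>Gy x \<mu> y)
        \<le> \<kappa> * (1 + norm x + sqrt (moment2 \<mu>) + norm y)"
    and B: "L_jointly_convex G"
      "\<forall>t\<in>{0..T}. \<forall>p q. L_jointly_convex (\<lambda>x \<mu>. hamiltonian b \<sigma> C t x \<mu> p q)"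
    and solution: "potential_mfg_solution T M F C \<delta>C G \<delta>G K X \<xi>s \<mu>s"
  shows "\<forall>\<xi>\<in>admissible_controls T M F. J_mfc T M C G K X \<xi>s \<le> J_mfc T M C G K X \<xi>"
proof
  fix \<xi> :: "real \<Rightarrow> 'w \<Rightarrow> real^'m"
  assume \<xi>: "\<xi> \<in> admissible_controls T M F"
  have M: "prob_space M" by (rule space(1))
  have T0: "0 \<in> {0..T}" and TT: "T \<in> {0..T}" using T by auto
  obtain L where L: "\<And>t. t \<in> {0..T} \<Longrightarrow> L-lipschitz_on UNIV (b t)" "\<And>t. t \<in> {0..T} \<Longrightarrow> L-lipschitz_on UNIV (\<sigma> t)"
    using A1 by blast
  interpret D: controlled_diffusion M T F W b \<sigma> \<zeta> x0 L
    by (rule controlled_diffusion.intro[OF filtered_brownian.intro[OF M filtered_brownian_axioms.intro[OF space(3) W]]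
          controlled_diffusion_axioms.intro[OF T b_meas L A2]])
  \<comment> \<open>The growth assumption bounds a sum of nonnegative terms; taking the point
    variable to be 0 removes it from the right-hand side.\<close>
  have gC: "\<bar>C t x \<mu>\<bar> \<le> \<kappa> * (1 + (norm x)\<^sup>2 + moment2 \<mu>)" "\<bar>G x \<mu>\<bar> \<le> \<kappa> * (1 + (norm x)\<^sup>2 + moment2 \<mu>)"
    if "t \<in> {0..T}" "\<mu> \<in> P2" for t x \<mu>
    using A4_growth[rule_format, OF that, of x 0] by simp_all
  have g\<delta>: "\<bar>\<delta>C t x \<mu> y\<bar> \<le> \<kappa> * (1 + (norm x)\<^sup>2 + moment2 \<mu> + (norm y)\<^sup>2)" "\<bar>\<delta>G x \<mu> y\<bar> \<le> \<kappa> * (1 + (norm x)\<^sup>2 + moment2 \<mu> + (norm y)\<^sup>2)"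
    if "t \<in> {0..T}" "\<mu> \<in> P2" for t x \<mu> y
    using A4_growth[rule_format, OF that, of x y] by simp_all
  have g\<delta>y: "norm (\<delta>Cy t x \<mu> y) \<le> \<kappa> * (1 + norm x + sqrt (moment2 \<mu>) + norm y)"
    "norm (\<delta>Gy x \<mu> y) \<le> \<kappa> * (1 + norm x + sqrt (moment2 \<mu>) + norm y)"
    if "t \<in> {0..T}" "\<mu> \<in> P2" for t x \<mu> y
    using A5_growth[rule_format, OF that, of x y] norm_ge_zero[of "Cx t x \<mu>"] norm_ge_zero[of "Gx x \<mu>"]
      norm_ge_zero[of "\<delta>Cy t x \<mu> y"] norm_ge_zero[of "\<delta>Gy x \<mu> y"] by linarith+
  \<comment> \<open>The growth bounds for \<open>G\<close> are stated jointly with those for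
    \<open>C\<close>, so some time has to be chosen to extract them; 0 serves.\<close>
  have G: "mean_field_cost G \<delta>G \<delta>Gy \<kappa>"
    by (rule mean_field_cost.intro[OF A3(2)[rule_format] A4_continuous(2,4) A5_continuous(4)
          gC(2)[OF T0] g\<delta>(2)[OF T0] g\<delta>y(2)[OF T0] A5_derivatives(4)[rule_format] \<kappa>])
  have cost_at: "mean_field_cost (C t) (\<delta>C t) (\<delta>Cy t) \<kappa>" if t: "t \<in> {0..T}" for t
    by (rule mean_field_cost.intro[OF A3(1)[rule_format, OF t]
          continuous_map_slice[OF A4_continuous(1) t, simplified] continuous_map_slice[OF A4_continuous(3) t, simplified]
          continuous_map_slice[OF A5_continuous(3) t, simplified]
          gC(1)[OF t] g\<delta>(1)[OF t] g\<delta>y(1)[OF t] A5_derivatives(3)[rule_format, OF t] \<kappa>])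
  interpret C: mean_field_running_cost T \<kappa> C \<delta>C \<delta>Cy
    by (rule mean_field_running_cost.intro[OF T cost_at A4_continuous(1,3)])
  have \<xi>s: "\<xi>s \<in> admissible_controls T M F" and \<mu>s: "\<forall>t\<in>{0..T}. \<mu>s t = distr M borel (X \<xi>s t)"
    and opt: "\<And>\<eta>. \<eta> \<in> admissible_controls T M F \<Longrightarrow>
      J_mfg T M (\<lambda>t. potential (C t) (\<delta>C t)) (potential G \<delta>G) K X \<xi>s \<mu>s
      \<le> J_mfg T M (\<lambda>t. potential (C t) (\<delta>C t)) (potential G \<delta>G) K X \<eta> \<mu>s"
    using solution unfolding potential_mfg_solution_def by blast+
  have sol: "solves_state_equation T M F W b \<sigma> \<zeta> x0 \<eta> (X \<eta>)" if "\<eta> \<in> admissible_controls T M F" for \<eta>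
    using X that by blast
  have L2: "\<exists>R. L2_process M T R (X \<eta>)" if \<eta>: "\<eta> \<in> admissible_controls T M F" for \<eta>
    by (rule controlled_state.L2_process_state[OF controlled_state.intro
          [OF D.controlled_diffusion_axioms controlled_state_axioms.intro[OF \<eta> sol[OF \<eta>]]]])
  obtain R1 R2 where "L2_process M T R1 (X \<xi>s)" "L2_process M T R2 (X \<xi>)" using L2[OF \<xi>s] L2[OF \<xi>] by blast
  \<comment> \<open>A common moment bound for the optimal state and its competitor, as
    \<open>mean_field_variation\<close> demands.\<close>
  then have A: "L2_process M T (max R1 R2) (X \<xi>s)" and B': "L2_process M T (max R1 R2) (X \<xi>)"
    by (auto elim: L2_process_mono)
  note k = D.integrable_control_cost[OF K(1)]
  let ?k = "\<integral>\<omega>. control_cost T K \<xi>s \<omega> \<partial>M" and ?l = "\<integral>\<omega>. control_cost T K \<xi> \<omega> \<partial>M"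
  have "C.running_potential M (X \<xi>s) (X \<xi>s) + (\<integral>\<omega>. potential G \<delta>G (X \<xi>s T \<omega>) (distr M borel (X \<xi>s T)) \<partial>M) + ?k
    \<le> C.running_potential M (X \<xi>s) (\<lambda>t \<omega>. X \<xi>s t \<omega> + e *\<^sub>R (X \<xi> t \<omega> - X \<xi>s t \<omega>))
      + (\<integral>\<omega>. potential G \<delta>G (X \<xi>s T \<omega> + e *\<^sub>R (X \<xi> T \<omega> - X \<xi>s T \<omega>)) (distr M borel (X \<xi>s T)) \<partial>M) + ((1 - e) * ?k + e * ?l)"
    if e: "0 < e" "e \<le> 1" for e
  proof -
    let ?\<eta> = "\<lambda>t \<omega>. (1 - e) *\<^sub>R \<xi>s t \<omega> + e *\<^sub>R \<xi> t \<omega>" and ?Y = "\<lambda>t \<omega>. X \<xi>s t \<omega> + e *\<^sub>R (X \<xi> t \<omega> - X \<xi>s t \<omega>)"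
    have e': "0 \<le> e" "0 \<le> 1 - e" using e by auto
    have \<eta>: "?\<eta> \<in> admissible_controls T M F" by (rule D.admissible_convex[OF \<xi>s \<xi> e'(2,1)])
    have aff: "b t ((1 - e) *\<^sub>R x + e *\<^sub>R y) = (1 - e) *\<^sub>R b t x + e *\<^sub>R b t y"
      "\<sigma> t ((1 - e) *\<^sub>R x + e *\<^sub>R y) = (1 - e) *\<^sub>R \<sigma> t x + e *\<^sub>R \<sigma> t y" if t: "t \<in> {0..T}" for t x y
      by (rule hamiltonian_convex_imp_affine[OF B(2)[rule_format, OF t] e'(1) e(2)])+
    \<comment> \<open>Here uniqueness enters: \<open>X\<close> may deliver any solution for the
      control \<open>?\<eta>\<close>, and it agrees almost surely at each time with the interpolated
      state. That is enough for the expectations below.\<close>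
    have eq: "AE \<omega> in M. X ?\<eta> t \<omega> = ?Y t \<omega>" if t: "t \<in> {0..T}" for t
    proof -
      have "AE \<omega> in M. X ?\<eta> t \<omega> = (1 - e) *\<^sub>R X \<xi>s t \<omega> + e *\<^sub>R X \<xi> t \<omega>"
        by (rule D.state_affine[OF aff e'(1) e(2) \<xi>s \<xi> sol[OF \<xi>s] sol[OF \<xi>] sol[OF \<eta>] t])
      then show ?thesis by eventually_elim (simp add: algebra_simps)
    qed
    obtain R3 where X\<eta>: "L2_process M T R3 (X ?\<eta>)" using L2[OF \<eta>] by blast
    note Y = L2_process_interpolation[OF M A B' e'(1) e(2)]
    have 1: "C.running_potential M (X \<xi>s) (X ?\<eta>) = C.running_potential M (X \<xi>s) ?Y"
      by (rule C.running_potential_cong_AE[OF M A X\<eta> Y eq])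
    have 2: "(\<integral>\<omega>. potential G \<delta>G (X ?\<eta> T \<omega>) (distr M borel (X \<xi>s T)) \<partial>M) = (\<integral>\<omega>. potential G \<delta>G (?Y T \<omega>) (distr M borel (X \<xi>s T)) \<partial>M)"
      by (rule mean_field_cost.expectation_potential_cong_AE[OF G M L2_processD(1)[OF X\<eta> TT] L2_processD(1)[OF Y TT]
            square_integrable_P2[OF M L2_processD(1)[OF A TT]] eq[OF TT]])
    have "(\<integral>\<omega>. control_cost T K ?\<eta> \<omega> \<partial>M) = (\<integral>\<omega>. (1 - e) * control_cost T K \<xi>s \<omega> + e * control_cost T K \<xi> \<omega> \<partial>M)"
      by (rule Bochner_Integration.integral_cong[OF refl]) (rule D.control_cost_combination[OF K(1) \<xi>s \<xi> _ e'(2,1)])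
    then have 3: "(\<integral>\<omega>. control_cost T K ?\<eta> \<omega> \<partial>M) = (1 - e) * ?k + e * ?l" using k[OF \<xi>s] k[OF \<xi>] by simp
    show ?thesis
      using opt[OF \<eta>]
      unfolding J_mfg_def C.expected_potential[OF M A A G k[OF \<xi>s] \<mu>s] C.expected_potential[OF M A X\<eta> G k[OF \<eta>] \<mu>s] 1 2 3 .
  qed
  from C.first_order_condition_imp_optimal[OF M A B' G hamiltonian_convex_imp_cost_convex[OF B(2)[rule_format]] B(1) this]
  show "J_mfc T M C G K X \<xi>s \<le> J_mfc T M C G K X \<xi>"
    unfolding J_mfc_def C.expected_cost[OF M A G k[OF \<xi>s]] C.expected_cost[OF M B' G k[OF \<xi>]] .
qed

end
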